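(* Let $p$ be a prime and let $R$ be a $p$-Kummerian ring with $\operatorname{Pic}(R)[p]=0$. Then there are bijective correspondences $$(R^*/R^{*p})\big/(\mathbb{Z}/(p))^*\ \longleftrightarrow\ \mathbb{H}(R,\mathcal{C}_p)\big/\operatorname{Aut}(\mathcal{C}_p)\ \longleftrightarrow\ \{\text{conjugacy classes of } p\text{-cyclic Galois extensions }(S,G)\text{ of }R\}.$$ In more explicit terms, given two $p$-cyclic Galois extensions $(S_i,G_i)$ of $R$ for $i=1,2$, and choices $\alpha_i\in S_i$ of $G_i$-primitive elements, the following are equivalent: (1) $(S_1,G_1)$ and $(S_2,G_2)$ are conjugate $p$-cyclic Galois extensions of $R$. (2) $\alpha_1^{p}/\alpha_2^{pb}\in R^{*p}$ for some $b\in(\mathbb{Z}/(p))^*$.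
   Context: A commutative ring $R$ is $p$-Kummerian if $p$ is prime to $\operatorname{char}(R)$ and its unit group $R^*$ contains a distinguished cyclic subgroup $\mu_p$ of order $p$. $R^{*p}$ is the group of $p$th powers in $R^*$. $\operatorname{Pic}(R)[p]$ is the $p$-torsion subgroup of the Picard group. $\mathcal{C}_p$ is the cyclic group of order $p$. Galois extension: a commutative ring extension $S$ of $R$ with an action of a finite group $G$ is a $G$-Galois extension of $R$ if $G$ acts faithfully on $S$ by $R$-algebra automorphisms, $S^G=R$, $S$ is a separable $R$-algebra (projective as $S\otimes_R S$-module), and for all $g\neq h$ in $G$ and every nonzero idempotent $e\in S$ there is $s\in S$ with $g(s)e\neq h(s)e$. It is $p$-cyclic if $G$ is cyclic of order $p$. $\mathbb{H}(R,\mathcal{C}_p)$ (Harrison group) is the set of $\mathcal{C}_p$-Galois extensions of $R$ modulo $\mathcal{C}_p$-equivariant $R$-algebra isomorphism. Conjugacy: $(S_1,G_1)$ and $(S_2,G_2)$ are conjugate if there are an $R$-algebra isomorphism $\phi:S_1\to S_2$ and a group isomorphism $\tau:G_1\to G_2$ with $\phi\circ g=\tau(g)\circ\phi$ for all $g\in G_1$. Actions: $b\in(\mathbb{Z}/(p))^*$ acts on $R^*/R^{*p}$ by $u\mapsto u^b$; $\tau\in\operatorname{Aut}(\mathcal{C}_p)$ acts on $\mathbb{H}(R,\mathcal{C}_p)$ by twisting: $(S,\mathcal{C}_p)^\tau$ is the same extension $S$ with $g$ now acting as $\tau(g)$ did. $G$-primitive element: for a cyclic group $G$ of order $p$ acting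 on $S$ by $R$-automorphisms, $\alpha\in S$ is $G$-primitive if for some nontrivial character $\chi:G\to\mu_p$ one has $g(\alpha)=\chi(g)\alpha$ for all $g\in G$, and $1,\alpha,\dots,\alpha^{p-1}$ is an $R$-module basis of $S$. For a $p$-cyclic Galois extension $(S,G)$ such an $\alpha$ satisfies $\alpha^p\in R^*$, so the quotient in (2) makes sense.
   Formalization: "p prime to char(R)" is taken as p invertible in R (R = Z, p = 2 fails), and nontrivial elements of μ_p must differ from 1 on every component: ζe ≠ e for each nonzero idempotent e. Without the latter the claim fails for F_7 × F_5, p = 3, μ_p = μ_3(F_7) × 1. *)

theory Defs
  imports
    "HOL-Algebra.Module"
    "HOL-Algebra.QuotRing"
    "HOL-Algebra.Group_Action"
    "HOL-Algebra.Elementary_Groups"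
    "HOL-Number_Theory.Residues"
begin

section \<open>Modules\<close>

text \<open>The record \<^type>\<open>module\<close> extends the record of rings; for a module that is not an algebra
  the multiplicative fields carry no information.  They matter only for the ring structure on
  quotients and tensor products of algebras.\<close>

definition module_hom ::
    "('r, 'k) ring_scheme \<Rightarrow> ('r, 'm, 'x) module_scheme \<Rightarrow> ('r, 'n, 'y) module_scheme \<Rightarrow> ('m \<Rightarrow> 'n) set"
  where "module_hom R M N =
    {f \<in> hom (add_monoid M) (add_monoid N).
       \<forall>r\<in>carrier R. \<forall>x\<in>carrier M. f (r \<odot>\<^bsub>M\<^esub> x) = r \<odot>\<^bsub>N\<^esub> f x}"

definition module_isomorphic ::
    "('r, 'k) ring_scheme \<Rightarrow> ('r, 'm, 'x) module_scheme \<Rightarrow> ('r, 'n, 'y) module_scheme \<Rightarrow> bool"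
  where "module_isomorphic R M N \<longleftrightarrow>
    (\<exists>f\<in>module_hom R M N. bij_betw f (carrier M) (carrier N))"

definition regular_module :: "('r, 'k) ring_scheme \<Rightarrow> ('r, 'r) module"
  where "regular_module R =
    \<lparr>carrier = carrier R, monoid.mult = monoid.mult R, one = one R,
     zero = zero R, add = add R, smult = monoid.mult R\<rparr>"

definition basis_vector :: "('r, 'k) ring_scheme \<Rightarrow> 'a \<Rightarrow> 'a \<Rightarrow> 'r"
  where "basis_vector R a = (\<lambda>b. if b = a then \<one>\<^bsub>R\<^esub> else \<zero>\<^bsub>R\<^esub>)"

definition free_module :: "('r, 'k) ring_scheme \<Rightarrow> 'a set \<Rightarrow> ('r, 'a \<Rightarrow> 'r) module"
  where "free_module R A =
    \<lparr>carrier = {f. (\<forall>a. f a \<in> carrier R) \<and> finite {a. f a \<noteq> \<zero>\<^bsub>R\<^esub>} \<and> {a. f a \<noteq> \<zero>\<^bsub>R\<^esub>} \<subseteq> A},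
     monoid.mult = undefined, one = undefined,
     zero = (\<lambda>a. \<zero>\<^bsub>R\<^esub>), add = (\<lambda>f g a. f a \<oplus>\<^bsub>R\<^esub> g a), smult = (\<lambda>r f a. r \<otimes>\<^bsub>R\<^esub> f a)\<rparr>"

text \<open>Projective: a direct summand of a free module.  Index sets drawn from the type of \<open>P\<close>
  suffice, since every module is a quotient of the free module on its own carrier.\<close>

definition projective_module :: "('r, 'k) ring_scheme \<Rightarrow> ('r, 'm, 'x) module_scheme \<Rightarrow> bool"
  where "projective_module R P \<longleftrightarrow> module R P \<and>
    (\<exists>(I :: 'm set) i q. i \<in> module_hom R P (free_module R I) \<and>
        q \<in> module_hom R (free_module R I) P \<and> (\<forall>x\<in>carrier P. q (i x) = x))"

definition quotient_module ::
    "('r, 'm, 'x) module_scheme \<Rightarrow> 'm set \<Rightarrow> ('r, 'm set) module"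
  where "quotient_module M K = ring.extend (M Quot K)
    (module.fields (\<lambda>r X. \<Union>x\<in>X. K +>\<^bsub>M\<^esub> (r \<odot>\<^bsub>M\<^esub> x)))"


subsection \<open>Tensor products\<close>

text \<open>The free \<open>R\<close>-module on \<open>M \<times> N\<close>.  If \<open>M\<close> and \<open>N\<close> are algebras, the convolution product
  (the bilinear extension of \<open>(x, y) \<cdot> (x', y') = (x x', y y')\<close>) induces
  \<open>(x \<otimes> y) (x' \<otimes> y') = x x' \<otimes> y y'\<close> on the quotient below.\<close>

definition tensor_free ::
    "('r, 'k) ring_scheme \<Rightarrow> ('r, 'm, 'x) module_scheme \<Rightarrow> ('r, 'n, 'y) module_scheme
      \<Rightarrow> ('r, 'm \<times> 'n \<Rightarrow> 'r) module"
  where "tensor_free R M N = (free_module R (carrier M \<times> carrier N))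
    \<lparr>monoid.mult := (\<lambda>f g c. \<Oplus>\<^bsub>R\<^esub>z \<in> {(a, b). f a \<noteq> \<zero>\<^bsub>R\<^esub> \<and> g b \<noteq> \<zero>\<^bsub>R\<^esub> \<and>
                            (fst a \<otimes>\<^bsub>M\<^esub> fst b, snd a \<otimes>\<^bsub>N\<^esub> snd b) = c}. f (fst z) \<otimes>\<^bsub>R\<^esub> g (snd z)),
     one := basis_vector R (\<one>\<^bsub>M\<^esub>, \<one>\<^bsub>N\<^esub>)\<rparr>"

definition tensor_relations ::
    "('r, 'k) ring_scheme \<Rightarrow> ('r, 'm, 'x) module_scheme \<Rightarrow> ('r, 'n, 'y) module_scheme
      \<Rightarrow> ('m \<times> 'n \<Rightarrow> 'r) set"
  where "tensor_relations R M N =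
    (let F = tensor_free R M N; e = (\<lambda>x y. basis_vector R (x, y)) in
      {e (x \<oplus>\<^bsub>M\<^esub> x') y \<ominus>\<^bsub>F\<^esub> (e x y \<oplus>\<^bsub>F\<^esub> e x' y) | x x' y.
         x \<in> carrier M \<and> x' \<in> carrier M \<and> y \<in> carrier N} \<union>
      {e x (y \<oplus>\<^bsub>N\<^esub> y') \<ominus>\<^bsub>F\<^esub> (e x y \<oplus>\<^bsub>F\<^esub> e x y') | x y y'.
         x \<in> carrier M \<and> y \<in> carrier N \<and> y' \<in> carrier N} \<union>
      {e (r \<odot>\<^bsub>M\<^esub> x) y \<ominus>\<^bsub>F\<^esub> (r \<odot>\<^bsub>F\<^esub> e x y) | r x y.
         r \<in> carrier R \<and> x \<in> carrier M \<and> y \<in> carrier N} \<union>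
      {e x (r \<odot>\<^bsub>N\<^esub> y) \<ominus>\<^bsub>F\<^esub> (r \<odot>\<^bsub>F\<^esub> e x y) | r x y.
         r \<in> carrier R \<and> x \<in> carrier M \<and> y \<in> carrier N})"

definition tensor_product ::
    "('r, 'k) ring_scheme \<Rightarrow> ('r, 'm, 'x) module_scheme \<Rightarrow> ('r, 'n, 'y) module_scheme
      \<Rightarrow> ('r, ('m \<times> 'n \<Rightarrow> 'r) set) module"
  where "tensor_product R M N = quotient_module (tensor_free R M N)
    (\<Inter>{K. submodule K R (tensor_free R M N) \<and> tensor_relations R M N \<subseteq> K})"


section \<open>The Picard group\<close>

text \<open>Isomorphism classes are formed inside the type \<^typ>\<open>'r list\<close>.  Nothing is lost: an
  invertible module is finitely generated, hence a quotient of some \<open>R\<^sup>n\<close>, and so it is isomorphic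
  to a module carried by lists of length \<open>n\<close>.\<close>

definition invertible_module :: "('r, 'k) ring_scheme \<Rightarrow> ('r, 'm, 'x) module_scheme \<Rightarrow> bool"
  where "invertible_module R L \<longleftrightarrow> module R L \<and>
    (\<exists>N :: ('r, 'r list) module. module R N \<and>
        module_isomorphic R (tensor_product R L N) (regular_module R))"

definition Pic_class ::
    "('r, 'k) ring_scheme \<Rightarrow> ('r, 'm, 'x) module_scheme \<Rightarrow> ('r, 'r list) module set"
  where "Pic_class R M = {L. invertible_module R L \<and> module_isomorphic R L M}"

definition Pic :: "('r, 'k) ring_scheme \<Rightarrow> ('r, 'r list) module set monoid"
  where "Pic R =
    \<lparr>carrier = {Pic_class R L | L :: ('r, 'r list) module. invertible_module R L},
     monoid.mult = (\<lambda>X Y. \<Union>L\<in>X. \<Union>M\<in>Y. Pic_class R (tensor_product R L M)),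
     one = Pic_class R (regular_module R)\<rparr>"

definition torsion_part :: "('a, 'x) monoid_scheme \<Rightarrow> nat \<Rightarrow> 'a set"
  where "torsion_part G n = {x \<in> carrier G. x [^]\<^bsub>G\<^esub> n = \<one>\<^bsub>G\<^esub>}"


section \<open>Kummerian rings\<close>

text \<open>The distinguished subgroup \<open>\<mu>\<close> is part of the data.

  ``\<open>p\<close> is prime to the characteristic'' is read as invertibility of \<open>p\<close> in \<open>R\<close>.  In positive
  characteristic this is coprimality (see \<open>p_kummerianI_connected\<close>); in characteristic \<open>0\<close> it
  admits fields but not, for instance, the ring of integers with \<open>p = 2\<close>, which has two square
  classes of units but only the trivial quadratic Galois extension.

  ``Of order \<open>p\<close>'' is read as being of order \<open>p\<close> over every component of \<open>R\<close>: nontrivial elements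
  of \<open>\<mu>\<close> differ from \<open>1\<close> after multiplication by any nonzero idempotent.  The clause is void for
  connected \<open>R\<close>.  It excludes e.g. \<open>\<mu> = \<mu>\<^sub>3 \<times> 1\<close> in \<open>F\<^sub>7 \<times> F\<^sub>5\<close> with \<open>p = 3\<close>, for which there are
  two orbits of unit classes but five orbits in the Harrison group.\<close>

definition p_kummerian :: "nat \<Rightarrow> ('r, 'k) ring_scheme \<Rightarrow> 'r set \<Rightarrow> bool"
  where "p_kummerian p R \<mu> \<longleftrightarrow> cring R \<and> [p] \<cdot>\<^bsub>R\<^esub> \<one>\<^bsub>R\<^esub> \<in> Units R \<and>
    subgroup \<mu> (units_of R) \<and> cyclic_group ((units_of R)\<lparr>carrier := \<mu>\<rparr>) \<and> card \<mu> = p \<and>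
    (\<forall>\<zeta>\<in>\<mu>. \<forall>e\<in>carrier R. \<zeta> \<noteq> \<one>\<^bsub>R\<^esub> \<and> e \<otimes>\<^bsub>R\<^esub> e = e \<and> e \<noteq> \<zero>\<^bsub>R\<^esub> \<longrightarrow> \<zeta> \<otimes>\<^bsub>R\<^esub> e \<noteq> e)"

lemma p_kummerianI_connected:
  assumes "cring R"
    and conn: "\<And>e. e \<in> carrier R \<Longrightarrow> e \<otimes>\<^bsub>R\<^esub> e = e \<Longrightarrow> e = \<zero>\<^bsub>R\<^esub> \<or> e = \<one>\<^bsub>R\<^esub>"
    and char: "[(n::nat)] \<cdot>\<^bsub>R\<^esub> \<one>\<^bsub>R\<^esub> = \<zero>\<^bsub>R\<^esub>" and cop: "coprime p n"
    and \<mu>: "subgroup \<mu> (units_of R)" "cyclic_group ((units_of R)\<lparr>carrier := \<mu>\<rparr>)" "card \<mu> = p"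
  shows "p_kummerian p R \<mu>"
proof -
  interpret cring R by fact
  obtain a b :: int where ab: "a * int p + b * int n = 1"
    using cop bezout_int[of "int p" "int n"] by (metis coprime_imp_gcd_eq_1 coprime_int_iff)
  have "\<one>\<^bsub>R\<^esub> = [(1::int)] \<cdot>\<^bsub>R\<^esub> \<one>\<^bsub>R\<^esub>" by simp
  also have "\<dots> = [(a * int p + b * int n)] \<cdot>\<^bsub>R\<^esub> \<one>\<^bsub>R\<^esub>" by (simp only: ab)
  also have "\<dots> = [a] \<cdot>\<^bsub>R\<^esub> ([p] \<cdot>\<^bsub>R\<^esub> \<one>\<^bsub>R\<^esub>) \<oplus>\<^bsub>R\<^esub> [b] \<cdot>\<^bsub>R\<^esub> ([n] \<cdot>\<^bsub>R\<^esub> \<one>\<^bsub>R\<^esub>)"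
    by (simp add: add.int_pow_mult add.int_pow_pow[symmetric] mult.commute int_pow_int
        flip: add_pow_int_ge) (metis add.int_pow_pow add_pow_def int_pow_int one_closed mult.commute)
  also have "\<dots> = ([a] \<cdot>\<^bsub>R\<^esub> \<one>\<^bsub>R\<^esub>) \<otimes>\<^bsub>R\<^esub> ([p] \<cdot>\<^bsub>R\<^esub> \<one>\<^bsub>R\<^esub>)"
    using char by (simp add: add_pow_ldistr_int)
  finally have p_unit: "[p] \<cdot>\<^bsub>R\<^esub> \<one>\<^bsub>R\<^esub> \<in> Units R"
    unfolding Units_def using m_comm
    by (auto intro!: bexI[of _ "[a] \<cdot>\<^bsub>R\<^esub> \<one>\<^bsub>R\<^esub>"])
  moreover have "\<mu> \<subseteq> carrier R"
    using subgroup.subset[OF \<mu>(1)] by (auto simp: units_of_carrier)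
  ultimately have "\<zeta> \<otimes>\<^bsub>R\<^esub> e \<noteq> e"
    if "\<zeta> \<in> \<mu>" "e \<in> carrier R" "\<zeta> \<noteq> \<one>\<^bsub>R\<^esub>" "e \<otimes>\<^bsub>R\<^esub> e = e" "e \<noteq> \<zero>\<^bsub>R\<^esub>" for \<zeta> e
    using conn[of e] that by auto
  then show ?thesis
    unfolding p_kummerian_def using assms p_unit by blast
qed


section \<open>Galois extensions\<close>

text \<open>The structure of \<open>S\<close> as a module over \<open>S \<otimes>\<^sub>R S\<close>, given by
  \<open>(\<Sum> r \<cdot> x \<otimes> y) \<cdot> s = \<Sum> r \<cdot> (x s y)\<close>.  The value does not depend on the representative \<open>f\<close>
  of the coset \<open>X\<close>.\<close>

definition enveloping_module ::
    "('r, 'k) ring_scheme \<Rightarrow> ('r, 's, 'x) module_scheme \<Rightarrow> (('s \<times> 's \<Rightarrow> 'r) set, 's) module"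
  where "enveloping_module R S =
    \<lparr>carrier = carrier S, monoid.mult = monoid.mult S, one = one S, zero = zero S, add = add S,
     smult = (\<lambda>X s. let f = (SOME f. f \<in> X) in
       \<Oplus>\<^bsub>S\<^esub>z\<in>{z. f z \<noteq> \<zero>\<^bsub>R\<^esub>}. f z \<odot>\<^bsub>S\<^esub> (fst z \<otimes>\<^bsub>S\<^esub> s \<otimes>\<^bsub>S\<^esub> snd z))\<rparr>"

definition separable_algebra :: "('r, 'k) ring_scheme \<Rightarrow> ('r, 's, 'x) module_scheme \<Rightarrow> bool"
  where "separable_algebra R S \<longleftrightarrow>
    algebra R S \<and> projective_module (tensor_product R S S) (enveloping_module R S)"

text \<open>\<open>S\<close> is an extension of \<open>R\<close> through the injective structure map \<open>r \<mapsto> r \<cdot> 1\<close>.\<close>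

definition structure_map :: "('r, 's, 'x) module_scheme \<Rightarrow> 'r \<Rightarrow> 's"
  where "structure_map S r = r \<odot>\<^bsub>S\<^esub> \<one>\<^bsub>S\<^esub>"

locale galois_extension = algebra R S + faithful_action G "carrier S" \<phi>
  for R :: "('r, 'k) ring_scheme" and S :: "('r, 's, 'x) module_scheme"
    and G :: "('g, 'y) monoid_scheme" and \<phi> :: "'g \<Rightarrow> 's \<Rightarrow> 's" +
  assumes extension: "inj_on (structure_map S) (carrier R)"
    and finite_group: "finite (carrier G)"
    and ring_automorphism: "\<And>g. g \<in> carrier G \<Longrightarrow> \<phi> g \<in> ring_iso S S"
    and linear: "\<And>g r s. g \<in> carrier G \<Longrightarrow> r \<in> carrier R \<Longrightarrow> s \<in> carrier S \<Longrightarrow>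
      \<phi> g (r \<odot>\<^bsub>S\<^esub> s) = r \<odot>\<^bsub>S\<^esub> \<phi> g s"
    and fixed_ring: "{s \<in> carrier S. \<forall>g\<in>carrier G. \<phi> g s = s} = structure_map S ` carrier R"
    and separable: "separable_algebra R S"
    and strongly_distinct: "\<And>g h e. g \<in> carrier G \<Longrightarrow> h \<in> carrier G \<Longrightarrow> g \<noteq> h \<Longrightarrow>
      e \<in> carrier S \<Longrightarrow> e \<otimes>\<^bsub>S\<^esub> e = e \<Longrightarrow> e \<noteq> \<zero>\<^bsub>S\<^esub> \<Longrightarrow>
      \<exists>s\<in>carrier S. \<phi> g s \<otimes>\<^bsub>S\<^esub> e \<noteq> \<phi> h s \<otimes>\<^bsub>S\<^esub> e"

definition p_cyclic_galois ::
    "nat \<Rightarrow> ('r, 'k) ring_scheme \<Rightarrow> ('r, 's, 'x) module_scheme \<Rightarrow> ('g, 'y) monoid_scheme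
      \<Rightarrow> ('g \<Rightarrow> 's \<Rightarrow> 's) \<Rightarrow> bool"
  where "p_cyclic_galois p R S G \<phi> \<longleftrightarrow>
    galois_extension R S G \<phi> \<and> cyclic_group G \<and> order G = p"

definition algebra_iso ::
    "('r, 'k) ring_scheme \<Rightarrow> ('r, 's, 'x) module_scheme \<Rightarrow> ('r, 't, 'y) module_scheme \<Rightarrow> ('s \<Rightarrow> 't) set"
  where "algebra_iso R S T =
    {f \<in> ring_iso S T. \<forall>r\<in>carrier R. \<forall>s\<in>carrier S. f (r \<odot>\<^bsub>S\<^esub> s) = r \<odot>\<^bsub>T\<^esub> f s}"

definition conjugate_extensions ::
    "('r, 'k) ring_scheme
      \<Rightarrow> ('r, 's) module \<times> 'g monoid \<times> ('g \<Rightarrow> 's \<Rightarrow> 's)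
      \<Rightarrow> ('r, 't) module \<times> 'h monoid \<times> ('h \<Rightarrow> 't \<Rightarrow> 't) \<Rightarrow> bool"
  where "conjugate_extensions R = (\<lambda>(S\<^sub>1, G\<^sub>1, \<phi>\<^sub>1) (S\<^sub>2, G\<^sub>2, \<phi>\<^sub>2).
    \<exists>f\<in>algebra_iso R S\<^sub>1 S\<^sub>2. \<exists>\<tau>\<in>iso G\<^sub>1 G\<^sub>2.
      \<forall>g\<in>carrier G\<^sub>1. \<forall>s\<in>carrier S\<^sub>1. f (\<phi>\<^sub>1 g s) = \<phi>\<^sub>2 (\<tau> g) (f s))"

definition p_cyclic_extensions ::
    "nat \<Rightarrow> ('r, 'k) ring_scheme \<Rightarrow> (('r, 's) module \<times> 'g monoid \<times> ('g \<Rightarrow> 's \<Rightarrow> 's)) set"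
  where "p_cyclic_extensions p R = {(S, G, \<phi>). p_cyclic_galois p R S G \<phi>}"

definition conjugacy ::
    "nat \<Rightarrow> ('r, 'k) ring_scheme \<Rightarrow> (('r, 's) module \<times> 'g monoid \<times> ('g \<Rightarrow> 's \<Rightarrow> 's)) rel"
  where "conjugacy p R =
    {(X, Y) \<in> p_cyclic_extensions p R \<times> p_cyclic_extensions p R. conjugate_extensions R X Y}"

abbreviation conjugacy_classes ::
    "nat \<Rightarrow> ('r, 'k) ring_scheme \<Rightarrow> (('r, 's) module \<times> 'g monoid \<times> ('g \<Rightarrow> 's \<Rightarrow> 's)) set set"
  where "conjugacy_classes p R \<equiv> p_cyclic_extensions p R // conjugacy p R"


section \<open>The Harrison set and its twisting action\<close>

abbreviation Cyc :: "nat \<Rightarrow> int monoid"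
  where "Cyc p \<equiv> integer_mod_group p"

definition C_extensions ::
    "nat \<Rightarrow> ('r, 'k) ring_scheme \<Rightarrow> (('r, 's) module \<times> (int \<Rightarrow> 's \<Rightarrow> 's)) set"
  where "C_extensions p R = {(S, \<phi>). galois_extension R S (Cyc p) \<phi>}"

definition harrison_rel ::
    "nat \<Rightarrow> ('r, 'k) ring_scheme \<Rightarrow> (('r, 's) module \<times> (int \<Rightarrow> 's \<Rightarrow> 's)) rel"
  where "harrison_rel p R =
    {((S\<^sub>1, \<phi>\<^sub>1), (S\<^sub>2, \<phi>\<^sub>2)). (S\<^sub>1, \<phi>\<^sub>1) \<in> C_extensions p R \<and> (S\<^sub>2, \<phi>\<^sub>2) \<in> C_extensions p R \<and>
       (\<exists>f\<in>algebra_iso R S\<^sub>1 S\<^sub>2.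
          \<forall>g\<in>carrier (Cyc p). \<forall>s\<in>carrier S\<^sub>1. f (\<phi>\<^sub>1 g s) = \<phi>\<^sub>2 g (f s))}"

abbreviation harrison_set ::
    "nat \<Rightarrow> ('r, 'k) ring_scheme \<Rightarrow> (('r, 's) module \<times> (int \<Rightarrow> 's \<Rightarrow> 's)) set set"
  where "harrison_set p R \<equiv> C_extensions p R // harrison_rel p R"

definition harrison_twist ::
    "nat \<Rightarrow> ('r, 'k) ring_scheme \<Rightarrow> (int \<Rightarrow> int)
      \<Rightarrow> (('r, 's) module \<times> (int \<Rightarrow> 's \<Rightarrow> 's)) set \<Rightarrow> (('r, 's) module \<times> (int \<Rightarrow> 's \<Rightarrow> 's)) set"
  where "harrison_twist p R \<tau> X = (\<Union>(S, \<phi>)\<in>X. harrison_rel p R `` {(S, \<lambda>g. \<phi> (\<tau> g))})"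

abbreviation harrison_orbit ::
    "nat \<Rightarrow> ('r, 'k) ring_scheme \<Rightarrow> ('r, 's) module \<times> (int \<Rightarrow> 's \<Rightarrow> 's)
      \<Rightarrow> (('r, 's) module \<times> (int \<Rightarrow> 's \<Rightarrow> 's)) set set"
  where "harrison_orbit p R X \<equiv>
    orbit (AutoGroup (Cyc p)) (harrison_twist p R) (harrison_rel p R `` {X})"

abbreviation harrison_orbits ::
    "nat \<Rightarrow> ('r, 'k) ring_scheme \<Rightarrow> (('r, 's) module \<times> (int \<Rightarrow> 's \<Rightarrow> 's)) set set set"
  where "harrison_orbits p R \<equiv> orbits (AutoGroup (Cyc p)) (harrison_set p R) (harrison_twist p R)"


section \<open>Classes of units modulo \<open>p\<close>-th powers\<close>

definition pth_powers :: "nat \<Rightarrow> ('r, 'k) ring_scheme \<Rightarrow> 'r set"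
  where "pth_powers p R = (\<lambda>u. u [^]\<^bsub>R\<^esub> p) ` Units R"

definition unit_classes :: "nat \<Rightarrow> ('r, 'k) ring_scheme \<Rightarrow> 'r set monoid"
  where "unit_classes p R = units_of R Mod pth_powers p R"

abbreviation Zp_units :: "nat \<Rightarrow> int monoid"
  where "Zp_units p \<equiv> units_of (residue_ring (int p))"

abbreviation unit_orbit :: "nat \<Rightarrow> ('r, 'k) ring_scheme \<Rightarrow> 'r \<Rightarrow> 'r set set"
  where "unit_orbit p R u \<equiv>
    orbit (Zp_units p) (\<lambda>b X. X [^]\<^bsub>unit_classes p R\<^esub> b) (pth_powers p R #>\<^bsub>units_of R\<^esub> u)"

abbreviation unit_orbits :: "nat \<Rightarrow> ('r, 'k) ring_scheme \<Rightarrow> 'r set set set"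
  where "unit_orbits p R \<equiv>
    orbits (Zp_units p) (carrier (unit_classes p R)) (\<lambda>b X. X [^]\<^bsub>unit_classes p R\<^esub> b)"


section \<open>Primitive elements\<close>

definition primitive_element ::
    "nat \<Rightarrow> ('r, 'k) ring_scheme \<Rightarrow> 'r set \<Rightarrow> ('r, 's, 'x) module_scheme \<Rightarrow> ('g, 'y) monoid_scheme
      \<Rightarrow> ('g \<Rightarrow> 's \<Rightarrow> 's) \<Rightarrow> 's \<Rightarrow> bool"
  where "primitive_element p R \<mu> S G \<phi> \<alpha> \<longleftrightarrow> \<alpha> \<in> carrier S \<and>
    (\<exists>\<chi>\<in>hom G ((units_of R)\<lparr>carrier := \<mu>\<rparr>). (\<exists>g\<in>carrier G. \<chi> g \<noteq> \<one>\<^bsub>R\<^esub>) \<and>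
        (\<forall>g\<in>carrier G. \<phi> g \<alpha> = \<chi> g \<odot>\<^bsub>S\<^esub> \<alpha>)) \<and>
    (\<forall>s\<in>carrier S. \<exists>!c. c \<in> {..<p} \<rightarrow>\<^sub>E carrier R \<and>
        s = (\<Oplus>\<^bsub>S\<^esub>i\<in>{..<p}. c i \<odot>\<^bsub>S\<^esub> (\<alpha> [^]\<^bsub>S\<^esub> i)))"

text \<open>The power \<open>\<alpha>\<^sup>p\<close> of a primitive element, as the unit of \<open>R\<close> it comes from.\<close>

definition kummer_unit ::
    "nat \<Rightarrow> ('r, 'k) ring_scheme \<Rightarrow> ('r, 's, 'x) module_scheme \<Rightarrow> 's \<Rightarrow> 'r"
  where "kummer_unit p R S \<alpha> = (THE u. u \<in> Units R \<and> structure_map S u = \<alpha> [^]\<^bsub>S\<^esub> p)"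

end

theory Submission
  imports Defs "HOL-Algebra.Weak_Morphisms"
begin

text \<open>Separability and strong distinctness yield Galois coordinates, elements \<open>x\<^sub>i, y\<^sub>i\<close> of
  \<open>S\<close> with \<open>\<Sum> x\<^sub>i g(y\<^sub>i) = \<delta>\<^sub>g\<^sub>,\<^sub>1\<close>.  A nontrivial character
  \<open>\<chi> : G \<rightarrow> \<mu>\<^sub>p\<close> splits \<open>S\<close> into eigenspaces \<open>S\<^sub>n\<close>, and the coordinates make the products
  \<open>S\<^sub>n \<otimes> S\<^sub>m \<rightarrow> S\<^sub>n\<^sub>+\<^sub>m\<close> isomorphisms.  So \<open>S\<^sub>1\<close> is invertible with \<open>p\<close>-th tensor power \<open>S\<^sub>0 = R\<close>, and
  \<open>Pic(R)[p] = 0\<close> makes it free.  A generator \<open>\<alpha>\<close> is primitive and \<open>S = R[\<alpha>]\<close> with \<open>\<alpha>\<^sup>p = u \<in> R\<^sup>*\<close>.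
  Conversely \<open>R[\<alpha>] / (\<alpha>\<^sup>p - u)\<close> is Galois for every unit \<open>u\<close>.  An isomorphism that conjugates two
  extensions permutes the nontrivial characters, so it moves \<open>\<alpha>\<^sub>1\<close> to a unit multiple of some
  \<open>\<alpha>\<^sub>2\<^sup>b\<close>; hence conjugacy is the relation \<open>u\<^sub>1 = w\<^sup>p u\<^sub>2\<^sup>b\<close>.\<close>

section \<open>Modules\<close>

text \<open>The substitute is that distinct elements of \<open>\<mu>\<close> differ by a unit. This
  rests on p being invertible and on the idempotent clause of \<open>p_kummerian\<close>. It makes
  character sums vanish, keeps the eigenspaces independent and separates the automorphisms of
  R[\<alpha>]. A second obstacle is the ring structure on tensor products: the product of two cosets
  is a union over representatives, and it has to be argued that this union is one coset. For a
  separable algebra that is part of projectivity, because the scalars of a module form a ring. For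
  R[\<alpha>] it follows from Galois coordinates, which make the maps x \<otimes> y -> x g(y)
  jointly injective. A third obstacle is typing. Classes in \<open>Pic\<close> consist of modules on
  lists, and classes of extensions live in one fixed type. Eigenspaces and the algebra R[\<alpha>]
  are therefore copied along injections that list the coordinates in a finite dual basis or in the
  power basis.\<close>

lemma module_homI:
  assumes "\<And>x. x \<in> carrier M \<Longrightarrow> f x \<in> carrier N"
    and "\<And>x y. x \<in> carrier M \<Longrightarrow> y \<in> carrier M \<Longrightarrow> f (x \<oplus>\<^bsub>M\<^esub> y) = f x \<oplus>\<^bsub>N\<^esub> f y"
    and "\<And>r x. r \<in> carrier R \<Longrightarrow> x \<in> carrier M \<Longrightarrow> f (r \<odot>\<^bsub>M\<^esub> x) = r \<odot>\<^bsub>N\<^esub> f x"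
  shows "f \<in> module_hom R M N"
  using assms by (auto simp: module_hom_def hom_def)

lemma module_homD:
  assumes "f \<in> module_hom R M N"
  shows "\<And>x. x \<in> carrier M \<Longrightarrow> f x \<in> carrier N"
    and "\<And>x y. x \<in> carrier M \<Longrightarrow> y \<in> carrier M \<Longrightarrow> f (x \<oplus>\<^bsub>M\<^esub> y) = f x \<oplus>\<^bsub>N\<^esub> f y"
    and "\<And>r x. r \<in> carrier R \<Longrightarrow> x \<in> carrier M \<Longrightarrow> f (r \<odot>\<^bsub>M\<^esub> x) = r \<odot>\<^bsub>N\<^esub> f x"
  using assms by (auto simp: module_hom_def hom_def)

lemma module_hom_zero:
  assumes "module R M" "module R N" "f \<in> module_hom R M N"
  shows "f \<zero>\<^bsub>M\<^esub> = \<zero>\<^bsub>N\<^esub>"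
proof -
  interpret M: module R M by fact
  interpret N: module R N by fact
  have "f (\<zero>\<^bsub>R\<^esub> \<odot>\<^bsub>M\<^esub> \<zero>\<^bsub>M\<^esub>) = \<zero>\<^bsub>R\<^esub> \<odot>\<^bsub>N\<^esub> f \<zero>\<^bsub>M\<^esub>"
    by (rule module_homD(3)[OF assms(3)]) simp_all
  then show ?thesis using module_homD(1)[OF assms(3)] by simp
qed

lemma module_hom_finsum:
  assumes "module R M" "module R N" "f \<in> module_hom R M N" "g \<in> A \<rightarrow> carrier M"
  shows "f (\<Oplus>\<^bsub>M\<^esub>a\<in>A. g a) = (\<Oplus>\<^bsub>N\<^esub>a\<in>A. f (g a))"
proof -
  interpret M: module R M by fact
  interpret N: module R N by fact
  note f = module_homD[OF assms(3)]
  show ?thesis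
  proof (cases "finite A")
    case True
    then show ?thesis using assms(4)
    proof (induction A)
      case empty
      then show ?case by (simp add: module_hom_zero[OF assms(1-3)])
    next
      case (insert a A)
      then have "g a \<in> carrier M" "g \<in> A \<rightarrow> carrier M" by auto
      moreover from this have "(\<lambda>a. f (g a)) \<in> A \<rightarrow> carrier N" using f(1) by auto
      ultimately show ?case using insert f by (simp add: M.finsum_insert)
    qed
  next
    case False
    then show ?thesis by (simp add: M.finsum_infinite N.finsum_infinite module_hom_zero[OF assms(1-3)])
  qed
qed

lemma module_hom_comp:
  assumes "f \<in> module_hom R M N" "g \<in> module_hom R N P"
  shows "(\<lambda>x. g (f x)) \<in> module_hom R M P"
  using module_homD[OF assms(1)] module_homD[OF assms(2)] by (intro module_homI) auto

lemma module_hom_inv: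
  assumes "module R M" "f \<in> module_hom R M N" "bij_betw f (carrier M) (carrier N)"
  shows "inv_into (carrier M) f \<in> module_hom R N M"
proof -
  interpret M: module R M by fact
  let ?g = "inv_into (carrier M) f"
  note f = module_homD[OF assms(2)]
  have inj: "inj_on f (carrier M)" and im: "f ` carrier M = carrier N"
    using assms(3) by (auto simp: bij_betw_def)
  have g: "?g y \<in> carrier M" "f (?g y) = y" if "y \<in> carrier N" for y
    using that im by (auto intro: inv_into_into f_inv_into_f)
  show ?thesis
  proof (intro module_homI)
    fix x y assume "x \<in> carrier N" "y \<in> carrier N"
    then have "x \<oplus>\<^bsub>N\<^esub> y = f (?g x \<oplus>\<^bsub>M\<^esub> ?g y)" by (simp add: f g)
    then show "?g (x \<oplus>\<^bsub>N\<^esub> y) = ?g x \<oplus>\<^bsub>M\<^esub> ?g y"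
      using \<open>x \<in> carrier N\<close> \<open>y \<in> carrier N\<close> by (simp add: g inv_into_f_f[OF inj])
  next
    fix r x assume "r \<in> carrier R" "x \<in> carrier N"
    then have "r \<odot>\<^bsub>N\<^esub> x = f (r \<odot>\<^bsub>M\<^esub> ?g x)" by (simp add: f g)
    then show "?g (r \<odot>\<^bsub>N\<^esub> x) = r \<odot>\<^bsub>M\<^esub> ?g x"
      using \<open>r \<in> carrier R\<close> \<open>x \<in> carrier N\<close> by (simp add: g inv_into_f_f[OF inj])
  qed (simp add: g)
qed

lemma module_isomorphic_sym:
  assumes "module R M" "module_isomorphic R M N"
  shows "module_isomorphic R N M"
  using assms module_hom_inv bij_betw_inv_into unfolding module_isomorphic_def by blast

lemma module_isomorphic_trans:
  assumes "module_isomorphic R M N" "module_isomorphic R N P"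
  shows "module_isomorphic R M P"
proof -
  from assms obtain f g where fg: "f \<in> module_hom R M N" "bij_betw f (carrier M) (carrier N)"
    "g \<in> module_hom R N P" "bij_betw g (carrier N) (carrier P)"
    unfolding module_isomorphic_def by blast
  have "bij_betw (\<lambda>x. g (f x)) (carrier M) (carrier P)"
    using bij_betw_trans[OF fg(2,4)] by (simp add: comp_def)
  then show ?thesis
    unfolding module_isomorphic_def using module_hom_comp[OF fg(1,3)] by blast
qed

text \<open>The multiplicative fields of the record do not enter the module axioms.
  \<open>tensor_free\<close> differs from \<open>free_module\<close> only in those fields, so it
  inherits the module structure.\<close>

lemma module_cong:
  assumes "module R M" "carrier N = carrier M" "zero N = zero M" "add N = add M" "smult N = smult M"
  shows "module R N"
proof -
  interpret module R M by fact
  have "abelian_group N"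
    by (rule abelian_groupI)
      (auto simp: assms(2-) M.a_ac M.r_neg intro!: bexI[of _ "\<ominus>\<^bsub>M\<^esub> _"])
  then show ?thesis
    by (intro moduleI) (auto simp: assms(2-) R.is_cring smult_l_distr smult_r_distr smult_assoc1)
qed

section \<open>Transport of structure along an injection\<close>

text \<open>All operations are conjugated by \<open>h\<close> and a partial inverse of it. It serves
  to move eigenspaces into lists over \<open>R\<close> and the algebra R[\<alpha>] into a given
  type.\<close>

definition image_algebra :: "('s \<Rightarrow> 't) \<Rightarrow> ('r, 's, 'x) module_scheme \<Rightarrow> ('r, 't) module"
  where "image_algebra h S = (let k = inv_into (carrier S) h in
    \<lparr>carrier = h ` carrier S, monoid.mult = (\<lambda>x y. h (k x \<otimes>\<^bsub>S\<^esub> k y)), one = h \<one>\<^bsub>S\<^esub>,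
     zero = h \<zero>\<^bsub>S\<^esub>, add = (\<lambda>x y. h (k x \<oplus>\<^bsub>S\<^esub> k y)), smult = (\<lambda>r x. h (r \<odot>\<^bsub>S\<^esub> k x))\<rparr>)"

lemma image_algebra_module:
  assumes "module R M" and inj: "inj_on h (carrier M)"
  shows "module R (image_algebra h M)" "h \<in> module_hom R M (image_algebra h M)"
    "bij_betw h (carrier M) (carrier (image_algebra h M))"
proof -
  interpret module R M by fact
  have k[simp]: "inv_into (carrier M) h (h x) = x" if "x \<in> carrier M" for x
    using inv_into_f_f[OF inj that] .
  have "abelian_group (image_algebra h M)"
    by (rule abelian_groupI)
      (auto simp: image_algebra_def Let_def M.a_ac M.r_neg intro!: bexI[of _ "\<ominus>\<^bsub>M\<^esub> _"])
  then show "module R (image_algebra h M)"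
    by (intro moduleI)
      (auto simp: image_algebra_def Let_def R.is_cring smult_l_distr smult_r_distr smult_assoc1)
  show "h \<in> module_hom R M (image_algebra h M)"
    by (rule module_homI) (auto simp: image_algebra_def Let_def)
  show "bij_betw h (carrier M) (carrier (image_algebra h M))"
    using inj by (simp add: image_algebra_def Let_def bij_betw_def)
qed

lemma image_algebra_algebra:
  assumes "algebra R S" and inj: "inj_on h (carrier S)"
  shows "algebra R (image_algebra h S)" "h \<in> algebra_iso R S (image_algebra h S)"
proof -
  interpret S: cring S using assms(1) by (rule algebra.axioms(2))
  interpret algebra R S by fact
  have k[simp]: "inv_into (carrier S) h (h x) = x" if "x \<in> carrier S" for x
    using inv_into_f_f[OF inj that] .
  have M: "module R (image_algebra h S)"
    by (rule image_algebra_module[OF module inj])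
  interpret I: module R "image_algebra h S" by fact
  have "cring (image_algebra h S)"
    using I.M.abelian_group_axioms
    by (intro cringI comm_monoidI)
      (auto simp: image_algebra_def Let_def S.m_assoc S.m_comm S.m_lcomm S.l_distr S.r_distr)
  then show "algebra R (image_algebra h S)"
    by (intro algebra.intro algebra_axioms.intro M)
      (auto simp: image_algebra_def Let_def smult_assoc2)
  show "h \<in> algebra_iso R S (image_algebra h S)"
    using inj by (auto simp: algebra_iso_def ring_iso_def image_algebra_def Let_def bij_betw_def
        intro!: ring_hom_memI)
qed

subsection \<open>Free modules\<close>

lemma (in cring) free_module_module: "module R (free_module R A)"
proof -
  have sub: "{a. f a \<oplus> g a \<noteq> \<zero>} \<subseteq> {a. f a \<noteq> \<zero>} \<union> {a. g a \<noteq> \<zero>}" for f g :: "'c \<Rightarrow> 'a"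
    by auto
  have neg: "{a. \<ominus> f a \<noteq> \<zero>} = {a. f a \<noteq> \<zero>}" if "\<And>a. f a \<in> carrier R" for f :: "'c \<Rightarrow> 'a"
    using that by (metis add.inv_eq_1_iff)
  have "abelian_group (free_module R A)"
  proof (rule abelian_groupI)
    fix f assume f: "f \<in> carrier (free_module R A)"
    then show "\<exists>g\<in>carrier (free_module R A). g \<oplus>\<^bsub>free_module R A\<^esub> f = \<zero>\<^bsub>free_module R A\<^esub>"
      by (intro bexI[of _ "\<lambda>a. \<ominus> f a"]) (auto simp: free_module_def neg l_neg)
  next
    fix f g assume "f \<in> carrier (free_module R A)" "g \<in> carrier (free_module R A)"
    then show "f \<oplus>\<^bsub>free_module R A\<^esub> g \<in> carrier (free_module R A)"
      using sub[of f g] by (auto simp: free_module_def intro: finite_subset[OF sub])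
  qed (auto simp: free_module_def a_ac)
  moreover have "{a. r \<otimes> f a \<noteq> \<zero>} \<subseteq> {a. f a \<noteq> \<zero>}" if "r \<in> carrier R" for r and f :: "'c \<Rightarrow> 'a"
    using that by auto
  then have "r \<odot>\<^bsub>free_module R A\<^esub> f \<in> carrier (free_module R A)"
    if "r \<in> carrier R" "f \<in> carrier (free_module R A)" for r f
    using that by (auto simp: free_module_def intro: finite_subset)
  ultimately show ?thesis
    by (intro moduleI) (auto simp: free_module_def is_cring l_distr r_distr m_assoc)
qed

lemma (in cring) basis_vector_closed:
  assumes "a \<in> A"
  shows "basis_vector R a \<in> carrier (free_module R A)"
proof -
  have "{b. basis_vector R a b \<noteq> \<zero>} \<subseteq> {a}" by (auto simp: basis_vector_def)
  then show ?thesis using assms finite_subset[of _ "{a}"]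
    by (auto simp: free_module_def basis_vector_def)
qed

lemma (in cring) finsum_free_module:
  assumes "finite B" "\<And>b. b \<in> B \<Longrightarrow> g b \<in> carrier (free_module R A)"
  shows "(\<Oplus>\<^bsub>free_module R A\<^esub>b\<in>B. g b) = (\<lambda>x. \<Oplus>b\<in>B. g b x)"
proof -
  interpret F: module R "free_module R A" by (rule free_module_module)
  show ?thesis using assms
  proof (induction B)
    case empty
    have "(\<Oplus>\<^bsub>free_module R A\<^esub>b\<in>{}. g b) = \<zero>\<^bsub>free_module R A\<^esub>" by (rule F.finsum_empty)
    then show ?case by (simp add: free_module_def)
  next
    case (insert b B)
    then have "g b x \<in> carrier R" "(\<lambda>b. g b x) \<in> B \<rightarrow> carrier R" for x
      by (auto simp: free_module_def)
    moreover have "f \<oplus>\<^bsub>free_module R A\<^esub> f' = (\<lambda>x. f x \<oplus> f' x)" for f f'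
      by (simp add: free_module_def)
    ultimately show ?case using insert by (simp add: F.finsum_insert Pi_def)
  qed
qed

lemma (in cring) free_module_expand:
  assumes f: "f \<in> carrier (free_module R A)"
  shows "f = (\<Oplus>\<^bsub>free_module R A\<^esub>a\<in>{a. f a \<noteq> \<zero>}. f a \<odot>\<^bsub>free_module R A\<^esub> basis_vector R a)"
proof -
  interpret F: module R "free_module R A" by (rule free_module_module)
  let ?S = "{a. f a \<noteq> \<zero>}"
  have fin: "finite ?S" and fR: "\<And>a. f a \<in> carrier R" and sub: "?S \<subseteq> A"
    using f by (auto simp: free_module_def)
  have cl: "f a \<odot>\<^bsub>free_module R A\<^esub> basis_vector R a \<in> carrier (free_module R A)" if "a \<in> ?S" for a
    using that sub fR by (intro F.smult_closed basis_vector_closed) auto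
  have "(\<Oplus>a\<in>?S. (f a \<odot>\<^bsub>free_module R A\<^esub> basis_vector R a) x) = f x" for x
  proof -
    have "(\<Oplus>a\<in>?S. (f a \<odot>\<^bsub>free_module R A\<^esub> basis_vector R a) x) = (\<Oplus>a\<in>?S. if x = a then f a else \<zero>)"
      using fR by (intro add.finprod_cong') (auto simp: free_module_def basis_vector_def)
    also have "\<dots> = f x"
    proof (cases "x \<in> ?S")
      case True
      then show ?thesis using add.finprod_singleton[OF True fin, of f] fR by simp
    next
      case False
      then have "(\<Oplus>a\<in>?S. if x = a then f a else \<zero>) = (\<Oplus>a\<in>?S. \<zero>)"
        by (intro add.finprod_cong') auto
      then show ?thesis using False by simp
    qed
    finally show ?thesis .
  qed
  then show ?thesis using finsum_free_module[OF fin cl] by simp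
qed

text \<open>The linear map out of a free module that sends the basis vector at \<open>a\<close> to
  \<open>b a\<close>. Restricting the sum to the support keeps it finite for an infinite index
  set.\<close>

definition lin_ext :: "('r, 'k) ring_scheme \<Rightarrow> ('r, 'n, 'y) module_scheme \<Rightarrow> ('a \<Rightarrow> 'n) \<Rightarrow> ('a \<Rightarrow> 'r) \<Rightarrow> 'n"
  where "lin_ext R N b f = (\<Oplus>\<^bsub>N\<^esub>a\<in>{a. f a \<noteq> \<zero>\<^bsub>R\<^esub>}. f a \<odot>\<^bsub>N\<^esub> b a)"

text \<open>Terms outside the support vanish. Additivity needs this, since the supports of two
  functions and of their sum differ and all three sums must run over a common set.\<close>

lemma (in module) lin_ext_superset:
  assumes "f \<in> carrier (free_module R A)" "b \<in> A \<rightarrow> carrier M"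
    and "finite B" "{a. f a \<noteq> \<zero>} \<subseteq> B" "B \<subseteq> A"
  shows "lin_ext R M b f = (\<Oplus>\<^bsub>M\<^esub>a\<in>B. f a \<odot>\<^bsub>M\<^esub> b a)"
  unfolding lin_ext_def using assms
  by (intro M.add.finprod_mono_neutral_cong_left) (auto simp: free_module_def Pi_def subset_iff)

lemma (in module) lin_ext_hom:
  assumes b: "b \<in> A \<rightarrow> carrier M"
  shows "lin_ext R M b \<in> module_hom R (free_module R A) M"
proof (intro module_homI)
  interpret F: module R "free_module R A" by (rule R.free_module_module)
  fix f assume f: "f \<in> carrier (free_module R A)"
  then have fb: "f a \<odot>\<^bsub>M\<^esub> b a \<in> carrier M" if "a \<in> A" for a
    using b that by (auto simp: free_module_def)
  have supp: "finite {a. f a \<noteq> \<zero>}" "{a. f a \<noteq> \<zero>} \<subseteq> A"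
    using f by (auto simp: free_module_def)
  show "lin_ext R M b f \<in> carrier M"
    unfolding lin_ext_def using supp fb by (intro M.finsum_closed) auto
  show "lin_ext R M b (r \<odot>\<^bsub>free_module R A\<^esub> f) = r \<odot>\<^bsub>M\<^esub> lin_ext R M b f" if r: "r \<in> carrier R" for r
  proof -
    have rf: "r \<odot>\<^bsub>free_module R A\<^esub> f \<in> carrier (free_module R A)" using r f by simp
    have "lin_ext R M b (r \<odot>\<^bsub>free_module R A\<^esub> f) =
        (\<Oplus>\<^bsub>M\<^esub>a\<in>{a. f a \<noteq> \<zero>}. (r \<odot>\<^bsub>free_module R A\<^esub> f) a \<odot>\<^bsub>M\<^esub> b a)"
      using rf supp r by (intro lin_ext_superset[OF _ b]) (auto simp: free_module_def)
    also have "\<dots> = (\<Oplus>\<^bsub>M\<^esub>a\<in>{a. f a \<noteq> \<zero>}. r \<odot>\<^bsub>M\<^esub> (f a \<odot>\<^bsub>M\<^esub> b a))"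
      using supp r b f fb
      by (intro M.add.finprod_cong') (auto simp: free_module_def subset_iff smult_assoc1 Pi_def)
    also have "\<dots> = r \<odot>\<^bsub>M\<^esub> lin_ext R M b f"
      unfolding lin_ext_def using supp fb r by (subst finsum_smult_ldistr) auto
    finally show ?thesis .
  qed
  fix g assume g: "g \<in> carrier (free_module R A)"
  then have gb: "g a \<odot>\<^bsub>M\<^esub> b a \<in> carrier M" if "a \<in> A" for a
    using b that by (auto simp: free_module_def)
  have supp': "finite {a. g a \<noteq> \<zero>}" "{a. g a \<noteq> \<zero>} \<subseteq> A"
    using g by (auto simp: free_module_def)
  let ?B = "{a. f a \<noteq> \<zero>} \<union> {a. g a \<noteq> \<zero>}"
  have fg: "f \<oplus>\<^bsub>free_module R A\<^esub> g \<in> carrier (free_module R A)" using f g by simp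
  have B: "finite ?B" "?B \<subseteq> A" using supp supp' by auto
  have "lin_ext R M b (f \<oplus>\<^bsub>free_module R A\<^esub> g) =
      (\<Oplus>\<^bsub>M\<^esub>a\<in>?B. (f \<oplus>\<^bsub>free_module R A\<^esub> g) a \<odot>\<^bsub>M\<^esub> b a)"
    using B by (intro lin_ext_superset[OF fg b]) (auto simp: free_module_def)
  also have "\<dots> = (\<Oplus>\<^bsub>M\<^esub>a\<in>?B. f a \<odot>\<^bsub>M\<^esub> b a \<oplus>\<^bsub>M\<^esub> g a \<odot>\<^bsub>M\<^esub> b a)"
    using B f g b fb gb
    by (intro M.add.finprod_cong') (auto simp: free_module_def subset_iff smult_l_distr Pi_def)
  also have "\<dots> = (\<Oplus>\<^bsub>M\<^esub>a\<in>?B. f a \<odot>\<^bsub>M\<^esub> b a) \<oplus>\<^bsub>M\<^esub> (\<Oplus>\<^bsub>M\<^esub>a\<in>?B. g a \<odot>\<^bsub>M\<^esub> b a)"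
    using B fb gb by (intro M.finsum_addf) auto
  also have "(\<Oplus>\<^bsub>M\<^esub>a\<in>?B. f a \<odot>\<^bsub>M\<^esub> b a) = lin_ext R M b f"
    using B by (intro lin_ext_superset[OF f b, symmetric]) auto
  also have "(\<Oplus>\<^bsub>M\<^esub>a\<in>?B. g a \<odot>\<^bsub>M\<^esub> b a) = lin_ext R M b g"
    using B by (intro lin_ext_superset[OF g b, symmetric]) auto
  finally show "lin_ext R M b (f \<oplus>\<^bsub>free_module R A\<^esub> g) = lin_ext R M b f \<oplus>\<^bsub>M\<^esub> lin_ext R M b g" .
qed

lemma (in module) lin_ext_basis_vector:
  assumes b: "b \<in> A \<rightarrow> carrier M" "a \<in> A"
  shows "lin_ext R M b (basis_vector R a) = b a"
proof -
  have "lin_ext R M b (basis_vector R a) = (\<Oplus>\<^bsub>M\<^esub>c\<in>{a}. basis_vector R a c \<odot>\<^bsub>M\<^esub> b c)"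
    using assms by (intro lin_ext_superset[OF R.basis_vector_closed[OF assms(2)] b(1)])
      (auto simp: basis_vector_def)
  also have "\<dots> = b a" using assms by (auto simp: basis_vector_def M.finsum_insert Pi_def)
  finally show ?thesis .
qed

subsection \<open>Quotient modules\<close>

lemma (in module) quotient_module_sel:
  "carrier (quotient_module M K) = (\<lambda>x. K +>\<^bsub>M\<^esub> x) ` carrier M"
  "zero (quotient_module M K) = K"
  "one (quotient_module M K) = K +>\<^bsub>M\<^esub> \<one>\<^bsub>M\<^esub>"
  "add (quotient_module M K) = set_add M"
  "monoid.mult (quotient_module M K) = rcoset_mult M K"
  "smult (quotient_module M K) = (\<lambda>r X. \<Union>x\<in>X. K +>\<^bsub>M\<^esub> (r \<odot>\<^bsub>M\<^esub> x))"
  by (simp_all add: quotient_module_def ring.extend_def module.fields_def FactRing_simps UNION_singleton_eq_range)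

context module
begin

context
  fixes K assumes K: "submodule K R M"
begin

lemma coset_eq_iff:
  assumes "x \<in> carrier M" "y \<in> carrier M"
  shows "K +>\<^bsub>M\<^esub> x = K +>\<^bsub>M\<^esub> y \<longleftrightarrow> x \<ominus>\<^bsub>M\<^esub> y \<in> K"
proof -
  have sg: "subgroup K (add_monoid M)" using K by (simp add: submodule_def)
  have sub: "K \<subseteq> carrier M" using submoduleE(1)[OF K] .
  show ?thesis
  proof
    assume "K +>\<^bsub>M\<^esub> x = K +>\<^bsub>M\<^esub> y"
    then have "K +>\<^bsub>M\<^esub> (x \<ominus>\<^bsub>M\<^esub> y) = K"
      using M.a_coset_add_inv2[OF _ assms sub] by (simp add: M.minus_eq)
    then show "x \<ominus>\<^bsub>M\<^esub> y \<in> K" using M.a_coset_join1[OF _ _ sg] assms by auto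
  next
    assume "x \<ominus>\<^bsub>M\<^esub> y \<in> K"
    then have "K +>\<^bsub>M\<^esub> (x \<ominus>\<^bsub>M\<^esub> y) = K" using M.a_coset_join2[OF _ sg] assms by auto
    then show "K +>\<^bsub>M\<^esub> x = K +>\<^bsub>M\<^esub> y" using M.a_coset_add_inv1 assms sub by (simp add: M.minus_eq)
  qed
qed

lemma coset_rep:
  assumes "x \<in> carrier M" "y \<in> K +>\<^bsub>M\<^esub> x"
  shows "y \<in> carrier M" "K +>\<^bsub>M\<^esub> y = K +>\<^bsub>M\<^esub> x"
proof -
  have sg: "subgroup K (add_monoid M)" using K by (simp add: submodule_def)
  show "y \<in> carrier M" using M.a_r_coset_subset_G[OF submoduleE(1)[OF K] assms(1)] assms(2) by blast
  show "K +>\<^bsub>M\<^esub> y = K +>\<^bsub>M\<^esub> x" using M.a_repr_independence[OF assms(2,1) sg] by simp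
qed

lemma coset_self:
  assumes "x \<in> carrier M"
  shows "x \<in> K +>\<^bsub>M\<^esub> x"
proof -
  have "\<zero>\<^bsub>M\<^esub> \<in> K" using subgroup.one_closed[OF submodule.axioms(1)[OF K]] by simp
  then show ?thesis using M.a_rcosI[OF _ submoduleE(1)[OF K] assms, of "\<zero>\<^bsub>M\<^esub>"] assms by simp
qed

lemma coset_add:
  assumes "x \<in> carrier M" "y \<in> carrier M"
  shows "(K +>\<^bsub>M\<^esub> x) \<oplus>\<^bsub>quotient_module M K\<^esub> (K +>\<^bsub>M\<^esub> y) = K +>\<^bsub>M\<^esub> (x \<oplus>\<^bsub>M\<^esub> y)"
proof -
  interpret S: abelian_subgroup K M
    using K M.abelian_group_axioms
    by (intro abelian_subgroupI3 additive_subgroupI) (auto simp: submodule_def)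
  show ?thesis using S.a_rcos_sum[OF assms] by (simp add: quotient_module_sel)
qed

text \<open>The scalar multiple of a coset is defined as a union over its elements; since
  \<open>K\<close> is closed under scalars, every element contributes the same coset.\<close>

lemma coset_smult:
  assumes "r \<in> carrier R" "x \<in> carrier M"
  shows "r \<odot>\<^bsub>quotient_module M K\<^esub> (K +>\<^bsub>M\<^esub> x) = K +>\<^bsub>M\<^esub> (r \<odot>\<^bsub>M\<^esub> x)"
proof -
  have "K +>\<^bsub>M\<^esub> (r \<odot>\<^bsub>M\<^esub> y) = K +>\<^bsub>M\<^esub> (r \<odot>\<^bsub>M\<^esub> x)" if y: "y \<in> K +>\<^bsub>M\<^esub> x" for y
  proof -
    note y = coset_rep[OF assms(2) y]
    have "r \<odot>\<^bsub>M\<^esub> (y \<ominus>\<^bsub>M\<^esub> x) \<in> K"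
      using coset_eq_iff[OF y(1) assms(2)] y(2) submodule.smult_closed[OF K assms(1)] by simp
    also have "r \<odot>\<^bsub>M\<^esub> (y \<ominus>\<^bsub>M\<^esub> x) = r \<odot>\<^bsub>M\<^esub> y \<ominus>\<^bsub>M\<^esub> r \<odot>\<^bsub>M\<^esub> x"
      using assms y by (simp add: M.minus_eq smult_r_distr smult_r_minus)
    finally show ?thesis using coset_eq_iff assms y by simp
  qed
  then have "(\<Union>y\<in>K +>\<^bsub>M\<^esub> x. K +>\<^bsub>M\<^esub> (r \<odot>\<^bsub>M\<^esub> y)) = (\<Union>y\<in>K +>\<^bsub>M\<^esub> x. K +>\<^bsub>M\<^esub> (r \<odot>\<^bsub>M\<^esub> x))"
    by (rule SUP_cong[OF refl])
  also have "\<dots> = K +>\<^bsub>M\<^esub> (r \<odot>\<^bsub>M\<^esub> x)" using coset_self[OF assms(2)] by (metis SUP_const empty_iff)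
  finally show ?thesis by (simp only: quotient_module_sel)
qed

lemma quotient_module_module: "module R (quotient_module M K)"
proof -
  let ?Q = "quotient_module M K"
  have K0: "K = K +>\<^bsub>M\<^esub> \<zero>\<^bsub>M\<^esub>" using submoduleE(1)[OF K] by simp
  have z: "\<zero>\<^bsub>?Q\<^esub> = K +>\<^bsub>M\<^esub> \<zero>\<^bsub>M\<^esub>" using K0 by (simp add: quotient_module_sel)
  have c: "X \<in> carrier ?Q \<Longrightarrow> \<exists>x\<in>carrier M. X = K +>\<^bsub>M\<^esub> x"
    and c': "x \<in> carrier M \<Longrightarrow> K +>\<^bsub>M\<^esub> x \<in> carrier ?Q" for X x by (auto simp: quotient_module_sel)
  have "abelian_group ?Q"
  proof (rule abelian_groupI)
    fix X assume "X \<in> carrier ?Q"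
    then obtain x where "x \<in> carrier M" "X = K +>\<^bsub>M\<^esub> x" using c by blast
    then show "\<exists>Y\<in>carrier ?Q. Y \<oplus>\<^bsub>?Q\<^esub> X = \<zero>\<^bsub>?Q\<^esub>"
      by (intro bexI[of _ "K +>\<^bsub>M\<^esub> (\<ominus>\<^bsub>M\<^esub> x)"]) (auto simp: z coset_add M.l_neg c')
  qed (auto simp: z coset_add M.a_ac c' dest!: c)
  then show ?thesis
    by (intro moduleI)
      (auto simp: coset_add coset_smult c' R.is_cring smult_l_distr smult_r_distr smult_assoc1 dest!: c)
qed

lemma coset_hom: "(\<lambda>x. K +>\<^bsub>M\<^esub> x) \<in> module_hom R M (quotient_module M K)"
  by (rule module_homI) (simp_all add: quotient_module_sel(1) coset_add coset_smult)

end

end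

section \<open>Tensor products\<close>

lemma (in abelian_group) minus_eq_zeroD:
  assumes "x \<ominus> y = \<zero>" "x \<in> carrier G" "y \<in> carrier G"
  shows "x = y"
proof -
  have "x = (x \<ominus> y) \<oplus> y" using assms(2,3) by (simp add: minus_eq a_assoc l_neg)
  then show ?thesis using assms by simp
qed

lemma module_hom_finsum_fun:
  assumes "module R M" "module R N" "\<And>k. k \<in> I \<Longrightarrow> h k \<in> module_hom R M N"
  shows "(\<lambda>x. \<Oplus>\<^bsub>N\<^esub>k\<in>I. h k x) \<in> module_hom R M N"
proof -
  interpret M: module R M by fact
  interpret N: module R N by fact
  note h = module_homD[OF assms(3)]
  have c: "(\<lambda>k. h k x) \<in> I \<rightarrow> carrier N" if "x \<in> carrier M" for x using h that by auto
  show ?thesis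
  proof (cases "finite I")
    case False
    then show ?thesis by (intro module_homI) (auto simp: N.finsum_infinite)
  next
    case True
    show ?thesis
    proof (intro module_homI)
      fix x y assume "x \<in> carrier M" "y \<in> carrier M"
      moreover from this have "(\<Oplus>\<^bsub>N\<^esub>k\<in>I. h k (x \<oplus>\<^bsub>M\<^esub> y)) = (\<Oplus>\<^bsub>N\<^esub>k\<in>I. h k x \<oplus>\<^bsub>N\<^esub> h k y)"
        using h by (intro N.M.add.finprod_cong') auto
      ultimately show "(\<Oplus>\<^bsub>N\<^esub>k\<in>I. h k (x \<oplus>\<^bsub>M\<^esub> y)) = (\<Oplus>\<^bsub>N\<^esub>k\<in>I. h k x) \<oplus>\<^bsub>N\<^esub> (\<Oplus>\<^bsub>N\<^esub>k\<in>I. h k y)"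
        using N.M.finsum_addf[OF c c, of x y] by simp
    next
      fix r x assume rx: "r \<in> carrier R" "x \<in> carrier M"
      then have "(\<Oplus>\<^bsub>N\<^esub>k\<in>I. h k (r \<odot>\<^bsub>M\<^esub> x)) = (\<Oplus>\<^bsub>N\<^esub>k\<in>I. r \<odot>\<^bsub>N\<^esub> h k x)"
        using h by (intro N.M.add.finprod_cong') auto
      then show "(\<Oplus>\<^bsub>N\<^esub>k\<in>I. h k (r \<odot>\<^bsub>M\<^esub> x)) = r \<odot>\<^bsub>N\<^esub> (\<Oplus>\<^bsub>N\<^esub>k\<in>I. h k x)"
        using N.finsum_smult_ldistr[OF True rx(1) c[OF rx(2)]] by simp
    qed (use c in \<open>auto intro!: N.M.finsum_closed\<close>)
  qed
qed

section \<open>Elementary tensors and the universal property\<close>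

definition bilinear_map ::
    "('r, 'k) ring_scheme \<Rightarrow> ('r, 'l, 'x) module_scheme \<Rightarrow> ('r, 'm, 'y) module_scheme
      \<Rightarrow> ('r, 'n, 'z) module_scheme \<Rightarrow> ('l \<Rightarrow> 'm \<Rightarrow> 'n) \<Rightarrow> bool"
  where "bilinear_map R L M N \<beta> \<longleftrightarrow>
    (\<forall>x\<in>carrier L. \<beta> x \<in> module_hom R M N) \<and>
    (\<forall>y\<in>carrier M. (\<lambda>x. \<beta> x y) \<in> module_hom R L N)"

locale tensor_modules = L: module R L + M: module R M
  for R (structure) and L :: "('r, 'l, 'x) module_scheme" and M :: "('r, 'm, 'y) module_scheme"
begin

abbreviation "F \<equiv> tensor_free R L M"

abbreviation "T \<equiv> tensor_product R L M"

definition "K = \<Inter>{K. submodule K R F \<and> tensor_relations R L M \<subseteq> K}"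

text \<open>The elementary tensor x \<otimes> y.\<close>

definition tns :: "'l \<Rightarrow> 'm \<Rightarrow> ('l \<times> 'm \<Rightarrow> 'r) set"
  where "tns x y = K +>\<^bsub>F\<^esub> basis_vector R (x, y)"

lemma F_sel:
  "carrier F = carrier (free_module R (carrier L \<times> carrier M))"
  "zero F = zero (free_module R (carrier L \<times> carrier M))"
  "add F = add (free_module R (carrier L \<times> carrier M))"
  "smult F = smult (free_module R (carrier L \<times> carrier M))"
  by (simp_all add: tensor_free_def)

lemma F_module: "module R F"
  by (rule module_cong[OF L.R.free_module_module]) (rule F_sel)+

interpretation F: module R F by (rule F_module)

lemma F_basis_closed: "x \<in> carrier L \<Longrightarrow> y \<in> carrier M \<Longrightarrow> basis_vector R (x, y) \<in> carrier F"
  unfolding F_sel by (rule L.R.basis_vector_closed) simp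

lemma relations_subset: "tensor_relations R L M \<subseteq> carrier F"
  unfolding tensor_relations_def Let_def by (auto intro!: F.M.minus_closed F.M.a_closed F.smult_closed F_basis_closed)

lemma K_submodule: "submodule K R F"
proof -
  \<comment> \<open>The intersected family is nonempty; only for this reason does the intersection
    lie in the carrier.\<close>
  have "carrier F \<in> {K. submodule K R F \<and> tensor_relations R L M \<subseteq> K}"
    using F.carrier_is_submodule relations_subset by simp
  then have "K \<subseteq> carrier F" unfolding K_def by blast
  then show ?thesis
  proof (rule F.submoduleI)
    show "\<zero>\<^bsub>F\<^esub> \<in> K"
      unfolding K_def using subgroup.one_closed[OF submodule.axioms(1)] by fastforce
    show "\<ominus>\<^bsub>F\<^esub> a \<in> K" if "a \<in> K" for a
      using that F.submoduleE(3) unfolding K_def by blast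
    show "a \<oplus>\<^bsub>F\<^esub> b \<in> K" if "a \<in> K" "b \<in> K" for a b
      using that F.submoduleE(5) unfolding K_def by blast
    show "r \<odot>\<^bsub>F\<^esub> a \<in> K" if "r \<in> carrier R" "a \<in> K" for r a
      using that F.submoduleE(4) unfolding K_def by blast
  qed
qed

lemma relations_K: "tensor_relations R L M \<subseteq> K"
  unfolding K_def by blast

lemma T_quotient: "T = quotient_module F K"
  by (simp add: tensor_product_def K_def)

lemma T_module: "module R T"
  unfolding T_quotient by (rule F.quotient_module_module[OF K_submodule])

interpretation T: module R T by (rule T_module)

lemma coset_hom_T: "(\<lambda>f. K +>\<^bsub>F\<^esub> f) \<in> module_hom R F T"
  unfolding T_quotient by (rule F.coset_hom[OF K_submodule])

lemma T_carrier: "carrier T = (\<lambda>f. K +>\<^bsub>F\<^esub> f) ` carrier F"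
  unfolding T_quotient by (rule F.quotient_module_sel(1))

lemma tns_closed: "x \<in> carrier L \<Longrightarrow> y \<in> carrier M \<Longrightarrow> tns x y \<in> carrier T"
  unfolding tns_def T_carrier using F_basis_closed by blast

text \<open>Each of the four families in \<open>tensor_relations\<close> gives one of the four
  laws.\<close>

lemma tns_bilinear: "bilinear_map R L M T tns"
proof -
  have eq: "K +>\<^bsub>F\<^esub> a = K +>\<^bsub>F\<^esub> b"
    if "a \<ominus>\<^bsub>F\<^esub> b \<in> tensor_relations R L M" "a \<in> carrier F" "b \<in> carrier F" for a b
    using F.coset_eq_iff[OF K_submodule that(2,3)] relations_K that(1) by blast
  note c = module_homD(2,3)[OF coset_hom_T] and e = F_basis_closed
  have "tns x (y \<oplus>\<^bsub>M\<^esub> y') = tns x y \<oplus>\<^bsub>T\<^esub> tns x y'"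
    if x: "x \<in> carrier L" "y \<in> carrier M" "y' \<in> carrier M" for x y y'
    unfolding tns_def c(1)[OF e e, OF x(1,2) x(1,3), symmetric]
    by (rule eq, unfold tensor_relations_def Let_def) (use x e in blast)+
  moreover have "tns (x \<oplus>\<^bsub>L\<^esub> x') y = tns x y \<oplus>\<^bsub>T\<^esub> tns x' y"
    if x: "x \<in> carrier L" "x' \<in> carrier L" "y \<in> carrier M" for x x' y
    unfolding tns_def c(1)[OF e e, OF x(1,3) x(2,3), symmetric]
    by (rule eq, unfold tensor_relations_def Let_def) (use x e in blast)+
  moreover have "tns (r \<odot>\<^bsub>L\<^esub> x) y = r \<odot>\<^bsub>T\<^esub> tns x y"
    if x: "r \<in> carrier R" "x \<in> carrier L" "y \<in> carrier M" for r x y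
    unfolding tns_def c(2)[OF x(1) e, OF x(2,3), symmetric]
    by (rule eq, unfold tensor_relations_def Let_def) (use x e in blast)+
  moreover have "tns x (r \<odot>\<^bsub>M\<^esub> y) = r \<odot>\<^bsub>T\<^esub> tns x y"
    if x: "r \<in> carrier R" "x \<in> carrier L" "y \<in> carrier M" for r x y
    unfolding tns_def c(2)[OF x(1) e, OF x(2,3), symmetric]
    by (rule eq, unfold tensor_relations_def Let_def) (use x e in blast)+
  ultimately show ?thesis
    unfolding bilinear_map_def by (intro conjI ballI module_homI) (simp_all add: tns_closed)
qed

lemmas tns_hom_right = tns_bilinear[unfolded bilinear_map_def, THEN conjunct1, rule_format]
lemmas tns_hom_left = tns_bilinear[unfolded bilinear_map_def, THEN conjunct2, rule_format]

lemma finsum_F: "finsum F = finsum (free_module R (carrier L \<times> carrier M))"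
  by (intro ext) (simp add: finsum_def F_sel)

text \<open>The elementary tensors span: the coset map is linear and is applied to the expansion of
  \<open>f\<close> in basis vectors.\<close>

lemma coset_expand:
  assumes f: "f \<in> carrier F"
  shows "K +>\<^bsub>F\<^esub> f = (\<Oplus>\<^bsub>T\<^esub>z\<in>{z. f z \<noteq> \<zero>}. f z \<odot>\<^bsub>T\<^esub> tns (fst z) (snd z))"
proof -
  have fz: "f z \<in> carrier R" "f z \<noteq> \<zero> \<Longrightarrow> fst z \<in> carrier L \<and> snd z \<in> carrier M" for z
    using f by (cases z, force simp: F_sel free_module_def)+
  have "f = (\<Oplus>\<^bsub>F\<^esub>z\<in>{z. f z \<noteq> \<zero>}. f z \<odot>\<^bsub>F\<^esub> basis_vector R z)"
    using L.R.free_module_expand[of f] f by (simp add: F_sel finsum_F)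
  then have "K +>\<^bsub>F\<^esub> f = K +>\<^bsub>F\<^esub> (\<Oplus>\<^bsub>F\<^esub>z\<in>{z. f z \<noteq> \<zero>}. f z \<odot>\<^bsub>F\<^esub> basis_vector R z)"
    by simp
  also have "\<dots> = (\<Oplus>\<^bsub>T\<^esub>z\<in>{z. f z \<noteq> \<zero>}. K +>\<^bsub>F\<^esub> (f z \<odot>\<^bsub>F\<^esub> basis_vector R z))"
    using fz F_basis_closed
    by (intro module_hom_finsum[OF F_module T_module coset_hom_T]) auto
  also have "\<dots> = (\<Oplus>\<^bsub>T\<^esub>z\<in>{z. f z \<noteq> \<zero>}. f z \<odot>\<^bsub>T\<^esub> tns (fst z) (snd z))"
  proof (intro T.M.add.finprod_cong')
    fix z assume "z \<in> {z. f z \<noteq> \<zero>}"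
    then show "K +>\<^bsub>F\<^esub> (f z \<odot>\<^bsub>F\<^esub> basis_vector R z) = f z \<odot>\<^bsub>T\<^esub> tns (fst z) (snd z)"
      using fz[of z] F_basis_closed[of "fst z" "snd z"] module_homD(3)[OF coset_hom_T]
      by (simp add: tns_def)
  qed (use fz tns_closed in auto)
  finally show ?thesis .
qed

text \<open>Elementary tensors span, so they determine a linear map. Identities between maps on
  tensor products are checked through this criterion.\<close>

lemma T_hom_eqI:
  assumes "module R N" "g \<in> module_hom R T N" "h \<in> module_hom R T N"
    and eq: "\<And>x y. x \<in> carrier L \<Longrightarrow> y \<in> carrier M \<Longrightarrow> g (tns x y) = h (tns x y)"
    and X: "X \<in> carrier T"
  shows "g X = h X"
proof -
  interpret N: module R N by fact
  obtain f where f: "f \<in> carrier F" "X = K +>\<^bsub>F\<^esub> f" using X T_carrier by blast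
  have fz: "f z \<in> carrier R" "f z \<noteq> \<zero> \<Longrightarrow> fst z \<in> carrier L \<and> snd z \<in> carrier M" for z
    using f by (cases z, force simp: F_sel free_module_def)+
  have cl: "(\<lambda>z. f z \<odot>\<^bsub>T\<^esub> tns (fst z) (snd z)) \<in> {z. f z \<noteq> \<zero>} \<rightarrow> carrier T"
    using fz tns_closed by auto
  have "g X = (\<Oplus>\<^bsub>N\<^esub>z\<in>{z. f z \<noteq> \<zero>}. g (f z \<odot>\<^bsub>T\<^esub> tns (fst z) (snd z)))"
    unfolding f(2) coset_expand[OF f(1)] by (rule module_hom_finsum[OF T_module assms(1,2) cl])
  also have "\<dots> = (\<Oplus>\<^bsub>N\<^esub>z\<in>{z. f z \<noteq> \<zero>}. h (f z \<odot>\<^bsub>T\<^esub> tns (fst z) (snd z)))"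
  proof (intro N.M.add.finprod_cong')
    show "(\<lambda>z. h (f z \<odot>\<^bsub>T\<^esub> tns (fst z) (snd z))) \<in> {z. f z \<noteq> \<zero>} \<rightarrow> carrier N"
      using module_homD(1)[OF assms(3)] cl by auto
  qed (use fz tns_closed eq module_homD(3)[OF assms(2)] module_homD(3)[OF assms(3)] in auto)
  also have "\<dots> = h X"
    unfolding f(2) coset_expand[OF f(1)] by (rule module_hom_finsum[OF T_module assms(1,3) cl, symmetric])
  finally show ?thesis .
qed

text \<open>The map induced by a bilinear \<beta>, evaluated at an arbitrary representative of the
  coset. \<open>lift_coset\<close> shows that the choice has no influence.\<close>

definition lift :: "('r, 'n, 'z) module_scheme \<Rightarrow> ('l \<Rightarrow> 'm \<Rightarrow> 'n) \<Rightarrow> ('l \<times> 'm \<Rightarrow> 'r) set \<Rightarrow> 'n"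
  where "lift N \<beta> X = lin_ext R N (\<lambda>z. \<beta> (fst z) (snd z)) (SOME f. f \<in> X)"

abbreviation \<Lambda> :: "('r, 'n, 'z) module_scheme \<Rightarrow> ('l \<Rightarrow> 'm \<Rightarrow> 'n) \<Rightarrow> ('l \<times> 'm \<Rightarrow> 'r) \<Rightarrow> 'n"
  where "\<Lambda> N \<beta> \<equiv> lin_ext R N (\<lambda>z. \<beta> (fst z) (snd z))"

context
  fixes N :: "('r, 'n, 'z) module_scheme" and \<beta>
  assumes N: "module R N" and \<beta>: "bilinear_map R L M N \<beta>"
begin

interpretation N: module R N by (rule N)

lemmas bilinear_right = \<beta>[unfolded bilinear_map_def, THEN conjunct1, rule_format, THEN module_homD(2)]
  \<beta>[unfolded bilinear_map_def, THEN conjunct1, rule_format, THEN module_homD(3)]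

lemmas bilinear_left = \<beta>[unfolded bilinear_map_def, THEN conjunct2, rule_format, THEN module_homD(2)]
  \<beta>[unfolded bilinear_map_def, THEN conjunct2, rule_format, THEN module_homD(3)]

lemmas bilinear_closed = \<beta>[unfolded bilinear_map_def, THEN conjunct1, rule_format, THEN module_homD(1)]

lemma \<Lambda>_hom: "\<Lambda> N \<beta> \<in> module_hom R F N"
proof -
  have "\<Lambda> N \<beta> \<in> module_hom R (free_module R (carrier L \<times> carrier M)) N"
    by (rule N.lin_ext_hom) (simp add: Pi_def bilinear_closed)
  then show ?thesis by (simp add: module_hom_def hom_def F_sel)
qed

lemma \<Lambda>_basis: "x \<in> carrier L \<Longrightarrow> y \<in> carrier M \<Longrightarrow> \<Lambda> N \<beta> (basis_vector R (x, y)) = \<beta> x y"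
  using N.lin_ext_basis_vector[of "\<lambda>z. \<beta> (fst z) (snd z)" "carrier L \<times> carrier M" "(x, y)"]
  by (simp add: Pi_def bilinear_closed)

lemma \<Lambda>_minus:
  assumes "f \<in> carrier F" "g \<in> carrier F"
  shows "\<Lambda> N \<beta> (f \<ominus>\<^bsub>F\<^esub> g) = \<Lambda> N \<beta> f \<ominus>\<^bsub>N\<^esub> \<Lambda> N \<beta> g"
proof -
  note h = module_homD[OF \<Lambda>_hom]
  have "\<Lambda> N \<beta> (f \<ominus>\<^bsub>F\<^esub> g) \<oplus>\<^bsub>N\<^esub> \<Lambda> N \<beta> g = \<Lambda> N \<beta> ((f \<ominus>\<^bsub>F\<^esub> g) \<oplus>\<^bsub>F\<^esub> g)" using assms h by simp
  also have "\<dots> = \<Lambda> N \<beta> f" using assms by (simp add: F.M.minus_eq F.M.a_assoc F.M.l_neg)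
  finally have "\<Lambda> N \<beta> f \<ominus>\<^bsub>N\<^esub> \<Lambda> N \<beta> g = (\<Lambda> N \<beta> (f \<ominus>\<^bsub>F\<^esub> g) \<oplus>\<^bsub>N\<^esub> \<Lambda> N \<beta> g) \<ominus>\<^bsub>N\<^esub> \<Lambda> N \<beta> g" by simp
  also have "\<dots> = \<Lambda> N \<beta> (f \<ominus>\<^bsub>F\<^esub> g)"
    using h(1) assms by (simp add: N.M.minus_eq N.M.a_assoc N.M.r_neg)
  finally show ?thesis ..
qed

text \<open>The kernel of the linear extension is a submodule containing the relations, hence it
  contains the smallest such submodule \<open>K\<close>.\<close>

lemma \<Lambda>_K: "f \<in> K \<Longrightarrow> \<Lambda> N \<beta> f = \<zero>\<^bsub>N\<^esub>"
proof -
  note h = module_homD[OF \<Lambda>_hom]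
  let ?K = "{f \<in> carrier F. \<Lambda> N \<beta> f = \<zero>\<^bsub>N\<^esub>}"
  have z: "\<Lambda> N \<beta> \<zero>\<^bsub>F\<^esub> = \<zero>\<^bsub>N\<^esub>" by (rule module_hom_zero[OF F_module N \<Lambda>_hom])
  have "\<Lambda> N \<beta> (\<ominus>\<^bsub>F\<^esub> a) = \<zero>\<^bsub>N\<^esub>" if "a \<in> carrier F" "\<Lambda> N \<beta> a = \<zero>\<^bsub>N\<^esub>" for a
    using \<Lambda>_minus[of "\<zero>\<^bsub>F\<^esub>" a] that z by (simp add: F.M.minus_eq N.M.minus_eq)
  then have "submodule ?K R F" using h z by (intro F.submoduleI) auto
  moreover have "tensor_relations R L M \<subseteq> ?K"
    using relations_subset unfolding tensor_relations_def Let_def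
    by (auto simp: \<Lambda>_minus \<Lambda>_basis F_basis_closed h bilinear_left bilinear_right bilinear_closed
        N.M.minus_eq N.M.r_neg)
  ultimately show "f \<in> K \<Longrightarrow> \<Lambda> N \<beta> f = \<zero>\<^bsub>N\<^esub>" unfolding K_def by blast
qed

lemma lift_coset:
  assumes f: "f \<in> carrier F"
  shows "lift N \<beta> (K +>\<^bsub>F\<^esub> f) = \<Lambda> N \<beta> f"
proof -
  let ?g = "SOME g. g \<in> K +>\<^bsub>F\<^esub> f"
  have "?g \<in> K +>\<^bsub>F\<^esub> f" by (rule someI[of "\<lambda>g. g \<in> K +>\<^bsub>F\<^esub> f", OF F.coset_self[OF K_submodule f]])
  note g = F.coset_rep[OF K_submodule f this]
  then have "?g \<ominus>\<^bsub>F\<^esub> f \<in> K" using F.coset_eq_iff[OF K_submodule g(1) f] by simp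
  then have "\<Lambda> N \<beta> ?g \<ominus>\<^bsub>N\<^esub> \<Lambda> N \<beta> f = \<zero>\<^bsub>N\<^esub>" using \<Lambda>_minus[OF g(1) f] \<Lambda>_K by simp
  then have "\<Lambda> N \<beta> ?g = \<Lambda> N \<beta> f" using module_homD(1)[OF \<Lambda>_hom] f g(1) by (simp add: N.M.minus_eq_zeroD)
  then show ?thesis by (simp add: lift_def)
qed

lemma lift_hom: "lift N \<beta> \<in> module_hom R T N"
proof -
  note h = module_homD[OF \<Lambda>_hom] and c = module_homD(2,3)[OF coset_hom_T, symmetric]
  show ?thesis
    by (rule module_homI) (auto simp: T_carrier lift_coset c h)
qed

lemma lift_tns: "x \<in> carrier L \<Longrightarrow> y \<in> carrier M \<Longrightarrow> lift N \<beta> (tns x y) = \<beta> x y"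
  by (simp add: tns_def lift_coset F_basis_closed \<Lambda>_basis)

text \<open>The family \<open>(y\<^sub>k, t\<^sub>k)\<close> is a dual basis of \<open>M\<close>, over which the tensors expand.\<close>

lemma tensor_product_isomorphic:
  assumes I: "finite I" and y: "\<And>k. k \<in> I \<Longrightarrow> y k \<in> carrier M"
    and w: "\<And>k. k \<in> I \<Longrightarrow> w k \<in> module_hom R N L"
    and t: "\<And>k m. k \<in> I \<Longrightarrow> m \<in> carrier M \<Longrightarrow> t k m \<in> carrier R"
    and wt: "\<And>k x m. k \<in> I \<Longrightarrow> x \<in> carrier L \<Longrightarrow> m \<in> carrier M \<Longrightarrow> w k (\<beta> x m) = t k m \<odot>\<^bsub>L\<^esub> x"
    and ty: "\<And>m. m \<in> carrier M \<Longrightarrow> (\<Oplus>\<^bsub>M\<^esub>k\<in>I. t k m \<odot>\<^bsub>M\<^esub> y k) = m"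
    and wy: "\<And>n. n \<in> carrier N \<Longrightarrow> (\<Oplus>\<^bsub>N\<^esub>k\<in>I. \<beta> (w k n) (y k)) = n"
  shows "module_isomorphic R T N"
proof -
  \<comment> \<open>The inverse of the lift: n is expanded over the y_k, with the components w_k(n)
    placed in the left factor.\<close>
  let ?g = "\<lambda>n. \<Oplus>\<^bsub>T\<^esub>k\<in>I. tns (w k n) (y k)"
  note w' = module_homD[OF w]
  have g: "?g \<in> module_hom R N T"
    by (rule module_hom_finsum_fun[OF N T_module]) (rule module_hom_comp[OF w tns_hom_left[OF y]])
  have cl: "(\<lambda>k. tns (w k n) (y k)) \<in> I \<rightarrow> carrier T" if "n \<in> carrier N" for n
    using w' y that by (auto intro: tns_closed)
  have lg: "lift N \<beta> (?g n) = n" if n: "n \<in> carrier N" for n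
  proof -
    have "lift N \<beta> (?g n) = (\<Oplus>\<^bsub>N\<^esub>k\<in>I. lift N \<beta> (tns (w k n) (y k)))"
      by (rule module_hom_finsum[OF T_module N lift_hom cl[OF n]])
    also have "\<dots> = (\<Oplus>\<^bsub>N\<^esub>k\<in>I. \<beta> (w k n) (y k))"
      using w' y n by (intro N.M.add.finprod_cong') (auto simp: lift_tns bilinear_closed)
    finally show ?thesis using wy n by simp
  qed
  have gl: "?g (lift N \<beta> X) = X" if "X \<in> carrier T" for X
  proof (rule T_hom_eqI[OF T_module module_hom_comp[OF lift_hom g] _ _ that])
    show "(\<lambda>X. X) \<in> module_hom R T T" by (rule module_homI) auto
  next
    fix x m assume xm: "x \<in> carrier L" "m \<in> carrier M"
    \<comment> \<open>The scalars t_k(m) cross the tensor sign from x to y_k, where the dual basis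
      recombines them to m.\<close>
    have "?g (lift N \<beta> (tns x m)) = (\<Oplus>\<^bsub>T\<^esub>k\<in>I. tns x (t k m \<odot>\<^bsub>M\<^esub> y k))"
    proof (intro T.M.add.finprod_cong')
      fix k assume k: "k \<in> I"
      have "tns (w k (lift N \<beta> (tns x m))) (y k) = t k m \<odot>\<^bsub>T\<^esub> tns x (y k)"
        using k xm t y by (simp add: lift_tns wt module_homD(3)[OF tns_hom_left])
      also have "\<dots> = tns x (t k m \<odot>\<^bsub>M\<^esub> y k)"
        using k xm t y by (simp add: module_homD(3)[OF tns_hom_right])
      finally show "tns (w k (lift N \<beta> (tns x m))) (y k) = tns x (t k m \<odot>\<^bsub>M\<^esub> y k)" .
    qed (use xm t y tns_closed in auto)
    also have "\<dots> = tns x (\<Oplus>\<^bsub>M\<^esub>k\<in>I. t k m \<odot>\<^bsub>M\<^esub> y k)"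
      using xm t y by (intro module_hom_finsum[OF M.module_axioms T_module tns_hom_right, symmetric]) auto
    finally show "?g (lift N \<beta> (tns x m)) = tns x m" using ty xm by simp
  qed
  have "bij_betw (lift N \<beta>) (carrier T) (carrier N)"
    by (rule bij_betw_byWitness[where f' = ?g])
      (use lg gl module_homD(1)[OF g] module_homD(1)[OF lift_hom] in auto)
  then show ?thesis using lift_hom unfolding module_isomorphic_def by blast
qed

end

end

section \<open>Tensor products of algebras and separability\<close>

lemma (in abelian_monoid) finsum_fibres:
  assumes "finite A" "h \<in> A \<rightarrow> carrier G"
  shows "(\<Oplus>c\<in>m ` A. \<Oplus>z\<in>{z \<in> A. m z = c}. h z) = (\<Oplus>z\<in>A. h z)"
proof -
  have "(\<Oplus>z\<in>(\<Union>c\<in>m ` A. {z \<in> A. m z = c}). h z) = (\<Oplus>c\<in>m ` A. \<Oplus>z\<in>{z \<in> A. m z = c}. h z)"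
    using assms by (intro add.finprod_UN_disjoint) (auto simp: pairwise_def disjnt_def)
  moreover have "(\<Union>c\<in>m ` A. {z \<in> A. m z = c}) = A" by auto
  ultimately show ?thesis by simp
qed

lemma (in abelian_monoid) finsum_Times:
  assumes "finite A" "finite B" "\<And>a b. a \<in> A \<Longrightarrow> b \<in> B \<Longrightarrow> h (a, b) \<in> carrier G"
  shows "(\<Oplus>z\<in>A \<times> B. h z) = (\<Oplus>a\<in>A. \<Oplus>b\<in>B. h (a, b))"
proof -
  have "(\<Oplus>z\<in>A \<times> B. h z) = (\<Oplus>z\<in>(\<Union>a\<in>A. Pair a ` B). h z)"
    by (rule arg_cong[where f = "finsum G h"]) auto
  also have "\<dots> = (\<Oplus>a\<in>A. \<Oplus>z\<in>Pair a ` B. h z)"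
    using assms by (intro add.finprod_UN_disjoint) (auto simp: pairwise_def disjnt_def)
  also have "\<dots> = (\<Oplus>a\<in>A. \<Oplus>b\<in>B. h (a, b))"
    using assms by (intro add.finprod_cong' add.finprod_reindex funcsetI finsum_closed) (auto intro: inj_onI)
  finally show ?thesis .
qed

lemma (in abelian_monoid) finsum_swap:
  assumes "finite A" "finite B" "\<And>a b. a \<in> A \<Longrightarrow> b \<in> B \<Longrightarrow> h a b \<in> carrier G"
  shows "(\<Oplus>a\<in>A. \<Oplus>b\<in>B. h a b) = (\<Oplus>b\<in>B. \<Oplus>a\<in>A. h a b)"
proof -
  have "(\<Oplus>a\<in>A. \<Oplus>b\<in>B. h a b) = (\<Oplus>z\<in>A \<times> B. h (fst z) (snd z))"
    using assms by (subst finsum_Times) auto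
  also have "A \<times> B = prod.swap ` (B \<times> A)" by auto
  also have "(\<Oplus>z\<in>prod.swap ` (B \<times> A). h (fst z) (snd z)) = (\<Oplus>z\<in>B \<times> A. h (snd z) (fst z))"
    using assms by (subst add.finprod_reindex) (auto intro: inj_onI)
  also have "\<dots> = (\<Oplus>b\<in>B. \<Oplus>a\<in>A. h a b)"
    using assms by (subst finsum_Times) auto
  finally show ?thesis .
qed

lemma (in module) finsum_smult_rdistr:
  assumes "finite A" "x \<in> carrier M" "f \<in> A \<rightarrow> carrier R"
  shows "(\<Oplus>i\<in>A. f i) \<odot>\<^bsub>M\<^esub> x = (\<Oplus>\<^bsub>M\<^esub>i\<in>A. f i \<odot>\<^bsub>M\<^esub> x)"
  using assms
proof (induction A)
  case empty
  then show ?case by (simp add: M.finsum_empty)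
next
  case (insert a A)
  then show ?case by (simp add: M.finsum_insert R.finsum_insert Pi_def smult_l_distr)
qed

lemma (in cring) finsum_mult:
  assumes "finite A" "finite B" "f \<in> A \<rightarrow> carrier R" "g \<in> B \<rightarrow> carrier R"
  shows "(\<Oplus>a\<in>A. f a) \<otimes> (\<Oplus>b\<in>B. g b) = (\<Oplus>z\<in>A \<times> B. f (fst z) \<otimes> g (snd z))"
proof -
  have "(\<Oplus>a\<in>A. f a) \<otimes> (\<Oplus>b\<in>B. g b) = (\<Oplus>a\<in>A. f a \<otimes> (\<Oplus>b\<in>B. g b))"
    using assms by (intro finsum_ldistr) auto
  also have "\<dots> = (\<Oplus>a\<in>A. \<Oplus>b\<in>B. f a \<otimes> g b)"
    using assms by (intro add.finprod_cong' finsum_rdistr funcsetI finsum_closed) auto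
  finally show ?thesis using assms by (subst finsum_Times) auto
qed

locale tensor_algebras = L: algebra R L + M: algebra R M
  for R (structure) and L :: "('r, 'l, 'x) module_scheme" and M :: "('r, 'm, 'y) module_scheme"
begin

sublocale tensor_modules R L M ..

text \<open>The componentwise product of two index pairs; the product of \<open>tensor_free\<close>
  is convolution along it.\<close>

definition "prd z = (fst (fst z) \<otimes>\<^bsub>L\<^esub> fst (snd z), snd (fst z) \<otimes>\<^bsub>M\<^esub> snd (snd z))"

lemma F_mult: "f \<otimes>\<^bsub>F\<^esub> g =
    (\<lambda>c. \<Oplus>z\<in>{z \<in> {a. f a \<noteq> \<zero>} \<times> {b. g b \<noteq> \<zero>}. prd z = c}. f (fst z) \<otimes> g (snd z))"
proof -
  have "{(a, b). f a \<noteq> \<zero> \<and> g b \<noteq> \<zero> \<and> (fst a \<otimes>\<^bsub>L\<^esub> fst b, snd a \<otimes>\<^bsub>M\<^esub> snd b) = c} =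
      {z \<in> {a. f a \<noteq> \<zero>} \<times> {b. g b \<noteq> \<zero>}. prd z = c}" for c
    by (auto simp: prd_def)
  then show ?thesis by (simp add: tensor_free_def)
qed

lemma F_mem: "f \<in> carrier F \<longleftrightarrow> (\<forall>a. f a \<in> carrier R) \<and> finite {a. f a \<noteq> \<zero>} \<and>
    {a. f a \<noteq> \<zero>} \<subseteq> carrier L \<times> carrier M"
  unfolding F_sel by (simp add: free_module_def)

lemma F_mult_support:
  assumes "f \<in> carrier F" "g \<in> carrier F"
  shows "{c. (f \<otimes>\<^bsub>F\<^esub> g) c \<noteq> \<zero>} \<subseteq> prd ` ({a. f a \<noteq> \<zero>} \<times> {b. g b \<noteq> \<zero>})"
proof
  fix c assume c: "c \<in> {c. (f \<otimes>\<^bsub>F\<^esub> g) c \<noteq> \<zero>}"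
  show "c \<in> prd ` ({a. f a \<noteq> \<zero>} \<times> {b. g b \<noteq> \<zero>})"
  proof (rule ccontr)
    assume "\<not> ?thesis"
    then have "{z \<in> {a. f a \<noteq> \<zero>} \<times> {b. g b \<noteq> \<zero>}. prd z = c} = {}" by blast
    then have "(f \<otimes>\<^bsub>F\<^esub> g) c = \<zero>" by (simp only: F_mult L.R.finsum_empty)
    then show False using c by simp
  qed
qed

lemma F_mult_closed:
  assumes "f \<in> carrier F" "g \<in> carrier F"
  shows "f \<otimes>\<^bsub>F\<^esub> g \<in> carrier F"
proof -
  have fg: "\<forall>a. f a \<in> carrier R" "\<forall>a. g a \<in> carrier R" "finite {a. f a \<noteq> \<zero>}" "finite {a. g a \<noteq> \<zero>}"
    "{a. f a \<noteq> \<zero>} \<subseteq> carrier L \<times> carrier M" "{a. g a \<noteq> \<zero>} \<subseteq> carrier L \<times> carrier M"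
    using assms by (simp_all add: F_mem)
  let ?P = "prd ` ({a. f a \<noteq> \<zero>} \<times> {b. g b \<noteq> \<zero>})"
  have "?P \<subseteq> carrier L \<times> carrier M" using fg(5,6) by (fastforce simp: prd_def)
  moreover have "finite ?P" using fg(3,4) by simp
  moreover have "(f \<otimes>\<^bsub>F\<^esub> g) c \<in> carrier R" for c
    unfolding F_mult using fg(1,2) by (intro L.R.finsum_closed) auto
  ultimately show ?thesis
    using F_mult_support[OF assms] finite_subset[OF F_mult_support[OF assms]] unfolding F_mem by blast
qed

text \<open>If \<beta> is multiplicative on pairs, its linear extension is multiplicative for the
  convolution, as for monoid algebras: the double sum is grouped by the value of \<open>prd\<close>,
  and each term splits.\<close>

lemma \<Lambda>_mult:
  assumes "algebra R A" and \<beta>: "bilinear_map R L M A \<beta>"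
    and mult: "\<And>x x' y y'. x \<in> carrier L \<Longrightarrow> x' \<in> carrier L \<Longrightarrow> y \<in> carrier M \<Longrightarrow> y' \<in> carrier M \<Longrightarrow>
      \<beta> (x \<otimes>\<^bsub>L\<^esub> x') (y \<otimes>\<^bsub>M\<^esub> y') = \<beta> x y \<otimes>\<^bsub>A\<^esub> \<beta> x' y'"
    and f: "f \<in> carrier F" and g: "g \<in> carrier F"
  shows "\<Lambda> A \<beta> (f \<otimes>\<^bsub>F\<^esub> g) = \<Lambda> A \<beta> f \<otimes>\<^bsub>A\<^esub> \<Lambda> A \<beta> g"
proof -
  interpret A: cring A using assms(1) by (rule algebra.axioms)
  interpret AA: algebra R A by fact
  have M: "module R A" by (rule AA.module)
  define b where "b = (\<lambda>z. \<beta> (fst z) (snd z))"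
  have b: "b \<in> carrier L \<times> carrier M \<rightarrow> carrier A"
    using bilinear_closed[OF M \<beta>] by (auto simp: b_def)
  define Z where "Z = {a. f a \<noteq> \<zero>} \<times> {b. g b \<noteq> \<zero>}"
  have fg: "\<And>a. f a \<in> carrier R" "\<And>a. g a \<in> carrier R" "finite {a. f a \<noteq> \<zero>}" "finite {a. g a \<noteq> \<zero>}"
    "{a. f a \<noteq> \<zero>} \<subseteq> carrier L \<times> carrier M" "{a. g a \<noteq> \<zero>} \<subseteq> carrier L \<times> carrier M"
    using f g by (simp_all add: F_mem del: split_paired_All)
  have Z: "finite Z" "Z \<subseteq> (carrier L \<times> carrier M) \<times> (carrier L \<times> carrier M)"
    using fg by (auto simp: Z_def)
  have pZ: "prd ` Z \<subseteq> carrier L \<times> carrier M" using Z(2) by (fastforce simp: prd_def)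
  have "\<Lambda> A \<beta> (f \<otimes>\<^bsub>F\<^esub> g) = (\<Oplus>\<^bsub>A\<^esub>c\<in>prd ` Z. (f \<otimes>\<^bsub>F\<^esub> g) c \<odot>\<^bsub>A\<^esub> b c)"
    unfolding b_def[symmetric]
  proof (rule AA.lin_ext_superset[OF _ b _ _ pZ])
    show "f \<otimes>\<^bsub>F\<^esub> g \<in> carrier (free_module R (carrier L \<times> carrier M))"
      using F_mult_closed[OF f g] by (simp only: F_sel)
  qed (use F_mult_support[OF f g] Z in \<open>simp_all add: Z_def\<close>)
  also have "\<dots> = (\<Oplus>\<^bsub>A\<^esub>c\<in>prd ` Z. \<Oplus>\<^bsub>A\<^esub>z\<in>{z \<in> Z. prd z = c}. (f (fst z) \<otimes> g (snd z)) \<odot>\<^bsub>A\<^esub> b (prd z))"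
  proof (intro A.add.finprod_cong' refl)
    fix c assume c: "c \<in> prd ` Z"
    then have bc: "b c \<in> carrier A" using b pZ by blast
    have "(f \<otimes>\<^bsub>F\<^esub> g) c \<odot>\<^bsub>A\<^esub> b c = (\<Oplus>\<^bsub>A\<^esub>z\<in>{z \<in> Z. prd z = c}. (f (fst z) \<otimes> g (snd z)) \<odot>\<^bsub>A\<^esub> b c)"
      unfolding F_mult Z_def[symmetric] using fg Z(1) bc by (intro AA.finsum_smult_rdistr) auto
    also have "\<dots> = (\<Oplus>\<^bsub>A\<^esub>z\<in>{z \<in> Z. prd z = c}. (f (fst z) \<otimes> g (snd z)) \<odot>\<^bsub>A\<^esub> b (prd z))"
      using fg bc by (intro A.add.finprod_cong') auto
    finally show "(f \<otimes>\<^bsub>F\<^esub> g) c \<odot>\<^bsub>A\<^esub> b c =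
      (\<Oplus>\<^bsub>A\<^esub>z\<in>{z \<in> Z. prd z = c}. (f (fst z) \<otimes> g (snd z)) \<odot>\<^bsub>A\<^esub> b (prd z))" .
  next
    have "b (prd z) \<in> carrier A" if "z \<in> Z" for z using b pZ that by blast
    then show "(\<lambda>c. \<Oplus>\<^bsub>A\<^esub>z\<in>{z \<in> Z. prd z = c}. (f (fst z) \<otimes> g (snd z)) \<odot>\<^bsub>A\<^esub> b (prd z))
      \<in> prd ` Z \<rightarrow> carrier A"
      using fg by (intro funcsetI A.finsum_closed) auto
  qed
  \<comment> \<open>The fibres of \<open>prd\<close> are collected, so the sum now runs over pairs
    of indices and no longer over their products.\<close>
  also have "\<dots> = (\<Oplus>\<^bsub>A\<^esub>z\<in>Z. (f (fst z) \<otimes> g (snd z)) \<odot>\<^bsub>A\<^esub> b (prd z))"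
  proof (rule A.finsum_fibres[OF Z(1)])
    have "b (prd z) \<in> carrier A" if "z \<in> Z" for z using b pZ that by blast
    then show "(\<lambda>z. (f (fst z) \<otimes> g (snd z)) \<odot>\<^bsub>A\<^esub> b (prd z)) \<in> Z \<rightarrow> carrier A"
      using fg by auto
  qed
  also have "\<dots> = (\<Oplus>\<^bsub>A\<^esub>z\<in>Z. (f (fst z) \<odot>\<^bsub>A\<^esub> b (fst z)) \<otimes>\<^bsub>A\<^esub> (g (snd z) \<odot>\<^bsub>A\<^esub> b (snd z)))"
  proof (intro A.add.finprod_cong' refl)
    fix z assume z: "z \<in> Z"
    have bz: "b (fst z) \<in> carrier A" "b (snd z) \<in> carrier A"
      using z Z(2) funcset_mem[OF b] by auto
    have "b (prd z) = b (fst z) \<otimes>\<^bsub>A\<^esub> b (snd z)"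
      using z Z(2) unfolding b_def prd_def by (auto intro!: mult)
    then show "(f (fst z) \<otimes> g (snd z)) \<odot>\<^bsub>A\<^esub> b (prd z) =
      (f (fst z) \<odot>\<^bsub>A\<^esub> b (fst z)) \<otimes>\<^bsub>A\<^esub> (g (snd z) \<odot>\<^bsub>A\<^esub> b (snd z))"
      using fg bz by (simp add: AA.smult_assoc1 AA.smult_assoc2 A.m_comm[of "b (fst z)"])
  next
    have "b (fst z) \<in> carrier A" "b (snd z) \<in> carrier A" if "z \<in> Z" for z
      using that Z(2) funcset_mem[OF b] by auto
    then show "(\<lambda>z. (f (fst z) \<odot>\<^bsub>A\<^esub> b (fst z)) \<otimes>\<^bsub>A\<^esub> (g (snd z) \<odot>\<^bsub>A\<^esub> b (snd z))) \<in> Z \<rightarrow> carrier A"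
      using fg by (intro funcsetI A.m_closed AA.smult_closed) auto
  qed
  also have "\<dots> = (\<Oplus>\<^bsub>A\<^esub>a\<in>{a. f a \<noteq> \<zero>}. f a \<odot>\<^bsub>A\<^esub> b a) \<otimes>\<^bsub>A\<^esub> (\<Oplus>\<^bsub>A\<^esub>a\<in>{a. g a \<noteq> \<zero>}. g a \<odot>\<^bsub>A\<^esub> b a)"
  proof -
    have "f a \<odot>\<^bsub>A\<^esub> b a \<in> carrier A" if "f a \<noteq> \<zero>" for a
      using that fg(1,5) b by (intro AA.smult_closed) blast+
    moreover have "g a \<odot>\<^bsub>A\<^esub> b a \<in> carrier A" if "g a \<noteq> \<zero>" for a
      using that fg(2,6) b by (intro AA.smult_closed) blast+
    ultimately show ?thesis
      unfolding Z_def using fg(3,4) by (intro A.finsum_mult[symmetric]) auto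
  qed
  finally show ?thesis unfolding lin_ext_def b_def by simp
qed

interpretation F: module R F by (rule F_module)

lemma T_mult: "X \<otimes>\<^bsub>T\<^esub> Y = (\<Union>a\<in>X. \<Union>b\<in>Y. K +>\<^bsub>F\<^esub> (a \<otimes>\<^bsub>F\<^esub> b))"
  by (simp only: T_quotient F.quotient_module_sel rcoset_mult_def)

lemma T_rep:
  assumes "X \<in> carrier T" "a \<in> X"
  shows "a \<in> carrier F" "X = K +>\<^bsub>F\<^esub> a"
proof -
  obtain f where f: "f \<in> carrier F" "X = K +>\<^bsub>F\<^esub> f" using assms T_carrier by blast
  then show "a \<in> carrier F" "X = K +>\<^bsub>F\<^esub> a" using F.coset_rep[OF K_submodule f(1)] assms by auto
qed

lemma T_nonempty: "X \<in> carrier T \<Longrightarrow> \<exists>a. a \<in> X"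
  using F.coset_self[OF K_submodule] T_carrier by auto

text \<open>A product of cosets is a union of cosets. The last assumption says that it is a single
  one; it then equals the coset of the product of any two representatives, and
  \<open>\<Lambda>_mult\<close> applies.\<close>

lemma lift_mult:
  assumes A: "algebra R A" and \<beta>: "bilinear_map R L M A \<beta>"
    and mult: "\<And>x x' y y'. x \<in> carrier L \<Longrightarrow> x' \<in> carrier L \<Longrightarrow> y \<in> carrier M \<Longrightarrow> y' \<in> carrier M \<Longrightarrow>
      \<beta> (x \<otimes>\<^bsub>L\<^esub> x') (y \<otimes>\<^bsub>M\<^esub> y') = \<beta> x y \<otimes>\<^bsub>A\<^esub> \<beta> x' y'"
    and X: "X \<in> carrier T" and Y: "Y \<in> carrier T" and XY: "X \<otimes>\<^bsub>T\<^esub> Y \<in> carrier T"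
  shows "lift A \<beta> (X \<otimes>\<^bsub>T\<^esub> Y) = lift A \<beta> X \<otimes>\<^bsub>A\<^esub> lift A \<beta> Y"
proof -
  have M: "module R A" by (rule algebra.module[OF A])
  obtain a b where ab: "a \<in> X" "b \<in> Y" using T_nonempty X Y by blast
  note a = T_rep[OF X ab(1)] and b = T_rep[OF Y ab(2)]
  have abF: "a \<otimes>\<^bsub>F\<^esub> b \<in> carrier F" by (rule F_mult_closed[OF a(1) b(1)])
  have "a \<otimes>\<^bsub>F\<^esub> b \<in> X \<otimes>\<^bsub>T\<^esub> Y"
    unfolding T_mult using ab F.coset_self[OF K_submodule abF] by blast
  then have "X \<otimes>\<^bsub>T\<^esub> Y = K +>\<^bsub>F\<^esub> (a \<otimes>\<^bsub>F\<^esub> b)" by (rule T_rep(2)[OF XY])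
  then show ?thesis
    using lift_coset[OF M \<beta>] a b abF \<Lambda>_mult[OF A \<beta> mult a(1) b(1)] by simp
qed

lemma T_one: "\<one>\<^bsub>T\<^esub> = tns \<one>\<^bsub>L\<^esub> \<one>\<^bsub>M\<^esub>"
proof -
  have "\<one>\<^bsub>F\<^esub> = basis_vector R (\<one>\<^bsub>L\<^esub>, \<one>\<^bsub>M\<^esub>)" by (simp add: tensor_free_def)
  then show ?thesis by (simp only: T_quotient F.quotient_module_sel tns_def)
qed

text \<open>The product on cosets is defined as a union over representatives; jointly injective
  multiplicative maps show that the union is a single coset.\<close>

lemma T_mult_closed:
  assumes A: "algebra R A" and \<beta>: "\<And>g. g \<in> I \<Longrightarrow> bilinear_map R L M A (\<beta> g)"
    and mult: "\<And>g x x' y y'. g \<in> I \<Longrightarrow> x \<in> carrier L \<Longrightarrow> x' \<in> carrier L \<Longrightarrow> y \<in> carrier M \<Longrightarrow> y' \<in> carrier M \<Longrightarrow>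
      \<beta> g (x \<otimes>\<^bsub>L\<^esub> x') (y \<otimes>\<^bsub>M\<^esub> y') = \<beta> g x y \<otimes>\<^bsub>A\<^esub> \<beta> g x' y'"
    and inj: "\<And>X Y. X \<in> carrier T \<Longrightarrow> Y \<in> carrier T \<Longrightarrow>
      (\<And>g. g \<in> I \<Longrightarrow> lift A (\<beta> g) X = lift A (\<beta> g) Y) \<Longrightarrow> X = Y"
    and X: "X \<in> carrier T" and Y: "Y \<in> carrier T"
  shows "X \<otimes>\<^bsub>T\<^esub> Y \<in> carrier T"
proof -
  have M: "module R A" by (rule algebra.module[OF A])
  have c: "K +>\<^bsub>F\<^esub> (a \<otimes>\<^bsub>F\<^esub> b) \<in> carrier T" if "a \<in> X" "b \<in> Y" for a b
    using T_rep[OF X that(1)] T_rep[OF Y that(2)] F_mult_closed T_carrier by auto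
  have l: "lift A (\<beta> g) (K +>\<^bsub>F\<^esub> (a \<otimes>\<^bsub>F\<^esub> b)) = lift A (\<beta> g) X \<otimes>\<^bsub>A\<^esub> lift A (\<beta> g) Y"
    if "a \<in> X" "b \<in> Y" "g \<in> I" for a b g
  proof -
    note a = T_rep[OF X that(1)] and b = T_rep[OF Y that(2)]
    show ?thesis
      using lift_coset[OF M \<beta>[OF that(3)]] a b F_mult_closed[OF a(1) b(1)]
        \<Lambda>_mult[OF A \<beta>[OF that(3)] mult[OF that(3)] a(1) b(1)] by simp
  qed
  obtain a b where ab: "a \<in> X" "b \<in> Y" using T_nonempty X Y by blast
  have "K +>\<^bsub>F\<^esub> (a' \<otimes>\<^bsub>F\<^esub> b') = K +>\<^bsub>F\<^esub> (a \<otimes>\<^bsub>F\<^esub> b)" if "a' \<in> X" "b' \<in> Y" for a' b'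
    by (rule inj[OF c[OF that] c[OF ab]]) (simp add: l that ab)
  then have "X \<otimes>\<^bsub>T\<^esub> Y = (\<Union>a'\<in>X. \<Union>b'\<in>Y. K +>\<^bsub>F\<^esub> (a \<otimes>\<^bsub>F\<^esub> b))"
    unfolding T_mult by (intro SUP_cong refl)
  also have "\<dots> = K +>\<^bsub>F\<^esub> (a \<otimes>\<^bsub>F\<^esub> b)" using ab by blast
  finally show ?thesis using c[OF ab] by simp
qed

text \<open>The ring laws are pulled back from \<open>A\<close> along multiplicative maps that are
  jointly injective.\<close>

lemma T_cring:
  assumes A: "algebra R A" and \<beta>: "\<And>g. g \<in> I \<Longrightarrow> bilinear_map R L M A (\<beta> g)"
    and mult: "\<And>g x x' y y'. g \<in> I \<Longrightarrow> x \<in> carrier L \<Longrightarrow> x' \<in> carrier L \<Longrightarrow> y \<in> carrier M \<Longrightarrow> y' \<in> carrier M \<Longrightarrow>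
      \<beta> g (x \<otimes>\<^bsub>L\<^esub> x') (y \<otimes>\<^bsub>M\<^esub> y') = \<beta> g x y \<otimes>\<^bsub>A\<^esub> \<beta> g x' y'"
    and one: "\<And>g. g \<in> I \<Longrightarrow> \<beta> g \<one>\<^bsub>L\<^esub> \<one>\<^bsub>M\<^esub> = \<one>\<^bsub>A\<^esub>"
    and inj: "\<And>X Y. X \<in> carrier T \<Longrightarrow> Y \<in> carrier T \<Longrightarrow>
      (\<And>g. g \<in> I \<Longrightarrow> lift A (\<beta> g) X = lift A (\<beta> g) Y) \<Longrightarrow> X = Y"
  shows "cring T"
proof -
  interpret A: cring A using A by (rule algebra.axioms)
  interpret T: module R T by (rule T_module)
  have M: "module R A" by (rule algebra.module[OF A])
  have cl: "X \<otimes>\<^bsub>T\<^esub> Y \<in> carrier T" if "X \<in> carrier T" "Y \<in> carrier T" for X Y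
    by (rule T_mult_closed[of A I \<beta>, OF A]) (fact \<beta> mult inj that)+
  have lm: "lift A (\<beta> g) (X \<otimes>\<^bsub>T\<^esub> Y) = lift A (\<beta> g) X \<otimes>\<^bsub>A\<^esub> lift A (\<beta> g) Y"
    if "g \<in> I" "X \<in> carrier T" "Y \<in> carrier T" for g X Y
    by (rule lift_mult[OF A \<beta>[OF that(1)] mult[OF that(1)] that(2,3) cl[OF that(2,3)]])
  have la: "lift A (\<beta> g) (X \<oplus>\<^bsub>T\<^esub> Y) = lift A (\<beta> g) X \<oplus>\<^bsub>A\<^esub> lift A (\<beta> g) Y"
    and lc: "lift A (\<beta> g) X \<in> carrier A"
    if "g \<in> I" "X \<in> carrier T" "Y \<in> carrier T" for g X Y
    using module_homD(1,2)[OF lift_hom[OF M \<beta>]] that by auto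
  have T1: "\<one>\<^bsub>T\<^esub> \<in> carrier T" unfolding T_one by (rule tns_closed) auto
  have l1: "lift A (\<beta> g) \<one>\<^bsub>T\<^esub> = \<one>\<^bsub>A\<^esub>" if "g \<in> I" for g
    unfolding T_one using lift_tns[OF M \<beta>[OF that]] one that by simp
  show ?thesis
  proof (rule cringI[OF T.M.abelian_group_axioms], rule comm_monoidI)
    show "X \<otimes>\<^bsub>T\<^esub> Y \<otimes>\<^bsub>T\<^esub> Z = X \<otimes>\<^bsub>T\<^esub> (Y \<otimes>\<^bsub>T\<^esub> Z)"
      if "X \<in> carrier T" "Y \<in> carrier T" "Z \<in> carrier T" for X Y Z
      by (rule inj) (use that cl in \<open>simp_all add: lm lc A.m_assoc\<close>)
    show "X \<otimes>\<^bsub>T\<^esub> Y = Y \<otimes>\<^bsub>T\<^esub> X" if "X \<in> carrier T" "Y \<in> carrier T" for X Y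
      by (rule inj) (use that cl in \<open>simp_all add: lm lc A.m_comm\<close>)
    show "\<one>\<^bsub>T\<^esub> \<otimes>\<^bsub>T\<^esub> X = X" if "X \<in> carrier T" for X
      by (rule inj) (use that cl T1 in \<open>simp_all add: lm lc l1\<close>)
    show "(X \<oplus>\<^bsub>T\<^esub> Y) \<otimes>\<^bsub>T\<^esub> Z = X \<otimes>\<^bsub>T\<^esub> Z \<oplus>\<^bsub>T\<^esub> Y \<otimes>\<^bsub>T\<^esub> Z"
      if "X \<in> carrier T" "Y \<in> carrier T" "Z \<in> carrier T" for X Y Z
      by (rule inj) (use that cl in \<open>simp_all add: lm lc la A.l_distr\<close>)
  qed (use T1 cl in auto)
qed

end

section \<open>The multiplication map and the separability element\<close>

locale R_algebra = R: cring R + S: cring S + A: algebra R S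
  for R :: "('r, 'k) ring_scheme" and S :: "('r, 's, 'x) module_scheme"
begin

sublocale SS: tensor_algebras R S S ..

abbreviation "\<iota> \<equiv> structure_map S"

lemma iota_closed [simp]: "r \<in> carrier R \<Longrightarrow> \<iota> r \<in> carrier S"
  by (simp add: structure_map_def)

lemma smult_iota: "r \<in> carrier R \<Longrightarrow> s \<in> carrier S \<Longrightarrow> r \<odot>\<^bsub>S\<^esub> s = \<iota> r \<otimes>\<^bsub>S\<^esub> s"
  by (simp add: structure_map_def A.smult_assoc2)

lemma iota_hom: "\<iota> \<in> ring_hom R S"
  by (rule ring_hom_memI)
    (simp_all add: structure_map_def A.smult_l_distr A.smult_assoc2 A.smult_assoc1)

text \<open>The \<open>R\<close>-algebra endomorphisms of \<open>S\<close>. The identity and the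
  automorphisms of the group are treated alike through this set.\<close>

definition linear_endos :: "('s \<Rightarrow> 's) set"
  where "linear_endos = {\<psi> \<in> ring_hom S S. \<forall>r\<in>carrier R. \<forall>s\<in>carrier S. \<psi> (r \<odot>\<^bsub>S\<^esub> s) = r \<odot>\<^bsub>S\<^esub> \<psi> s}"

lemma linear_endosD:
  assumes "\<psi> \<in> linear_endos"
  shows "\<And>x. x \<in> carrier S \<Longrightarrow> \<psi> x \<in> carrier S"
    "\<And>x y. x \<in> carrier S \<Longrightarrow> y \<in> carrier S \<Longrightarrow> \<psi> (x \<otimes>\<^bsub>S\<^esub> y) = \<psi> x \<otimes>\<^bsub>S\<^esub> \<psi> y"
    "\<And>x y. x \<in> carrier S \<Longrightarrow> y \<in> carrier S \<Longrightarrow> \<psi> (x \<oplus>\<^bsub>S\<^esub> y) = \<psi> x \<oplus>\<^bsub>S\<^esub> \<psi> y"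
    "\<psi> \<one>\<^bsub>S\<^esub> = \<one>\<^bsub>S\<^esub>"
    "\<And>r x. r \<in> carrier R \<Longrightarrow> x \<in> carrier S \<Longrightarrow> \<psi> (r \<odot>\<^bsub>S\<^esub> x) = r \<odot>\<^bsub>S\<^esub> \<psi> x"
  using assms unfolding linear_endos_def
  by (auto intro: ring_hom_closed ring_hom_mult ring_hom_add ring_hom_one)

lemma linear_endo_hom: "\<psi> \<in> linear_endos \<Longrightarrow> \<psi> \<in> module_hom R S S"
  by (rule module_homI) (simp_all add: linear_endosD)

lemma id_linear_endo: "(\<lambda>x. x) \<in> linear_endos"
  by (auto simp: linear_endos_def intro: ring_hom_memI)

text \<open>The algebra map x \<otimes> y -> x \<psi>(y). For the identity it is the multiplication
  of \<open>S\<close>; as \<psi> runs through the group it gives the components of the classical map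
  from S \<otimes> S to a product of copies of \<open>S\<close>.\<close>

abbreviation twist :: "('s \<Rightarrow> 's) \<Rightarrow> ('s \<times> 's \<Rightarrow> 'r) set \<Rightarrow> 's"
  where "twist \<psi> \<equiv> SS.lift S (\<lambda>x y. x \<otimes>\<^bsub>S\<^esub> \<psi> y)"

lemma twist_bilinear:
  assumes "\<psi> \<in> linear_endos"
  shows "bilinear_map R S S S (\<lambda>x y. x \<otimes>\<^bsub>S\<^esub> \<psi> y)"
proof -
  note p = linear_endosD[OF assms]
  have "x \<otimes>\<^bsub>S\<^esub> (r \<odot>\<^bsub>S\<^esub> y) = r \<odot>\<^bsub>S\<^esub> (x \<otimes>\<^bsub>S\<^esub> y)"
    if "r \<in> carrier R" "x \<in> carrier S" "y \<in> carrier S" for r x y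
    using that by (metis A.smult_assoc2 A.smult_closed S.m_comm)
  then show ?thesis
    unfolding bilinear_map_def
    by (auto intro!: module_homI simp: p S.r_distr S.l_distr A.smult_assoc2)
qed

lemma twist_mult_basis:
  assumes "\<psi> \<in> linear_endos" "x \<in> carrier S" "x' \<in> carrier S" "y \<in> carrier S" "y' \<in> carrier S"
  shows "(x \<otimes>\<^bsub>S\<^esub> x') \<otimes>\<^bsub>S\<^esub> \<psi> (y \<otimes>\<^bsub>S\<^esub> y') = (x \<otimes>\<^bsub>S\<^esub> \<psi> y) \<otimes>\<^bsub>S\<^esub> (x' \<otimes>\<^bsub>S\<^esub> \<psi> y')"
proof -
  have "\<psi> y \<in> carrier S" "\<psi> y' \<in> carrier S" using linear_endosD[OF assms(1)] assms by auto
  then show ?thesis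
    using assms linear_endosD(2)[OF assms(1)] by (simp add: S.m_assoc S.m_lcomm[of x' "\<psi> y"])
qed

lemmas twist_hom = SS.lift_hom[OF A.module twist_bilinear]
lemmas twist_tns = SS.lift_tns[OF A.module twist_bilinear]

lemma twist_mult:
  assumes "\<psi> \<in> linear_endos" "X \<in> carrier SS.T" "Y \<in> carrier SS.T" "X \<otimes>\<^bsub>SS.T\<^esub> Y \<in> carrier SS.T"
  shows "twist \<psi> (X \<otimes>\<^bsub>SS.T\<^esub> Y) = twist \<psi> X \<otimes>\<^bsub>S\<^esub> twist \<psi> Y"
  by (rule SS.lift_mult[OF A.algebra_axioms twist_bilinear _ assms(2-4)])
    (simp_all add: assms(1) twist_mult_basis)

text \<open>A single expansion of \<epsilon> serves every \<psi>, with the coefficients absorbed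
  into the left factor. This uniformity is what lets x and y become Galois coordinates.\<close>

lemma twist_expand:
  assumes "\<epsilon> \<in> carrier SS.T"
  shows "\<exists>Z x y. finite (Z :: ('s \<times> 's) set) \<and> x \<in> Z \<rightarrow> carrier S \<and> y \<in> Z \<rightarrow> carrier S \<and>
    (\<forall>\<psi>\<in>linear_endos. twist \<psi> \<epsilon> = (\<Oplus>\<^bsub>S\<^esub>z\<in>Z. x z \<otimes>\<^bsub>S\<^esub> \<psi> (y z)))"
proof -
  obtain f where f: "f \<in> carrier SS.F" "\<epsilon> = SS.K +>\<^bsub>SS.F\<^esub> f" using assms SS.T_carrier by auto
  let ?Z = "{z. f z \<noteq> \<zero>\<^bsub>R\<^esub>}"
  have Z: "finite ?Z" "fst \<in> ?Z \<rightarrow> carrier S" "snd \<in> ?Z \<rightarrow> carrier S" "\<And>z. f z \<in> carrier R"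
    using f(1) unfolding SS.F_mem by auto
  have "twist \<psi> \<epsilon> = (\<Oplus>\<^bsub>S\<^esub>z\<in>?Z. (f z \<odot>\<^bsub>S\<^esub> fst z) \<otimes>\<^bsub>S\<^esub> \<psi> (snd z))" if "\<psi> \<in> linear_endos" for \<psi>
  proof -
    have "twist \<psi> \<epsilon> = (\<Oplus>\<^bsub>S\<^esub>z\<in>?Z. f z \<odot>\<^bsub>S\<^esub> (fst z \<otimes>\<^bsub>S\<^esub> \<psi> (snd z)))"
      unfolding f(2) SS.lift_coset[OF A.module twist_bilinear[OF that] f(1)] lin_ext_def ..
    also have "\<dots> = (\<Oplus>\<^bsub>S\<^esub>z\<in>?Z. (f z \<odot>\<^bsub>S\<^esub> fst z) \<otimes>\<^bsub>S\<^esub> \<psi> (snd z))"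
      using Z linear_endosD(1)[OF that] by (intro S.add.finprod_cong') (auto simp: A.smult_assoc2 Pi_def)
    finally show ?thesis .
  qed
  then show ?thesis
    using Z by (intro exI[of _ ?Z] exI[of _ "\<lambda>z. f z \<odot>\<^bsub>S\<^esub> fst z"] exI[of _ snd]) auto
qed

abbreviation "E \<equiv> enveloping_module R S"

lemma E_sel:
  "carrier E = carrier S" "add E = add S" "zero E = zero S"
  by (simp_all add: enveloping_module_def)

text \<open>Commutativity of \<open>S\<close> moves s out of the middle of x s y, so a tensor acts
  through its image under multiplication.\<close>

lemma E_smult:
  assumes X: "X \<in> carrier SS.T" and s: "s \<in> carrier S"
  shows "X \<odot>\<^bsub>E\<^esub> s = twist (\<lambda>x. x) X \<otimes>\<^bsub>S\<^esub> s"
proof -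
  let ?f = "SOME f. f \<in> X"
  have "?f \<in> X" using SS.T_nonempty[OF X] by (rule someI_ex)
  then have f: "?f \<in> carrier SS.F" by (rule SS.T_rep[OF X])
  let ?Z = "{z. ?f z \<noteq> \<zero>\<^bsub>R\<^esub>}"
  have Z: "finite ?Z" "\<And>z. z \<in> ?Z \<Longrightarrow> fst z \<in> carrier S" "\<And>z. z \<in> ?Z \<Longrightarrow> snd z \<in> carrier S"
    "\<And>z. ?f z \<in> carrier R"
    using f unfolding SS.F_mem by auto
  have "X \<odot>\<^bsub>E\<^esub> s = (\<Oplus>\<^bsub>S\<^esub>z\<in>?Z. ?f z \<odot>\<^bsub>S\<^esub> (fst z \<otimes>\<^bsub>S\<^esub> s \<otimes>\<^bsub>S\<^esub> snd z))"
    by (simp add: enveloping_module_def Let_def)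
  also have "\<dots> = (\<Oplus>\<^bsub>S\<^esub>z\<in>?Z. ?f z \<odot>\<^bsub>S\<^esub> (fst z \<otimes>\<^bsub>S\<^esub> snd z) \<otimes>\<^bsub>S\<^esub> s)"
  proof (intro S.add.finprod_cong' refl)
    fix z assume z: "z \<in> ?Z"
    show "?f z \<odot>\<^bsub>S\<^esub> (fst z \<otimes>\<^bsub>S\<^esub> s \<otimes>\<^bsub>S\<^esub> snd z) = ?f z \<odot>\<^bsub>S\<^esub> (fst z \<otimes>\<^bsub>S\<^esub> snd z) \<otimes>\<^bsub>S\<^esub> s"
      using Z(2,3)[OF z] Z(4) s by (simp add: A.smult_assoc2 S.m_assoc S.m_comm[of s])
  qed (use Z s in auto)
  also have "\<dots> = (\<Oplus>\<^bsub>S\<^esub>z\<in>?Z. ?f z \<odot>\<^bsub>S\<^esub> (fst z \<otimes>\<^bsub>S\<^esub> snd z)) \<otimes>\<^bsub>S\<^esub> s"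
    using Z s by (intro S.finsum_ldistr[symmetric]) auto
  \<comment> \<open>\<open>lift\<close> and the enveloping action choose the representative of
    \<open>X\<close> by the same term, so the two sums agree literally.\<close>
  finally show ?thesis by (simp add: SS.lift_def lin_ext_def)
qed

text \<open>The image of \<open>1\<close> under a splitting of the multiplication \<open>S \<otimes> S \<rightarrow> S\<close> is the
  separability idempotent.\<close>

lemma separability_element:
  assumes "separable_algebra R S"
  shows "cring SS.T" "\<exists>\<epsilon>\<in>carrier SS.T. twist (\<lambda>x. x) \<epsilon> = \<one>\<^bsub>S\<^esub> \<and>
    (\<forall>s\<in>carrier S. SS.tns s \<one>\<^bsub>S\<^esub> \<otimes>\<^bsub>SS.T\<^esub> \<epsilon> = SS.tns \<one>\<^bsub>S\<^esub> s \<otimes>\<^bsub>SS.T\<^esub> \<epsilon>)"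
proof -
  obtain I :: "'s set" and i q where TE: "module SS.T E"
    and i: "i \<in> module_hom SS.T E (free_module SS.T I)"
    and q: "q \<in> module_hom SS.T (free_module SS.T I) E"
    and qi: "\<And>x. x \<in> carrier E \<Longrightarrow> q (i x) = x"
    using assms unfolding separable_algebra_def projective_module_def by blast
  \<comment> \<open>Projectivity includes that the tensor product is a commutative ring, as the
    scalars of a module are required to form one.\<close>
  show cr: "cring SS.T" using TE by (rule module.axioms)
  interpret T: cring SS.T by (rule cr)
  interpret TE: module SS.T E by fact
  have FM: "module SS.T (free_module SS.T I)" by (rule T.free_module_module)
  note m = twist_mult[OF id_linear_endo]
  let ?f = "i \<one>\<^bsub>S\<^esub>"
  let ?A = "{a. ?f a \<noteq> \<zero>\<^bsub>SS.T\<^esub>}"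
  let ?s = "\<lambda>a. q (basis_vector SS.T a)"
  have one: "\<one>\<^bsub>S\<^esub> \<in> carrier E" by (simp add: E_sel)
  have f: "?f \<in> carrier (free_module SS.T I)" by (rule module_homD(1)[OF i one])
  have A: "finite ?A" "?A \<subseteq> I" "\<And>a. ?f a \<in> carrier SS.T"
    using f by (auto simp: free_module_def)
  have bv: "basis_vector SS.T a \<in> carrier (free_module SS.T I)" if "a \<in> ?A" for a
    using A(2) that by (intro T.basis_vector_closed) auto
  have s: "?s a \<in> carrier S" if "a \<in> ?A" for a
    using module_homD(1)[OF q bv[OF that]] by (simp add: E_sel)
  have t: "SS.tns x \<one>\<^bsub>S\<^esub> \<in> carrier SS.T" "SS.tns \<one>\<^bsub>S\<^esub> x \<in> carrier SS.T" if "x \<in> carrier S" for x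
    using that by (simp_all add: SS.tns_closed)
  have tw: "twist (\<lambda>x. x) X \<in> carrier S" if "X \<in> carrier SS.T" for X
    using module_homD(1)[OF twist_hom[OF id_linear_endo] that] .
  have tt: "twist (\<lambda>x. x) (SS.tns x \<one>\<^bsub>S\<^esub>) = x" "twist (\<lambda>x. x) (SS.tns \<one>\<^bsub>S\<^esub> x) = x" if "x \<in> carrier S" for x
    using that twist_tns[OF id_linear_endo] by simp_all
  have fE: "(\<Oplus>\<^bsub>E\<^esub>a\<in>B. h a) = (\<Oplus>\<^bsub>S\<^esub>a\<in>B. h a)" if "finite B" "h \<in> B \<rightarrow> carrier S" for B :: "'s set" and h
    using that
  proof (induction B)
    case empty
    then show ?case using TE.M.finsum_empty[of h] by (simp add: E_sel)
  next
    case (insert b B)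
    then show ?case using TE.M.finsum_insert[of B b h] by (simp add: E_sel Pi_def)
  qed
  have "\<one>\<^bsub>S\<^esub> = q ?f" using qi[OF one] by simp
  also have "\<dots> = q (\<Oplus>\<^bsub>free_module SS.T I\<^esub>a\<in>?A. ?f a \<odot>\<^bsub>free_module SS.T I\<^esub> basis_vector SS.T a)"
    using T.free_module_expand[OF f] by simp
  also have "\<dots> = (\<Oplus>\<^bsub>E\<^esub>a\<in>?A. q (?f a \<odot>\<^bsub>free_module SS.T I\<^esub> basis_vector SS.T a))"
    using A bv by (intro module_hom_finsum[OF FM TE q] funcsetI module.smult_closed[OF FM]) auto
  also have "\<dots> = (\<Oplus>\<^bsub>S\<^esub>a\<in>?A. twist (\<lambda>x. x) (?f a) \<otimes>\<^bsub>S\<^esub> ?s a)"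
  proof (subst fE[OF A(1)], use module_homD(1)[OF q] module.smult_closed[OF FM A(3) bv] in
      \<open>force simp: E_sel\<close>, intro S.add.finprod_cong' refl)
    fix a assume a: "a \<in> ?A"
    show "q (?f a \<odot>\<^bsub>free_module SS.T I\<^esub> basis_vector SS.T a) = twist (\<lambda>x. x) (?f a) \<otimes>\<^bsub>S\<^esub> ?s a"
      using module_homD(3)[OF q A(3) bv[OF a]] E_smult[OF A(3) s[OF a]] by simp
  qed (use tw A s in auto)
  finally have 1: "\<one>\<^bsub>S\<^esub> = (\<Oplus>\<^bsub>S\<^esub>a\<in>?A. twist (\<lambda>x. x) (?f a) \<otimes>\<^bsub>S\<^esub> ?s a)" .
  \<comment> \<open>The coordinates of \<open>i \<one>\<close> in the free module, multiplied by the
    values of \<open>q\<close> at the basis vectors. Under multiplication this becomes q(i 1) =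
    1.\<close>
  define \<epsilon> where "\<epsilon> = (\<Oplus>\<^bsub>SS.T\<^esub>a\<in>?A. ?f a \<otimes>\<^bsub>SS.T\<^esub> SS.tns (?s a) \<one>\<^bsub>S\<^esub>)"
  have cl: "(\<lambda>a. ?f a \<otimes>\<^bsub>SS.T\<^esub> SS.tns (?s a) \<one>\<^bsub>S\<^esub>) \<in> ?A \<rightarrow> carrier SS.T"
    using A s t by auto
  have \<epsilon>: "\<epsilon> \<in> carrier SS.T" unfolding \<epsilon>_def by (rule T.finsum_closed[OF cl])
  have "twist (\<lambda>x. x) \<epsilon> = (\<Oplus>\<^bsub>S\<^esub>a\<in>?A. twist (\<lambda>x. x) (?f a \<otimes>\<^bsub>SS.T\<^esub> SS.tns (?s a) \<one>\<^bsub>S\<^esub>))"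
    unfolding \<epsilon>_def by (rule module_hom_finsum[OF SS.T_module A.module twist_hom[OF id_linear_endo] cl])
  also have "\<dots> = (\<Oplus>\<^bsub>S\<^esub>a\<in>?A. twist (\<lambda>x. x) (?f a) \<otimes>\<^bsub>S\<^esub> ?s a)"
  proof (intro S.add.finprod_cong' refl)
    fix a assume a: "a \<in> ?A"
    show "twist (\<lambda>x. x) (?f a \<otimes>\<^bsub>SS.T\<^esub> SS.tns (?s a) \<one>\<^bsub>S\<^esub>) = twist (\<lambda>x. x) (?f a) \<otimes>\<^bsub>S\<^esub> ?s a"
      using m[OF A(3) t(1)] A(3) t(1) s[OF a] tt(1)[OF s[OF a]] by simp
  qed (use tw A s in auto)
  finally have \<epsilon>1: "twist (\<lambda>x. x) \<epsilon> = \<one>\<^bsub>S\<^esub>" using 1 by simp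
  have "SS.tns x \<one>\<^bsub>S\<^esub> \<otimes>\<^bsub>SS.T\<^esub> \<epsilon> = SS.tns \<one>\<^bsub>S\<^esub> x \<otimes>\<^bsub>SS.T\<^esub> \<epsilon>" if x: "x \<in> carrier S" for x
  proof -
    \<comment> \<open>Both x \<otimes> 1 and 1 \<otimes> x carry 1 to x in the enveloping module. By
      linearity of \<open>i\<close>, either one turns the coordinates of \<open>i \<one>\<close>
      into those of \<open>i x\<close>; this yields the commutation with \<epsilon>.\<close>
    have fx: "X \<otimes>\<^bsub>SS.T\<^esub> ?f a = i x a" if "X \<in> carrier SS.T" "twist (\<lambda>x. x) X = x" for X a
    proof -
      have "i x = i (X \<odot>\<^bsub>E\<^esub> \<one>\<^bsub>S\<^esub>)" using E_smult[OF that(1), of "\<one>\<^bsub>S\<^esub>"] that(2) x by simp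
      also have "\<dots> = X \<odot>\<^bsub>free_module SS.T I\<^esub> ?f" by (rule module_homD(3)[OF i that(1) one])
      finally show ?thesis by (simp add: free_module_def)
    qed
    have e: "X \<otimes>\<^bsub>SS.T\<^esub> \<epsilon> = (\<Oplus>\<^bsub>SS.T\<^esub>a\<in>?A. X \<otimes>\<^bsub>SS.T\<^esub> ?f a \<otimes>\<^bsub>SS.T\<^esub> SS.tns (?s a) \<one>\<^bsub>S\<^esub>)"
      if X: "X \<in> carrier SS.T" for X
    proof -
      have "X \<otimes>\<^bsub>SS.T\<^esub> \<epsilon> = (\<Oplus>\<^bsub>SS.T\<^esub>a\<in>?A. X \<otimes>\<^bsub>SS.T\<^esub> (?f a \<otimes>\<^bsub>SS.T\<^esub> SS.tns (?s a) \<one>\<^bsub>S\<^esub>))"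
        unfolding \<epsilon>_def by (rule T.finsum_rdistr[OF A(1) X cl])
      also have "\<dots> = (\<Oplus>\<^bsub>SS.T\<^esub>a\<in>?A. X \<otimes>\<^bsub>SS.T\<^esub> ?f a \<otimes>\<^bsub>SS.T\<^esub> SS.tns (?s a) \<one>\<^bsub>S\<^esub>)"
        using X A(3) s t by (intro T.add.finprod_cong') (auto simp: T.m_assoc)
      finally show ?thesis .
    qed
    show ?thesis unfolding e[OF t(1)[OF x]] e[OF t(2)[OF x]] fx[OF t(1)[OF x] tt(1)[OF x]]
      fx[OF t(2)[OF x] tt(2)[OF x]] ..
  qed
  then show "\<exists>\<epsilon>\<in>carrier SS.T. twist (\<lambda>x. x) \<epsilon> = \<one>\<^bsub>S\<^esub> \<and>
    (\<forall>s\<in>carrier S. SS.tns s \<one>\<^bsub>S\<^esub> \<otimes>\<^bsub>SS.T\<^esub> \<epsilon> = SS.tns \<one>\<^bsub>S\<^esub> s \<otimes>\<^bsub>SS.T\<^esub> \<epsilon>)"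
    using \<epsilon> \<epsilon>1 by blast
qed

end

section \<open>Galois coordinates\<close>

text \<open>A Galois extension without faithfulness, injectivity of the structure map, separability
  and strong distinctness. It is thus available also while an action is still being shown to be
  Galois.\<close>

locale algebra_action = R_algebra R S + group_action G "carrier S" \<phi>
  for R :: "('r, 'k) ring_scheme" and S :: "('r, 's, 'x) module_scheme"
    and G :: "('g, 'y) monoid_scheme" and \<phi> :: "'g \<Rightarrow> 's \<Rightarrow> 's" +
  assumes finite_group: "finite (carrier G)"
    and ring_automorphism: "\<And>g. g \<in> carrier G \<Longrightarrow> \<phi> g \<in> ring_iso S S"
    and linear: "\<And>g r s. g \<in> carrier G \<Longrightarrow> r \<in> carrier R \<Longrightarrow> s \<in> carrier S \<Longrightarrow>
      \<phi> g (r \<odot>\<^bsub>S\<^esub> s) = r \<odot>\<^bsub>S\<^esub> \<phi> g s"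
    and fixed_ring: "{s \<in> carrier S. \<forall>g\<in>carrier G. \<phi> g s = s} = structure_map S ` carrier R"
begin

sublocale G: group G
  using group_hom by (simp add: group_hom_def)

lemma action_endo: "g \<in> carrier G \<Longrightarrow> \<phi> g \<in> linear_endos"
  using ring_automorphism linear by (auto simp: linear_endos_def ring_iso_def)

lemmas action_simps = linear_endosD[OF action_endo]

lemma action_hom: "g \<in> carrier G \<Longrightarrow> \<phi> g \<in> module_hom R S S"
  by (rule linear_endo_hom[OF action_endo])

lemma action_one: "s \<in> carrier S \<Longrightarrow> \<phi> \<one>\<^bsub>G\<^esub> s = s"
  using id_eq_one by (metis restrict_apply')

lemma action_comp:
  "s \<in> carrier S \<Longrightarrow> g \<in> carrier G \<Longrightarrow> h \<in> carrier G \<Longrightarrow> \<phi> g (\<phi> h s) = \<phi> (g \<otimes>\<^bsub>G\<^esub> h) s"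
  by (rule composition_rule[symmetric])

lemma finsum_translate:
  assumes h: "h \<in> carrier G" and F: "F \<in> carrier G \<rightarrow> carrier S"
  shows "(\<Oplus>\<^bsub>S\<^esub>g\<in>carrier G. F (h \<otimes>\<^bsub>G\<^esub> g)) = (\<Oplus>\<^bsub>S\<^esub>g\<in>carrier G. F g)"
proof -
  have "(\<Oplus>\<^bsub>S\<^esub>g\<in>(\<otimes>\<^bsub>G\<^esub>) h ` carrier G. F g) = (\<Oplus>\<^bsub>S\<^esub>g\<in>carrier G. F (h \<otimes>\<^bsub>G\<^esub> g))"
    using F h by (intro S.add.finprod_reindex G.inj_on_cmult) (auto simp: G.surj_const_mult)
  then show ?thesis using h by (simp add: G.surj_const_mult)
qed

lemma action_finsum:
  "g \<in> carrier G \<Longrightarrow> f \<in> I \<rightarrow> carrier S \<Longrightarrow> \<phi> g (\<Oplus>\<^bsub>S\<^esub>i\<in>I. f i) = (\<Oplus>\<^bsub>S\<^esub>i\<in>I. \<phi> g (f i))"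
  by (rule module_hom_finsum[OF A.module A.module action_hom])

definition trace :: "'s \<Rightarrow> 's"
  where "trace s = (\<Oplus>\<^bsub>S\<^esub>g\<in>carrier G. \<phi> g s)"

lemma fixedE:
  assumes "s \<in> carrier S" "\<And>g. g \<in> carrier G \<Longrightarrow> \<phi> g s = s"
  obtains r where "r \<in> carrier R" "s = \<iota> r"
  using fixed_ring assms by blast

lemma traceE:
  assumes s: "s \<in> carrier S"
  obtains r where "r \<in> carrier R" "trace s = \<iota> r"
proof -
  have cl: "(\<lambda>g. \<phi> g s) \<in> carrier G \<rightarrow> carrier S" using action_simps(1) s by auto
  have "\<phi> h (trace s) = trace s" if h: "h \<in> carrier G" for h
  proof -
    have "\<phi> h (trace s) = (\<Oplus>\<^bsub>S\<^esub>g\<in>carrier G. \<phi> h (\<phi> g s))"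
      unfolding trace_def by (rule action_finsum[OF h cl])
    also have "\<dots> = (\<Oplus>\<^bsub>S\<^esub>g\<in>carrier G. \<phi> (h \<otimes>\<^bsub>G\<^esub> g) s)"
      using cl h s action_simps(1) by (intro S.add.finprod_cong') (auto simp: action_comp)
    also have "\<dots> = trace s" unfolding trace_def by (rule finsum_translate[OF h cl])
    finally show ?thesis .
  qed
  moreover have "trace s \<in> carrier S" unfolding trace_def by (rule S.finsum_closed[OF cl])
  ultimately show thesis using fixedE that by blast
qed

text \<open>The index type is left open: coordinates extracted from a tensor are indexed by pairs in
  \<open>S\<close>, those of a Kummer extension by the exponents below p.\<close>

definition galois_coordinates :: "'z set \<Rightarrow> ('z \<Rightarrow> 's) \<Rightarrow> ('z \<Rightarrow> 's) \<Rightarrow> bool"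
  where "galois_coordinates Z x y \<longleftrightarrow> finite Z \<and> x \<in> Z \<rightarrow> carrier S \<and> y \<in> Z \<rightarrow> carrier S \<and>
    (\<forall>g\<in>carrier G. (\<Oplus>\<^bsub>S\<^esub>z\<in>Z. x z \<otimes>\<^bsub>S\<^esub> \<phi> g (y z)) = (if g = \<one>\<^bsub>G\<^esub> then \<one>\<^bsub>S\<^esub> else \<zero>\<^bsub>S\<^esub>))"

text \<open>The image \<open>e\<^sub>g\<close> of the separability element under \<open>x \<otimes> y \<mapsto> x \<cdot> g(y)\<close> is an idempotent on which
  \<open>g\<close> and the identity agree, so strong distinctness kills it unless \<open>g = 1\<close>.\<close>

lemma galois_coordinates_exist:
  assumes sep: "separable_algebra R S"
    and dist: "\<And>g h e. g \<in> carrier G \<Longrightarrow> h \<in> carrier G \<Longrightarrow> g \<noteq> h \<Longrightarrow>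
      e \<in> carrier S \<Longrightarrow> e \<otimes>\<^bsub>S\<^esub> e = e \<Longrightarrow> e \<noteq> \<zero>\<^bsub>S\<^esub> \<Longrightarrow>
      \<exists>s\<in>carrier S. \<phi> g s \<otimes>\<^bsub>S\<^esub> e \<noteq> \<phi> h s \<otimes>\<^bsub>S\<^esub> e"
  shows "\<exists>(Z :: ('s \<times> 's) set) x y. galois_coordinates Z x y"
proof -
  interpret T: cring SS.T by (rule separability_element(1)[OF sep])
  obtain \<epsilon> where \<epsilon>: "\<epsilon> \<in> carrier SS.T" "twist (\<lambda>x. x) \<epsilon> = \<one>\<^bsub>S\<^esub>"
    and comm: "\<And>s. s \<in> carrier S \<Longrightarrow>
      SS.tns s \<one>\<^bsub>S\<^esub> \<otimes>\<^bsub>SS.T\<^esub> \<epsilon> = SS.tns \<one>\<^bsub>S\<^esub> s \<otimes>\<^bsub>SS.T\<^esub> \<epsilon>"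
    using separability_element(2)[OF sep] by blast
  obtain Z :: "('s \<times> 's) set" and x y where Z: "finite Z" "x \<in> Z \<rightarrow> carrier S" "y \<in> Z \<rightarrow> carrier S"
    and tw: "\<And>\<psi>. \<psi> \<in> linear_endos \<Longrightarrow> twist \<psi> \<epsilon> = (\<Oplus>\<^bsub>S\<^esub>z\<in>Z. x z \<otimes>\<^bsub>S\<^esub> \<psi> (y z))"
    using twist_expand[OF \<epsilon>(1)] by blast
  have "twist (\<phi> g) \<epsilon> = \<zero>\<^bsub>S\<^esub>" if g: "g \<in> carrier G" "g \<noteq> \<one>\<^bsub>G\<^esub>" for g
  proof (rule ccontr)
    assume ne: "twist (\<phi> g) \<epsilon> \<noteq> \<zero>\<^bsub>S\<^esub>"
    note p = action_endo[OF g(1)]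
    have e: "twist (\<phi> g) \<epsilon> \<in> carrier S" by (rule module_homD(1)[OF twist_hom[OF p] \<epsilon>(1)])
    \<comment> \<open>The image of (s \<otimes> 1) \<epsilon> = (1 \<otimes> s) \<epsilon> under x
      \<otimes> y -> x g(y).\<close>
    have se: "\<phi> g s \<otimes>\<^bsub>S\<^esub> twist (\<phi> g) \<epsilon> = s \<otimes>\<^bsub>S\<^esub> twist (\<phi> g) \<epsilon>" if s: "s \<in> carrier S" for s
    proof -
      have t: "SS.tns s \<one>\<^bsub>S\<^esub> \<in> carrier SS.T" "SS.tns \<one>\<^bsub>S\<^esub> s \<in> carrier SS.T"
        using s by (simp_all add: SS.tns_closed)
      have "twist (\<phi> g) (SS.tns s \<one>\<^bsub>S\<^esub>) \<otimes>\<^bsub>S\<^esub> twist (\<phi> g) \<epsilon> =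
        twist (\<phi> g) (SS.tns \<one>\<^bsub>S\<^esub> s) \<otimes>\<^bsub>S\<^esub> twist (\<phi> g) \<epsilon>"
        using twist_mult[OF p t(1) \<epsilon>(1)] twist_mult[OF p t(2) \<epsilon>(1)] t \<epsilon>(1) comm[OF s]
        by simp
      then show ?thesis using s twist_tns[OF p] action_simps(1)[OF g(1)] linear_endosD(4)[OF p] by simp
    qed
    have "twist (\<phi> g) \<epsilon> \<otimes>\<^bsub>S\<^esub> twist (\<phi> g) \<epsilon> =
      (\<Oplus>\<^bsub>S\<^esub>z\<in>Z. x z \<otimes>\<^bsub>S\<^esub> \<phi> g (y z) \<otimes>\<^bsub>S\<^esub> twist (\<phi> g) \<epsilon>)"
      using Z action_simps(1)[OF g(1)] e
      by (subst (1) tw[OF p]) (intro S.finsum_ldistr, auto)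
    \<comment> \<open>\<open>se\<close> replaces g(y) by y in each term; what is then left in front
      is the image of \<epsilon> under multiplication, which is 1.\<close>
    also have "\<dots> = (\<Oplus>\<^bsub>S\<^esub>z\<in>Z. x z \<otimes>\<^bsub>S\<^esub> y z \<otimes>\<^bsub>S\<^esub> twist (\<phi> g) \<epsilon>)"
    proof (intro S.add.finprod_cong' refl)
      fix z assume "z \<in> Z"
      then have "x z \<in> carrier S" "y z \<in> carrier S" using Z by auto
      then show "x z \<otimes>\<^bsub>S\<^esub> \<phi> g (y z) \<otimes>\<^bsub>S\<^esub> twist (\<phi> g) \<epsilon> = x z \<otimes>\<^bsub>S\<^esub> y z \<otimes>\<^bsub>S\<^esub> twist (\<phi> g) \<epsilon>"
        using e action_simps(1)[OF g(1)] by (simp add: S.m_assoc se)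
    qed (use Z e in auto)
    also have "\<dots> = twist (\<lambda>x. x) \<epsilon> \<otimes>\<^bsub>S\<^esub> twist (\<phi> g) \<epsilon>"
      unfolding tw[OF id_linear_endo] using Z e by (intro S.finsum_ldistr[symmetric]) auto
    also have "\<dots> = twist (\<phi> g) \<epsilon>" using e \<epsilon>(2) by simp
    finally have idem: "twist (\<phi> g) \<epsilon> \<otimes>\<^bsub>S\<^esub> twist (\<phi> g) \<epsilon> = twist (\<phi> g) \<epsilon>" .
    have "\<exists>s\<in>carrier S. \<phi> g s \<otimes>\<^bsub>S\<^esub> twist (\<phi> g) \<epsilon> \<noteq> \<phi> \<one>\<^bsub>G\<^esub> s \<otimes>\<^bsub>S\<^esub> twist (\<phi> g) \<epsilon>"
      by (rule dist[OF g(1) G.one_closed g(2) e idem ne])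
    then show False using se action_one by auto
  qed
  moreover have "(\<Oplus>\<^bsub>S\<^esub>z\<in>Z. x z \<otimes>\<^bsub>S\<^esub> \<phi> \<one>\<^bsub>G\<^esub> (y z)) = \<one>\<^bsub>S\<^esub>"
  proof -
    have "(\<Oplus>\<^bsub>S\<^esub>z\<in>Z. x z \<otimes>\<^bsub>S\<^esub> \<phi> \<one>\<^bsub>G\<^esub> (y z)) = (\<Oplus>\<^bsub>S\<^esub>z\<in>Z. x z \<otimes>\<^bsub>S\<^esub> y z)"
      using Z by (intro S.add.finprod_cong') (auto simp: action_one Pi_def)
    then show ?thesis using tw[OF id_linear_endo] \<epsilon>(2) by simp
  qed
  ultimately have "galois_coordinates Z x y"
    using Z tw[OF action_endo] by (simp add: galois_coordinates_def)
  then show ?thesis by blast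
qed

section \<open>Dual bases and separability from Galois coordinates\<close>

context
  fixes Z :: "'z set" and x y
  assumes coords: "galois_coordinates Z x y"
begin

lemma coordsD:
  "finite Z" "\<And>z. z \<in> Z \<Longrightarrow> x z \<in> carrier S" "\<And>z. z \<in> Z \<Longrightarrow> y z \<in> carrier S"
  "\<And>g. g \<in> carrier G \<Longrightarrow>
    (\<Oplus>\<^bsub>S\<^esub>z\<in>Z. x z \<otimes>\<^bsub>S\<^esub> \<phi> g (y z)) = (if g = \<one>\<^bsub>G\<^esub> then \<one>\<^bsub>S\<^esub> else \<zero>\<^bsub>S\<^esub>)"
  using coords by (auto simp: galois_coordinates_def)

text \<open>The coordinate identity for the inverse of g, with g applied to it.\<close>

lemma coords_flip:
  assumes g: "g \<in> carrier G"
  shows "(\<Oplus>\<^bsub>S\<^esub>z\<in>Z. \<phi> g (x z) \<otimes>\<^bsub>S\<^esub> y z) = (if g = \<one>\<^bsub>G\<^esub> then \<one>\<^bsub>S\<^esub> else \<zero>\<^bsub>S\<^esub>)"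
proof -
  have ig: "inv\<^bsub>G\<^esub> g \<in> carrier G" using g by simp
  have "(\<Oplus>\<^bsub>S\<^esub>z\<in>Z. \<phi> g (x z) \<otimes>\<^bsub>S\<^esub> y z) = (\<Oplus>\<^bsub>S\<^esub>z\<in>Z. \<phi> g (x z \<otimes>\<^bsub>S\<^esub> \<phi> (inv\<^bsub>G\<^esub> g) (y z)))"
    using g ig coordsD(2,3) action_simps(1,2)
    by (intro S.add.finprod_cong') (auto simp: action_comp action_one)
  also have "\<dots> = \<phi> g (\<Oplus>\<^bsub>S\<^esub>z\<in>Z. x z \<otimes>\<^bsub>S\<^esub> \<phi> (inv\<^bsub>G\<^esub> g) (y z))"
    using g ig coordsD(2,3) action_simps(1) by (intro action_finsum[symmetric]) auto
  also have "\<dots> = (if g = \<one>\<^bsub>G\<^esub> then \<one>\<^bsub>S\<^esub> else \<zero>\<^bsub>S\<^esub>)"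
    using g by (simp add: coordsD(4) action_simps(4) module_hom_zero[OF A.module A.module action_hom]
        G.inv_eq_1_iff)
  finally show ?thesis .
qed

text \<open>The functionals s -> trace(s x_z) and the elements y_z form a dual basis of
  \<open>S\<close> over \<open>R\<close>. Once the sums are interchanged, \<open>coords_flip\<close>
  leaves only the summand at g = 1.\<close>

lemma trace_expand:
  assumes s: "s \<in> carrier S"
  shows "(\<Oplus>\<^bsub>S\<^esub>z\<in>Z. trace (s \<otimes>\<^bsub>S\<^esub> x z) \<otimes>\<^bsub>S\<^esub> y z) = s"
proof -
  note a = action_simps(1) and xy = coordsD(2,3)
  have "(\<Oplus>\<^bsub>S\<^esub>z\<in>Z. trace (s \<otimes>\<^bsub>S\<^esub> x z) \<otimes>\<^bsub>S\<^esub> y z) =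
    (\<Oplus>\<^bsub>S\<^esub>z\<in>Z. \<Oplus>\<^bsub>S\<^esub>g\<in>carrier G. \<phi> g s \<otimes>\<^bsub>S\<^esub> (\<phi> g (x z) \<otimes>\<^bsub>S\<^esub> y z))"
  proof (intro S.add.finprod_cong' refl)
    fix z assume z: "z \<in> Z"
    have "trace (s \<otimes>\<^bsub>S\<^esub> x z) \<otimes>\<^bsub>S\<^esub> y z = (\<Oplus>\<^bsub>S\<^esub>g\<in>carrier G. \<phi> g (s \<otimes>\<^bsub>S\<^esub> x z) \<otimes>\<^bsub>S\<^esub> y z)"
      unfolding trace_def using s a xy[OF z] finite_group by (intro S.finsum_ldistr) auto
    also have "\<dots> = (\<Oplus>\<^bsub>S\<^esub>g\<in>carrier G. \<phi> g s \<otimes>\<^bsub>S\<^esub> (\<phi> g (x z) \<otimes>\<^bsub>S\<^esub> y z))"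
      using s a xy[OF z] by (intro S.add.finprod_cong') (auto simp: action_simps(2) S.m_assoc)
    finally show "trace (s \<otimes>\<^bsub>S\<^esub> x z) \<otimes>\<^bsub>S\<^esub> y z =
      (\<Oplus>\<^bsub>S\<^esub>g\<in>carrier G. \<phi> g s \<otimes>\<^bsub>S\<^esub> (\<phi> g (x z) \<otimes>\<^bsub>S\<^esub> y z))" .
  qed (use s a xy in \<open>auto intro!: S.finsum_closed\<close>)
  also have "\<dots> = (\<Oplus>\<^bsub>S\<^esub>g\<in>carrier G. \<Oplus>\<^bsub>S\<^esub>z\<in>Z. \<phi> g s \<otimes>\<^bsub>S\<^esub> (\<phi> g (x z) \<otimes>\<^bsub>S\<^esub> y z))"
    using s a xy coordsD(1) finite_group by (intro S.finsum_swap) auto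
  also have "\<dots> = (\<Oplus>\<^bsub>S\<^esub>g\<in>carrier G. if \<one>\<^bsub>G\<^esub> = g then \<phi> g s else \<zero>\<^bsub>S\<^esub>)"
  proof (intro S.add.finprod_cong' refl)
    fix g assume g: "g \<in> carrier G"
    have "(\<Oplus>\<^bsub>S\<^esub>z\<in>Z. \<phi> g s \<otimes>\<^bsub>S\<^esub> (\<phi> g (x z) \<otimes>\<^bsub>S\<^esub> y z)) = \<phi> g s \<otimes>\<^bsub>S\<^esub> (\<Oplus>\<^bsub>S\<^esub>z\<in>Z. \<phi> g (x z) \<otimes>\<^bsub>S\<^esub> y z)"
      using s a g xy coordsD(1) by (intro S.finsum_rdistr[symmetric]) auto
    then show "(\<Oplus>\<^bsub>S\<^esub>z\<in>Z. \<phi> g s \<otimes>\<^bsub>S\<^esub> (\<phi> g (x z) \<otimes>\<^bsub>S\<^esub> y z)) = (if \<one>\<^bsub>G\<^esub> = g then \<phi> g s else \<zero>\<^bsub>S\<^esub>)"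
      using a[OF g s] by (auto simp: coords_flip[OF g])
  qed (use s a in auto)
  also have "\<dots> = \<phi> \<one>\<^bsub>G\<^esub> s"
    using s a finite_group by (intro S.add.finprod_singleton) auto
  finally show ?thesis using s by (simp add: action_one)
qed

text \<open>Reconstructs a tensor from its images under x \<otimes> y -> x g(y). At s \<otimes> t
  the inner sum is s trace(t x_z); the trace lies in \<open>R\<close>, crosses to the right factor,
  and \<open>trace_expand\<close> gives back t.\<close>

lemma tensor_expand:
  assumes X: "X \<in> carrier SS.T"
  shows "(\<Oplus>\<^bsub>SS.T\<^esub>z\<in>Z. SS.tns (\<Oplus>\<^bsub>S\<^esub>g\<in>carrier G. twist (\<phi> g) X \<otimes>\<^bsub>S\<^esub> \<phi> g (x z)) (y z)) = X"
proof (rule SS.T_hom_eqI[OF SS.T_module _ _ _ X])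
  note a = action_simps(1) and xy = coordsD(2,3)
  interpret T: module R SS.T by (rule SS.T_module)
  have rm: "(\<lambda>s. s \<otimes>\<^bsub>S\<^esub> t) \<in> module_hom R S S" if "t \<in> carrier S" for t
    using that by (intro module_homI) (auto simp: S.l_distr A.smult_assoc2)
  show "(\<lambda>X. \<Oplus>\<^bsub>SS.T\<^esub>z\<in>Z. SS.tns (\<Oplus>\<^bsub>S\<^esub>g\<in>carrier G. twist (\<phi> g) X \<otimes>\<^bsub>S\<^esub> \<phi> g (x z)) (y z))
    \<in> module_hom R SS.T SS.T"
  proof (rule module_hom_finsum_fun[OF SS.T_module SS.T_module])
    fix z assume z: "z \<in> Z"
    show "(\<lambda>X. SS.tns (\<Oplus>\<^bsub>S\<^esub>g\<in>carrier G. twist (\<phi> g) X \<otimes>\<^bsub>S\<^esub> \<phi> g (x z)) (y z)) \<in> module_hom R SS.T SS.T"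
    proof (rule module_hom_comp[OF _ SS.tns_hom_left[OF xy(2)[OF z]]],
        rule module_hom_finsum_fun[OF SS.T_module A.module])
      fix g assume g: "g \<in> carrier G"
      show "(\<lambda>X. twist (\<phi> g) X \<otimes>\<^bsub>S\<^esub> \<phi> g (x z)) \<in> module_hom R SS.T S"
        by (rule module_hom_comp[OF twist_hom[OF action_endo[OF g]] rm[OF a[OF g xy(1)[OF z]]]])
    qed
  qed
  show "(\<lambda>X. X) \<in> module_hom R SS.T SS.T" by (rule module_homI) auto
  fix s t assume st: "s \<in> carrier S" "t \<in> carrier S"
  \<comment> \<open>Elements r_z of \<open>R\<close> representing the traces are fixed here, because
    only scalars from \<open>R\<close> can be moved across the tensor sign.\<close>
  have "\<forall>z\<in>Z. \<exists>r. r \<in> carrier R \<and> trace (t \<otimes>\<^bsub>S\<^esub> x z) = \<iota> r"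
    using traceE st xy by (metis S.m_closed)
  then obtain r where r: "\<And>z. z \<in> Z \<Longrightarrow> r z \<in> carrier R" "\<And>z. z \<in> Z \<Longrightarrow> trace (t \<otimes>\<^bsub>S\<^esub> x z) = \<iota> (r z)"
    by metis
  have "(\<Oplus>\<^bsub>SS.T\<^esub>z\<in>Z. SS.tns (\<Oplus>\<^bsub>S\<^esub>g\<in>carrier G. twist (\<phi> g) (SS.tns s t) \<otimes>\<^bsub>S\<^esub> \<phi> g (x z)) (y z)) =
    (\<Oplus>\<^bsub>SS.T\<^esub>z\<in>Z. SS.tns s (r z \<odot>\<^bsub>S\<^esub> y z))"
  proof (intro T.M.add.finprod_cong' refl)
    fix z assume z: "z \<in> Z"
    have "(\<Oplus>\<^bsub>S\<^esub>g\<in>carrier G. twist (\<phi> g) (SS.tns s t) \<otimes>\<^bsub>S\<^esub> \<phi> g (x z)) =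
      (\<Oplus>\<^bsub>S\<^esub>g\<in>carrier G. s \<otimes>\<^bsub>S\<^esub> \<phi> g (t \<otimes>\<^bsub>S\<^esub> x z))"
      using st a xy[OF z]
      by (intro S.add.finprod_cong') (auto simp: twist_tns[OF action_endo] action_simps(2) S.m_assoc)
    also have "\<dots> = s \<otimes>\<^bsub>S\<^esub> trace (t \<otimes>\<^bsub>S\<^esub> x z)"
      unfolding trace_def using st a xy[OF z] finite_group by (intro S.finsum_rdistr[symmetric]) auto
    also have "\<dots> = r z \<odot>\<^bsub>S\<^esub> s"
      using r[OF z] st by (simp add: smult_iota S.m_comm)
    finally show "SS.tns (\<Oplus>\<^bsub>S\<^esub>g\<in>carrier G. twist (\<phi> g) (SS.tns s t) \<otimes>\<^bsub>S\<^esub> \<phi> g (x z)) (y z) =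
      SS.tns s (r z \<odot>\<^bsub>S\<^esub> y z)"
      using r[OF z] st xy[OF z]
      by (simp add: module_homD(3)[OF SS.tns_hom_left] module_homD(3)[OF SS.tns_hom_right])
  qed (use st r xy in \<open>auto intro!: SS.tns_closed\<close>)
  also have "\<dots> = SS.tns s (\<Oplus>\<^bsub>S\<^esub>z\<in>Z. r z \<odot>\<^bsub>S\<^esub> y z)"
    using st r xy by (intro module_hom_finsum[OF A.module SS.T_module SS.tns_hom_right, symmetric]) auto
  also have "(\<Oplus>\<^bsub>S\<^esub>z\<in>Z. r z \<odot>\<^bsub>S\<^esub> y z) = (\<Oplus>\<^bsub>S\<^esub>z\<in>Z. trace (t \<otimes>\<^bsub>S\<^esub> x z) \<otimes>\<^bsub>S\<^esub> y z)"
    using r xy by (intro S.add.finprod_cong') (auto simp: smult_iota)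
  also have "\<dots> = t" by (rule trace_expand[OF st(2)])
  finally show "(\<Oplus>\<^bsub>SS.T\<^esub>z\<in>Z. SS.tns (\<Oplus>\<^bsub>S\<^esub>g\<in>carrier G. twist (\<phi> g) (SS.tns s t) \<otimes>\<^bsub>S\<^esub> \<phi> g (x z)) (y z)) =
    SS.tns s t" .
qed

text \<open>Injectivity of the classical map from S \<otimes> S to a product of copies of
  \<open>S\<close> indexed by the group. It reduces identities between tensors to identities in
  \<open>S\<close>.\<close>

lemma twist_jointly_inj:
  assumes "X \<in> carrier SS.T" "Y \<in> carrier SS.T"
    and eq: "\<And>g. g \<in> carrier G \<Longrightarrow> twist (\<phi> g) X = twist (\<phi> g) Y"
  shows "X = Y"
proof -
  have "(\<Oplus>\<^bsub>S\<^esub>g\<in>carrier G. twist (\<phi> g) X \<otimes>\<^bsub>S\<^esub> \<phi> g (x z)) =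
    (\<Oplus>\<^bsub>S\<^esub>g\<in>carrier G. twist (\<phi> g) Y \<otimes>\<^bsub>S\<^esub> \<phi> g (x z))" if "z \<in> Z" for z
    using that eq coordsD(2) action_simps(1) module_homD(1)[OF twist_hom[OF action_endo]] assms(2)
    by (intro S.add.finprod_cong') auto
  moreover interpret T: module R SS.T by (rule SS.T_module)
  have "(\<lambda>z. SS.tns (\<Oplus>\<^bsub>S\<^esub>g\<in>carrier G. twist (\<phi> g) Y \<otimes>\<^bsub>S\<^esub> \<phi> g (x z)) (y z)) \<in> Z \<rightarrow> carrier SS.T"
    using coordsD(2,3) action_simps(1) module_homD(1)[OF twist_hom[OF action_endo]] assms(2)
    by (intro funcsetI SS.tns_closed S.finsum_closed) auto
  ultimately have "(\<Oplus>\<^bsub>SS.T\<^esub>z\<in>Z. SS.tns (\<Oplus>\<^bsub>S\<^esub>g\<in>carrier G. twist (\<phi> g) X \<otimes>\<^bsub>S\<^esub> \<phi> g (x z)) (y z)) =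
    (\<Oplus>\<^bsub>SS.T\<^esub>z\<in>Z. SS.tns (\<Oplus>\<^bsub>S\<^esub>g\<in>carrier G. twist (\<phi> g) Y \<otimes>\<^bsub>S\<^esub> \<phi> g (x z)) (y z))"
    by (intro T.M.add.finprod_cong') simp_all
  then show ?thesis using tensor_expand assms(1,2) by simp
qed

lemma coords_T_cring: "cring SS.T"
proof (rule SS.T_cring[of S "carrier G" "\<lambda>g x y. x \<otimes>\<^bsub>S\<^esub> \<phi> g y", OF A.algebra_axioms])
  show "bilinear_map R S S S (\<lambda>x y. x \<otimes>\<^bsub>S\<^esub> \<phi> g y)" if "g \<in> carrier G" for g
    by (rule twist_bilinear[OF action_endo[OF that]])
  show "(x \<otimes>\<^bsub>S\<^esub> x') \<otimes>\<^bsub>S\<^esub> \<phi> g (y \<otimes>\<^bsub>S\<^esub> y') = (x \<otimes>\<^bsub>S\<^esub> \<phi> g y) \<otimes>\<^bsub>S\<^esub> (x' \<otimes>\<^bsub>S\<^esub> \<phi> g y')"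
    if "g \<in> carrier G" "x \<in> carrier S" "x' \<in> carrier S" "y \<in> carrier S" "y' \<in> carrier S" for g x x' y y'
    by (rule twist_mult_basis[OF action_endo[OF that(1)] that(2-5)])
  show "\<one>\<^bsub>S\<^esub> \<otimes>\<^bsub>S\<^esub> \<phi> g \<one>\<^bsub>S\<^esub> = \<one>\<^bsub>S\<^esub>" if "g \<in> carrier G" for g
    using that by (simp add: action_simps(4))
qed (rule twist_jointly_inj)

text \<open>The converse of the extraction of coordinates. The tensor with component 1 at the
  identity and 0 at every other g is an idempotent that splits multiplication, so \<open>S\<close>
  is a summand of the free module of rank one over S \<otimes> S.\<close>

lemma coords_separable: "separable_algebra R S"
proof -
  interpret T: cring SS.T by (rule coords_T_cring)
  interpret Tm: module R SS.T by (rule SS.T_module)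
  let ?\<mu> = "twist (\<lambda>x. x)"
  note m = twist_hom[OF id_linear_endo] and a = action_simps(1) and xy = coordsD(2,3)
  note th = twist_hom[OF action_endo]
  have mm: "?\<mu> (X \<otimes>\<^bsub>SS.T\<^esub> Y) = ?\<mu> X \<otimes>\<^bsub>S\<^esub> ?\<mu> Y" if "X \<in> carrier SS.T" "Y \<in> carrier SS.T" for X Y
    using that by (intro twist_mult[OF id_linear_endo]) auto
  have tm: "twist (\<phi> g) (X \<otimes>\<^bsub>SS.T\<^esub> Y) = twist (\<phi> g) X \<otimes>\<^bsub>S\<^esub> twist (\<phi> g) Y"
    if "g \<in> carrier G" "X \<in> carrier SS.T" "Y \<in> carrier SS.T" for g X Y
    using that by (intro twist_mult[OF action_endo]) auto
  \<comment> \<open>\<open>\<phi> \<one>\<close> is the identity on the carrier only, so the two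
    lifts are compared on elementary tensors.\<close>
  have t1: "twist (\<phi> \<one>\<^bsub>G\<^esub>) X = ?\<mu> X" if "X \<in> carrier SS.T" for X
    by (rule SS.T_hom_eqI[OF A.module th m _ that])
      (simp_all add: twist_tns[OF action_endo] twist_tns[OF id_linear_endo] action_one)
  have m1: "?\<mu> \<one>\<^bsub>SS.T\<^esub> = \<one>\<^bsub>S\<^esub>" unfolding SS.T_one by (simp add: twist_tns[OF id_linear_endo])
  have mc: "?\<mu> X \<in> carrier S" if "X \<in> carrier SS.T" for X using module_homD(1)[OF m that] .
  have E: "module SS.T E"
  proof (rule moduleI[OF coords_T_cring])
    show "abelian_group E"
      by (rule abelian_groupI) (auto simp: E_sel S.a_ac S.r_neg intro!: bexI[of _ "\<ominus>\<^bsub>S\<^esub> _"])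
  qed (simp_all add: E_sel E_smult mc mm m1 module_homD(2)[OF m] S.l_distr S.r_distr S.m_assoc)
  \<comment> \<open>The splitting: \<open>e s\<close> has component s at the identity and 0
    elsewhere, as \<open>te\<close> verifies.\<close>
  define e where "e s = (\<Oplus>\<^bsub>SS.T\<^esub>z\<in>Z. SS.tns (s \<otimes>\<^bsub>S\<^esub> x z) (y z))" for s
  have ecl: "(\<lambda>z. SS.tns (s \<otimes>\<^bsub>S\<^esub> x z) (y z)) \<in> Z \<rightarrow> carrier SS.T" if "s \<in> carrier S" for s
    using that xy by (auto intro!: SS.tns_closed)
  have ec: "e s \<in> carrier SS.T" if "s \<in> carrier S" for s
    unfolding e_def by (rule T.finsum_closed[OF ecl[OF that]])
  have te: "twist (\<phi> g) (e s) = (if g = \<one>\<^bsub>G\<^esub> then s else \<zero>\<^bsub>S\<^esub>)" if s: "s \<in> carrier S" and g: "g \<in> carrier G" for s g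
  proof -
    have "twist (\<phi> g) (e s) = (\<Oplus>\<^bsub>S\<^esub>z\<in>Z. twist (\<phi> g) (SS.tns (s \<otimes>\<^bsub>S\<^esub> x z) (y z)))"
      unfolding e_def by (rule module_hom_finsum[OF SS.T_module A.module th[OF g] ecl[OF s]])
    also have "\<dots> = (\<Oplus>\<^bsub>S\<^esub>z\<in>Z. s \<otimes>\<^bsub>S\<^esub> (x z \<otimes>\<^bsub>S\<^esub> \<phi> g (y z)))"
      using s g xy a by (intro S.add.finprod_cong') (auto simp: twist_tns[OF action_endo] S.m_assoc)
    also have "\<dots> = s \<otimes>\<^bsub>S\<^esub> (\<Oplus>\<^bsub>S\<^esub>z\<in>Z. x z \<otimes>\<^bsub>S\<^esub> \<phi> g (y z))"
      using s g xy a coordsD(1) by (intro S.finsum_rdistr[symmetric]) auto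
    finally show ?thesis using s g by (simp add: coordsD(4))
  qed
  have eq: "e s = e' " if "s \<in> carrier S" "e' \<in> carrier SS.T"
    "\<And>g. g \<in> carrier G \<Longrightarrow> twist (\<phi> g) e' = (if g = \<one>\<^bsub>G\<^esub> then s else \<zero>\<^bsub>S\<^esub>)" for s e'
    by (rule twist_jointly_inj[OF ec that(2)]) (use that te in auto)
  have eadd: "e (s \<oplus>\<^bsub>S\<^esub> t) = e s \<oplus>\<^bsub>SS.T\<^esub> e t" if "s \<in> carrier S" "t \<in> carrier S" for s t
    by (rule eq) (use that in \<open>auto simp: ec te module_homD(2)[OF th]\<close>)
  have emul: "e (?\<mu> X \<otimes>\<^bsub>S\<^esub> s) = X \<otimes>\<^bsub>SS.T\<^esub> e s" if "s \<in> carrier S" "X \<in> carrier SS.T" for s X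
    by (rule eq) (use that in \<open>auto simp: ec te mc tm t1 module_homD(1)[OF th]\<close>)
  \<comment> \<open>The free module has one basis vector; its index must come from the type of
    \<open>S\<close>, and the unit of \<open>S\<close> is taken as a label.\<close>
  define i where "i s = (\<lambda>b. if b = \<one>\<^bsub>S\<^esub> then e s else \<zero>\<^bsub>SS.T\<^esub>)" for s
  have "{b. i s b \<noteq> \<zero>\<^bsub>SS.T\<^esub>} \<subseteq> {\<one>\<^bsub>S\<^esub>}" for s by (auto simp: i_def)
  then have ic: "i s \<in> carrier (free_module SS.T {\<one>\<^bsub>S\<^esub>})" if "s \<in> carrier S" for s
    using ec[OF that] finite_subset[of _ "{\<one>\<^bsub>S\<^esub>}"] by (auto simp: free_module_def i_def)
  have i: "i \<in> module_hom SS.T E (free_module SS.T {\<one>\<^bsub>S\<^esub>})"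
  proof (rule module_homI)
    show "i s \<in> carrier (free_module SS.T {\<one>\<^bsub>S\<^esub>})" if "s \<in> carrier E" for s
      using ic that by (simp add: E_sel)
  qed (auto simp: E_sel E_smult i_def eadd emul free_module_def fun_eq_iff)
  define q where "q f = ?\<mu> (f \<one>\<^bsub>S\<^esub>)" for f
  have q: "q \<in> module_hom SS.T (free_module SS.T {\<one>\<^bsub>S\<^esub>}) E"
    by (rule module_homI)
      (auto simp: q_def E_sel E_smult mc mm module_homD(2)[OF m] free_module_def)
  have "q (i s) = s" if "s \<in> carrier E" for s
    using that te[of s "\<one>\<^bsub>G\<^esub>"] t1[OF ec] by (simp add: q_def i_def E_sel)
  then show ?thesis
    unfolding separable_algebra_def projective_module_def
    using A.algebra_axioms E i q by blast
qed

end

end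

section \<open>Roots of unity\<close>

text \<open>The exponential map of a generator factors through residues modulo p. It is onto a set
  with as many elements as its domain, hence bijective.\<close>

lemma cyclic_group_iso:
  fixes G (structure)
  assumes "group G" "cyclic_group G" "order G = p" "p > 0"
  shows "\<exists>h. h \<in> iso (integer_mod_group p) G"
proof -
  interpret group G by fact
  obtain x where x: "x \<in> carrier G" "carrier G = range (\<lambda>n::int. x [^] n)"
    using assms(2) cyclic_group by blast
  have fin: "finite (carrier G)" using assms(3,4) order_gt_0_iff_finite by simp
  have xp: "x [^] int p = \<one>"
    using pow_order_eq_1[OF x(1)] assms(3) by (simp add: int_pow_int)
  have md: "x [^] n = x [^] (n mod int p)" for n :: int
  proof -
    have "x [^] n = x [^] (int p * (n div int p) + n mod int p)" by simp
    also have "\<dots> = x [^] (int p * (n div int p)) \<otimes> x [^] (n mod int p)"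
      using x(1) by (rule int_pow_mult)
    also have "x [^] (int p * (n div int p)) = \<one>"
      using int_pow_pow[OF x(1), of "int p" "n div int p"] xp by simp
    finally show ?thesis using x(1) by simp
  qed
  have im: "(\<lambda>n::int. x [^] n) ` {0..<int p} = carrier G"
  proof
    show "carrier G \<subseteq> (\<lambda>n::int. x [^] n) ` {0..<int p}"
    proof
      fix y assume "y \<in> carrier G"
      then obtain n :: int where "y = x [^] n" using x(2) by blast
      then have "y = x [^] (n mod int p)" using md by metis
      then show "y \<in> (\<lambda>n::int. x [^] n) ` {0..<int p}" using assms(4) by auto
    qed
  qed (use x(1) in auto)
  then have "card ((\<lambda>n::int. x [^] n) ` {0..<int p}) = card {0..<int p}"
    using assms(3) by (simp add: order_def)
  then have "inj_on (\<lambda>n::int. x [^] n) {0..<int p}" by (simp add: eq_card_imp_inj_on)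
  moreover have "(\<lambda>n::int. x [^] n) \<in> hom (integer_mod_group p) G"
    using x(1) assms(4) md[of "_ + _"] by (auto intro!: homI simp: int_pow_mult)
  ultimately have "(\<lambda>n::int. x [^] n) \<in> iso (integer_mod_group p) G"
    using im assms(4) by (simp add: iso_def bij_betw_def carrier_integer_mod_group)
  then show ?thesis by blast
qed

text \<open>By Lagrange the kernel is trivial or everything, and a nontrivial value excludes the
  latter.\<close>

lemma hom_inj_prime_order:
  assumes "group G" "group H" "f \<in> hom G H" "Factorial_Ring.prime (order G)"
    and "\<exists>g\<in>carrier G. f g \<noteq> \<one>\<^bsub>H\<^esub>"
  shows "inj_on f (carrier G)"
proof -
  interpret group_hom G H f using assms by (simp add: group_hom_def group_hom_axioms_def)
  have sg: "subgroup (kernel G H f) G" by (rule subgroup_kernel)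
  have fin: "finite (carrier G)" using prime_gt_0_nat[OF assms(4)] by (simp add: G.order_gt_0_iff_finite)
  have "card (kernel G H f) dvd order G" unfolding G.lagrange[OF sg, symmetric] by (rule dvd_triv_right)
  then consider "card (kernel G H f) = 1" | "card (kernel G H f) = order G"
    using assms(4) unfolding prime_nat_iff by blast
  then have "kernel G H f = {\<one>\<^bsub>G\<^esub>}"
  proof cases
    case 1
    then obtain a where "kernel G H f = {a}" using card_1_singletonE by blast
    then show ?thesis using subgroup.one_closed[OF sg] by auto
  next
    case 2
    then have "kernel G H f = carrier G"
      using fin card_subset_eq[OF fin subgroup.subset[OF sg]] by (simp add: order_def)
    then show ?thesis using assms(5) by (auto simp: kernel_def)
  qed
  then show ?thesis by (rule trivial_ker_imp_inj)
qed

locale kummerian = R: cring R for R :: "('r, 'k) ring_scheme" +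
  fixes p :: nat and \<mu> :: "'r set"
  assumes prime: "Factorial_Ring.prime p" and kummerian: "p_kummerian p R \<mu>"
begin

abbreviation "M\<mu> \<equiv> (units_of R)\<lparr>carrier := \<mu>\<rparr>"

text \<open>The inverse of p in \<open>R\<close>, the weight in all averages over the group.\<close>

definition "q = inv\<^bsub>R\<^esub> ([p] \<cdot>\<^bsub>R\<^esub> \<one>\<^bsub>R\<^esub>)"

lemma p_gt: "p > 1" "p > 0"
  using prime prime_gt_1_nat prime_gt_0_nat by auto

lemma p_unit: "[p] \<cdot>\<^bsub>R\<^esub> \<one>\<^bsub>R\<^esub> \<in> Units R"
  and mu_subgroup: "subgroup \<mu> (units_of R)"
  and mu_cyclic: "cyclic_group M\<mu>" and mu_card: "card \<mu> = p"
  and mu_idem: "\<And>z e. z \<in> \<mu> \<Longrightarrow> e \<in> carrier R \<Longrightarrow> z \<noteq> \<one>\<^bsub>R\<^esub> \<Longrightarrow> e \<otimes>\<^bsub>R\<^esub> e = e \<Longrightarrow>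
    z \<otimes>\<^bsub>R\<^esub> e = e \<Longrightarrow> e = \<zero>\<^bsub>R\<^esub>"
  using kummerian unfolding p_kummerian_def by auto

lemma q_closed [simp]: "q \<in> carrier R"
  unfolding q_def using p_unit by simp

lemma p_q: "([p] \<cdot>\<^bsub>R\<^esub> \<one>\<^bsub>R\<^esub>) \<otimes>\<^bsub>R\<^esub> q = \<one>\<^bsub>R\<^esub>" "q \<otimes>\<^bsub>R\<^esub> ([p] \<cdot>\<^bsub>R\<^esub> \<one>\<^bsub>R\<^esub>) = \<one>\<^bsub>R\<^esub>"
  unfolding q_def using p_unit by simp_all

lemma M_group: "group M\<mu>"
  by (rule subgroup.subgroup_is_group[OF mu_subgroup R.units_group])

lemma mu_Units: "z \<in> \<mu> \<Longrightarrow> z \<in> Units R"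
  using subgroup.subset[OF mu_subgroup] by (auto simp: units_of_carrier)

lemma mu_closed [simp]: "z \<in> \<mu> \<Longrightarrow> z \<in> carrier R"
  using mu_Units by auto

lemma mu_one: "\<one>\<^bsub>R\<^esub> \<in> \<mu>"
  using subgroup.one_closed[OF mu_subgroup] by (simp add: units_of_one)

lemma mu_mult: "z \<in> \<mu> \<Longrightarrow> w \<in> \<mu> \<Longrightarrow> z \<otimes>\<^bsub>R\<^esub> w \<in> \<mu>"
  using subgroup.m_closed[OF mu_subgroup] by (simp add: units_of_mult)

lemma mu_pow: "z \<in> \<mu> \<Longrightarrow> z [^]\<^bsub>R\<^esub> (n::nat) \<in> \<mu>"
  by (induction n) (auto intro: mu_one mu_mult)

lemma M_pow: "z [^]\<^bsub>M\<mu>\<^esub> (n::nat) = z [^]\<^bsub>R\<^esub> n"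
  by (simp add: nat_pow_def units_of_mult units_of_one)

lemma mu_pow_p: "z \<in> \<mu> \<Longrightarrow> z [^]\<^bsub>R\<^esub> p = \<one>\<^bsub>R\<^esub>"
  using group.pow_order_eq_1[OF M_group, of z]
  by (simp add: order_def mu_card M_pow units_of_one)

lemma mu_pow_p_mult: "z \<in> \<mu> \<Longrightarrow> p dvd n \<Longrightarrow> z [^]\<^bsub>R\<^esub> (n::nat) = \<one>\<^bsub>R\<^esub>"
  by (auto elim!: dvdE simp: R.nat_pow_pow[symmetric] mu_pow_p)

text \<open>An inverse of n modulo p recovers z from z^n, so z^n = 1 would force z = 1.\<close>

lemma mu_pow_neq_one:
  assumes z: "z \<in> \<mu>" "z \<noteq> \<one>\<^bsub>R\<^esub>" and n: "\<not> p dvd n"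
  shows "z [^]\<^bsub>R\<^esub> (n::nat) \<noteq> \<one>\<^bsub>R\<^esub>"
proof
  assume 1: "z [^]\<^bsub>R\<^esub> n = \<one>\<^bsub>R\<^esub>"
  have "coprime n p" using prime n by (metis coprime_commute prime_imp_coprime)
  then obtain x where "[n * x = 1] (mod p)" using cong_solve_coprime_nat by fastforce
  then have x: "n * x mod p = 1" using p_gt by (simp add: cong_def)
  have "z [^]\<^bsub>R\<^esub> (n * x) = \<one>\<^bsub>R\<^esub>" using z 1 by (simp add: R.nat_pow_pow[symmetric])
  moreover have "n * x = p * (n * x div p) + 1" using x by (metis mult_div_mod_eq)
  then have "z [^]\<^bsub>R\<^esub> (n * x) = z [^]\<^bsub>R\<^esub> (p * (n * x div p)) \<otimes>\<^bsub>R\<^esub> z"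
    using z by (metis R.nat_pow_Suc Suc_eq_plus1)
  ultimately show False using z mu_pow_p_mult[of z "p * (n * x div p)"] by simp
qed

text \<open>The sum \<open>N\<close> of the powers of \<open>z\<close> satisfies \<open>N\<^sup>2 = p N\<close> and \<open>z N = N\<close>, so \<open>N / p\<close> is an
  idempotent fixed by \<open>z\<close>.\<close>

lemma mu_sum_zero:
  assumes z: "z \<in> \<mu>" "z \<noteq> \<one>\<^bsub>R\<^esub>"
  shows "(\<Oplus>\<^bsub>R\<^esub>i\<in>{..<p}. z [^]\<^bsub>R\<^esub> i) = \<zero>\<^bsub>R\<^esub>"
proof -
  define N where "N = (\<Oplus>\<^bsub>R\<^esub>i\<in>{..<p}. z [^]\<^bsub>R\<^esub> i)"
  obtain m where m: "p = Suc m" using p_gt by (cases p) auto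
  have zc: "z \<in> carrier R" using z by simp
  have cl: "(\<lambda>i. z [^]\<^bsub>R\<^esub> i) \<in> A \<rightarrow> carrier R" for A :: "nat set" using zc by auto
  have N: "N \<in> carrier R" unfolding N_def by (rule R.finsum_closed[OF cl])
  have N': "N = (\<Oplus>\<^bsub>R\<^esub>i\<in>{..m}. z [^]\<^bsub>R\<^esub> i)" unfolding N_def m lessThan_Suc_atMost ..
  have "z \<otimes>\<^bsub>R\<^esub> N = (\<Oplus>\<^bsub>R\<^esub>i\<in>{..m}. z [^]\<^bsub>R\<^esub> Suc i)"
    unfolding N' using R.finsum_rdistr[OF _ zc cl, of "{..m}"] zc
    by (simp add: R.m_comm)
  \<comment> \<open>Both z N + 1 and z^p + N equal the sum of the powers from 0 to p, split at its
    first and at its last term.\<close>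
  then have "z \<otimes>\<^bsub>R\<^esub> N \<oplus>\<^bsub>R\<^esub> \<one>\<^bsub>R\<^esub> = (\<Oplus>\<^bsub>R\<^esub>i\<in>{..Suc m}. z [^]\<^bsub>R\<^esub> i)"
    using R.finsum_Suc2[OF cl, of m] by simp
  also have "\<dots> = z [^]\<^bsub>R\<^esub> Suc m \<oplus>\<^bsub>R\<^esub> N" unfolding N' by (rule R.finsum_Suc[OF cl])
  also have "\<dots> = N \<oplus>\<^bsub>R\<^esub> \<one>\<^bsub>R\<^esub>" using mu_pow_p[OF z(1)] m N by (simp add: R.a_comm)
  finally have zN: "z \<otimes>\<^bsub>R\<^esub> N = N" using N zc by simp
  have zi: "z [^]\<^bsub>R\<^esub> (i::nat) \<otimes>\<^bsub>R\<^esub> N = N" for i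
    using zc N zN by (induction i) (auto simp: R.m_assoc)
  have "N \<otimes>\<^bsub>R\<^esub> N = (\<Oplus>\<^bsub>R\<^esub>i\<in>{..<p}. z [^]\<^bsub>R\<^esub> i \<otimes>\<^bsub>R\<^esub> N)"
    by (subst (1) N_def) (rule R.finsum_ldistr[OF _ N cl], simp)
  also have "\<dots> = [p] \<cdot>\<^bsub>R\<^esub> N" unfolding zi using R.add.finprod_const[OF N, of "{..<p}"] by simp
  also have "\<dots> = ([p] \<cdot>\<^bsub>R\<^esub> \<one>\<^bsub>R\<^esub>) \<otimes>\<^bsub>R\<^esub> N"
    using R.add_pow_ldistr[OF R.one_closed N, of p] N by simp
  finally have NN: "N \<otimes>\<^bsub>R\<^esub> N = ([p] \<cdot>\<^bsub>R\<^esub> \<one>\<^bsub>R\<^esub>) \<otimes>\<^bsub>R\<^esub> N" .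
  have pc: "[p] \<cdot>\<^bsub>R\<^esub> \<one>\<^bsub>R\<^esub> \<in> carrier R" by simp
  have "(q \<otimes>\<^bsub>R\<^esub> N) \<otimes>\<^bsub>R\<^esub> (q \<otimes>\<^bsub>R\<^esub> N) = q \<otimes>\<^bsub>R\<^esub> (q \<otimes>\<^bsub>R\<^esub> (N \<otimes>\<^bsub>R\<^esub> N))"
    using N by (simp add: R.m_ac)
  also have "\<dots> = (q \<otimes>\<^bsub>R\<^esub> ([p] \<cdot>\<^bsub>R\<^esub> \<one>\<^bsub>R\<^esub>)) \<otimes>\<^bsub>R\<^esub> (q \<otimes>\<^bsub>R\<^esub> N)"
    unfolding NN using N pc by (simp only: R.m_ac q_closed R.m_closed)
  finally have "(q \<otimes>\<^bsub>R\<^esub> N) \<otimes>\<^bsub>R\<^esub> (q \<otimes>\<^bsub>R\<^esub> N) = q \<otimes>\<^bsub>R\<^esub> N" using N p_q(2) by simp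
  moreover have "z \<otimes>\<^bsub>R\<^esub> (q \<otimes>\<^bsub>R\<^esub> N) = q \<otimes>\<^bsub>R\<^esub> N"
    using R.m_lcomm[OF zc q_closed N] zN by simp
  ultimately have "q \<otimes>\<^bsub>R\<^esub> N = \<zero>\<^bsub>R\<^esub>" using mu_idem[OF z(1) _ z(2)] N by simp
  moreover have "N = ([p] \<cdot>\<^bsub>R\<^esub> \<one>\<^bsub>R\<^esub>) \<otimes>\<^bsub>R\<^esub> (q \<otimes>\<^bsub>R\<^esub> N)"
    using N pc p_q(1) by (simp add: R.m_assoc[symmetric])
  ultimately show ?thesis using pc by (simp add: N_def)
qed

text \<open>Every 1 - z^i is a multiple of 1 - z. Summed over i < p these differences give p, since
  the powers of z add up to 0, and p is invertible.\<close>

lemma mu_one_minus_unit: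
  assumes z: "z \<in> \<mu>" "z \<noteq> \<one>\<^bsub>R\<^esub>"
  shows "\<exists>w\<in>carrier R. (\<one>\<^bsub>R\<^esub> \<ominus>\<^bsub>R\<^esub> z) \<otimes>\<^bsub>R\<^esub> w = \<one>\<^bsub>R\<^esub>"
proof -
  have zc: "z \<in> carrier R" using z by simp
  have "\<exists>w\<in>carrier R. \<one>\<^bsub>R\<^esub> \<ominus>\<^bsub>R\<^esub> z [^]\<^bsub>R\<^esub> (i::nat) = (\<one>\<^bsub>R\<^esub> \<ominus>\<^bsub>R\<^esub> z) \<otimes>\<^bsub>R\<^esub> w" for i
  proof (induction i)
    case 0
    show ?case using zc by (intro bexI[of _ "\<zero>\<^bsub>R\<^esub>"]) (auto simp: R.minus_eq R.r_neg)
  next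
    case (Suc i)
    then obtain w where w: "w \<in> carrier R" "\<one>\<^bsub>R\<^esub> \<ominus>\<^bsub>R\<^esub> z [^]\<^bsub>R\<^esub> i = (\<one>\<^bsub>R\<^esub> \<ominus>\<^bsub>R\<^esub> z) \<otimes>\<^bsub>R\<^esub> w" by blast
    have "\<one>\<^bsub>R\<^esub> \<ominus>\<^bsub>R\<^esub> z [^]\<^bsub>R\<^esub> Suc i = (\<one>\<^bsub>R\<^esub> \<ominus>\<^bsub>R\<^esub> z) \<oplus>\<^bsub>R\<^esub> z \<otimes>\<^bsub>R\<^esub> (\<one>\<^bsub>R\<^esub> \<ominus>\<^bsub>R\<^esub> z [^]\<^bsub>R\<^esub> i)"
      using zc by (simp only: R.nat_pow_Suc2) (simp add: R.minus_eq R.r_distr R.l_distr R.r_minus R.a_assoc R.r_neg1)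
    also have "\<dots> = (\<one>\<^bsub>R\<^esub> \<ominus>\<^bsub>R\<^esub> z) \<otimes>\<^bsub>R\<^esub> (\<one>\<^bsub>R\<^esub> \<oplus>\<^bsub>R\<^esub> z \<otimes>\<^bsub>R\<^esub> w)"
      unfolding w(2) using w(1) zc by (simp add: R.r_distr R.m_lcomm)
    finally show ?case using w(1) zc by blast
  qed
  then obtain w where w: "\<And>i. w i \<in> carrier R"
    "\<And>i::nat. \<one>\<^bsub>R\<^esub> \<ominus>\<^bsub>R\<^esub> z [^]\<^bsub>R\<^esub> i = (\<one>\<^bsub>R\<^esub> \<ominus>\<^bsub>R\<^esub> z) \<otimes>\<^bsub>R\<^esub> w i" by metis
  define W where "W = (\<Oplus>\<^bsub>R\<^esub>i\<in>{..<p}. w i)"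
  have W: "W \<in> carrier R" unfolding W_def using w(1) by (intro R.finsum_closed) auto
  have "(\<one>\<^bsub>R\<^esub> \<ominus>\<^bsub>R\<^esub> z) \<otimes>\<^bsub>R\<^esub> W = (\<Oplus>\<^bsub>R\<^esub>i\<in>{..<p}. \<one>\<^bsub>R\<^esub> \<ominus>\<^bsub>R\<^esub> z [^]\<^bsub>R\<^esub> i)"
    unfolding W_def w(2) using w(1) zc by (intro R.finsum_rdistr) auto
  then have "(\<one>\<^bsub>R\<^esub> \<ominus>\<^bsub>R\<^esub> z) \<otimes>\<^bsub>R\<^esub> W \<oplus>\<^bsub>R\<^esub> (\<Oplus>\<^bsub>R\<^esub>i\<in>{..<p}. z [^]\<^bsub>R\<^esub> i) =
    (\<Oplus>\<^bsub>R\<^esub>i\<in>{..<p}. (\<one>\<^bsub>R\<^esub> \<ominus>\<^bsub>R\<^esub> z [^]\<^bsub>R\<^esub> i) \<oplus>\<^bsub>R\<^esub> z [^]\<^bsub>R\<^esub> i)"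
    using zc by (simp add: R.finsum_addf Pi_def)
  also have "\<dots> = (\<Oplus>\<^bsub>R\<^esub>i\<in>{..<p}. \<one>\<^bsub>R\<^esub>)"
    using zc by (intro R.add.finprod_cong') (auto simp: R.minus_eq R.a_assoc R.l_neg)
  also have "\<dots> = [p] \<cdot>\<^bsub>R\<^esub> \<one>\<^bsub>R\<^esub>" using R.add.finprod_const[OF R.one_closed, of "{..<p}"] by simp
  finally have "(\<one>\<^bsub>R\<^esub> \<ominus>\<^bsub>R\<^esub> z) \<otimes>\<^bsub>R\<^esub> W = [p] \<cdot>\<^bsub>R\<^esub> \<one>\<^bsub>R\<^esub>"
    using mu_sum_zero[OF z] W zc by simp
  then have "(\<one>\<^bsub>R\<^esub> \<ominus>\<^bsub>R\<^esub> z) \<otimes>\<^bsub>R\<^esub> (W \<otimes>\<^bsub>R\<^esub> q) = \<one>\<^bsub>R\<^esub>"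
    using W zc p_q by (simp add: R.m_assoc[symmetric])
  then show ?thesis using W by (intro bexI[of _ "W \<otimes>\<^bsub>R\<^esub> q"]) auto
qed

text \<open>Write z - w = z (1 - z^(p-1) w), where z^(p-1) is the inverse of z.\<close>

lemma mu_diff_unit:
  assumes "z \<in> \<mu>" "w \<in> \<mu>" "z \<noteq> w"
  shows "\<exists>v\<in>carrier R. v \<otimes>\<^bsub>R\<^esub> (z \<ominus>\<^bsub>R\<^esub> w) = \<one>\<^bsub>R\<^esub>"
proof -
  have c: "z \<in> carrier R" "w \<in> carrier R" using assms by auto
  let ?i = "z [^]\<^bsub>R\<^esub> (p - 1)"
  have i: "z \<otimes>\<^bsub>R\<^esub> ?i = \<one>\<^bsub>R\<^esub>" "?i \<in> carrier R"
    using mu_pow_p[OF assms(1)] p_gt c by (auto simp flip: R.nat_pow_Suc2)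
  have zw: "z \<otimes>\<^bsub>R\<^esub> (?i \<otimes>\<^bsub>R\<^esub> w) = w" using i c by (simp add: R.m_assoc[symmetric])
  then have "?i \<otimes>\<^bsub>R\<^esub> w \<noteq> \<one>\<^bsub>R\<^esub>" using assms(3) c by auto
  then obtain v where v: "v \<in> carrier R" "(\<one>\<^bsub>R\<^esub> \<ominus>\<^bsub>R\<^esub> ?i \<otimes>\<^bsub>R\<^esub> w) \<otimes>\<^bsub>R\<^esub> v = \<one>\<^bsub>R\<^esub>"
    using mu_one_minus_unit[of "?i \<otimes>\<^bsub>R\<^esub> w"] mu_pow mu_mult assms(1,2) by blast
  have "z \<ominus>\<^bsub>R\<^esub> w = z \<otimes>\<^bsub>R\<^esub> (\<one>\<^bsub>R\<^esub> \<ominus>\<^bsub>R\<^esub> ?i \<otimes>\<^bsub>R\<^esub> w)"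
    using c i(2) zw by (simp add: R.minus_eq R.r_distr R.r_minus)
  then have "(?i \<otimes>\<^bsub>R\<^esub> v) \<otimes>\<^bsub>R\<^esub> (z \<ominus>\<^bsub>R\<^esub> w) = (z \<otimes>\<^bsub>R\<^esub> ?i) \<otimes>\<^bsub>R\<^esub> ((\<one>\<^bsub>R\<^esub> \<ominus>\<^bsub>R\<^esub> ?i \<otimes>\<^bsub>R\<^esub> w) \<otimes>\<^bsub>R\<^esub> v)"
    using c i(2) v(1) by (simp add: R.m_ac)
  then show ?thesis using i v by (metis R.m_closed R.one_closed R.r_one)
qed

text \<open>This takes the place of cancellation in a domain: an element on which two distinct
  members of \<open>\<mu>\<close> act alike is killed by a unit.\<close>

lemma mu_smult_cancel:
  assumes "module R N" "z \<in> \<mu>" "w \<in> \<mu>" "z \<noteq> w" "x \<in> carrier N" "z \<odot>\<^bsub>N\<^esub> x = w \<odot>\<^bsub>N\<^esub> x"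
  shows "x = \<zero>\<^bsub>N\<^esub>"
proof -
  interpret N: module R N by fact
  have c: "z \<in> carrier R" "w \<in> carrier R" using assms by auto
  obtain v where v: "v \<in> carrier R" "v \<otimes>\<^bsub>R\<^esub> (z \<ominus>\<^bsub>R\<^esub> w) = \<one>\<^bsub>R\<^esub>"
    using mu_diff_unit[OF assms(2-4)] by blast
  have "(z \<ominus>\<^bsub>R\<^esub> w) \<odot>\<^bsub>N\<^esub> x = \<zero>\<^bsub>N\<^esub>"
    using c assms(5,6) by (simp add: R.minus_eq N.smult_l_distr N.smult_l_minus N.M.r_neg)
  then have "(v \<otimes>\<^bsub>R\<^esub> (z \<ominus>\<^bsub>R\<^esub> w)) \<odot>\<^bsub>N\<^esub> x = \<zero>\<^bsub>N\<^esub>"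
    using c v(1) assms(5) by (simp add: N.smult_assoc1)
  then show ?thesis using v(2) assms(5) by simp
qed

lemma mu_power_sum:
  assumes z: "z \<in> \<mu>"
  shows "(\<Oplus>\<^bsub>R\<^esub>i\<in>{..<p}. z [^]\<^bsub>R\<^esub> i) = (if z = \<one>\<^bsub>R\<^esub> then [p] \<cdot>\<^bsub>R\<^esub> \<one>\<^bsub>R\<^esub> else \<zero>\<^bsub>R\<^esub>)"
  using mu_sum_zero[OF z] R.add.finprod_const[OF R.one_closed, of "{..<p}"] by simp

lemma mu_character_bij:
  assumes "group G" "order G = p" "\<chi> \<in> hom G M\<mu>" "\<exists>g\<in>carrier G. \<chi> g \<noteq> \<one>\<^bsub>R\<^esub>"
  shows "bij_betw \<chi> (carrier G) \<mu>"
proof -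
  have inj: "inj_on \<chi> (carrier G)"
    using hom_inj_prime_order[OF assms(1) M_group assms(3)] assms(2,4) prime by (simp add: units_of_one)
  have "\<chi> ` carrier G \<subseteq> \<mu>" using assms(3) by (auto simp: hom_def)
  moreover have "card (\<chi> ` carrier G) = card \<mu>"
    using card_image[OF inj] assms(2) mu_card by (simp add: order_def)
  moreover have "finite \<mu>" using mu_card p_gt card.infinite by force
  ultimately have "\<chi> ` carrier G = \<mu>" by (simp add: card_subset_eq)
  then show ?thesis using inj by (simp add: bij_betw_def)
qed

lemma mu_character_exists:
  assumes "group G" "cyclic_group G" "order G = p"
  obtains \<chi> where "\<chi> \<in> hom G M\<mu>" "\<exists>g\<in>carrier G. \<chi> g \<noteq> \<one>\<^bsub>R\<^esub>"
proof -
  obtain h where h: "h \<in> iso (integer_mod_group p) G"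
    using cyclic_group_iso[OF assms] p_gt by blast
  obtain k where k: "k \<in> iso (integer_mod_group p) M\<mu>"
    using cyclic_group_iso[OF M_group mu_cyclic, of p] p_gt mu_card by (auto simp: order_def)
  have "inv_into (carrier (integer_mod_group p)) h \<in> iso G (integer_mod_group p)"
    using group.iso_set_sym[OF group_integer_mod_group h] .
  then have \<chi>: "k \<circ> inv_into (carrier (integer_mod_group p)) h \<in> iso G M\<mu>"
    using iso_set_trans[OF _ k] by blast
  obtain z where z: "z \<in> \<mu>" "z \<noteq> \<one>\<^bsub>R\<^esub>"
  proof -
    have "\<mu> \<noteq> {\<one>\<^bsub>R\<^esub>}" using mu_card p_gt by auto
    then show thesis using that mu_one by blast
  qed
  moreover have "z \<in> (k \<circ> inv_into (carrier (integer_mod_group p)) h) ` carrier G"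
    using \<chi> z(1) by (auto simp: iso_def bij_betw_def)
  ultimately show thesis using that[of "k \<circ> inv_into (carrier (integer_mod_group p)) h"] \<chi>
    by (auto simp: iso_def)
qed

end

section \<open>The eigenspace decomposition\<close>

text \<open>The nontrivial character is a parameter because the numbering of the eigenspaces depends
  on it; passing to another character renumbers them.\<close>

locale kummer_action = algebra_action R S G \<phi> + kummerian R p \<mu>
  for R :: "('r, 'k) ring_scheme" and S :: "('r, 's, 'x) module_scheme"
    and G :: "('g, 'y) monoid_scheme" and \<phi> :: "'g \<Rightarrow> 's \<Rightarrow> 's" and p :: nat and \<mu> :: "'r set" +
  fixes \<chi> :: "'g \<Rightarrow> 'r"
  assumes order_G: "order G = p" and chi_hom: "\<chi> \<in> hom G M\<mu>"
    and chi_nontrivial: "\<exists>g\<in>carrier G. \<chi> g \<noteq> \<one>\<^bsub>R\<^esub>"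
begin

lemma chi_bij: "bij_betw \<chi> (carrier G) \<mu>"
  by (rule mu_character_bij[OF G.group_axioms order_G chi_hom chi_nontrivial])

lemma chi_mu: "g \<in> carrier G \<Longrightarrow> \<chi> g \<in> \<mu>"
  using chi_bij by (auto simp: bij_betw_def)

lemma chi_closed [simp]: "g \<in> carrier G \<Longrightarrow> \<chi> g \<in> carrier R"
  using chi_mu by simp

lemma chi_mult: "g \<in> carrier G \<Longrightarrow> h \<in> carrier G \<Longrightarrow> \<chi> (g \<otimes>\<^bsub>G\<^esub> h) = \<chi> g \<otimes>\<^bsub>R\<^esub> \<chi> h"
  using hom_mult[OF chi_hom] by (simp add: units_of_mult)

lemma chi_one: "\<chi> \<one>\<^bsub>G\<^esub> = \<one>\<^bsub>R\<^esub>"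
  using hom_one[OF chi_hom G.group_axioms M_group] by (simp add: units_of_one)

lemma chi_eq_one_iff: "g \<in> carrier G \<Longrightarrow> \<chi> g = \<one>\<^bsub>R\<^esub> \<longleftrightarrow> g = \<one>\<^bsub>G\<^esub>"
  using inj_on_eq_iff[OF bij_betw_imp_inj_on[OF chi_bij], of g "\<one>\<^bsub>G\<^esub>"] by (simp add: chi_one)

lemma chi_mult_pow:
  "g \<in> carrier G \<Longrightarrow> h \<in> carrier G \<Longrightarrow>
    \<chi> (g \<otimes>\<^bsub>G\<^esub> h) [^]\<^bsub>R\<^esub> (n::nat) = \<chi> g [^]\<^bsub>R\<^esub> n \<otimes>\<^bsub>R\<^esub> \<chi> h [^]\<^bsub>R\<^esub> n"
  by (simp add: chi_mult R.nat_pow_distrib)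

lemma average_const:
  assumes "finite I" "card I = p" "s \<in> carrier S"
  shows "q \<odot>\<^bsub>S\<^esub> (\<Oplus>\<^bsub>S\<^esub>i\<in>I. s) = s"
proof -
  have "(\<Oplus>\<^bsub>S\<^esub>i\<in>I. s) = (\<Oplus>\<^bsub>S\<^esub>i\<in>I. \<one>\<^bsub>R\<^esub> \<odot>\<^bsub>S\<^esub> s)" using assms by simp
  also have "\<dots> = (\<Oplus>\<^bsub>R\<^esub>i\<in>I. \<one>\<^bsub>R\<^esub>) \<odot>\<^bsub>S\<^esub> s"
    using assms by (intro A.finsum_smult_rdistr[symmetric]) auto
  also have "(\<Oplus>\<^bsub>R\<^esub>i\<in>I. \<one>\<^bsub>R\<^esub>) = [p] \<cdot>\<^bsub>R\<^esub> \<one>\<^bsub>R\<^esub>"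
    using R.add.finprod_const[OF R.one_closed, of I] assms(2) by simp
  finally show ?thesis using assms(3) p_q(2) by (simp flip: A.smult_assoc1)
qed

text \<open>Translation by h multiplies the sum by \<chi>(h)^k and leaves it unchanged. This factor
  is an element of \<open>\<mu>\<close> other than 1, so \<open>mu_smult_cancel\<close>
  applies.\<close>

lemma character_sum_zero:
  assumes k: "\<not> p dvd k" and s: "s \<in> carrier S"
  shows "(\<Oplus>\<^bsub>S\<^esub>g\<in>carrier G. \<chi> g [^]\<^bsub>R\<^esub> (k::nat) \<odot>\<^bsub>S\<^esub> s) = \<zero>\<^bsub>S\<^esub>"
proof -
  obtain h where h: "h \<in> carrier G" "\<chi> h \<noteq> \<one>\<^bsub>R\<^esub>" using chi_nontrivial by blast
  define t where "t = (\<Oplus>\<^bsub>S\<^esub>g\<in>carrier G. \<chi> g [^]\<^bsub>R\<^esub> k \<odot>\<^bsub>S\<^esub> s)"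
  have t: "t \<in> carrier S" unfolding t_def using s by (intro S.finsum_closed) auto
  have "\<chi> h [^]\<^bsub>R\<^esub> k \<odot>\<^bsub>S\<^esub> t = (\<Oplus>\<^bsub>S\<^esub>g\<in>carrier G. \<chi> h [^]\<^bsub>R\<^esub> k \<odot>\<^bsub>S\<^esub> (\<chi> g [^]\<^bsub>R\<^esub> k \<odot>\<^bsub>S\<^esub> s))"
    unfolding t_def using s h finite_group by (intro A.finsum_smult_ldistr) auto
  also have "\<dots> = (\<Oplus>\<^bsub>S\<^esub>g\<in>carrier G. \<chi> (h \<otimes>\<^bsub>G\<^esub> g) [^]\<^bsub>R\<^esub> k \<odot>\<^bsub>S\<^esub> s)"
    using s h by (intro S.add.finprod_cong') (auto simp: chi_mult_pow A.smult_assoc1)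
  also have "\<dots> = t" unfolding t_def using s by (intro finsum_translate[OF h(1)]) auto
  finally have "\<chi> h [^]\<^bsub>R\<^esub> k \<odot>\<^bsub>S\<^esub> t = \<one>\<^bsub>R\<^esub> \<odot>\<^bsub>S\<^esub> t" using t by simp
  then show ?thesis
    unfolding t_def[symmetric]
    using mu_smult_cancel[OF A.module mu_pow[OF chi_mu[OF h(1)]] mu_one _ t]
      mu_pow_neq_one[OF chi_mu[OF h(1)] h(2) k] by blast
qed

section \<open>Eigenspaces and the projections onto them\<close>

definition eig :: "nat \<Rightarrow> 's set"
  where "eig n = {s \<in> carrier S. \<forall>g\<in>carrier G. \<phi> g s = \<chi> g [^]\<^bsub>R\<^esub> n \<odot>\<^bsub>S\<^esub> s}"

text \<open>The character is not inverted, so \<open>proj m\<close> projects onto the eigenspace of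
  index -m: onto \<open>eig n\<close> when p divides m + n. All exponents stay natural
  numbers.\<close>

definition proj :: "nat \<Rightarrow> 's \<Rightarrow> 's"
  where "proj m s = q \<odot>\<^bsub>S\<^esub> (\<Oplus>\<^bsub>S\<^esub>g\<in>carrier G. \<chi> g [^]\<^bsub>R\<^esub> m \<odot>\<^bsub>S\<^esub> \<phi> g s)"

lemma eig_closed: "s \<in> eig n \<Longrightarrow> s \<in> carrier S"
  by (simp add: eig_def)

lemma eigD: "s \<in> eig n \<Longrightarrow> g \<in> carrier G \<Longrightarrow> \<phi> g s = \<chi> g [^]\<^bsub>R\<^esub> n \<odot>\<^bsub>S\<^esub> s"
  by (simp add: eig_def)

lemma chi_pow_mod: "g \<in> carrier G \<Longrightarrow> \<chi> g [^]\<^bsub>R\<^esub> (n::nat) = \<chi> g [^]\<^bsub>R\<^esub> (n mod p)"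
proof -
  assume g: "g \<in> carrier G"
  have "\<chi> g [^]\<^bsub>R\<^esub> n = \<chi> g [^]\<^bsub>R\<^esub> (p * (n div p) + n mod p)" by simp
  also have "\<dots> = \<chi> g [^]\<^bsub>R\<^esub> (p * (n div p)) \<otimes>\<^bsub>R\<^esub> \<chi> g [^]\<^bsub>R\<^esub> (n mod p)"
    using g by (simp only: R.nat_pow_mult chi_closed)
  finally show ?thesis using g mu_pow_p_mult[OF chi_mu[OF g], of "p * (n div p)"] by simp
qed

lemma eig_mod: "eig n = eig (n mod p)"
  unfolding eig_def by (intro Collect_cong conj_cong ball_cong refl) (simp add: chi_pow_mod[of _ n])

lemma smult_swap:
  "a \<in> carrier R \<Longrightarrow> b \<in> carrier R \<Longrightarrow> x \<in> carrier S \<Longrightarrow> a \<odot>\<^bsub>S\<^esub> (b \<odot>\<^bsub>S\<^esub> x) = b \<odot>\<^bsub>S\<^esub> (a \<odot>\<^bsub>S\<^esub> x)"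
  using A.smult_assoc1[of a b x] A.smult_assoc1[of b a x] by (simp add: R.m_comm)

lemma eig_submodule: "submodule (eig n) R S"
proof (rule A.submoduleI)
  show "\<ominus>\<^bsub>S\<^esub> a \<in> eig n" if "a \<in> eig n" for a
  proof -
    have a: "a \<in> carrier S" using that by (rule eig_closed)
    have "\<phi> g (\<ominus>\<^bsub>S\<^esub> a) = \<chi> g [^]\<^bsub>R\<^esub> n \<odot>\<^bsub>S\<^esub> (\<ominus>\<^bsub>S\<^esub> a)" if g: "g \<in> carrier G" for g
    proof -
      have m: "(\<ominus>\<^bsub>R\<^esub> \<one>\<^bsub>R\<^esub>) \<odot>\<^bsub>S\<^esub> b = \<ominus>\<^bsub>S\<^esub> b" if "b \<in> carrier S" for b
        using that by (simp add: A.smult_l_minus)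
      have "\<phi> g (\<ominus>\<^bsub>S\<^esub> a) = (\<ominus>\<^bsub>R\<^esub> \<one>\<^bsub>R\<^esub>) \<odot>\<^bsub>S\<^esub> \<phi> g a"
        using action_simps(5)[OF g, of "\<ominus>\<^bsub>R\<^esub> \<one>\<^bsub>R\<^esub>" a] a m by simp
      then show ?thesis using eigD[OF \<open>a \<in> eig n\<close> g] a g m by (simp add: A.smult_r_minus)
    qed
    then show ?thesis using a by (simp add: eig_def)
  qed
  show "r \<odot>\<^bsub>S\<^esub> x \<in> eig n" if "r \<in> carrier R" "x \<in> eig n" for r x
  proof -
    have c: "x \<in> carrier S" using that(2) by (rule eig_closed)
    have "\<phi> g (r \<odot>\<^bsub>S\<^esub> x) = \<chi> g [^]\<^bsub>R\<^esub> n \<odot>\<^bsub>S\<^esub> (r \<odot>\<^bsub>S\<^esub> x)" if g: "g \<in> carrier G" for g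
      using c g \<open>r \<in> carrier R\<close> eigD[OF \<open>x \<in> eig n\<close> g]
      by (simp add: action_simps(5)[OF g] smult_swap)
    then show ?thesis using c \<open>r \<in> carrier R\<close> by (simp add: eig_def)
  qed
  show "\<zero>\<^bsub>S\<^esub> \<in> eig n"
    by (simp add: eig_def module_hom_zero[OF A.module A.module action_hom])
  show "a \<oplus>\<^bsub>S\<^esub> b \<in> eig n" if "a \<in> eig n" "b \<in> eig n" for a b
    using that by (simp add: eig_def action_simps(3) A.smult_r_distr)
qed (simp add: eig_def)

lemma eig_mult:
  assumes "s \<in> eig m" "t \<in> eig n"
  shows "s \<otimes>\<^bsub>S\<^esub> t \<in> eig (m + n)"
proof -
  note c = eig_closed[OF assms(1)] eig_closed[OF assms(2)]
  have "\<phi> g (s \<otimes>\<^bsub>S\<^esub> t) = \<chi> g [^]\<^bsub>R\<^esub> (m + n) \<odot>\<^bsub>S\<^esub> (s \<otimes>\<^bsub>S\<^esub> t)" if g: "g \<in> carrier G" for g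
  proof -
    have "\<phi> g (s \<otimes>\<^bsub>S\<^esub> t) = (\<chi> g [^]\<^bsub>R\<^esub> m \<odot>\<^bsub>S\<^esub> s) \<otimes>\<^bsub>S\<^esub> (\<chi> g [^]\<^bsub>R\<^esub> n \<odot>\<^bsub>S\<^esub> t)"
      using c by (simp add: action_simps(2)[OF g] eigD[OF assms(1) g] eigD[OF assms(2) g])
    also have "\<dots> = \<iota> (\<chi> g [^]\<^bsub>R\<^esub> m) \<otimes>\<^bsub>S\<^esub> \<iota> (\<chi> g [^]\<^bsub>R\<^esub> n) \<otimes>\<^bsub>S\<^esub> (s \<otimes>\<^bsub>S\<^esub> t)"
      using c g by (simp add: smult_iota S.m_ac)
    also have "\<iota> (\<chi> g [^]\<^bsub>R\<^esub> m) \<otimes>\<^bsub>S\<^esub> \<iota> (\<chi> g [^]\<^bsub>R\<^esub> n) = \<iota> (\<chi> g [^]\<^bsub>R\<^esub> (m + n))"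
      using g by (simp add: ring_hom_mult[OF iota_hom, symmetric] R.nat_pow_mult)
    finally show ?thesis using c g by (simp add: smult_iota)
  qed
  then show ?thesis using c by (simp add: eig_def)
qed

lemma eig_zero: "eig 0 = \<iota> ` carrier R"
  unfolding eig_def fixed_ring[symmetric] by auto

lemma eig_dvd: "p dvd n \<Longrightarrow> eig n = \<iota> ` carrier R"
  using eig_mod[of n] by (simp add: eig_zero)

lemma eig_pow: "s \<in> eig 1 \<Longrightarrow> s [^]\<^bsub>S\<^esub> (n::nat) \<in> eig n"
proof (induction n)
  case 0
  show ?case by (auto simp: eig_def action_simps(4))
next
  case (Suc n)
  then show ?case using eig_mult[of "s [^]\<^bsub>S\<^esub> n" n s 1] by simp
qed

lemma proj_terms: "s \<in> carrier S \<Longrightarrow> g \<in> carrier G \<Longrightarrow> \<chi> g [^]\<^bsub>R\<^esub> (m::nat) \<odot>\<^bsub>S\<^esub> \<phi> g s \<in> carrier S"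
  using action_simps(1) by auto

lemma proj_closed: "s \<in> carrier S \<Longrightarrow> proj m s \<in> carrier S"
  unfolding proj_def using proj_terms by (intro A.smult_closed S.finsum_closed) auto

text \<open>A translation of the sum by h shows that \<chi>(h)^m h(P) = P for the projection P.
  Multiplying by \<chi>(h)^n, the inverse of \<chi>(h)^m, gives the eigenvector law.\<close>

lemma proj_in_eig:
  assumes s: "s \<in> carrier S" and mn: "p dvd m + n"
  shows "proj m s \<in> eig n"
proof -
  have P: "proj m s \<in> carrier S" using s by (rule proj_closed)
  have "\<phi> h (proj m s) = \<chi> h [^]\<^bsub>R\<^esub> n \<odot>\<^bsub>S\<^esub> proj m s" if h: "h \<in> carrier G" for h
  proof -
    have cl: "(\<lambda>g. \<chi> g [^]\<^bsub>R\<^esub> m \<odot>\<^bsub>S\<^esub> \<phi> (h \<otimes>\<^bsub>G\<^esub> g) s) \<in> carrier G \<rightarrow> carrier S"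
      using h s action_simps(1) by auto
    have "\<phi> h (proj m s) = q \<odot>\<^bsub>S\<^esub> (\<Oplus>\<^bsub>S\<^esub>g\<in>carrier G. \<phi> h (\<chi> g [^]\<^bsub>R\<^esub> m \<odot>\<^bsub>S\<^esub> \<phi> g s))"
      unfolding proj_def using proj_terms[OF s] h
      by (simp add: action_simps(5)[OF h] S.finsum_closed action_finsum Pi_def)
    also have "(\<Oplus>\<^bsub>S\<^esub>g\<in>carrier G. \<phi> h (\<chi> g [^]\<^bsub>R\<^esub> m \<odot>\<^bsub>S\<^esub> \<phi> g s)) =
      (\<Oplus>\<^bsub>S\<^esub>g\<in>carrier G. \<chi> g [^]\<^bsub>R\<^esub> m \<odot>\<^bsub>S\<^esub> \<phi> (h \<otimes>\<^bsub>G\<^esub> g) s)"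
      using h s action_simps(1) cl
      by (intro S.add.finprod_cong') (auto simp: action_simps(5)[OF h] action_comp)
    finally have 1: "\<phi> h (proj m s) = q \<odot>\<^bsub>S\<^esub> (\<Oplus>\<^bsub>S\<^esub>g\<in>carrier G. \<chi> g [^]\<^bsub>R\<^esub> m \<odot>\<^bsub>S\<^esub> \<phi> (h \<otimes>\<^bsub>G\<^esub> g) s)" .
    have "\<chi> h [^]\<^bsub>R\<^esub> m \<odot>\<^bsub>S\<^esub> \<phi> h (proj m s) =
      q \<odot>\<^bsub>S\<^esub> (\<chi> h [^]\<^bsub>R\<^esub> m \<odot>\<^bsub>S\<^esub> (\<Oplus>\<^bsub>S\<^esub>g\<in>carrier G. \<chi> g [^]\<^bsub>R\<^esub> m \<odot>\<^bsub>S\<^esub> \<phi> (h \<otimes>\<^bsub>G\<^esub> g) s))"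
      unfolding 1 using h cl by (intro smult_swap) (auto intro: S.finsum_closed)
    also have "\<chi> h [^]\<^bsub>R\<^esub> m \<odot>\<^bsub>S\<^esub> (\<Oplus>\<^bsub>S\<^esub>g\<in>carrier G. \<chi> g [^]\<^bsub>R\<^esub> m \<odot>\<^bsub>S\<^esub> \<phi> (h \<otimes>\<^bsub>G\<^esub> g) s) =
      (\<Oplus>\<^bsub>S\<^esub>g\<in>carrier G. \<chi> h [^]\<^bsub>R\<^esub> m \<odot>\<^bsub>S\<^esub> (\<chi> g [^]\<^bsub>R\<^esub> m \<odot>\<^bsub>S\<^esub> \<phi> (h \<otimes>\<^bsub>G\<^esub> g) s))"
      using h cl finite_group by (intro A.finsum_smult_ldistr) auto
    also have "\<dots> = (\<Oplus>\<^bsub>S\<^esub>g\<in>carrier G. \<chi> (h \<otimes>\<^bsub>G\<^esub> g) [^]\<^bsub>R\<^esub> m \<odot>\<^bsub>S\<^esub> \<phi> (h \<otimes>\<^bsub>G\<^esub> g) s)"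
      using h s action_simps(1) by (intro S.add.finprod_cong') (auto simp: chi_mult_pow A.smult_assoc1)
    also have "\<dots> = (\<Oplus>\<^bsub>S\<^esub>g\<in>carrier G. \<chi> g [^]\<^bsub>R\<^esub> m \<odot>\<^bsub>S\<^esub> \<phi> g s)"
      using proj_terms[OF s] by (intro finsum_translate[OF h]) auto
    finally have 2: "\<chi> h [^]\<^bsub>R\<^esub> m \<odot>\<^bsub>S\<^esub> \<phi> h (proj m s) = proj m s" unfolding proj_def .
    have hP: "\<phi> h (proj m s) \<in> carrier S" using action_simps(1)[OF h P] .
    have "\<chi> h [^]\<^bsub>R\<^esub> n \<otimes>\<^bsub>R\<^esub> \<chi> h [^]\<^bsub>R\<^esub> m = \<one>\<^bsub>R\<^esub>"
      using mu_pow_p_mult[OF chi_mu[OF h], of "n + m"] mn h by (simp add: R.nat_pow_mult add.commute)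
    then have "\<phi> h (proj m s) = (\<chi> h [^]\<^bsub>R\<^esub> n \<otimes>\<^bsub>R\<^esub> \<chi> h [^]\<^bsub>R\<^esub> m) \<odot>\<^bsub>S\<^esub> \<phi> h (proj m s)"
      using hP by simp
    also have "\<dots> = \<chi> h [^]\<^bsub>R\<^esub> n \<odot>\<^bsub>S\<^esub> proj m s" using hP h 2 by (simp add: A.smult_assoc1)
    finally show ?thesis .
  qed
  then show ?thesis using P by (simp add: eig_def)
qed

text \<open>Orthogonality of characters: the average of \<chi>^(m+n) over the group is 1 or
  0.\<close>

lemma proj_eig:
  assumes s: "s \<in> eig n"
  shows "proj m s = (if p dvd m + n then s else \<zero>\<^bsub>S\<^esub>)"
proof -
  have c: "s \<in> carrier S" using s by (rule eig_closed)
  have "proj m s = q \<odot>\<^bsub>S\<^esub> (\<Oplus>\<^bsub>S\<^esub>g\<in>carrier G. \<chi> g [^]\<^bsub>R\<^esub> (m + n) \<odot>\<^bsub>S\<^esub> s)"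
    unfolding proj_def using c
    by (intro arg_cong[where f = "\<lambda>x. q \<odot>\<^bsub>S\<^esub> x"] S.add.finprod_cong')
      (auto simp: eigD[OF s] R.nat_pow_mult simp flip: A.smult_assoc1)
  also have "\<dots> = (if p dvd m + n then s else \<zero>\<^bsub>S\<^esub>)"
  proof (cases "p dvd m + n")
    case True
    have "(\<Oplus>\<^bsub>S\<^esub>g\<in>carrier G. \<chi> g [^]\<^bsub>R\<^esub> (m + n) \<odot>\<^bsub>S\<^esub> s) = (\<Oplus>\<^bsub>S\<^esub>g\<in>carrier G. s)"
      using c mu_pow_p_mult[OF chi_mu True] by (intro S.add.finprod_cong') auto
    then show ?thesis using average_const[OF finite_group _ c] order_G True by (simp add: order_def)
  next
    case False
    then show ?thesis using character_sum_zero[OF False c] by simp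
  qed
  finally show ?thesis .
qed

lemma proj_hom: "proj m \<in> module_hom R S S"
proof -
  have "(\<lambda>s. \<Oplus>\<^bsub>S\<^esub>g\<in>carrier G. \<chi> g [^]\<^bsub>R\<^esub> m \<odot>\<^bsub>S\<^esub> \<phi> g s) \<in> module_hom R S S"
  proof (rule module_hom_finsum_fun[OF A.module A.module])
    fix g assume g: "g \<in> carrier G"
    show "(\<lambda>s. \<chi> g [^]\<^bsub>R\<^esub> m \<odot>\<^bsub>S\<^esub> \<phi> g s) \<in> module_hom R S S"
      using g action_simps(1)[OF g] action_simps(3,5)[OF g]
      by (intro module_homI) (simp_all add: A.smult_r_distr smult_swap)
  qed
  note h = module_homD[OF this]
  show ?thesis
    unfolding proj_def using h
    by (intro module_homI) (simp_all add: A.smult_r_distr smult_swap)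
qed

text \<open>The dual orthogonality relation: for fixed g the sum of \<chi>(g)^m over m < p is p at
  the identity and 0 elsewhere.\<close>

lemma proj_sum:
  assumes s: "s \<in> carrier S"
  shows "(\<Oplus>\<^bsub>S\<^esub>m\<in>{..<p}. proj m s) = s"
proof -
  note t = proj_terms[OF s]
  have "(\<Oplus>\<^bsub>S\<^esub>m\<in>{..<p}. proj m s) =
    q \<odot>\<^bsub>S\<^esub> (\<Oplus>\<^bsub>S\<^esub>m\<in>{..<p}. \<Oplus>\<^bsub>S\<^esub>g\<in>carrier G. \<chi> g [^]\<^bsub>R\<^esub> m \<odot>\<^bsub>S\<^esub> \<phi> g s)"
    unfolding proj_def using t by (intro A.finsum_smult_ldistr[symmetric] funcsetI S.finsum_closed) auto
  also have "(\<Oplus>\<^bsub>S\<^esub>m\<in>{..<p}. \<Oplus>\<^bsub>S\<^esub>g\<in>carrier G. \<chi> g [^]\<^bsub>R\<^esub> m \<odot>\<^bsub>S\<^esub> \<phi> g s) =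
    (\<Oplus>\<^bsub>S\<^esub>g\<in>carrier G. \<Oplus>\<^bsub>S\<^esub>m\<in>{..<p}. \<chi> g [^]\<^bsub>R\<^esub> m \<odot>\<^bsub>S\<^esub> \<phi> g s)"
    using t finite_group by (intro S.finsum_swap) auto
  also have "\<dots> = (\<Oplus>\<^bsub>S\<^esub>g\<in>carrier G. if \<one>\<^bsub>G\<^esub> = g then ([p] \<cdot>\<^bsub>R\<^esub> \<one>\<^bsub>R\<^esub>) \<odot>\<^bsub>S\<^esub> s else \<zero>\<^bsub>S\<^esub>)"
  proof (intro S.add.finprod_cong' refl)
    fix g assume g: "g \<in> carrier G"
    have "(\<Oplus>\<^bsub>S\<^esub>m\<in>{..<p}. \<chi> g [^]\<^bsub>R\<^esub> m \<odot>\<^bsub>S\<^esub> \<phi> g s) = (\<Oplus>\<^bsub>R\<^esub>m\<in>{..<p}. \<chi> g [^]\<^bsub>R\<^esub> m) \<odot>\<^bsub>S\<^esub> \<phi> g s"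
      using g s action_simps(1) by (intro A.finsum_smult_rdistr[symmetric]) auto
    then show "(\<Oplus>\<^bsub>S\<^esub>m\<in>{..<p}. \<chi> g [^]\<^bsub>R\<^esub> m \<odot>\<^bsub>S\<^esub> \<phi> g s) =
      (if \<one>\<^bsub>G\<^esub> = g then ([p] \<cdot>\<^bsub>R\<^esub> \<one>\<^bsub>R\<^esub>) \<odot>\<^bsub>S\<^esub> s else \<zero>\<^bsub>S\<^esub>)"
      using mu_power_sum[OF chi_mu[OF g]] chi_eq_one_iff[OF g] action_simps(1)[OF g s] s
      by (auto simp: action_one)
  qed (use s in auto)
  also have "\<dots> = ([p] \<cdot>\<^bsub>R\<^esub> \<one>\<^bsub>R\<^esub>) \<odot>\<^bsub>S\<^esub> s"
    using finite_group s by (intro S.add.finprod_singleton) auto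
  finally show ?thesis using s p_q(2) by (simp flip: A.smult_assoc1)
qed

text \<open>As g(a) = \<chi>(g)^n a, pulling a out of the average raises the exponent from 0 to
  n.\<close>

lemma proj_zero_mult:
  assumes a: "a \<in> eig n" and y: "y \<in> carrier S"
  shows "proj 0 (a \<otimes>\<^bsub>S\<^esub> y) = a \<otimes>\<^bsub>S\<^esub> proj n y"
proof -
  have c: "a \<in> carrier S" using a by (rule eig_closed)
  have "a \<otimes>\<^bsub>S\<^esub> proj n y = q \<odot>\<^bsub>S\<^esub> (a \<otimes>\<^bsub>S\<^esub> (\<Oplus>\<^bsub>S\<^esub>g\<in>carrier G. \<chi> g [^]\<^bsub>R\<^esub> n \<odot>\<^bsub>S\<^esub> \<phi> g y))"
    unfolding proj_def using c proj_terms[OF y]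
    by (simp add: smult_iota S.finsum_closed S.m_lcomm Pi_def)
  also have "a \<otimes>\<^bsub>S\<^esub> (\<Oplus>\<^bsub>S\<^esub>g\<in>carrier G. \<chi> g [^]\<^bsub>R\<^esub> n \<odot>\<^bsub>S\<^esub> \<phi> g y) =
    (\<Oplus>\<^bsub>S\<^esub>g\<in>carrier G. a \<otimes>\<^bsub>S\<^esub> (\<chi> g [^]\<^bsub>R\<^esub> n \<odot>\<^bsub>S\<^esub> \<phi> g y))"
    using c proj_terms[OF y] finite_group by (intro S.finsum_rdistr) auto
  also have "\<dots> = (\<Oplus>\<^bsub>S\<^esub>g\<in>carrier G. \<chi> g [^]\<^bsub>R\<^esub> (0::nat) \<odot>\<^bsub>S\<^esub> \<phi> g (a \<otimes>\<^bsub>S\<^esub> y))"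
  proof (intro S.add.finprod_cong' refl)
    fix g assume g: "g \<in> carrier G"
    show "a \<otimes>\<^bsub>S\<^esub> (\<chi> g [^]\<^bsub>R\<^esub> n \<odot>\<^bsub>S\<^esub> \<phi> g y) = \<chi> g [^]\<^bsub>R\<^esub> (0::nat) \<odot>\<^bsub>S\<^esub> \<phi> g (a \<otimes>\<^bsub>S\<^esub> y)"
      using c y g action_simps(1)[OF g y] eigD[OF a g]
      by (simp add: action_simps(2)[OF g] smult_iota[of "\<chi> g [^]\<^bsub>R\<^esub> n"] S.m_ac)
  qed (use proj_terms[of "a \<otimes>\<^bsub>S\<^esub> y" _ 0] c y in auto)
  finally show ?thesis unfolding proj_def by simp
qed

text \<open>Galois coordinates are projected to opposite eigenspaces. The identity obtained says
  that the pairing of \<open>eig m\<close> with \<open>eig n\<close> into \<open>R\<close> reaches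
  1, which is the source of all dual bases of eigenspaces and of the invertibility of a
  generator.\<close>

lemma eig_coordinates:
  assumes coords: "galois_coordinates Z x y" and mn: "p dvd m + n"
  obtains a b where "\<And>z. z \<in> Z \<Longrightarrow> a z \<in> eig m" "\<And>z. z \<in> Z \<Longrightarrow> b z \<in> eig n"
    "(\<Oplus>\<^bsub>S\<^esub>z\<in>Z. a z \<otimes>\<^bsub>S\<^esub> b z) = \<one>\<^bsub>S\<^esub>"
proof -
  note xy = coordsD(2,3)[OF coords] and fin = coordsD(1)[OF coords]
  define a where "a z = proj n (x z)" for z
  define b where "b z = proj m (y z)" for z
  have a: "a z \<in> eig m" if "z \<in> Z" for z
    unfolding a_def using mn xy that by (intro proj_in_eig) (auto simp: add.commute)
  have b: "b z \<in> eig n" if "z \<in> Z" for z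
    unfolding b_def using mn xy that by (intro proj_in_eig) auto
  note ac = eig_closed[OF a] and bc = eig_closed[OF b]
  have "(\<Oplus>\<^bsub>S\<^esub>z\<in>Z. a z \<otimes>\<^bsub>S\<^esub> y z) =
    (\<Oplus>\<^bsub>S\<^esub>z\<in>Z. \<Oplus>\<^bsub>S\<^esub>g\<in>carrier G. (q \<otimes>\<^bsub>R\<^esub> \<chi> g [^]\<^bsub>R\<^esub> n) \<odot>\<^bsub>S\<^esub> (\<phi> g (x z) \<otimes>\<^bsub>S\<^esub> y z))"
  proof (intro S.add.finprod_cong' refl)
    fix z assume z: "z \<in> Z"
    have "a z \<otimes>\<^bsub>S\<^esub> y z = (\<Oplus>\<^bsub>S\<^esub>g\<in>carrier G. q \<odot>\<^bsub>S\<^esub> (\<chi> g [^]\<^bsub>R\<^esub> n \<odot>\<^bsub>S\<^esub> \<phi> g (x z))) \<otimes>\<^bsub>S\<^esub> y z"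
      unfolding a_def proj_def using proj_terms[OF xy(1)[OF z]] finite_group
      by (subst A.finsum_smult_ldistr) auto
    also have "\<dots> = (\<Oplus>\<^bsub>S\<^esub>g\<in>carrier G. q \<odot>\<^bsub>S\<^esub> (\<chi> g [^]\<^bsub>R\<^esub> n \<odot>\<^bsub>S\<^esub> \<phi> g (x z)) \<otimes>\<^bsub>S\<^esub> y z)"
      using proj_terms[OF xy(1)[OF z]] finite_group xy[OF z] by (intro S.finsum_ldistr) auto
    also have "\<dots> = (\<Oplus>\<^bsub>S\<^esub>g\<in>carrier G. (q \<otimes>\<^bsub>R\<^esub> \<chi> g [^]\<^bsub>R\<^esub> n) \<odot>\<^bsub>S\<^esub> (\<phi> g (x z) \<otimes>\<^bsub>S\<^esub> y z))"
      using action_simps(1) xy[OF z]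
      by (intro S.add.finprod_cong') (auto simp: A.smult_assoc1 A.smult_assoc2)
    finally show "a z \<otimes>\<^bsub>S\<^esub> y z =
      (\<Oplus>\<^bsub>S\<^esub>g\<in>carrier G. (q \<otimes>\<^bsub>R\<^esub> \<chi> g [^]\<^bsub>R\<^esub> n) \<odot>\<^bsub>S\<^esub> (\<phi> g (x z) \<otimes>\<^bsub>S\<^esub> y z))" .
  qed (use action_simps(1) xy in \<open>auto intro!: S.finsum_closed\<close>)
  also have "\<dots> = (\<Oplus>\<^bsub>S\<^esub>g\<in>carrier G. \<Oplus>\<^bsub>S\<^esub>z\<in>Z. (q \<otimes>\<^bsub>R\<^esub> \<chi> g [^]\<^bsub>R\<^esub> n) \<odot>\<^bsub>S\<^esub> (\<phi> g (x z) \<otimes>\<^bsub>S\<^esub> y z))"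
    using fin finite_group action_simps(1) xy by (intro S.finsum_swap) auto
  \<comment> \<open>By \<open>coords_flip\<close> only the identity of the group contributes, with
    the weight 1/p of the average.\<close>
  also have "\<dots> = (\<Oplus>\<^bsub>S\<^esub>g\<in>carrier G. if \<one>\<^bsub>G\<^esub> = g then \<iota> q else \<zero>\<^bsub>S\<^esub>)"
  proof (intro S.add.finprod_cong' refl)
    fix g assume g: "g \<in> carrier G"
    have "(\<Oplus>\<^bsub>S\<^esub>z\<in>Z. (q \<otimes>\<^bsub>R\<^esub> \<chi> g [^]\<^bsub>R\<^esub> n) \<odot>\<^bsub>S\<^esub> (\<phi> g (x z) \<otimes>\<^bsub>S\<^esub> y z)) =
      (q \<otimes>\<^bsub>R\<^esub> \<chi> g [^]\<^bsub>R\<^esub> n) \<odot>\<^bsub>S\<^esub> (\<Oplus>\<^bsub>S\<^esub>z\<in>Z. \<phi> g (x z) \<otimes>\<^bsub>S\<^esub> y z)"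
      using fin g action_simps(1) xy by (intro A.finsum_smult_ldistr[symmetric]) auto
    then show "(\<Oplus>\<^bsub>S\<^esub>z\<in>Z. (q \<otimes>\<^bsub>R\<^esub> \<chi> g [^]\<^bsub>R\<^esub> n) \<odot>\<^bsub>S\<^esub> (\<phi> g (x z) \<otimes>\<^bsub>S\<^esub> y z)) =
      (if \<one>\<^bsub>G\<^esub> = g then \<iota> q else \<zero>\<^bsub>S\<^esub>)"
      using coords_flip[OF coords g] g by (auto simp: chi_one structure_map_def)
  qed auto
  also have "\<dots> = \<iota> q" using finite_group by (intro S.add.finprod_singleton) auto
  finally have ay: "(\<Oplus>\<^bsub>S\<^esub>z\<in>Z. a z \<otimes>\<^bsub>S\<^esub> y z) = \<iota> q" .
  \<comment> \<open>The constant 1/p is invariant. Applying \<open>proj 0\<close> to its expansion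
    replaces each y_z by the component b_z, since a_z is already an eigenvector.\<close>
  have "\<iota> q = proj 0 (\<iota> q)" using proj_eig[of "\<iota> q" 0 0] eig_zero by simp
  also have "\<dots> = (\<Oplus>\<^bsub>S\<^esub>z\<in>Z. proj 0 (a z \<otimes>\<^bsub>S\<^esub> y z))"
    unfolding ay[symmetric] using ac xy by (intro module_hom_finsum[OF A.module A.module proj_hom]) auto
  also have "\<dots> = (\<Oplus>\<^bsub>S\<^esub>z\<in>Z. a z \<otimes>\<^bsub>S\<^esub> b z)"
    unfolding b_def using ac xy proj_closed
    by (intro S.add.finprod_cong') (auto simp: proj_zero_mult[OF a])
  finally have ab: "(\<Oplus>\<^bsub>S\<^esub>z\<in>Z. a z \<otimes>\<^bsub>S\<^esub> b z) = \<iota> q" by simp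
  have pc: "[p] \<cdot>\<^bsub>R\<^esub> \<one>\<^bsub>R\<^esub> \<in> carrier R" by simp
  \<comment> \<open>Rescaling the left elements by p turns 1/p into 1 without leaving the
    eigenspace.\<close>
  have "(\<Oplus>\<^bsub>S\<^esub>z\<in>Z. (([p] \<cdot>\<^bsub>R\<^esub> \<one>\<^bsub>R\<^esub>) \<odot>\<^bsub>S\<^esub> a z) \<otimes>\<^bsub>S\<^esub> b z) =
    (\<Oplus>\<^bsub>S\<^esub>z\<in>Z. ([p] \<cdot>\<^bsub>R\<^esub> \<one>\<^bsub>R\<^esub>) \<odot>\<^bsub>S\<^esub> (a z \<otimes>\<^bsub>S\<^esub> b z))"
    using ac bc pc by (intro S.add.finprod_cong') (auto simp: A.smult_assoc2)
  also have "\<dots> = ([p] \<cdot>\<^bsub>R\<^esub> \<one>\<^bsub>R\<^esub>) \<odot>\<^bsub>S\<^esub> \<iota> q"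
    unfolding ab[symmetric] using fin ac bc pc by (intro A.finsum_smult_ldistr[symmetric]) auto
  also have "\<dots> = \<one>\<^bsub>S\<^esub>"
    using pc p_q(1) by (simp add: structure_map_def flip: A.smult_assoc1)
  finally show thesis
    using that[of "\<lambda>z. ([p] \<cdot>\<^bsub>R\<^esub> \<one>\<^bsub>R\<^esub>) \<odot>\<^bsub>S\<^esub> a z" b] a b pc A.submoduleE(4)[OF eig_submodule] by blast
qed

end

section \<open>Primitive elements\<close>

lemma (in cring) regular_module_module: "module R (regular_module R)"
proof -
  have "abelian_group (regular_module R)"
    by (rule abelian_groupI) (auto simp: regular_module_def a_ac r_neg intro!: bexI[of _ "\<ominus> _"])
  then show ?thesis
    by (intro moduleI) (auto simp: regular_module_def is_cring l_distr r_distr m_assoc)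
qed

lemma Pic_class_cong:
  assumes "module R M" "module_isomorphic R M M'"
  shows "Pic_class R M = Pic_class R M'"
  unfolding Pic_class_def
proof (intro Collect_cong conj_cong refl)
  fix L :: "('a, 'a list) module"
  show "module_isomorphic R L M \<longleftrightarrow> module_isomorphic R L M'"
    using module_isomorphic_trans[OF _ assms(2), of L]
      module_isomorphic_trans[OF _ module_isomorphic_sym[OF assms], of L] by blast
qed

section \<open>Eigenspaces as invertible modules\<close>

context kummer_action
begin

abbreviation "En n \<equiv> S\<lparr>carrier := eig n\<rparr>"

lemma En_module: "module R (En n)"
  by (rule submodule.submodule_is_module[OF eig_submodule A.module])

lemma En_incl: "(\<lambda>x. x) \<in> module_hom R (En n) S"
  by (rule module_homI) (auto simp: eig_closed)

lemma En_finsum: "f \<in> I \<rightarrow> eig n \<Longrightarrow> (\<Oplus>\<^bsub>En n\<^esub>i\<in>I. f i) = (\<Oplus>\<^bsub>S\<^esub>i\<in>I. f i)"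
  using module_hom_finsum[OF En_module A.module En_incl, of f I n] by simp

lemma eig_smult: "r \<in> carrier R \<Longrightarrow> s \<in> eig n \<Longrightarrow> r \<odot>\<^bsub>S\<^esub> s \<in> eig n"
  by (rule A.submoduleE(4)[OF eig_submodule])

lemma eig_mult': "s \<in> eig m \<Longrightarrow> t \<in> eig n \<Longrightarrow> (m + n) mod p = k mod p \<Longrightarrow> s \<otimes>\<^bsub>S\<^esub> t \<in> eig k"
  using eig_mult[of s m t n] eig_mod[of k] eig_mod[of "m + n"] by simp

text \<open>The natural number n (p - 1) stands for -n modulo p.\<close>

lemma dual_index: "(n + n * (p - 1)) mod p = 0" "p dvd n + n * (p - 1)"
proof -
  have "n + n * (p - 1) = n * p" using p_gt by (cases p) auto
  then show "(n + n * (p - 1)) mod p = 0" "p dvd n + n * (p - 1)" by simp_all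
qed

context
  fixes Z :: "'z set" and x y
  assumes coords: "galois_coordinates Z x y"
begin

text \<open>\<open>Pic\<close> is formed from modules on lists. An element s of \<open>eig n\<close>
  is recovered from its coordinates s b_z in \<open>R\<close> by s = \<Sum> (s b_z) a_z, so listing
  the coordinates embeds the eigenspace into lists.\<close>

lemma eig_list_copy: "\<exists>L :: ('r, 'r list) module. module R L \<and> module_isomorphic R L (En n)"
proof -
  have fin: "finite Z" using coordsD(1)[OF coords] .
  then obtain zs where zs: "set zs = Z" using finite_list by blast
  obtain a b where a: "\<And>z. z \<in> Z \<Longrightarrow> a z \<in> eig n" and b: "\<And>z. z \<in> Z \<Longrightarrow> b z \<in> eig (n * (p - 1))"
    and ab: "(\<Oplus>\<^bsub>S\<^esub>z\<in>Z. a z \<otimes>\<^bsub>S\<^esub> b z) = \<one>\<^bsub>S\<^esub>"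
    by (rule eig_coordinates[OF coords dual_index(2)[of n]]) (rule that)
  note c = eig_closed[OF a] eig_closed[OF b]
  have sb: "s \<otimes>\<^bsub>S\<^esub> b z \<in> \<iota> ` carrier R" if "s \<in> eig n" "z \<in> Z" for s z
    using eig_mult[OF that(1) b[OF that(2)]] eig_dvd[OF dual_index(2)] by simp
  \<comment> \<open>\<open>inv_into\<close> picks some preimage of a coordinate under \<iota>;
    equality of the preimages forces equality of the coordinates.\<close>
  define h where "h s = map (\<lambda>z. inv_into (carrier R) \<iota> (s \<otimes>\<^bsub>S\<^esub> b z)) zs" for s
  have ex: "s = (\<Oplus>\<^bsub>S\<^esub>z\<in>Z. (s \<otimes>\<^bsub>S\<^esub> b z) \<otimes>\<^bsub>S\<^esub> a z)" if s: "s \<in> eig n" for s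
  proof -
    have sc: "s \<in> carrier S" using s by (rule eig_closed)
    have "s = s \<otimes>\<^bsub>S\<^esub> (\<Oplus>\<^bsub>S\<^esub>z\<in>Z. a z \<otimes>\<^bsub>S\<^esub> b z)" using ab sc by simp
    also have "\<dots> = (\<Oplus>\<^bsub>S\<^esub>z\<in>Z. s \<otimes>\<^bsub>S\<^esub> (a z \<otimes>\<^bsub>S\<^esub> b z))"
      using c sc fin by (intro S.finsum_rdistr) auto
    also have "\<dots> = (\<Oplus>\<^bsub>S\<^esub>z\<in>Z. (s \<otimes>\<^bsub>S\<^esub> b z) \<otimes>\<^bsub>S\<^esub> a z)"
      using c sc by (intro S.add.finprod_cong') (auto simp: S.m_ac)
    finally show ?thesis .
  qed
  have inj: "inj_on h (carrier (En n))"
  proof (rule inj_onI)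
    fix s t assume s: "s \<in> carrier (En n)" and t: "t \<in> carrier (En n)" and eq: "h s = h t"
    have st: "s \<in> eig n" "t \<in> eig n" using s t by auto
    have "s \<otimes>\<^bsub>S\<^esub> b z = t \<otimes>\<^bsub>S\<^esub> b z" if z: "z \<in> Z" for z
    proof -
      have "inv_into (carrier R) \<iota> (s \<otimes>\<^bsub>S\<^esub> b z) = inv_into (carrier R) \<iota> (t \<otimes>\<^bsub>S\<^esub> b z)"
        using eq z zs by (auto simp: h_def)
      then have "\<iota> (inv_into (carrier R) \<iota> (s \<otimes>\<^bsub>S\<^esub> b z)) = \<iota> (inv_into (carrier R) \<iota> (t \<otimes>\<^bsub>S\<^esub> b z))"
        by (rule arg_cong)
      then show ?thesis unfolding f_inv_into_f[OF sb[OF st(1) z]] f_inv_into_f[OF sb[OF st(2) z]] .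
    qed
    then have "(\<Oplus>\<^bsub>S\<^esub>z\<in>Z. (s \<otimes>\<^bsub>S\<^esub> b z) \<otimes>\<^bsub>S\<^esub> a z) = (\<Oplus>\<^bsub>S\<^esub>z\<in>Z. (t \<otimes>\<^bsub>S\<^esub> b z) \<otimes>\<^bsub>S\<^esub> a z)"
      using c eig_closed[OF st(2)] by (intro S.add.finprod_cong') auto
    with ex[OF st(1)] show "s = t" using ex[OF st(2), symmetric] by (rule trans[OF trans])
  qed
  note im = image_algebra_module[OF En_module inj]
  have "module_isomorphic R (En n) (image_algebra h (En n))"
    unfolding module_isomorphic_def using im(2,3) by blast
  then have "module_isomorphic R (image_algebra h (En n)) (En n)"
    by (rule module_isomorphic_sym[OF En_module])
  then show ?thesis using im(1) by blast
qed

text \<open>Here the dual basis of \<open>S\<^sub>n\<close> is \<open>(a\<^sub>z, s \<mapsto> s b\<^sub>z)\<close> with \<open>\<Sum> a\<^sub>z b\<^sub>z = 1\<close>, \<open>b\<^sub>z \<in> S\<^sub>-\<^sub>n\<close>.\<close>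

lemma tensor_eig:
  assumes L: "module R L" "module_isomorphic R L (En m)"
    and M: "module R M" "module_isomorphic R M (En n)"
  shows "module_isomorphic R (tensor_product R L M) (En (m + n))"
proof -
  interpret L: module R L by fact
  interpret M: module R M by fact
  interpret LM: tensor_modules R L M by unfold_locales
  have fin: "finite Z" using coordsD(1)[OF coords] .
  obtain f where f: "f \<in> module_hom R L (En m)" "bij_betw f (carrier L) (eig m)"
    using L(2) unfolding module_isomorphic_def by auto
  obtain g where g: "g \<in> module_hom R M (En n)" "bij_betw g (carrier M) (eig n)"
    using M(2) unfolding module_isomorphic_def by auto
  define f' where "f' = inv_into (carrier L) f"
  define g' where "g' = inv_into (carrier M) g"
  have f': "f' \<in> module_hom R (En m) L" unfolding f'_def using module_hom_inv[OF L(1) f(1)] f(2) by simp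
  have g': "g' \<in> module_hom R (En n) M" unfolding g'_def using module_hom_inv[OF M(1) g(1)] g(2) by simp
  have ff: "f (f' s) = s" if "s \<in> eig m" for s
    unfolding f'_def using f(2) that by (auto simp: bij_betw_def intro: f_inv_into_f)
  have gg: "g (g' s) = s" if "s \<in> eig n" for s
    unfolding g'_def using g(2) that by (auto simp: bij_betw_def intro: f_inv_into_f)
  have ff': "f' (f a) = a" if "a \<in> carrier L" for a
    unfolding f'_def using f(2) that by (auto simp: bij_betw_def)
  have gg': "g' (g a) = a" if "a \<in> carrier M" for a
    unfolding g'_def using g(2) that by (auto simp: bij_betw_def)
  note fh = module_homD[OF f(1), simplified] and gh = module_homD[OF g(1), simplified]
  note fh' = module_homD[OF f', simplified] and gh' = module_homD[OF g', simplified]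
  note fc = eig_closed[OF fh(1)] and gc = eig_closed[OF gh(1)]
  obtain a b where a: "\<And>z. z \<in> Z \<Longrightarrow> a z \<in> eig n" and b: "\<And>z. z \<in> Z \<Longrightarrow> b z \<in> eig (n * (p - 1))"
    and ab: "(\<Oplus>\<^bsub>S\<^esub>z\<in>Z. a z \<otimes>\<^bsub>S\<^esub> b z) = \<one>\<^bsub>S\<^esub>"
    by (rule eig_coordinates[OF coords dual_index(2)[of n]]) (rule that)
  note c = eig_closed[OF a] eig_closed[OF b]
  have sb: "s \<otimes>\<^bsub>S\<^esub> b z \<in> \<iota> ` carrier R" if "s \<in> eig n" "z \<in> Z" for s z
    using eig_mult[OF that(1) b[OF that(2)]] eig_dvd[OF dual_index(2)] by simp
  define t where "t z m = inv_into (carrier R) \<iota> (g m \<otimes>\<^bsub>S\<^esub> b z)" for z m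
  have t: "t z m \<in> carrier R" "\<iota> (t z m) = g m \<otimes>\<^bsub>S\<^esub> b z" if "z \<in> Z" "m \<in> carrier M" for z m
    unfolding t_def using sb[OF gh(1)[OF that(2)] that(1)] by (auto intro: inv_into_into f_inv_into_f)
  \<comment> \<open>Multiplication by b_z lowers the index m + n to m. This supplies the maps from
    the product eigenspace back to the left factor.\<close>
  have eb: "s \<otimes>\<^bsub>S\<^esub> b z \<in> eig m" if "s \<in> eig (m + n)" "z \<in> Z" for s z
  proof (rule eig_mult'[OF that(1) b[OF that(2)]])
    have "m + n + n * (p - 1) = m + (n + n * (p - 1))" by simp
    then show "(m + n + n * (p - 1)) mod p = m mod p"
      using dual_index(1)[of n] by (metis add.right_neutral mod_add_right_eq)
  qed
  have bil: "bilinear_map R L M (En (m + n)) (\<lambda>u v. f u \<otimes>\<^bsub>S\<^esub> g v)"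
    unfolding bilinear_map_def
    by (auto intro!: module_homI eig_mult simp: fh gh fc gc S.l_distr S.r_distr A.smult_assoc2
        smult_iota S.m_ac)
  show ?thesis
  proof (rule LM.tensor_product_isomorphic[OF En_module bil fin, of "\<lambda>z. g' (a z)"
        "\<lambda>z s. f' (s \<otimes>\<^bsub>S\<^esub> b z)" t])
    show "g' (a z) \<in> carrier M" if "z \<in> Z" for z using gh'(1) a that by auto
    show "(\<lambda>s. f' (s \<otimes>\<^bsub>S\<^esub> b z)) \<in> module_hom R (En (m + n)) L" if z: "z \<in> Z" for z
    proof (rule module_hom_comp[OF _ f'])
      show "(\<lambda>s. s \<otimes>\<^bsub>S\<^esub> b z) \<in> module_hom R (En (m + n)) (En m)"
        using z c(2) by (intro module_homI) (auto simp: eb eig_closed S.l_distr A.smult_assoc2)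
    qed
    show "t z m' \<in> carrier R" if "z \<in> Z" "m' \<in> carrier M" for z m' using t that by simp
    show "f' ((f u \<otimes>\<^bsub>S\<^esub> g m') \<otimes>\<^bsub>S\<^esub> b z) = t z m' \<odot>\<^bsub>L\<^esub> u"
      if "z \<in> Z" "u \<in> carrier L" "m' \<in> carrier M" for z u m'
    proof -
      have "(f u \<otimes>\<^bsub>S\<^esub> g m') \<otimes>\<^bsub>S\<^esub> b z = t z m' \<odot>\<^bsub>S\<^esub> f u"
        using that t fc gc c by (simp add: smult_iota S.m_ac)
      then show ?thesis using that t fh'(3) fh(1) ff' by simp
    qed
    show "(\<Oplus>\<^bsub>M\<^esub>z\<in>Z. t z m' \<odot>\<^bsub>M\<^esub> g' (a z)) = m'" if m': "m' \<in> carrier M" for m'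
    proof -
      have "(\<Oplus>\<^bsub>M\<^esub>z\<in>Z. t z m' \<odot>\<^bsub>M\<^esub> g' (a z)) = (\<Oplus>\<^bsub>M\<^esub>z\<in>Z. g' (t z m' \<odot>\<^bsub>S\<^esub> a z))"
        using t m' a gh' eig_smult by (intro M.M.add.finprod_cong') auto
      also have "\<dots> = g' (\<Oplus>\<^bsub>En n\<^esub>z\<in>Z. t z m' \<odot>\<^bsub>S\<^esub> a z)"
        using t m' a eig_smult by (intro module_hom_finsum[OF En_module M(1) g', symmetric]) auto
      also have "(\<Oplus>\<^bsub>En n\<^esub>z\<in>Z. t z m' \<odot>\<^bsub>S\<^esub> a z) = (\<Oplus>\<^bsub>S\<^esub>z\<in>Z. t z m' \<odot>\<^bsub>S\<^esub> a z)"
        using t m' a eig_smult by (intro En_finsum) auto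
      also have "\<dots> = (\<Oplus>\<^bsub>S\<^esub>z\<in>Z. g m' \<otimes>\<^bsub>S\<^esub> (a z \<otimes>\<^bsub>S\<^esub> b z))"
        using t m' c gc by (intro S.add.finprod_cong') (auto simp: smult_iota S.m_ac)
      also have "\<dots> = g m' \<otimes>\<^bsub>S\<^esub> (\<Oplus>\<^bsub>S\<^esub>z\<in>Z. a z \<otimes>\<^bsub>S\<^esub> b z)"
        using m' c gc fin by (intro S.finsum_rdistr[symmetric]) auto
      finally show ?thesis using ab gc gg' m' by simp
    qed
    show "(\<Oplus>\<^bsub>En (m + n)\<^esub>z\<in>Z. f (f' (s \<otimes>\<^bsub>S\<^esub> b z)) \<otimes>\<^bsub>S\<^esub> g (g' (a z))) = s" if "s \<in> carrier (En (m + n))" for s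
    proof -
      have s: "s \<in> eig (m + n)" "s \<in> carrier S" using that eig_closed by auto
      have "(\<Oplus>\<^bsub>En (m + n)\<^esub>z\<in>Z. f (f' (s \<otimes>\<^bsub>S\<^esub> b z)) \<otimes>\<^bsub>S\<^esub> g (g' (a z))) =
        (\<Oplus>\<^bsub>S\<^esub>z\<in>Z. f (f' (s \<otimes>\<^bsub>S\<^esub> b z)) \<otimes>\<^bsub>S\<^esub> g (g' (a z)))"
        using eb[OF s(1)] a by (intro En_finsum) (auto simp: ff gg intro!: eig_mult)
      also have "\<dots> = (\<Oplus>\<^bsub>S\<^esub>z\<in>Z. s \<otimes>\<^bsub>S\<^esub> (a z \<otimes>\<^bsub>S\<^esub> b z))"
        using eb[OF s(1)] a c s by (intro S.add.finprod_cong') (auto simp: ff gg S.m_ac)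
      also have "\<dots> = s \<otimes>\<^bsub>S\<^esub> (\<Oplus>\<^bsub>S\<^esub>z\<in>Z. a z \<otimes>\<^bsub>S\<^esub> b z)"
        using s c fin by (intro S.finsum_rdistr[symmetric]) auto
      finally show ?thesis using ab s by simp
    qed
  qed
qed

context
  assumes inj: "inj_on \<iota> (carrier R)"
begin

lemma regular_eig: "p dvd n \<Longrightarrow> module_isomorphic R (regular_module R) (En n)"
proof -
  assume n: "p dvd n"
  have "\<iota> \<in> module_hom R (regular_module R) (En n)"
    using ring_hom_add[OF iota_hom] eig_dvd[OF n]
    by (intro module_homI) (auto simp: regular_module_def structure_map_def A.smult_assoc1)
  moreover have "bij_betw \<iota> (carrier (regular_module R)) (carrier (En n))"
    using inj eig_dvd[OF n] by (simp add: bij_betw_def regular_module_def)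
  ultimately show ?thesis unfolding module_isomorphic_def by blast
qed

text \<open>The inverse is a list copy of the eigenspace of index -n: the index of the product is a
  multiple of p, and such an eigenspace is the image of \<open>R\<close>.\<close>

lemma invertible_eig:
  assumes L: "module R L" "module_isomorphic R L (En n)"
  shows "invertible_module R L"
proof -
  obtain N :: "('r, 'r list) module" where N: "module R N" "module_isomorphic R N (En (n * (p - 1)))"
    using eig_list_copy by blast
  have "module_isomorphic R (tensor_product R L N) (En (n + n * (p - 1)))"
    by (rule tensor_eig[OF L N])
  moreover have "module_isomorphic R (En (n + n * (p - 1))) (regular_module R)"
    by (rule module_isomorphic_sym[OF R.regular_module_module regular_eig[OF dual_index(2)]])
  ultimately have "module_isomorphic R (tensor_product R L N) (regular_module R)"
    by (rule module_isomorphic_trans)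
  then show ?thesis unfolding invertible_module_def using L N by blast
qed

text \<open>The product in \<open>Pic\<close> is a union over representatives. All of them
  contribute the class of \<open>eig (m + n)\<close> by \<open>tensor_eig\<close>, and the list
  copies show that there are representatives.\<close>

lemma Pic_mult_eig:
  "Pic_class R (En m) \<otimes>\<^bsub>Pic R\<^esub> Pic_class R (En n) = Pic_class R (En (m + n))"
proof -
  have mem: "\<exists>L. L \<in> Pic_class R (En n)" for n
    using eig_list_copy[of n] invertible_eig unfolding Pic_class_def by blast
  have "Pic_class R (tensor_product R L M) = Pic_class R (En (m + n))"
    if "L \<in> Pic_class R (En m)" "M \<in> Pic_class R (En n)" for L M
  proof (rule Pic_class_cong)
    have LM: "module R L" "module R M" "module_isomorphic R L (En m)" "module_isomorphic R M (En n)"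
      using that by (auto simp: Pic_class_def invertible_module_def)
    interpret LM: tensor_modules R L M using LM(1,2) by (intro tensor_modules.intro)
    show "module R (tensor_product R L M)" by (rule LM.T_module)
    show "module_isomorphic R (tensor_product R L M) (En (m + n))"
      by (rule tensor_eig[OF LM(1,3,2,4)])
  qed
  then have "Pic_class R (En m) \<otimes>\<^bsub>Pic R\<^esub> Pic_class R (En n) =
    (\<Union>L\<in>Pic_class R (En m). \<Union>M\<in>Pic_class R (En n). Pic_class R (En (m + n)))"
    unfolding Pic_def by simp
  also have "\<dots> = Pic_class R (En (m + n))" using mem by blast
  finally show ?thesis .
qed

lemma Pic_one_eig: "p dvd n \<Longrightarrow> \<one>\<^bsub>Pic R\<^esub> = Pic_class R (En n)"
  unfolding Pic_def using Pic_class_cong[OF R.regular_module_module regular_eig] by simp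

lemma Pic_pow_eig: "Pic_class R (En 1) [^]\<^bsub>Pic R\<^esub> (n::nat) = Pic_class R (En n)"
proof (induction n)
  case 0
  show ?case using Pic_one_eig[of 0] by (simp add: nat_pow_def)
next
  case (Suc n)
  then show ?case using Pic_mult_eig[of n 1] by (simp add: nat_pow_def)
qed

lemma eig_one_principal:
  assumes "torsion_part (Pic R) p = {\<one>\<^bsub>Pic R\<^esub>}"
  obtains \<alpha> where "\<alpha> \<in> eig 1" "\<And>s. s \<in> eig 1 \<Longrightarrow> \<exists>r\<in>carrier R. s = r \<odot>\<^bsub>S\<^esub> \<alpha>"
proof -
  obtain L :: "('r, 'r list) module" where L: "module R L" "module_isomorphic R L (En 1)"
    using eig_list_copy by blast
  have inv: "invertible_module R L" by (rule invertible_eig[OF L])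
  have "Pic_class R (En 1) = Pic_class R L" using Pic_class_cong[OF L] by simp
  then have "Pic_class R (En 1) \<in> carrier (Pic R)" unfolding Pic_def using inv by auto
  moreover have "Pic_class R (En 1) [^]\<^bsub>Pic R\<^esub> p = \<one>\<^bsub>Pic R\<^esub>"
    using Pic_pow_eig[of p] Pic_one_eig[of p] by simp
  ultimately have "Pic_class R (En 1) = \<one>\<^bsub>Pic R\<^esub>"
    using assms unfolding torsion_part_def by blast
  then have "L \<in> Pic_class R (regular_module R)"
    using inv L(2) unfolding Pic_def by (auto simp: Pic_class_def)
  then have "module_isomorphic R (regular_module R) L"
    using module_isomorphic_sym[OF L(1)] by (auto simp: Pic_class_def)
  then have "module_isomorphic R (regular_module R) (En 1)"
    using L(2) by (rule module_isomorphic_trans)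
  then obtain f where f: "f \<in> module_hom R (regular_module R) (En 1)" "bij_betw f (carrier R) (eig 1)"
    unfolding module_isomorphic_def by (auto simp: regular_module_def)
  have "f \<one>\<^bsub>R\<^esub> \<in> eig 1" using module_homD(1)[OF f(1)] by (simp add: regular_module_def)
  moreover have "\<exists>r\<in>carrier R. s = r \<odot>\<^bsub>S\<^esub> f \<one>\<^bsub>R\<^esub>" if "s \<in> eig 1" for s
  proof -
    have "s \<in> f ` carrier R" using f(2) that by (simp add: bij_betw_def)
    then obtain r where r: "r \<in> carrier R" "s = f r" by blast
    have "f (r \<odot>\<^bsub>regular_module R\<^esub> \<one>\<^bsub>R\<^esub>) = r \<odot>\<^bsub>En 1\<^esub> f \<one>\<^bsub>R\<^esub>"
      using r by (intro module_homD(3)[OF f(1)]) (simp_all add: regular_module_def)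
    then show ?thesis using r by (intro bexI[of _ r]) (simp_all add: regular_module_def)
  qed
  ultimately show thesis using that by blast
qed

end

text \<open>In \<Sum> a_z b_z = 1 with a_z in \<open>eig 1\<close>, write a_z = r_z \<alpha>; the
  remaining factor \<Sum> r_z b_z inverts \<alpha>.\<close>

lemma eig_generator_unit:
  assumes \<alpha>: "\<alpha> \<in> eig 1" "\<And>s. s \<in> eig 1 \<Longrightarrow> \<exists>r\<in>carrier R. s = r \<odot>\<^bsub>S\<^esub> \<alpha>"
  shows "\<exists>\<beta>\<in>carrier S. \<alpha> \<otimes>\<^bsub>S\<^esub> \<beta> = \<one>\<^bsub>S\<^esub>"
proof -
  have \<alpha>c: "\<alpha> \<in> carrier S" using \<alpha>(1) by (rule eig_closed)
  obtain a b where a: "\<And>z. z \<in> Z \<Longrightarrow> a z \<in> eig 1" and b: "\<And>z. z \<in> Z \<Longrightarrow> b z \<in> eig (1 * (p - 1))"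
    and ab: "(\<Oplus>\<^bsub>S\<^esub>z\<in>Z. a z \<otimes>\<^bsub>S\<^esub> b z) = \<one>\<^bsub>S\<^esub>"
    by (rule eig_coordinates[OF coords dual_index(2)[of 1]]) (rule that)
  obtain r where r: "\<And>z. z \<in> Z \<Longrightarrow> r z \<in> carrier R" "\<And>z. z \<in> Z \<Longrightarrow> a z = r z \<odot>\<^bsub>S\<^esub> \<alpha>"
    using \<alpha>(2)[OF a] by metis
  note bc = eig_closed[OF b]
  have "\<alpha> \<otimes>\<^bsub>S\<^esub> (\<Oplus>\<^bsub>S\<^esub>z\<in>Z. r z \<odot>\<^bsub>S\<^esub> b z) = (\<Oplus>\<^bsub>S\<^esub>z\<in>Z. \<alpha> \<otimes>\<^bsub>S\<^esub> (r z \<odot>\<^bsub>S\<^esub> b z))"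
    using \<alpha>c r bc coordsD(1)[OF coords] by (intro S.finsum_rdistr) auto
  also have "\<dots> = (\<Oplus>\<^bsub>S\<^esub>z\<in>Z. a z \<otimes>\<^bsub>S\<^esub> b z)"
    using \<alpha>c r bc by (intro S.add.finprod_cong') (auto simp: smult_iota S.m_ac)
  finally show ?thesis
    using ab r bc by (intro bexI[of _ "\<Oplus>\<^bsub>S\<^esub>z\<in>Z. r z \<odot>\<^bsub>S\<^esub> b z"]) (auto intro!: S.finsum_closed)
qed

end

end

section \<open>Powers of an invertible eigenvector as a basis\<close>

text \<open>The part of \<open>primitive_element\<close> that mentions neither group nor character.
  It depends on the algebra alone and can be carried along algebra isomorphisms.\<close>

definition power_basis :: "nat \<Rightarrow> ('r, 'k) ring_scheme \<Rightarrow> ('r, 's, 'x) module_scheme \<Rightarrow> 's \<Rightarrow> bool"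
  where "power_basis p R S \<alpha> \<longleftrightarrow> \<alpha> \<in> carrier S \<and>
    (\<forall>s\<in>carrier S. \<exists>!c. c \<in> {..<p} \<rightarrow>\<^sub>E carrier R \<and>
        s = (\<Oplus>\<^bsub>S\<^esub>i\<in>{..<p}. c i \<odot>\<^bsub>S\<^esub> (\<alpha> [^]\<^bsub>S\<^esub> i)))"

lemma primitive_element_iff:
  "primitive_element p R \<mu> S G \<phi> \<alpha> \<longleftrightarrow> power_basis p R S \<alpha> \<and>
    (\<exists>\<chi>\<in>hom G ((units_of R)\<lparr>carrier := \<mu>\<rparr>). (\<exists>g\<in>carrier G. \<chi> g \<noteq> \<one>\<^bsub>R\<^esub>) \<and>
        (\<forall>g\<in>carrier G. \<phi> g \<alpha> = \<chi> g \<odot>\<^bsub>S\<^esub> \<alpha>))"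
  unfolding primitive_element_def power_basis_def by blast

context kummer_action
begin

text \<open>Applying g to \<alpha> \<beta> = 1 yields \<alpha> g(\<beta>) = \<chi>(g)^n';
  multiplication by \<beta> gives the law for \<beta>.\<close>

lemma inverse_eig:
  assumes \<alpha>: "\<alpha> \<in> eig n" and \<beta>: "\<beta> \<in> carrier S" "\<alpha> \<otimes>\<^bsub>S\<^esub> \<beta> = \<one>\<^bsub>S\<^esub>" and n: "p dvd n + n'"
  shows "\<beta> \<in> eig n'"
proof -
  have \<alpha>c: "\<alpha> \<in> carrier S" using \<alpha> by (rule eig_closed)
  have "\<phi> g \<beta> = \<chi> g [^]\<^bsub>R\<^esub> n' \<odot>\<^bsub>S\<^esub> \<beta>" if g: "g \<in> carrier G" for g
  proof -
    have b: "\<phi> g \<beta> \<in> carrier S" using action_simps(1)[OF g \<beta>(1)] .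
    have c: "\<chi> g [^]\<^bsub>R\<^esub> n \<in> carrier R" "\<chi> g [^]\<^bsub>R\<^esub> n' \<in> carrier R" using g by auto
    have "\<chi> g [^]\<^bsub>R\<^esub> n \<odot>\<^bsub>S\<^esub> (\<alpha> \<otimes>\<^bsub>S\<^esub> \<phi> g \<beta>) = \<phi> g (\<alpha> \<otimes>\<^bsub>S\<^esub> \<beta>)"
      using \<alpha>c \<beta>(1) b c by (simp add: action_simps(2)[OF g] eigD[OF \<alpha> g] A.smult_assoc2)
    also have "\<dots> = \<one>\<^bsub>S\<^esub>" using \<beta>(2) action_simps(4)[OF g] by simp
    finally have 1: "\<chi> g [^]\<^bsub>R\<^esub> n \<odot>\<^bsub>S\<^esub> (\<alpha> \<otimes>\<^bsub>S\<^esub> \<phi> g \<beta>) = \<one>\<^bsub>S\<^esub>" .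
    have "\<chi> g [^]\<^bsub>R\<^esub> n' \<otimes>\<^bsub>R\<^esub> \<chi> g [^]\<^bsub>R\<^esub> n = \<one>\<^bsub>R\<^esub>"
      using mu_pow_p_mult[OF chi_mu[OF g] n] g by (simp add: R.nat_pow_mult add.commute)
    then have "\<alpha> \<otimes>\<^bsub>S\<^esub> \<phi> g \<beta> = (\<chi> g [^]\<^bsub>R\<^esub> n' \<otimes>\<^bsub>R\<^esub> \<chi> g [^]\<^bsub>R\<^esub> n) \<odot>\<^bsub>S\<^esub> (\<alpha> \<otimes>\<^bsub>S\<^esub> \<phi> g \<beta>)"
      using \<alpha>c b by simp
    also have "\<dots> = \<chi> g [^]\<^bsub>R\<^esub> n' \<odot>\<^bsub>S\<^esub> \<one>\<^bsub>S\<^esub>"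
      using \<alpha>c b c 1 by (simp add: A.smult_assoc1)
    finally have 2: "\<alpha> \<otimes>\<^bsub>S\<^esub> \<phi> g \<beta> = \<chi> g [^]\<^bsub>R\<^esub> n' \<odot>\<^bsub>S\<^esub> \<one>\<^bsub>S\<^esub>" .
    have "\<phi> g \<beta> = (\<alpha> \<otimes>\<^bsub>S\<^esub> \<beta>) \<otimes>\<^bsub>S\<^esub> \<phi> g \<beta>" using \<beta>(2) b by simp
    also have "\<dots> = (\<alpha> \<otimes>\<^bsub>S\<^esub> \<phi> g \<beta>) \<otimes>\<^bsub>S\<^esub> \<beta>" using \<alpha>c \<beta>(1) b by (simp add: S.m_ac)
    also have "\<dots> = \<chi> g [^]\<^bsub>R\<^esub> n' \<odot>\<^bsub>S\<^esub> \<beta>" unfolding 2 using \<beta>(1) c by (simp add: A.smult_assoc2)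
    finally show ?thesis .
  qed
  then show ?thesis using \<beta>(1) by (simp add: eig_def)
qed

lemma eig_pow_mult: "s \<in> eig m \<Longrightarrow> s [^]\<^bsub>S\<^esub> (n::nat) \<in> eig (n * m)"
proof (induction n)
  case 0
  show ?case by (auto simp: eig_def action_simps(4))
next
  case (Suc n)
  then show ?case using eig_mult[of "s [^]\<^bsub>S\<^esub> n" "n * m" s m] by (simp add: add.commute)
qed

text \<open>\<open>(p - j) mod p\<close> is the representative of -j below p; the outer
  \<open>mod\<close> matters at j = 0 only, where p - j would be p.\<close>

lemma dual_dvd: "i < p \<Longrightarrow> j < p \<Longrightarrow> p dvd (p - j) mod p + i \<longleftrightarrow> i = j"
proof -
  assume ij: "i < p" "j < p"
  show ?thesis
  proof (cases "j = 0")
    case True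
    then show ?thesis using ij by (auto simp: nat_dvd_not_less)
  next
    case False
    then have "(p - j) mod p + i = p - j + i" using ij by simp
    moreover have "p dvd p - j + i \<longleftrightarrow> i = j"
    proof
      assume "p dvd p - j + i"
      then obtain k where k: "p - j + i = p * k" by blast
      have "0 < p * k" "p * k < p * 2" unfolding k[symmetric] using False ij by linarith+
      then have "k = 1" unfolding nat_0_less_mult_iff mult_less_cancel1 by linarith
      then show "i = j" using k ij by simp
    next
      assume "i = j"
      then have "p - j + i = p" using ij by simp
      then show "p dvd p - j + i" by simp
    qed
    ultimately show ?thesis by simp
  qed
qed

text \<open>The decomposition of s with the summands renumbered so that the i-th one lies in
  \<open>eig i\<close>.\<close>

lemma proj_sum_dual:
  assumes s: "s \<in> carrier S"
  shows "(\<Oplus>\<^bsub>S\<^esub>i\<in>{..<p}. proj ((p - i) mod p) s) = s"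
proof -
  have inj: "inj_on (\<lambda>i. (p - i) mod p) {..<p}"
  proof (rule inj_onI)
    fix i j assume ij: "i \<in> {..<p}" "j \<in> {..<p}" "(p - i) mod p = (p - j) mod p"
    have "p dvd (p - j) mod p + j" using dual_dvd[of j j] ij by simp
    then have "p dvd (p - i) mod p + j" unfolding ij(3) .
    then show "i = j" using dual_dvd[of j i] ij(1,2) by simp
  qed
  have "(\<lambda>i. (p - i) mod p) ` {..<p} \<subseteq> {..<p}" using p_gt by auto
  then have im: "(\<lambda>i. (p - i) mod p) ` {..<p} = {..<p}"
    by (intro card_subset_eq) (simp_all add: card_image[OF inj])
  have "(\<Oplus>\<^bsub>S\<^esub>m\<in>(\<lambda>i. (p - i) mod p) ` {..<p}. proj m s) = (\<Oplus>\<^bsub>S\<^esub>i\<in>{..<p}. proj ((p - i) mod p) s)"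
    using proj_closed[OF s] by (intro S.add.finprod_reindex inj) auto
  then show ?thesis unfolding im proj_sum[OF s] ..
qed

text \<open>The powers of \<alpha> lie in different eigenspaces, so a projection isolates one term
  of a linear combination. Independence of the powers comes from here.\<close>

lemma proj_powers:
  assumes \<alpha>: "\<alpha> \<in> eig 1" and c: "c \<in> {..<p} \<rightarrow> carrier R" and j: "j < p"
  shows "proj ((p - j) mod p) (\<Oplus>\<^bsub>S\<^esub>i\<in>{..<p}. c i \<odot>\<^bsub>S\<^esub> \<alpha> [^]\<^bsub>S\<^esub> i) = c j \<odot>\<^bsub>S\<^esub> \<alpha> [^]\<^bsub>S\<^esub> j"
proof -
  have \<alpha>c: "\<alpha> \<in> carrier S" using \<alpha> by (rule eig_closed)
  have t: "(\<lambda>i. c i \<odot>\<^bsub>S\<^esub> \<alpha> [^]\<^bsub>S\<^esub> i) \<in> {..<p} \<rightarrow> carrier S" using c \<alpha>c by auto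
  have "proj ((p - j) mod p) (\<Oplus>\<^bsub>S\<^esub>i\<in>{..<p}. c i \<odot>\<^bsub>S\<^esub> \<alpha> [^]\<^bsub>S\<^esub> i) =
    (\<Oplus>\<^bsub>S\<^esub>i\<in>{..<p}. proj ((p - j) mod p) (c i \<odot>\<^bsub>S\<^esub> \<alpha> [^]\<^bsub>S\<^esub> i))"
    by (rule module_hom_finsum[OF A.module A.module proj_hom t])
  also have "\<dots> = (\<Oplus>\<^bsub>S\<^esub>i\<in>{..<p}. if j = i then c i \<odot>\<^bsub>S\<^esub> \<alpha> [^]\<^bsub>S\<^esub> i else \<zero>\<^bsub>S\<^esub>)"
  proof (intro S.add.finprod_cong' refl)
    fix i assume i: "i \<in> {..<p}"
    then have "c i \<odot>\<^bsub>S\<^esub> \<alpha> [^]\<^bsub>S\<^esub> i \<in> eig i"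
      using c by (intro eig_smult eig_pow[OF \<alpha>]) auto
    then show "proj ((p - j) mod p) (c i \<odot>\<^bsub>S\<^esub> \<alpha> [^]\<^bsub>S\<^esub> i) =
      (if j = i then c i \<odot>\<^bsub>S\<^esub> \<alpha> [^]\<^bsub>S\<^esub> i else \<zero>\<^bsub>S\<^esub>)"
      using proj_eig dual_dvd[of i j] i j by auto
  qed (use t in auto)
  also have "\<dots> = c j \<odot>\<^bsub>S\<^esub> \<alpha> [^]\<^bsub>S\<^esub> j"
    using t j by (intro S.add.finprod_singleton) auto
  finally show ?thesis .
qed

text \<open>Projecting an expansion of s to the first eigenspace leaves its linear term. A primitive
  element therefore generates \<open>eig 1\<close>, and \<open>eig_generator_unit\<close> shows that
  it is invertible.\<close>

lemma power_basis_eig: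
  assumes "power_basis p R S \<alpha>" "\<alpha> \<in> eig 1" "s \<in> eig 1"
  shows "\<exists>r\<in>carrier R. s = r \<odot>\<^bsub>S\<^esub> \<alpha>"
proof -
  have sc: "s \<in> carrier S" using assms(3) by (rule eig_closed)
  obtain c where c: "c \<in> {..<p} \<rightarrow>\<^sub>E carrier R" "s = (\<Oplus>\<^bsub>S\<^esub>i\<in>{..<p}. c i \<odot>\<^bsub>S\<^esub> (\<alpha> [^]\<^bsub>S\<^esub> i))"
    using assms(1) sc unfolding power_basis_def by blast
  have "s = proj ((p - 1) mod p) s" using proj_eig[OF assms(3), of "(p - 1) mod p"] dual_dvd[of 1 1] p_gt by simp
  also have "\<dots> = c 1 \<odot>\<^bsub>S\<^esub> \<alpha> [^]\<^bsub>S\<^esub> (1::nat)"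
    unfolding c(2) using c(1) p_gt by (intro proj_powers[OF assms(2)]) auto
  finally have "s = c 1 \<odot>\<^bsub>S\<^esub> \<alpha>" using eig_closed[OF assms(2)] by simp
  moreover have "c 1 \<in> carrier R" using c(1) p_gt by auto
  ultimately show ?thesis by blast
qed

context
  fixes \<alpha> \<beta>
  assumes \<alpha>: "\<alpha> \<in> eig 1" and \<beta>: "\<beta> \<in> carrier S" and \<alpha>\<beta>: "\<alpha> \<otimes>\<^bsub>S\<^esub> \<beta> = \<one>\<^bsub>S\<^esub>"
begin

lemma \<alpha>_closed: "\<alpha> \<in> carrier S"
  using \<alpha> by (rule eig_closed)

lemma \<beta>_eig: "\<beta> \<in> eig (p - 1)"
  using p_gt by (intro inverse_eig[OF \<alpha> \<beta> \<alpha>\<beta>]) simp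

lemma \<alpha>\<beta>_pow: "\<alpha> [^]\<^bsub>S\<^esub> (n::nat) \<otimes>\<^bsub>S\<^esub> \<beta> [^]\<^bsub>S\<^esub> n = \<one>\<^bsub>S\<^esub>"
  using \<alpha>_closed \<beta> \<alpha>\<beta> by (simp flip: S.nat_pow_distrib)

text \<open>The index of s \<beta>^n is a multiple of p, so this element comes from
  \<open>R\<close>; it is the coefficient sought.\<close>

lemma eig_generated:
  assumes s: "s \<in> eig n"
  shows "\<exists>r\<in>carrier R. s = r \<odot>\<^bsub>S\<^esub> \<alpha> [^]\<^bsub>S\<^esub> n"
proof -
  have sc: "s \<in> carrier S" using s by (rule eig_closed)
  have "s \<otimes>\<^bsub>S\<^esub> \<beta> [^]\<^bsub>S\<^esub> n \<in> eig (n + n * (p - 1))"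
    by (rule eig_mult[OF s eig_pow_mult[OF \<beta>_eig]])
  then obtain r where r: "r \<in> carrier R" "s \<otimes>\<^bsub>S\<^esub> \<beta> [^]\<^bsub>S\<^esub> n = \<iota> r"
    using eig_dvd[OF dual_index(2)] by blast
  have "r \<odot>\<^bsub>S\<^esub> \<alpha> [^]\<^bsub>S\<^esub> n = (s \<otimes>\<^bsub>S\<^esub> \<beta> [^]\<^bsub>S\<^esub> n) \<otimes>\<^bsub>S\<^esub> \<alpha> [^]\<^bsub>S\<^esub> n"
    using r \<alpha>_closed by (simp add: smult_iota)
  also have "\<dots> = s \<otimes>\<^bsub>S\<^esub> (\<alpha> [^]\<^bsub>S\<^esub> n \<otimes>\<^bsub>S\<^esub> \<beta> [^]\<^bsub>S\<^esub> n)"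
    using sc \<alpha>_closed \<beta> by (simp add: S.m_ac)
  finally show ?thesis using \<alpha>\<beta>_pow sc r(1) by auto
qed

context
  assumes inj: "inj_on \<iota> (carrier R)"
begin

text \<open>Each eigencomponent of s is a multiple of the corresponding power of \<alpha>. For
  uniqueness, projections isolate the j-th terms, \<beta>^j cancels \<alpha>^j, and \<iota> is
  injective.\<close>

lemma power_basisI: "power_basis p R S \<alpha>"
  unfolding power_basis_def
proof (intro conjI ballI)
  fix s assume s: "s \<in> carrier S"
  have "\<forall>i\<in>{..<p}. \<exists>r\<in>carrier R. proj ((p - i) mod p) s = r \<odot>\<^bsub>S\<^esub> \<alpha> [^]\<^bsub>S\<^esub> i"
    using s dual_dvd by (intro ballI eig_generated proj_in_eig) auto
  then obtain c where c: "\<And>i. i \<in> {..<p} \<Longrightarrow> c i \<in> carrier R"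
    "\<And>i. i \<in> {..<p} \<Longrightarrow> proj ((p - i) mod p) s = c i \<odot>\<^bsub>S\<^esub> \<alpha> [^]\<^bsub>S\<^esub> i" by metis
  have ex: "s = (\<Oplus>\<^bsub>S\<^esub>i\<in>{..<p}. restrict c {..<p} i \<odot>\<^bsub>S\<^esub> \<alpha> [^]\<^bsub>S\<^esub> i)"
    using c \<alpha>_closed by (subst proj_sum_dual[OF s, symmetric]) (intro S.add.finprod_cong', auto)
  have ex': "restrict c {..<p} \<in> {..<p} \<rightarrow>\<^sub>E carrier R" using c(1) by auto
  have un: "d = d'" if d: "d \<in> {..<p} \<rightarrow>\<^sub>E carrier R" "s = (\<Oplus>\<^bsub>S\<^esub>i\<in>{..<p}. d i \<odot>\<^bsub>S\<^esub> \<alpha> [^]\<^bsub>S\<^esub> i)"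
    and d': "d' \<in> {..<p} \<rightarrow>\<^sub>E carrier R" "s = (\<Oplus>\<^bsub>S\<^esub>i\<in>{..<p}. d' i \<odot>\<^bsub>S\<^esub> \<alpha> [^]\<^bsub>S\<^esub> i)" for d d'
  proof (rule PiE_ext[OF d(1) d'(1)])
    fix j assume j: "j \<in> {..<p}"
    have dj: "d j \<in> carrier R" "d' j \<in> carrier R" using d(1) d'(1) j by auto
    have "d j \<odot>\<^bsub>S\<^esub> \<alpha> [^]\<^bsub>S\<^esub> j = proj ((p - j) mod p) s"
      unfolding d(2) using d(1) j by (intro proj_powers[OF \<alpha>, symmetric]) auto
    also have "\<dots> = d' j \<odot>\<^bsub>S\<^esub> \<alpha> [^]\<^bsub>S\<^esub> j"
      unfolding d'(2) using d'(1) j by (intro proj_powers[OF \<alpha>]) auto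
    finally have "(d j \<odot>\<^bsub>S\<^esub> \<alpha> [^]\<^bsub>S\<^esub> j) \<otimes>\<^bsub>S\<^esub> \<beta> [^]\<^bsub>S\<^esub> j = (d' j \<odot>\<^bsub>S\<^esub> \<alpha> [^]\<^bsub>S\<^esub> j) \<otimes>\<^bsub>S\<^esub> \<beta> [^]\<^bsub>S\<^esub> j"
      by simp
    then have "\<iota> (d j) = \<iota> (d' j)"
      using dj \<alpha>_closed \<beta> \<alpha>\<beta>_pow[of j] by (simp add: A.smult_assoc2 structure_map_def)
    then show "d j = d' j" using inj dj by (simp add: inj_on_def)
  qed
  show "\<exists>!c. c \<in> {..<p} \<rightarrow>\<^sub>E carrier R \<and> s = (\<Oplus>\<^bsub>S\<^esub>i\<in>{..<p}. c i \<odot>\<^bsub>S\<^esub> \<alpha> [^]\<^bsub>S\<^esub> i)"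
    by (rule ex1I, rule conjI[OF ex' ex], elim conjE, rule un[OF _ _ ex' ex])
qed (rule \<alpha>_closed)

lemma primitiveI: "primitive_element p R \<mu> S G \<phi> \<alpha>"
  unfolding primitive_element_iff
  using power_basisI chi_hom chi_nontrivial eigD[OF \<alpha>] by auto

lemma iota_unit:
  assumes "r \<in> carrier R" "s \<in> eig 0" "\<iota> r \<otimes>\<^bsub>S\<^esub> s = \<one>\<^bsub>S\<^esub>"
  shows "r \<in> Units R"
proof -
  obtain v where v: "v \<in> carrier R" "s = \<iota> v" using assms(2) eig_zero by blast
  have "\<iota> (r \<otimes>\<^bsub>R\<^esub> v) = \<iota> \<one>\<^bsub>R\<^esub>"
    using assms v ring_hom_mult[OF iota_hom] ring_hom_one[OF iota_hom] by simp
  then have "r \<otimes>\<^bsub>R\<^esub> v = \<one>\<^bsub>R\<^esub>" using inj assms(1) v(1) by (simp add: inj_on_def)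
  then show ?thesis using assms(1) v(1) R.m_comm[OF v(1) assms(1)] unfolding Units_def by auto
qed

lemma power_p_unit: "\<exists>u\<in>Units R. \<iota> u = \<alpha> [^]\<^bsub>S\<^esub> p"
proof -
  have "\<alpha> [^]\<^bsub>S\<^esub> p \<in> \<iota> ` carrier R" using eig_pow[OF \<alpha>, of p] eig_dvd[of p] by simp
  then obtain u where u: "u \<in> carrier R" "\<iota> u = \<alpha> [^]\<^bsub>S\<^esub> p" by auto
  have "\<beta> [^]\<^bsub>S\<^esub> p \<in> eig 0"
    using eig_pow_mult[OF \<beta>_eig, of p] eig_dvd[of "p * (p - 1)"] eig_zero by simp
  then have "u \<in> Units R" using u \<alpha>\<beta>_pow[of p] by (intro iota_unit[OF u(1)]) simp_all
  then show ?thesis using u by blast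
qed

end

end

end

section \<open>Extensions with the same Kummer unit\<close>

definition algebra_hom ::
    "('r, 'k) ring_scheme \<Rightarrow> ('r, 's, 'x) module_scheme \<Rightarrow> ('r, 't, 'y) module_scheme \<Rightarrow> ('s \<Rightarrow> 't) set"
  where "algebra_hom R S T =
    {f \<in> ring_hom S T. \<forall>r\<in>carrier R. \<forall>s\<in>carrier S. f (r \<odot>\<^bsub>S\<^esub> s) = r \<odot>\<^bsub>T\<^esub> f s}"

lemma algebra_homI:
  assumes "\<And>x. x \<in> carrier S \<Longrightarrow> f x \<in> carrier T"
    "\<And>x y. x \<in> carrier S \<Longrightarrow> y \<in> carrier S \<Longrightarrow> f (x \<otimes>\<^bsub>S\<^esub> y) = f x \<otimes>\<^bsub>T\<^esub> f y"
    "\<And>x y. x \<in> carrier S \<Longrightarrow> y \<in> carrier S \<Longrightarrow> f (x \<oplus>\<^bsub>S\<^esub> y) = f x \<oplus>\<^bsub>T\<^esub> f y"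
    "f \<one>\<^bsub>S\<^esub> = \<one>\<^bsub>T\<^esub>"
    "\<And>r x. r \<in> carrier R \<Longrightarrow> x \<in> carrier S \<Longrightarrow> f (r \<odot>\<^bsub>S\<^esub> x) = r \<odot>\<^bsub>T\<^esub> f x"
  shows "f \<in> algebra_hom R S T"
  unfolding algebra_hom_def using assms by (intro CollectI conjI ballI ring_hom_memI)

lemma algebra_homD:
  assumes "f \<in> algebra_hom R S T"
  shows "\<And>x. x \<in> carrier S \<Longrightarrow> f x \<in> carrier T"
    "\<And>x y. x \<in> carrier S \<Longrightarrow> y \<in> carrier S \<Longrightarrow> f (x \<otimes>\<^bsub>S\<^esub> y) = f x \<otimes>\<^bsub>T\<^esub> f y"
    "\<And>x y. x \<in> carrier S \<Longrightarrow> y \<in> carrier S \<Longrightarrow> f (x \<oplus>\<^bsub>S\<^esub> y) = f x \<oplus>\<^bsub>T\<^esub> f y"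
    "f \<one>\<^bsub>S\<^esub> = \<one>\<^bsub>T\<^esub>"
    "\<And>r x. r \<in> carrier R \<Longrightarrow> x \<in> carrier S \<Longrightarrow> f (r \<odot>\<^bsub>S\<^esub> x) = r \<odot>\<^bsub>T\<^esub> f x"
  using assms unfolding algebra_hom_def
  by (auto intro: ring_hom_closed ring_hom_mult ring_hom_add ring_hom_one)

lemma algebra_hom_module_hom: "f \<in> algebra_hom R S T \<Longrightarrow> f \<in> module_hom R S T"
  by (rule module_homI) (simp_all add: algebra_homD)

lemma algebra_hom_pow:
  assumes "algebra R S" "f \<in> algebra_hom R S T" "x \<in> carrier S"
  shows "f (x [^]\<^bsub>S\<^esub> (n::nat)) = f x [^]\<^bsub>T\<^esub> n"
proof -
  interpret S: cring S using assms(1) by (rule algebra.axioms)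
  show ?thesis using assms(3) by (induction n) (simp_all add: algebra_homD[OF assms(2)])
qed

lemma algebra_hom_structure_map:
  assumes "algebra R S" "f \<in> algebra_hom R S T" "r \<in> carrier R"
  shows "f (structure_map S r) = structure_map T r"
proof -
  interpret S: cring S using assms(1) by (rule algebra.axioms)
  show ?thesis using assms(3) by (simp add: structure_map_def algebra_homD[OF assms(2)])
qed

lemma algebra_hom_comp:
  "f \<in> algebra_hom R S T \<Longrightarrow> g \<in> algebra_hom R T U \<Longrightarrow> (\<lambda>x. g (f x)) \<in> algebra_hom R S U"
  by (rule algebra_homI) (simp_all add: algebra_homD)

lemma algebra_isoD: "f \<in> algebra_iso R S T \<Longrightarrow> f \<in> algebra_hom R S T"
  "f \<in> algebra_iso R S T \<Longrightarrow> bij_betw f (carrier S) (carrier T)"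
  by (auto simp: algebra_iso_def algebra_hom_def ring_iso_def)

lemma algebra_isoI:
  "f \<in> algebra_hom R S T \<Longrightarrow> bij_betw f (carrier S) (carrier T) \<Longrightarrow> f \<in> algebra_iso R S T"
  by (auto simp: algebra_iso_def algebra_hom_def ring_iso_def)

lemma power_basis_hom_eqI:
  assumes "algebra R S" "module R T" and \<alpha>: "power_basis p R S \<alpha>"
    and f: "f \<in> module_hom R S T" and g: "g \<in> module_hom R S T"
    and eq: "\<And>i. i < p \<Longrightarrow> f (\<alpha> [^]\<^bsub>S\<^esub> i) = g (\<alpha> [^]\<^bsub>S\<^esub> i)" and s: "s \<in> carrier S"
  shows "f s = g s"
proof -
  interpret S: cring S using assms(1) by (rule algebra.axioms)
  interpret A: algebra R S by fact
  interpret T: module R T by fact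
  have \<alpha>c: "\<alpha> \<in> carrier S" using \<alpha> by (simp add: power_basis_def)
  obtain c where c: "c \<in> {..<p} \<rightarrow>\<^sub>E carrier R" "s = (\<Oplus>\<^bsub>S\<^esub>i\<in>{..<p}. c i \<odot>\<^bsub>S\<^esub> (\<alpha> [^]\<^bsub>S\<^esub> i))"
    using \<alpha> s unfolding power_basis_def by blast
  have t: "(\<lambda>i. c i \<odot>\<^bsub>S\<^esub> \<alpha> [^]\<^bsub>S\<^esub> i) \<in> {..<p} \<rightarrow> carrier S" using c(1) \<alpha>c by auto
  have "f s = (\<Oplus>\<^bsub>T\<^esub>i\<in>{..<p}. f (c i \<odot>\<^bsub>S\<^esub> \<alpha> [^]\<^bsub>S\<^esub> i))"
    unfolding c(2) by (rule module_hom_finsum[OF A.module assms(2) f t])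
  also have "\<dots> = (\<Oplus>\<^bsub>T\<^esub>i\<in>{..<p}. g (c i \<odot>\<^bsub>S\<^esub> \<alpha> [^]\<^bsub>S\<^esub> i))"
  proof (intro T.M.add.finprod_cong' refl)
    fix i assume "i \<in> {..<p}"
    then have "c i \<in> carrier R" "f (\<alpha> [^]\<^bsub>S\<^esub> i) = g (\<alpha> [^]\<^bsub>S\<^esub> i)" using c(1) eq by auto
    then show "f (c i \<odot>\<^bsub>S\<^esub> \<alpha> [^]\<^bsub>S\<^esub> i) = g (c i \<odot>\<^bsub>S\<^esub> \<alpha> [^]\<^bsub>S\<^esub> i)"
      using \<alpha>c by (simp add: module_homD(3)[OF f] module_homD(3)[OF g])
  qed (use t module_homD(1)[OF g] in auto)
  also have "\<dots> = g s"
    unfolding c(2) by (rule module_hom_finsum[OF A.module assms(2) g t, symmetric])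
  finally show ?thesis .
qed

lemma algebra_hom_eqI:
  assumes S: "algebra R S" and T: "algebra R T" and \<alpha>: "power_basis p R S \<alpha>"
    and f: "f \<in> algebra_hom R S T" and g: "g \<in> algebra_hom R S T" and eq: "f \<alpha> = g \<alpha>"
    and s: "s \<in> carrier S"
  shows "f s = g s"
proof (rule power_basis_hom_eqI[OF S algebra.module[OF T] \<alpha> _ _ _ s])
  have "\<alpha> \<in> carrier S" using \<alpha> by (simp add: power_basis_def)
  then show "f (\<alpha> [^]\<^bsub>S\<^esub> i) = g (\<alpha> [^]\<^bsub>S\<^esub> i)" for i :: nat
    using algebra_hom_pow[OF S f] algebra_hom_pow[OF S g] eq by simp
qed (use f g algebra_hom_module_hom in auto)

text \<open>Uniqueness of the coefficients makes the coordinate functions \<open>C\<close> linear;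
  the map is then given by its values on the basis.\<close>

lemma power_basis_lin_ext:
  assumes S: "algebra R S" and T: "module R T" and \<alpha>: "power_basis p R S \<alpha>"
    and b: "\<And>i. i < p \<Longrightarrow> b i \<in> carrier T"
  shows "\<exists>f\<in>module_hom R S T. \<forall>i<p. f (\<alpha> [^]\<^bsub>S\<^esub> i) = b i"
proof -
  interpret R: cring R using T by (rule module.axioms)
  interpret S: cring S using S by (rule algebra.axioms)
  interpret A: algebra R S by fact
  interpret T: module R T by fact
  have \<alpha>c: "\<alpha> \<in> carrier S" using \<alpha> by (simp add: power_basis_def)
  define C where "C s = (THE c. c \<in> {..<p} \<rightarrow>\<^sub>E carrier R \<and>
    s = (\<Oplus>\<^bsub>S\<^esub>i\<in>{..<p}. c i \<odot>\<^bsub>S\<^esub> (\<alpha> [^]\<^bsub>S\<^esub> i)))" for s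
  have ex1: "\<exists>!c. c \<in> {..<p} \<rightarrow>\<^sub>E carrier R \<and> s = (\<Oplus>\<^bsub>S\<^esub>i\<in>{..<p}. c i \<odot>\<^bsub>S\<^esub> (\<alpha> [^]\<^bsub>S\<^esub> i))"
    if "s \<in> carrier S" for s
    using \<alpha> that unfolding power_basis_def by (elim conjE) (rule bspec)
  have C: "C s \<in> {..<p} \<rightarrow>\<^sub>E carrier R" "s = (\<Oplus>\<^bsub>S\<^esub>i\<in>{..<p}. C s i \<odot>\<^bsub>S\<^esub> (\<alpha> [^]\<^bsub>S\<^esub> i))"
    if "s \<in> carrier S" for s
    using theI'[OF ex1[OF that], folded C_def] by (rule conjunct1) (rule conjunct2[OF theI'[OF ex1[OF that], folded C_def]])
  \<comment> \<open>Coefficients in the power basis are extensional functions, so an arbitrary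
    coefficient family is restricted before uniqueness is applied to it.\<close>
  have Ceq: "C s i = c i"
    if s: "s \<in> carrier S" and c: "c \<in> {..<p} \<rightarrow> carrier R"
      and e: "s = (\<Oplus>\<^bsub>S\<^esub>i\<in>{..<p}. c i \<odot>\<^bsub>S\<^esub> (\<alpha> [^]\<^bsub>S\<^esub> i))" and i: "i < p" for s c i
  proof -
    have cc: "c j \<in> carrier R" if "j < p" for j using c that by auto
    have "(\<Oplus>\<^bsub>S\<^esub>i\<in>{..<p}. c i \<odot>\<^bsub>S\<^esub> (\<alpha> [^]\<^bsub>S\<^esub> i)) =
      (\<Oplus>\<^bsub>S\<^esub>i\<in>{..<p}. restrict c {..<p} i \<odot>\<^bsub>S\<^esub> (\<alpha> [^]\<^bsub>S\<^esub> i))"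
      using cc \<alpha>c by (intro S.add.finprod_cong') auto
    then have "restrict c {..<p} \<in> {..<p} \<rightarrow>\<^sub>E carrier R \<and>
      s = (\<Oplus>\<^bsub>S\<^esub>i\<in>{..<p}. restrict c {..<p} i \<odot>\<^bsub>S\<^esub> (\<alpha> [^]\<^bsub>S\<^esub> i))"
      using cc e by simp
    then have "C s = restrict c {..<p}"
      unfolding C_def by (rule the1_equality[OF ex1[OF s]])
    then show ?thesis using i by simp
  qed
  have Cc: "C s i \<in> carrier R" if "s \<in> carrier S" "i < p" for s i using C(1)[OF that(1)] that(2) by auto
  define f where "f s = (\<Oplus>\<^bsub>T\<^esub>i\<in>{..<p}. C s i \<odot>\<^bsub>T\<^esub> b i)" for s
  have f: "f \<in> module_hom R S T"
  proof (rule module_homI)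
    show "f s \<in> carrier T" if "s \<in> carrier S" for s
      unfolding f_def using Cc[OF that] b by (intro T.M.finsum_closed) auto
    fix s t assume s: "s \<in> carrier S" and t: "t \<in> carrier S"
    have "s \<oplus>\<^bsub>S\<^esub> t = (\<Oplus>\<^bsub>S\<^esub>i\<in>{..<p}. C s i \<odot>\<^bsub>S\<^esub> (\<alpha> [^]\<^bsub>S\<^esub> i)) \<oplus>\<^bsub>S\<^esub> (\<Oplus>\<^bsub>S\<^esub>i\<in>{..<p}. C t i \<odot>\<^bsub>S\<^esub> (\<alpha> [^]\<^bsub>S\<^esub> i))"
      by (rule arg_cong2[OF C(2)[OF s] C(2)[OF t]])
    also have "\<dots> = (\<Oplus>\<^bsub>S\<^esub>i\<in>{..<p}. C s i \<odot>\<^bsub>S\<^esub> (\<alpha> [^]\<^bsub>S\<^esub> i) \<oplus>\<^bsub>S\<^esub> C t i \<odot>\<^bsub>S\<^esub> (\<alpha> [^]\<^bsub>S\<^esub> i))"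
      using Cc s t \<alpha>c by (intro S.finsum_addf[symmetric]) auto
    also have "\<dots> = (\<Oplus>\<^bsub>S\<^esub>i\<in>{..<p}. (C s i \<oplus>\<^bsub>R\<^esub> C t i) \<odot>\<^bsub>S\<^esub> (\<alpha> [^]\<^bsub>S\<^esub> i))"
      using Cc s t \<alpha>c by (intro S.add.finprod_cong') (auto simp: A.smult_l_distr)
    finally have st: "s \<oplus>\<^bsub>S\<^esub> t = (\<Oplus>\<^bsub>S\<^esub>i\<in>{..<p}. (C s i \<oplus>\<^bsub>R\<^esub> C t i) \<odot>\<^bsub>S\<^esub> (\<alpha> [^]\<^bsub>S\<^esub> i))" .
    have "C (s \<oplus>\<^bsub>S\<^esub> t) i = C s i \<oplus>\<^bsub>R\<^esub> C t i" if "i < p" for i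
      using Cc s t that by (intro Ceq[OF _ _ st]) auto
    then have "f (s \<oplus>\<^bsub>S\<^esub> t) = (\<Oplus>\<^bsub>T\<^esub>i\<in>{..<p}. C s i \<odot>\<^bsub>T\<^esub> b i \<oplus>\<^bsub>T\<^esub> C t i \<odot>\<^bsub>T\<^esub> b i)"
      unfolding f_def using Cc s t b by (intro T.M.add.finprod_cong') (auto simp: T.smult_l_distr)
    also have "\<dots> = f s \<oplus>\<^bsub>T\<^esub> f t"
      unfolding f_def using Cc s t b by (intro T.M.finsum_addf) auto
    finally show "f (s \<oplus>\<^bsub>S\<^esub> t) = f s \<oplus>\<^bsub>T\<^esub> f t" .
  next
    fix r s assume r: "r \<in> carrier R" and s: "s \<in> carrier S"
    have "r \<odot>\<^bsub>S\<^esub> s = r \<odot>\<^bsub>S\<^esub> (\<Oplus>\<^bsub>S\<^esub>i\<in>{..<p}. C s i \<odot>\<^bsub>S\<^esub> (\<alpha> [^]\<^bsub>S\<^esub> i))"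
      by (rule arg_cong[OF C(2)[OF s]])
    also have "\<dots> = (\<Oplus>\<^bsub>S\<^esub>i\<in>{..<p}. r \<odot>\<^bsub>S\<^esub> (C s i \<odot>\<^bsub>S\<^esub> (\<alpha> [^]\<^bsub>S\<^esub> i)))"
      using Cc r s \<alpha>c by (intro A.finsum_smult_ldistr) auto
    also have "\<dots> = (\<Oplus>\<^bsub>S\<^esub>i\<in>{..<p}. (r \<otimes>\<^bsub>R\<^esub> C s i) \<odot>\<^bsub>S\<^esub> (\<alpha> [^]\<^bsub>S\<^esub> i))"
      using Cc r s \<alpha>c by (intro S.add.finprod_cong') (auto simp: A.smult_assoc1)
    finally have rs: "r \<odot>\<^bsub>S\<^esub> s = (\<Oplus>\<^bsub>S\<^esub>i\<in>{..<p}. (r \<otimes>\<^bsub>R\<^esub> C s i) \<odot>\<^bsub>S\<^esub> (\<alpha> [^]\<^bsub>S\<^esub> i))" .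
    have "C (r \<odot>\<^bsub>S\<^esub> s) i = r \<otimes>\<^bsub>R\<^esub> C s i" if "i < p" for i
      using Cc r s that by (intro Ceq[OF _ _ rs]) auto
    then have "f (r \<odot>\<^bsub>S\<^esub> s) = (\<Oplus>\<^bsub>T\<^esub>i\<in>{..<p}. r \<odot>\<^bsub>T\<^esub> (C s i \<odot>\<^bsub>T\<^esub> b i))"
      unfolding f_def using Cc r s b by (intro T.M.add.finprod_cong') (auto simp: T.smult_assoc1)
    also have "\<dots> = r \<odot>\<^bsub>T\<^esub> f s"
      unfolding f_def using Cc r s b by (intro T.finsum_smult_ldistr[symmetric]) auto
    finally show "f (r \<odot>\<^bsub>S\<^esub> s) = r \<odot>\<^bsub>T\<^esub> f s" .
  qed
  have "f (\<alpha> [^]\<^bsub>S\<^esub> j) = b j" if j: "j < p" for j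
  proof -
    have "(\<Oplus>\<^bsub>S\<^esub>i\<in>{..<p}. (if j = i then \<one>\<^bsub>R\<^esub> else \<zero>\<^bsub>R\<^esub>) \<odot>\<^bsub>S\<^esub> (\<alpha> [^]\<^bsub>S\<^esub> i)) =
      (\<Oplus>\<^bsub>S\<^esub>i\<in>{..<p}. if j = i then \<alpha> [^]\<^bsub>S\<^esub> i else \<zero>\<^bsub>S\<^esub>)"
      using \<alpha>c by (intro S.add.finprod_cong') auto
    also have "\<dots> = \<alpha> [^]\<^bsub>S\<^esub> j" using \<alpha>c j by (intro S.add.finprod_singleton) auto
    finally have e: "\<alpha> [^]\<^bsub>S\<^esub> j = (\<Oplus>\<^bsub>S\<^esub>i\<in>{..<p}. (if j = i then \<one>\<^bsub>R\<^esub> else \<zero>\<^bsub>R\<^esub>) \<odot>\<^bsub>S\<^esub> (\<alpha> [^]\<^bsub>S\<^esub> i))" ..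
    have "C (\<alpha> [^]\<^bsub>S\<^esub> j) i = (if j = i then \<one>\<^bsub>R\<^esub> else \<zero>\<^bsub>R\<^esub>)" if "i < p" for i
      using \<alpha>c that by (intro Ceq[OF _ _ e]) auto
    then have "f (\<alpha> [^]\<^bsub>S\<^esub> j) = (\<Oplus>\<^bsub>T\<^esub>i\<in>{..<p}. if j = i then b i else \<zero>\<^bsub>T\<^esub>)"
      unfolding f_def using b by (intro T.M.add.finprod_cong') auto
    also have "\<dots> = b j" using b j by (intro T.M.add.finprod_singleton) auto
    finally show ?thesis .
  qed
  then show ?thesis using f by blast
qed

text \<open>\<open>S\<close> behaves as R[X]/(X^p - u): a homomorphism out of it is the choice of a
  p-th root of u in \<open>T\<close>.\<close>

lemma power_basis_hom:
  assumes S: "algebra R S" and T: "algebra R T" and \<alpha>: "power_basis p R S \<alpha>" and p: "p > 0"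
    and u: "u \<in> carrier R" "\<alpha> [^]\<^bsub>S\<^esub> p = structure_map S u"
    and \<beta>: "\<beta> \<in> carrier T" "\<beta> [^]\<^bsub>T\<^esub> p = structure_map T u"
  shows "\<exists>f\<in>algebra_hom R S T. f \<alpha> = \<beta>"
proof -
  interpret R: cring R using algebra.module[OF S] by (rule module.axioms)
  interpret S: cring S using S by (rule algebra.axioms)
  interpret T: cring T using T by (rule algebra.axioms)
  interpret A: R_algebra R S using S by (simp add: R_algebra_def R.is_cring S.is_cring)
  interpret B: R_algebra R T using T by (simp add: R_algebra_def R.is_cring T.is_cring)
  have \<alpha>c: "\<alpha> \<in> carrier S" using \<alpha> by (simp add: power_basis_def)
  obtain f where f: "f \<in> module_hom R S T" and fi: "\<And>i. i < p \<Longrightarrow> f (\<alpha> [^]\<^bsub>S\<^esub> i) = \<beta> [^]\<^bsub>T\<^esub> i"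
    using power_basis_lin_ext[OF S algebra.module[OF T] \<alpha>, of "\<lambda>i. \<beta> [^]\<^bsub>T\<^esub> i"] \<beta>(1) by blast
  note fh = module_homD[OF f]
  \<comment> \<open>Exponents of p or more are lowered by p through \<alpha>^p = u on one side and
    \<beta>^p = u on the other.\<close>
  have fk: "f (\<alpha> [^]\<^bsub>S\<^esub> k) = \<beta> [^]\<^bsub>T\<^esub> k" for k :: nat
  proof (induction k rule: less_induct)
    case (less k)
    show ?case
    proof (cases "k < p")
      case True
      then show ?thesis by (rule fi)
    next
      case False
      then have k: "k = p + (k - p)" by simp
      have "\<alpha> [^]\<^bsub>S\<^esub> k = u \<odot>\<^bsub>S\<^esub> \<alpha> [^]\<^bsub>S\<^esub> (k - p)"
        using \<alpha>c u by (subst k) (simp only: S.nat_pow_mult[symmetric] A.smult_iota S.nat_pow_closed)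
      moreover have "\<beta> [^]\<^bsub>T\<^esub> k = u \<odot>\<^bsub>T\<^esub> \<beta> [^]\<^bsub>T\<^esub> (k - p)"
        using \<beta> u by (subst k) (simp only: T.nat_pow_mult[symmetric] B.smult_iota T.nat_pow_closed)
      ultimately show ?thesis using less[of "k - p"] False p fh(3)[OF u(1)] \<alpha>c by simp
    qed
  qed
  have l: "(\<lambda>y. z \<otimes>\<^bsub>S\<^esub> y) \<in> module_hom R S S" if "z \<in> carrier S" for z
    using that by (intro module_homI) (auto simp: S.r_distr A.smult_iota S.m_lcomm)
  have l': "(\<lambda>y. z \<otimes>\<^bsub>T\<^esub> y) \<in> module_hom R T T" if "z \<in> carrier T" for z
    using that by (intro module_homI) (auto simp: T.r_distr B.smult_iota T.m_lcomm)
  \<comment> \<open>Multiplicativity is proved one argument at a time: for a fixed power of \<alpha>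
    both sides are linear in y and agree on the basis. The next fact does the same in the other
    argument.\<close>
  have 1: "f (\<alpha> [^]\<^bsub>S\<^esub> i \<otimes>\<^bsub>S\<^esub> y) = \<beta> [^]\<^bsub>T\<^esub> i \<otimes>\<^bsub>T\<^esub> f y" if "y \<in> carrier S" for i :: nat and y
  proof (rule power_basis_hom_eqI[OF S algebra.module[OF T] \<alpha> _ _ _ that])
    show "(\<lambda>y. f (\<alpha> [^]\<^bsub>S\<^esub> i \<otimes>\<^bsub>S\<^esub> y)) \<in> module_hom R S T" using \<alpha>c by (intro module_hom_comp[OF l f]) simp
    show "(\<lambda>y. \<beta> [^]\<^bsub>T\<^esub> i \<otimes>\<^bsub>T\<^esub> f y) \<in> module_hom R S T" using \<beta> by (intro module_hom_comp[OF f l']) simp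
  qed (use \<alpha>c \<beta> fk in \<open>simp add: S.nat_pow_mult T.nat_pow_mult\<close>)
  have 2: "f (x \<otimes>\<^bsub>S\<^esub> y) = f x \<otimes>\<^bsub>T\<^esub> f y" if "x \<in> carrier S" "y \<in> carrier S" for x y
  proof -
    have "f (y \<otimes>\<^bsub>S\<^esub> x) = f y \<otimes>\<^bsub>T\<^esub> f x"
    proof (rule power_basis_hom_eqI[OF S algebra.module[OF T] \<alpha> _ _ _ that(1)])
      show "(\<lambda>x. f (y \<otimes>\<^bsub>S\<^esub> x)) \<in> module_hom R S T" by (rule module_hom_comp[OF l[OF that(2)] f])
      show "(\<lambda>x. f y \<otimes>\<^bsub>T\<^esub> f x) \<in> module_hom R S T" by (rule module_hom_comp[OF f l'[OF fh(1)[OF that(2)]]])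
    qed (use 1[OF that(2)] fk that(2) fh(1) \<alpha>c \<beta>(1) in \<open>simp add: S.m_comm[of y] T.m_comm[of "f y"]\<close>)
    then show ?thesis using that fh(1) by (simp add: S.m_comm[of x] T.m_comm[of "f x"])
  qed
  have "f \<in> algebra_hom R S T"
    using fh 2 fk[of 0] by (intro algebra_homI) simp_all
  moreover have "f \<alpha> = \<beta>" using fk[of 1] \<alpha>c \<beta>(1) by simp
  ultimately show ?thesis by blast
qed

text \<open>The homomorphisms in both directions compose to endomorphisms that fix a generator,
  hence to identities.\<close>

lemma power_basis_iso:
  assumes S: "algebra R S" and T: "algebra R T" and p: "p > 0"
    and \<alpha>: "power_basis p R S \<alpha>" and \<beta>: "power_basis p R T \<beta>"
    and u: "u \<in> carrier R" "\<alpha> [^]\<^bsub>S\<^esub> p = structure_map S u" "\<beta> [^]\<^bsub>T\<^esub> p = structure_map T u"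
  shows "\<exists>f\<in>algebra_iso R S T. f \<alpha> = \<beta>"
proof -
  have c: "\<alpha> \<in> carrier S" "\<beta> \<in> carrier T" using \<alpha> \<beta> by (simp_all add: power_basis_def)
  obtain f where f: "f \<in> algebra_hom R S T" "f \<alpha> = \<beta>"
    using power_basis_hom[OF S T \<alpha> p u(1,2) c(2) u(3)] by blast
  obtain g where g: "g \<in> algebra_hom R T S" "g \<beta> = \<alpha>"
    using power_basis_hom[OF T S \<beta> p u(1,3) c(1) u(2)] by blast
  have id: "(\<lambda>x. x) \<in> algebra_hom R U U" for U :: "('a, 'z, 'w) module_scheme"
    by (rule algebra_homI) simp_all
  have "g (f x) = x" if "x \<in> carrier S" for x
    by (rule algebra_hom_eqI[OF S S \<alpha> algebra_hom_comp[OF f(1) g(1)] id _ that]) (simp add: f g)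
  moreover have "f (g x) = x" if "x \<in> carrier T" for x
    by (rule algebra_hom_eqI[OF T T \<beta> algebra_hom_comp[OF g(1) f(1)] id _ that]) (simp add: f g)
  ultimately have "bij_betw f (carrier S) (carrier T)"
    using algebra_homD(1)[OF f(1)] algebra_homD(1)[OF g(1)]
    by (intro bij_betw_byWitness[where f' = g]) auto
  then show ?thesis using algebra_isoI[OF f(1)] f(2) by blast
qed

section \<open>Conjugacy in terms of Kummer units\<close>

context kummerian
begin

text \<open>Separability and strong distinctness are traded here for Galois coordinates, the form in
  which the eigenspace arguments use them.\<close>

lemma p_cyclicD:
  fixes S :: "('r, 's, 'x) module_scheme" and G :: "('g, 'y) monoid_scheme"
  assumes "p_cyclic_galois p R S G \<phi>"
  shows "algebra_action R S G \<phi>" "inj_on (structure_map S) (carrier R)"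
    "group G" "cyclic_group G" "order G = p" "algebra R S"
    "\<exists>(Z :: ('s \<times> 's) set) x y. algebra_action.galois_coordinates S G \<phi> Z x y"
proof -
  interpret X: galois_extension R S G \<phi> using assms by (simp add: p_cyclic_galois_def)
  have S: "cring S" by (rule X.M_cring)
  show alg: "algebra R S" by (rule X.algebra_axioms)
  show act: "algebra_action R S G \<phi>"
    by (intro algebra_action.intro R_algebra.intro algebra_action_axioms.intro)
      (fact R.is_cring S alg X.group_action_axioms X.finite_group X.ring_automorphism X.linear X.fixed_ring)+
  interpret A: algebra_action R S G \<phi> by (rule act)
  show "inj_on (structure_map S) (carrier R)" by (rule X.extension)
  show "group G" by (rule A.G.is_group)
  show "cyclic_group G" "order G = p" using assms by (simp_all add: p_cyclic_galois_def)
  show "\<exists>(Z :: ('s \<times> 's) set) x y. A.galois_coordinates Z x y"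
    by (rule A.galois_coordinates_exist[OF X.separable X.strongly_distinct])
qed

lemma kummer_actionI:
  assumes "algebra_action R S G \<phi>" "order G = p" "\<chi> \<in> hom G M\<mu>" "\<exists>g\<in>carrier G. \<chi> g \<noteq> \<one>\<^bsub>R\<^esub>"
  shows "kummer_action R S G \<phi> p \<mu> \<chi>"
  using assms kummerian_axioms by (simp add: kummer_action_def kummer_action_axioms_def)

lemma primitive_element_exists:
  fixes S :: "('r, 's, 'x) module_scheme" and G :: "('g, 'y) monoid_scheme"
  assumes G: "p_cyclic_galois p R S G \<phi>" and Pic: "torsion_part (Pic R) p = {\<one>\<^bsub>Pic R\<^esub>}"
  shows "\<exists>\<alpha>. primitive_element p R \<mu> S G \<phi> \<alpha>"
proof -
  note D = p_cyclicD[OF G]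
  obtain \<chi> where \<chi>: "\<chi> \<in> hom G M\<mu>" "\<exists>g\<in>carrier G. \<chi> g \<noteq> \<one>\<^bsub>R\<^esub>"
    using mu_character_exists[OF D(3-5)] by blast
  interpret X: kummer_action R S G \<phi> p \<mu> \<chi> by (rule kummer_actionI[OF D(1,5) \<chi>])
  obtain Z :: "('s \<times> 's) set" and x y where coords: "X.galois_coordinates Z x y" using D(7) by blast
  obtain \<alpha> where \<alpha>: "\<alpha> \<in> X.eig 1" "\<And>s. s \<in> X.eig 1 \<Longrightarrow> \<exists>r\<in>carrier R. s = r \<odot>\<^bsub>S\<^esub> \<alpha>"
    using X.eig_one_principal[OF coords D(2) Pic] by blast
  obtain \<beta> where "\<beta> \<in> carrier S" "\<alpha> \<otimes>\<^bsub>S\<^esub> \<beta> = \<one>\<^bsub>S\<^esub>"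
    using X.eig_generator_unit[OF coords \<alpha>] by blast
  then show ?thesis using X.primitiveI[OF \<alpha>(1) _ _ D(2)] by blast
qed

text \<open>The character of the primitive element is the one that puts it into the first
  eigenspace. It generates that eigenspace, so it is invertible and its p-th power comes from a unit
  of \<open>R\<close>.\<close>

lemma primitive_elementE:
  fixes S :: "('r, 's, 'x) module_scheme" and G :: "('g, 'y) monoid_scheme"
  assumes G: "p_cyclic_galois p R S G \<phi>" and \<alpha>: "primitive_element p R \<mu> S G \<phi> \<alpha>"
  obtains \<chi> \<beta> u where "\<chi> \<in> hom G M\<mu>" "\<exists>g\<in>carrier G. \<chi> g \<noteq> \<one>\<^bsub>R\<^esub>"
    "kummer_action R S G \<phi> p \<mu> \<chi>" "\<alpha> \<in> kummer_action.eig R S G \<phi> \<chi> 1"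
    "\<alpha> \<in> carrier S" "\<beta> \<in> carrier S" "\<alpha> \<otimes>\<^bsub>S\<^esub> \<beta> = \<one>\<^bsub>S\<^esub>"
    "u \<in> Units R" "structure_map S u = \<alpha> [^]\<^bsub>S\<^esub> p"
proof -
  note D = p_cyclicD[OF G]
  obtain \<chi> where \<chi>: "\<chi> \<in> hom G M\<mu>" "\<exists>g\<in>carrier G. \<chi> g \<noteq> \<one>\<^bsub>R\<^esub>"
    and ev: "\<And>g. g \<in> carrier G \<Longrightarrow> \<phi> g \<alpha> = \<chi> g \<odot>\<^bsub>S\<^esub> \<alpha>" and pb: "power_basis p R S \<alpha>"
    using \<alpha> unfolding primitive_element_iff by blast
  interpret X: kummer_action R S G \<phi> p \<mu> \<chi> by (rule kummer_actionI[OF D(1,5) \<chi>])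
  obtain Z :: "('s \<times> 's) set" and x y where coords: "X.galois_coordinates Z x y" using D(7) by blast
  have ac: "\<alpha> \<in> carrier S" using pb by (simp add: power_basis_def)
  have ae: "\<alpha> \<in> X.eig 1" using ac ev by (simp add: X.eig_def)
  obtain \<beta> where \<beta>: "\<beta> \<in> carrier S" "\<alpha> \<otimes>\<^bsub>S\<^esub> \<beta> = \<one>\<^bsub>S\<^esub>"
    using X.eig_generator_unit[OF coords ae X.power_basis_eig[OF pb ae]] by blast
  obtain u where "u \<in> Units R" "structure_map S u = \<alpha> [^]\<^bsub>S\<^esub> p"
    using X.power_p_unit[OF ae \<beta> D(2)] by blast
  then show thesis using that[OF \<chi> X.kummer_action_axioms ae ac \<beta>] by blast
qed

text \<open>The structure map is injective, so the definite description has at most one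
  solution.\<close>

lemma kummer_unit_eq:
  assumes G: "p_cyclic_galois p R S G \<phi>" and "u \<in> Units R" "structure_map S u = \<alpha> [^]\<^bsub>S\<^esub> p"
  shows "kummer_unit p R S \<alpha> = u"
  unfolding kummer_unit_def
  using assms(2,3) by (intro the_equality) (auto intro: inj_onD[OF p_cyclicD(2)[OF G]])

text \<open>Equal units give an algebra isomorphism that matches the primitive elements.
  Equivariance then has to hold at the generator only, and this dictates the group
  isomorphism.\<close>

lemma conjugate_if_same_unit:
  fixes S\<^sub>1 :: "('r, 's1) module" and G\<^sub>1 :: "'g1 monoid"
    and S\<^sub>2 :: "('r, 's2) module" and G\<^sub>2 :: "'g2 monoid"
  assumes G1: "p_cyclic_galois p R S\<^sub>1 G\<^sub>1 \<phi>\<^sub>1" and a1: "primitive_element p R \<mu> S\<^sub>1 G\<^sub>1 \<phi>\<^sub>1 \<alpha>\<^sub>1"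
    and G2: "p_cyclic_galois p R S\<^sub>2 G\<^sub>2 \<phi>\<^sub>2" and a2: "primitive_element p R \<mu> S\<^sub>2 G\<^sub>2 \<phi>\<^sub>2 \<alpha>\<^sub>2"
    and u: "u \<in> carrier R" "\<alpha>\<^sub>1 [^]\<^bsub>S\<^sub>1\<^esub> p = structure_map S\<^sub>1 u" "\<alpha>\<^sub>2 [^]\<^bsub>S\<^sub>2\<^esub> p = structure_map S\<^sub>2 u"
  shows "conjugate_extensions R (S\<^sub>1, G\<^sub>1, \<phi>\<^sub>1) (S\<^sub>2, G\<^sub>2, \<phi>\<^sub>2)"
proof -
  note D1 = p_cyclicD[OF G1] and D2 = p_cyclicD[OF G2]
  have pb: "power_basis p R S\<^sub>1 \<alpha>\<^sub>1" "power_basis p R S\<^sub>2 \<alpha>\<^sub>2"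
    using a1 a2 unfolding primitive_element_iff by blast+
  obtain f where f: "f \<in> algebra_iso R S\<^sub>1 S\<^sub>2" "f \<alpha>\<^sub>1 = \<alpha>\<^sub>2"
    using power_basis_iso[OF D1(6) D2(6) p_gt(2) pb u] by blast
  note fh = algebra_isoD[OF f(1)]
  obtain \<chi>\<^sub>1 where c1: "\<chi>\<^sub>1 \<in> hom G\<^sub>1 M\<mu>" "\<exists>g\<in>carrier G\<^sub>1. \<chi>\<^sub>1 g \<noteq> \<one>\<^bsub>R\<^esub>"
    and e1: "\<And>g. g \<in> carrier G\<^sub>1 \<Longrightarrow> \<phi>\<^sub>1 g \<alpha>\<^sub>1 = \<chi>\<^sub>1 g \<odot>\<^bsub>S\<^sub>1\<^esub> \<alpha>\<^sub>1"
    using a1 unfolding primitive_element_iff by blast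
  obtain \<chi>\<^sub>2 where c2: "\<chi>\<^sub>2 \<in> hom G\<^sub>2 M\<mu>" "\<exists>g\<in>carrier G\<^sub>2. \<chi>\<^sub>2 g \<noteq> \<one>\<^bsub>R\<^esub>"
    and e2: "\<And>g. g \<in> carrier G\<^sub>2 \<Longrightarrow> \<phi>\<^sub>2 g \<alpha>\<^sub>2 = \<chi>\<^sub>2 g \<odot>\<^bsub>S\<^sub>2\<^esub> \<alpha>\<^sub>2"
    using a2 unfolding primitive_element_iff by blast
  interpret X1: kummer_action R S\<^sub>1 G\<^sub>1 \<phi>\<^sub>1 p \<mu> \<chi>\<^sub>1 by (rule kummer_actionI[OF D1(1,5) c1])
  interpret X2: kummer_action R S\<^sub>2 G\<^sub>2 \<phi>\<^sub>2 p \<mu> \<chi>\<^sub>2 by (rule kummer_actionI[OF D2(1,5) c2])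
  have i1: "\<chi>\<^sub>1 \<in> iso G\<^sub>1 M\<mu>" using c1(1) X1.chi_bij by (simp add: iso_def)
  have i2: "\<chi>\<^sub>2 \<in> iso G\<^sub>2 M\<mu>" using c2(1) X2.chi_bij by (simp add: iso_def)
  \<comment> \<open>Both characters are bijections onto \<open>\<mu>\<close>; \<tau> matches group
    elements with equal eigenvalues.\<close>
  define \<tau> where "\<tau> = inv_into (carrier G\<^sub>2) \<chi>\<^sub>2 \<circ> \<chi>\<^sub>1"
  have \<tau>: "\<tau> \<in> iso G\<^sub>1 G\<^sub>2"
    unfolding \<tau>_def by (rule iso_set_trans[OF i1 group.iso_set_sym[OF D2(3) i2]])
  have \<tau>c: "\<tau> g \<in> carrier G\<^sub>2" if "g \<in> carrier G\<^sub>1" for g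
    using \<tau> that by (auto simp: iso_def hom_def)
  have \<chi>\<tau>: "\<chi>\<^sub>2 (\<tau> g) = \<chi>\<^sub>1 g" if "g \<in> carrier G\<^sub>1" for g
    unfolding \<tau>_def using X1.chi_mu[OF that] X2.chi_bij by (auto simp: bij_betw_def intro: f_inv_into_f)
  have ac: "\<alpha>\<^sub>1 \<in> carrier S\<^sub>1" using pb by (simp add: power_basis_def)
  have "f (\<phi>\<^sub>1 g s) = \<phi>\<^sub>2 (\<tau> g) (f s)" if g: "g \<in> carrier G\<^sub>1" and s: "s \<in> carrier S\<^sub>1" for g s
  proof (rule algebra_hom_eqI[OF D1(6) D2(6) pb(1) _ _ _ s])
    have h1: "\<phi>\<^sub>1 g \<in> algebra_hom R S\<^sub>1 S\<^sub>1"
      using X1.action_simps[OF g] by (intro algebra_homI) auto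
    have h2: "\<phi>\<^sub>2 (\<tau> g) \<in> algebra_hom R S\<^sub>2 S\<^sub>2"
      using X2.action_simps[OF \<tau>c[OF g]] by (intro algebra_homI) auto
    show "(\<lambda>s. f (\<phi>\<^sub>1 g s)) \<in> algebra_hom R S\<^sub>1 S\<^sub>2" by (rule algebra_hom_comp[OF h1 fh(1)])
    show "(\<lambda>s. \<phi>\<^sub>2 (\<tau> g) (f s)) \<in> algebra_hom R S\<^sub>1 S\<^sub>2" by (rule algebra_hom_comp[OF fh(1) h2])
    show "f (\<phi>\<^sub>1 g \<alpha>\<^sub>1) = \<phi>\<^sub>2 (\<tau> g) (f \<alpha>\<^sub>1)"
      using g ac algebra_homD(5)[OF fh(1)] by (simp add: e1 e2 f(2) \<tau>c \<chi>\<tau>)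
  qed
  then show ?thesis unfolding conjugate_extensions_def using f(1) \<tau> by auto
qed

section \<open>Comparison of characters and of primitive elements\<close>

text \<open>The powers of z below p are distinct, because z^(j-i) is not 1, and there are as many as
  elements of \<open>\<mu>\<close>. The exponent p - i serves in place of an inverse of z^i.\<close>

lemma mu_generated:
  assumes "z \<in> \<mu>" "z \<noteq> \<one>\<^bsub>R\<^esub>" "w \<in> \<mu>"
  shows "\<exists>i<p. w = z [^]\<^bsub>R\<^esub> (i::nat)"
proof -
  have zc: "z \<in> carrier R" using assms(1) by simp
  have ne: "z [^]\<^bsub>R\<^esub> i \<noteq> z [^]\<^bsub>R\<^esub> j" if "i < j" "j < p" for i j :: nat
  proof
    assume eq: "z [^]\<^bsub>R\<^esub> i = z [^]\<^bsub>R\<^esub> j"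
    have "z [^]\<^bsub>R\<^esub> (j - i) = z [^]\<^bsub>R\<^esub> (j - i) \<otimes>\<^bsub>R\<^esub> z [^]\<^bsub>R\<^esub> (i + (p - i))"
      using that mu_pow_p[OF assms(1)] zc by simp
    also have "\<dots> = z [^]\<^bsub>R\<^esub> (j - i + i) \<otimes>\<^bsub>R\<^esub> z [^]\<^bsub>R\<^esub> (p - i)"
      using zc by (simp add: R.nat_pow_mult add.assoc)
    also have "\<dots> = z [^]\<^bsub>R\<^esub> i \<otimes>\<^bsub>R\<^esub> z [^]\<^bsub>R\<^esub> (p - i)" using that eq by simp
    also have "\<dots> = z [^]\<^bsub>R\<^esub> p" using that zc by (simp add: R.nat_pow_mult)
    finally have "z [^]\<^bsub>R\<^esub> (j - i) = \<one>\<^bsub>R\<^esub>" using mu_pow_p[OF assms(1)] by simp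
    moreover have "\<not> p dvd j - i" using that by (auto dest: dvd_imp_le)
    ultimately show False using mu_pow_neq_one[OF assms(1,2)] by blast
  qed
  have "inj_on (\<lambda>i. z [^]\<^bsub>R\<^esub> i) {..<p}"
  proof (rule inj_onI)
    fix i j assume "i \<in> {..<p}" "j \<in> {..<p}" "z [^]\<^bsub>R\<^esub> i = z [^]\<^bsub>R\<^esub> j"
    then show "i = j" using ne[of i j] ne[of j i] by (cases i j rule: linorder_cases) auto
  qed
  then have "card ((\<lambda>i. z [^]\<^bsub>R\<^esub> i) ` {..<p}) = card \<mu>" by (simp add: card_image mu_card)
  moreover have "finite \<mu>" using mu_card p_gt card.infinite by force
  moreover have "(\<lambda>i. z [^]\<^bsub>R\<^esub> i) ` {..<p} \<subseteq> \<mu>" using mu_pow[OF assms(1)] by auto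
  ultimately have "(\<lambda>i. z [^]\<^bsub>R\<^esub> i) ` {..<p} = \<mu>" by (simp add: card_subset_eq)
  then show ?thesis using assms(3) by auto
qed

text \<open>One h with nontrivial value fixes b. Since \<chi> is injective and its values are powers
  of \<chi>(h), every g is a power of h, and the relation spreads to the whole group.\<close>

lemma character_power:
  assumes G: "group G" "order G = p" and c: "\<chi> \<in> hom G M\<mu>" "\<exists>g\<in>carrier G. \<chi> g \<noteq> \<one>\<^bsub>R\<^esub>"
    and d: "\<psi> \<in> hom G M\<mu>" "\<exists>g\<in>carrier G. \<psi> g \<noteq> \<one>\<^bsub>R\<^esub>"
  shows "\<exists>b\<in>{1..<p}. \<forall>g\<in>carrier G. \<psi> g = \<chi> g [^]\<^bsub>R\<^esub> (b::nat)"
proof -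
  interpret G: group G by fact
  interpret c: group_hom G M\<mu> \<chi> using G c M_group by (simp add: group_hom_def group_hom_axioms_def)
  interpret d: group_hom G M\<mu> \<psi> using G d M_group by (simp add: group_hom_def group_hom_axioms_def)
  have bij: "bij_betw \<chi> (carrier G) \<mu>" by (rule mu_character_bij[OF G c])
  obtain h where h: "h \<in> carrier G" "\<chi> h \<noteq> \<one>\<^bsub>R\<^esub>" using c(2) by blast
  have mu: "\<chi> g \<in> \<mu>" "\<psi> g \<in> \<mu>" if "g \<in> carrier G" for g
    using c.hom_closed[OF that] d.hom_closed[OF that] by simp_all
  have pw: "\<chi> (h [^]\<^bsub>G\<^esub> i) = \<chi> h [^]\<^bsub>R\<^esub> i" "\<psi> (h [^]\<^bsub>G\<^esub> i) = \<psi> h [^]\<^bsub>R\<^esub> i" for i :: nat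
    using c.hom_nat_pow[OF h(1)] d.hom_nat_pow[OF h(1)] by (simp_all add: M_pow)
  obtain b where b: "b < p" "\<psi> h = \<chi> h [^]\<^bsub>R\<^esub> b" using mu_generated[OF mu(1)[OF h(1)] h(2) mu(2)[OF h(1)]] by blast
  have all: "\<psi> g = \<chi> g [^]\<^bsub>R\<^esub> b" if g: "g \<in> carrier G" for g
  proof -
    obtain i :: nat where i: "\<chi> g = \<chi> h [^]\<^bsub>R\<^esub> i" using mu_generated[OF mu(1)[OF h(1)] h(2) mu(1)[OF g]] by blast
    then have "\<chi> g = \<chi> (h [^]\<^bsub>G\<^esub> i)" using pw by simp
    then have "g = h [^]\<^bsub>G\<^esub> i" using bij_betw_imp_inj_on[OF bij] g h(1) by (auto simp: inj_on_def)
    then have "\<psi> g = (\<chi> h [^]\<^bsub>R\<^esub> b) [^]\<^bsub>R\<^esub> i" using pw b(2) by simp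
    also have "\<dots> = (\<chi> h [^]\<^bsub>R\<^esub> i) [^]\<^bsub>R\<^esub> b"
      using mu(1)[OF h(1)] by (simp add: R.nat_pow_pow mult.commute)
    finally show ?thesis using i by simp
  qed
  have "b \<noteq> 0"
  proof
    assume "b = 0"
    then show False using all d(2) by auto
  qed
  then show ?thesis using b(1) all by (intro bexI[of _ b]) auto
qed

text \<open>The element is invertible and is an eigenvector for \<chi>^b, a nontrivial character as
  p does not divide b. These are the hypotheses of \<open>primitiveI\<close>.\<close>

lemma primitive_power:
  assumes G: "p_cyclic_galois p R S G \<phi>" and \<alpha>: "primitive_element p R \<mu> S G \<phi> \<alpha>"
    and w: "w \<in> Units R" and b: "\<not> p dvd b"
    and u: "u \<in> Units R" "structure_map S u = \<alpha> [^]\<^bsub>S\<^esub> p"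
  shows "primitive_element p R \<mu> S G \<phi> (w \<odot>\<^bsub>S\<^esub> \<alpha> [^]\<^bsub>S\<^esub> (b::nat))"
    "(w \<odot>\<^bsub>S\<^esub> \<alpha> [^]\<^bsub>S\<^esub> b) [^]\<^bsub>S\<^esub> p = structure_map S (w [^]\<^bsub>R\<^esub> p \<otimes>\<^bsub>R\<^esub> u [^]\<^bsub>R\<^esub> b)"
proof -
  note D = p_cyclicD[OF G]
  obtain \<chi> \<beta> where \<chi>: "\<chi> \<in> hom G M\<mu>" "\<exists>g\<in>carrier G. \<chi> g \<noteq> \<one>\<^bsub>R\<^esub>"
    and K: "kummer_action R S G \<phi> p \<mu> \<chi>" and ae: "\<alpha> \<in> kummer_action.eig R S G \<phi> \<chi> 1"
    and ac: "\<alpha> \<in> carrier S" and \<beta>: "\<beta> \<in> carrier S" "\<alpha> \<otimes>\<^bsub>S\<^esub> \<beta> = \<one>\<^bsub>S\<^esub>"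
    by (rule primitive_elementE[OF G \<alpha>])
  interpret X: kummer_action R S G \<phi> p \<mu> \<chi> by (rule K)
  have cm: "\<chi> g \<in> \<mu>" if "g \<in> carrier G" for g using X.chi_mu[OF that] .
  have \<psi>: "(\<lambda>g. \<chi> g [^]\<^bsub>R\<^esub> b) \<in> hom G M\<mu>"
    using cm mu_pow by (intro homI) (auto simp: X.chi_mult_pow units_of_mult)
  have \<psi>1: "\<exists>g\<in>carrier G. \<chi> g [^]\<^bsub>R\<^esub> b \<noteq> \<one>\<^bsub>R\<^esub>"
    using \<chi>(2) mu_pow_neq_one[OF cm _ b] by blast
  \<comment> \<open>The same action read through \<chi>^b: its first eigenspace is the b-th
    eigenspace for \<chi>.\<close>
  interpret Y: kummer_action R S G \<phi> p \<mu> "\<lambda>g. \<chi> g [^]\<^bsub>R\<^esub> b" by (rule kummer_actionI[OF D(1,5) \<psi> \<psi>1])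
  have wc: "w \<in> carrier R" "inv\<^bsub>R\<^esub> w \<in> carrier R" using w by auto
  have "w \<odot>\<^bsub>S\<^esub> \<alpha> [^]\<^bsub>S\<^esub> b \<in> X.eig b"
    using X.eig_smult[OF wc(1) X.eig_pow[OF ae]] .
  then have e: "w \<odot>\<^bsub>S\<^esub> \<alpha> [^]\<^bsub>S\<^esub> b \<in> Y.eig 1" using cm by (simp add: X.eig_def Y.eig_def)
  have i: "inv\<^bsub>R\<^esub> w \<odot>\<^bsub>S\<^esub> \<beta> [^]\<^bsub>S\<^esub> b \<in> carrier S" using wc \<beta> by simp
  have "(w \<odot>\<^bsub>S\<^esub> \<alpha> [^]\<^bsub>S\<^esub> b) \<otimes>\<^bsub>S\<^esub> (inv\<^bsub>R\<^esub> w \<odot>\<^bsub>S\<^esub> \<beta> [^]\<^bsub>S\<^esub> b) =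
    (X.\<iota> w \<otimes>\<^bsub>S\<^esub> X.\<iota> (inv\<^bsub>R\<^esub> w)) \<otimes>\<^bsub>S\<^esub> (\<alpha> [^]\<^bsub>S\<^esub> b \<otimes>\<^bsub>S\<^esub> \<beta> [^]\<^bsub>S\<^esub> b)"
    using wc ac \<beta>(1) by (simp add: X.smult_iota X.S.m_ac)
  also have "X.\<iota> w \<otimes>\<^bsub>S\<^esub> X.\<iota> (inv\<^bsub>R\<^esub> w) = \<one>\<^bsub>S\<^esub>"
    using w wc ring_hom_mult[OF X.iota_hom, of w "inv\<^bsub>R\<^esub> w"] ring_hom_one[OF X.iota_hom] by simp
  finally have 1: "(w \<odot>\<^bsub>S\<^esub> \<alpha> [^]\<^bsub>S\<^esub> b) \<otimes>\<^bsub>S\<^esub> (inv\<^bsub>R\<^esub> w \<odot>\<^bsub>S\<^esub> \<beta> [^]\<^bsub>S\<^esub> b) = \<one>\<^bsub>S\<^esub>"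
    using X.\<alpha>\<beta>_pow[OF ae \<beta>] by simp
  show "primitive_element p R \<mu> S G \<phi> (w \<odot>\<^bsub>S\<^esub> \<alpha> [^]\<^bsub>S\<^esub> b)"
    using Y.primitiveI[OF e i 1 D(2)] .
  have pw: "X.\<iota> r [^]\<^bsub>S\<^esub> (n::nat) = X.\<iota> (r [^]\<^bsub>R\<^esub> n)" if "r \<in> carrier R" for r n
    using that ring_hom_mult[OF X.iota_hom] ring_hom_one[OF X.iota_hom] by (induction n) auto
  have uc: "u \<in> carrier R" using u by auto
  have "(w \<odot>\<^bsub>S\<^esub> \<alpha> [^]\<^bsub>S\<^esub> b) [^]\<^bsub>S\<^esub> p = X.\<iota> w [^]\<^bsub>S\<^esub> p \<otimes>\<^bsub>S\<^esub> (\<alpha> [^]\<^bsub>S\<^esub> b) [^]\<^bsub>S\<^esub> p"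
    using wc ac by (simp add: X.smult_iota X.S.nat_pow_distrib)
  also have "(\<alpha> [^]\<^bsub>S\<^esub> b) [^]\<^bsub>S\<^esub> p = (\<alpha> [^]\<^bsub>S\<^esub> p) [^]\<^bsub>S\<^esub> b"
    using ac by (simp add: X.S.nat_pow_pow mult.commute)
  finally show "(w \<odot>\<^bsub>S\<^esub> \<alpha> [^]\<^bsub>S\<^esub> b) [^]\<^bsub>S\<^esub> p = structure_map S (w [^]\<^bsub>R\<^esub> p \<otimes>\<^bsub>R\<^esub> u [^]\<^bsub>R\<^esub> b)"
    using wc uc by (simp add: u(2)[symmetric] pw ring_hom_mult[OF X.iota_hom])
qed

text \<open>Carried along the group isomorphism, the first character becomes the b-th power of the
  second. So f \<alpha>1 lies in the b-th eigenspace of the second extension and is r \<alpha>2^b;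
  the claim is the p-th power of this equation.\<close>

lemma conjugate_imp_unit:
  fixes S\<^sub>1 :: "('r, 's1) module" and G\<^sub>1 :: "'g1 monoid"
    and S\<^sub>2 :: "('r, 's2) module" and G\<^sub>2 :: "'g2 monoid"
  assumes G1: "p_cyclic_galois p R S\<^sub>1 G\<^sub>1 \<phi>\<^sub>1" and a1: "primitive_element p R \<mu> S\<^sub>1 G\<^sub>1 \<phi>\<^sub>1 \<alpha>\<^sub>1"
    and G2: "p_cyclic_galois p R S\<^sub>2 G\<^sub>2 \<phi>\<^sub>2" and a2: "primitive_element p R \<mu> S\<^sub>2 G\<^sub>2 \<phi>\<^sub>2 \<alpha>\<^sub>2"
    and u1: "u\<^sub>1 \<in> Units R" "structure_map S\<^sub>1 u\<^sub>1 = \<alpha>\<^sub>1 [^]\<^bsub>S\<^sub>1\<^esub> p"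
    and u2: "u\<^sub>2 \<in> Units R" "structure_map S\<^sub>2 u\<^sub>2 = \<alpha>\<^sub>2 [^]\<^bsub>S\<^sub>2\<^esub> p"
    and conj: "conjugate_extensions R (S\<^sub>1, G\<^sub>1, \<phi>\<^sub>1) (S\<^sub>2, G\<^sub>2, \<phi>\<^sub>2)"
  shows "\<exists>b\<in>{1..<p}. \<exists>w\<in>Units R. u\<^sub>1 = w [^]\<^bsub>R\<^esub> p \<otimes>\<^bsub>R\<^esub> u\<^sub>2 [^]\<^bsub>R\<^esub> (b::nat)"
proof -
  note D1 = p_cyclicD[OF G1] and D2 = p_cyclicD[OF G2]
  obtain \<chi>\<^sub>1 \<beta>\<^sub>1 where c1: "\<chi>\<^sub>1 \<in> hom G\<^sub>1 M\<mu>" "\<exists>g\<in>carrier G\<^sub>1. \<chi>\<^sub>1 g \<noteq> \<one>\<^bsub>R\<^esub>"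
    and K1: "kummer_action R S\<^sub>1 G\<^sub>1 \<phi>\<^sub>1 p \<mu> \<chi>\<^sub>1" and ae1: "\<alpha>\<^sub>1 \<in> kummer_action.eig R S\<^sub>1 G\<^sub>1 \<phi>\<^sub>1 \<chi>\<^sub>1 1"
    and ac1: "\<alpha>\<^sub>1 \<in> carrier S\<^sub>1" and b1: "\<beta>\<^sub>1 \<in> carrier S\<^sub>1" "\<alpha>\<^sub>1 \<otimes>\<^bsub>S\<^sub>1\<^esub> \<beta>\<^sub>1 = \<one>\<^bsub>S\<^sub>1\<^esub>"
    by (rule primitive_elementE[OF G1 a1])
  obtain \<chi>\<^sub>2 \<beta>\<^sub>2 where c2: "\<chi>\<^sub>2 \<in> hom G\<^sub>2 M\<mu>" "\<exists>g\<in>carrier G\<^sub>2. \<chi>\<^sub>2 g \<noteq> \<one>\<^bsub>R\<^esub>"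
    and K2: "kummer_action R S\<^sub>2 G\<^sub>2 \<phi>\<^sub>2 p \<mu> \<chi>\<^sub>2" and ae2: "\<alpha>\<^sub>2 \<in> kummer_action.eig R S\<^sub>2 G\<^sub>2 \<phi>\<^sub>2 \<chi>\<^sub>2 1"
    and ac2: "\<alpha>\<^sub>2 \<in> carrier S\<^sub>2" and b2: "\<beta>\<^sub>2 \<in> carrier S\<^sub>2" "\<alpha>\<^sub>2 \<otimes>\<^bsub>S\<^sub>2\<^esub> \<beta>\<^sub>2 = \<one>\<^bsub>S\<^sub>2\<^esub>"
    by (rule primitive_elementE[OF G2 a2])
  interpret X1: kummer_action R S\<^sub>1 G\<^sub>1 \<phi>\<^sub>1 p \<mu> \<chi>\<^sub>1 by (rule K1)
  interpret X2: kummer_action R S\<^sub>2 G\<^sub>2 \<phi>\<^sub>2 p \<mu> \<chi>\<^sub>2 by (rule K2)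
  obtain f \<tau> where f: "f \<in> algebra_iso R S\<^sub>1 S\<^sub>2" and \<tau>: "\<tau> \<in> iso G\<^sub>1 G\<^sub>2"
    and eqv: "\<And>g s. g \<in> carrier G\<^sub>1 \<Longrightarrow> s \<in> carrier S\<^sub>1 \<Longrightarrow> f (\<phi>\<^sub>1 g s) = \<phi>\<^sub>2 (\<tau> g) (f s)"
    using conj unfolding conjugate_extensions_def by auto
  note fh = algebra_isoD(1)[OF f] and fs = algebra_homD[OF algebra_isoD(1)[OF f]]
  define \<sigma> where "\<sigma> = inv_into (carrier G\<^sub>1) \<tau>"
  have \<sigma>: "\<sigma> \<in> iso G\<^sub>2 G\<^sub>1" unfolding \<sigma>_def by (rule group.iso_set_sym[OF D1(3) \<tau>])
  have \<sigma>c: "\<sigma> g \<in> carrier G\<^sub>1" "\<tau> (\<sigma> g) = g" if "g \<in> carrier G\<^sub>2" for g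
    using \<tau> that unfolding \<sigma>_def by (auto simp: iso_def bij_betw_def intro: inv_into_into f_inv_into_f)
  have \<psi>: "\<chi>\<^sub>1 \<circ> \<sigma> \<in> hom G\<^sub>2 M\<mu>"
    using \<sigma> c1(1) by (intro hom_compose[of _ _ G\<^sub>1]) (auto simp: iso_def)
  have \<psi>1: "\<exists>g\<in>carrier G\<^sub>2. (\<chi>\<^sub>1 \<circ> \<sigma>) g \<noteq> \<one>\<^bsub>R\<^esub>"
  proof -
    obtain h where h: "h \<in> carrier G\<^sub>1" "\<chi>\<^sub>1 h \<noteq> \<one>\<^bsub>R\<^esub>" using c1(2) by blast
    have "\<sigma> (\<tau> h) = h" "\<tau> h \<in> carrier G\<^sub>2"
      using \<tau> h(1) unfolding \<sigma>_def by (auto simp: iso_def bij_betw_def)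
    then show ?thesis using h(2) by (intro bexI[of _ "\<tau> h"]) auto
  qed
  obtain b where b: "b \<in> {1..<p}" "\<And>g. g \<in> carrier G\<^sub>2 \<Longrightarrow> \<chi>\<^sub>1 (\<sigma> g) = \<chi>\<^sub>2 g [^]\<^bsub>R\<^esub> (b::nat)"
    using character_power[OF D2(3,5) c2 \<psi> \<psi>1] by auto
  have fe: "f \<alpha>\<^sub>1 \<in> X2.eig b"
  proof -
    have "\<phi>\<^sub>2 g (f \<alpha>\<^sub>1) = \<chi>\<^sub>2 g [^]\<^bsub>R\<^esub> b \<odot>\<^bsub>S\<^sub>2\<^esub> f \<alpha>\<^sub>1" if g: "g \<in> carrier G\<^sub>2" for g
    proof -
      have "\<phi>\<^sub>2 g (f \<alpha>\<^sub>1) = f (\<phi>\<^sub>1 (\<sigma> g) \<alpha>\<^sub>1)" using eqv[OF \<sigma>c(1)[OF g] ac1] \<sigma>c(2)[OF g] by simp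
      also have "\<phi>\<^sub>1 (\<sigma> g) \<alpha>\<^sub>1 = \<chi>\<^sub>1 (\<sigma> g) \<odot>\<^bsub>S\<^sub>1\<^esub> \<alpha>\<^sub>1"
        using X1.eigD[OF ae1 \<sigma>c(1)[OF g]] X1.chi_closed[OF \<sigma>c(1)[OF g]] by simp
      also have "f \<dots> = \<chi>\<^sub>1 (\<sigma> g) \<odot>\<^bsub>S\<^sub>2\<^esub> f \<alpha>\<^sub>1" using X1.chi_closed[OF \<sigma>c(1)[OF g]] ac1 by (rule fs(5))
      finally show ?thesis using b(2)[OF g] by simp
    qed
    then show ?thesis using fs(1)[OF ac1] by (simp add: X2.eig_def)
  qed
  obtain r where r: "r \<in> carrier R" "f \<alpha>\<^sub>1 = r \<odot>\<^bsub>S\<^sub>2\<^esub> \<alpha>\<^sub>2 [^]\<^bsub>S\<^sub>2\<^esub> b"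
    using X2.eig_generated[OF ae2 b2 fe] by blast
  have fb: "f \<alpha>\<^sub>1 \<otimes>\<^bsub>S\<^sub>2\<^esub> f \<beta>\<^sub>1 = \<one>\<^bsub>S\<^sub>2\<^esub>" using fs(2)[OF ac1 b1(1)] b1(2) fs(4) by simp
  have fbc: "f \<beta>\<^sub>1 \<in> carrier S\<^sub>2" by (rule fs(1)[OF b1(1)])
  have "f \<beta>\<^sub>1 \<in> X2.eig (b * (p - 1))" by (rule X2.inverse_eig[OF fe fbc fb X2.dual_index(2)])
  then have "\<alpha>\<^sub>2 [^]\<^bsub>S\<^sub>2\<^esub> b \<otimes>\<^bsub>S\<^sub>2\<^esub> f \<beta>\<^sub>1 \<in> X2.eig (b + b * (p - 1))" by (rule X2.eig_mult[OF X2.eig_pow[OF ae2]])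
  then have "\<alpha>\<^sub>2 [^]\<^bsub>S\<^sub>2\<^esub> b \<otimes>\<^bsub>S\<^sub>2\<^esub> f \<beta>\<^sub>1 \<in> X2.eig 0"
    using X2.eig_dvd[OF X2.dual_index(2)] X2.eig_zero by simp
  moreover have "X2.\<iota> r \<otimes>\<^bsub>S\<^sub>2\<^esub> (\<alpha>\<^sub>2 [^]\<^bsub>S\<^sub>2\<^esub> b \<otimes>\<^bsub>S\<^sub>2\<^esub> f \<beta>\<^sub>1) = \<one>\<^bsub>S\<^sub>2\<^esub>"
    using fb r ac2 fbc by (simp add: X2.smult_iota X2.S.m_assoc)
  \<comment> \<open>The product of \<alpha>2^b with the inverse of f \<alpha>1 has an index
    divisible by p, so it comes from \<open>R\<close> and inverts r there.\<close>
  ultimately have rU: "r \<in> Units R" by (rule X2.iota_unit[OF ae2 b2 D2(2) r(1)])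
  have nd: "\<not> p dvd b" using b(1) by (auto dest: dvd_imp_le)
  have "structure_map S\<^sub>2 u\<^sub>1 = f (structure_map S\<^sub>1 u\<^sub>1)"
    using algebra_hom_structure_map[OF D1(6) fh, of u\<^sub>1] u1(1) by auto
  also have "\<dots> = f \<alpha>\<^sub>1 [^]\<^bsub>S\<^sub>2\<^esub> p" unfolding u1(2) by (rule algebra_hom_pow[OF D1(6) fh ac1])
  also have "\<dots> = structure_map S\<^sub>2 (r [^]\<^bsub>R\<^esub> p \<otimes>\<^bsub>R\<^esub> u\<^sub>2 [^]\<^bsub>R\<^esub> b)"
    unfolding r(2) by (rule primitive_power(2)[OF G2 a2 rU nd u2])
  finally have "u\<^sub>1 = r [^]\<^bsub>R\<^esub> p \<otimes>\<^bsub>R\<^esub> u\<^sub>2 [^]\<^bsub>R\<^esub> b"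
    using u1(1) u2(1) r(1) by (intro inj_onD[OF D2(2)]) auto
  then show ?thesis using b(1) rU by blast
qed

text \<open>For the direction from units, w \<alpha>2^b is another primitive element of the second
  extension, with unit \<open>u\<^sub>1\<close>; equal units imply conjugacy.\<close>

lemma conjugate_iff_unit:
  fixes S\<^sub>1 :: "('r, 's1) module" and G\<^sub>1 :: "'g1 monoid"
    and S\<^sub>2 :: "('r, 's2) module" and G\<^sub>2 :: "'g2 monoid"
  assumes G1: "p_cyclic_galois p R S\<^sub>1 G\<^sub>1 \<phi>\<^sub>1" and a1: "primitive_element p R \<mu> S\<^sub>1 G\<^sub>1 \<phi>\<^sub>1 \<alpha>\<^sub>1"
    and G2: "p_cyclic_galois p R S\<^sub>2 G\<^sub>2 \<phi>\<^sub>2" and a2: "primitive_element p R \<mu> S\<^sub>2 G\<^sub>2 \<phi>\<^sub>2 \<alpha>\<^sub>2"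
    and u1: "u\<^sub>1 \<in> Units R" "structure_map S\<^sub>1 u\<^sub>1 = \<alpha>\<^sub>1 [^]\<^bsub>S\<^sub>1\<^esub> p"
    and u2: "u\<^sub>2 \<in> Units R" "structure_map S\<^sub>2 u\<^sub>2 = \<alpha>\<^sub>2 [^]\<^bsub>S\<^sub>2\<^esub> p"
  shows "conjugate_extensions R (S\<^sub>1, G\<^sub>1, \<phi>\<^sub>1) (S\<^sub>2, G\<^sub>2, \<phi>\<^sub>2) \<longleftrightarrow>
    (\<exists>b\<in>{1..<p}. \<exists>w\<in>Units R. u\<^sub>1 = w [^]\<^bsub>R\<^esub> p \<otimes>\<^bsub>R\<^esub> u\<^sub>2 [^]\<^bsub>R\<^esub> (b::nat))"
proof
  assume "\<exists>b\<in>{1..<p}. \<exists>w\<in>Units R. u\<^sub>1 = w [^]\<^bsub>R\<^esub> p \<otimes>\<^bsub>R\<^esub> u\<^sub>2 [^]\<^bsub>R\<^esub> (b::nat)"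
  then obtain b w where b: "b \<in> {1..<p}" and w: "w \<in> Units R" "u\<^sub>1 = w [^]\<^bsub>R\<^esub> p \<otimes>\<^bsub>R\<^esub> u\<^sub>2 [^]\<^bsub>R\<^esub> (b::nat)" by blast
  have nd: "\<not> p dvd b" using b by (auto dest: dvd_imp_le)
  note P = primitive_power[OF G2 a2 w(1) nd u2]
  show "conjugate_extensions R (S\<^sub>1, G\<^sub>1, \<phi>\<^sub>1) (S\<^sub>2, G\<^sub>2, \<phi>\<^sub>2)"
    by (rule conjugate_if_same_unit[OF G1 a1 G2 P(1), of u\<^sub>1])
      (use u1 w(2) P(2) in auto)
qed (rule conjugate_imp_unit[OF G1 a1 G2 a2 u1 u2])

end

section \<open>Existence of Kummer extensions\<close>

lemma power_basis_coeff:
  assumes "algebra R S" "power_basis p R S \<alpha>" "c \<in> {..<p} \<rightarrow> carrier R" "d \<in> {..<p} \<rightarrow> carrier R"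
    and eq: "(\<Oplus>\<^bsub>S\<^esub>i\<in>{..<p}. c i \<odot>\<^bsub>S\<^esub> \<alpha> [^]\<^bsub>S\<^esub> i) = (\<Oplus>\<^bsub>S\<^esub>i\<in>{..<p}. d i \<odot>\<^bsub>S\<^esub> \<alpha> [^]\<^bsub>S\<^esub> i)" and j: "j < p"
  shows "c j = d j"
proof -
  interpret S: cring S using assms(1) by (rule algebra.axioms)
  interpret A: algebra R S by fact
  have \<alpha>c: "\<alpha> \<in> carrier S" using assms(2) by (simp add: power_basis_def)
  define s where "s = (\<Oplus>\<^bsub>S\<^esub>i\<in>{..<p}. d i \<odot>\<^bsub>S\<^esub> \<alpha> [^]\<^bsub>S\<^esub> i)"
  have cc: "c i \<in> carrier R" "d i \<in> carrier R" if "i < p" for i using assms(3,4) that by auto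
  have sc: "s \<in> carrier S" unfolding s_def using cc \<alpha>c by (intro S.finsum_closed) auto
  have r: "s = (\<Oplus>\<^bsub>S\<^esub>i\<in>{..<p}. restrict c {..<p} i \<odot>\<^bsub>S\<^esub> \<alpha> [^]\<^bsub>S\<^esub> i)"
    unfolding s_def eq[symmetric] using cc \<alpha>c by (intro S.add.finprod_cong') auto
  have r': "s = (\<Oplus>\<^bsub>S\<^esub>i\<in>{..<p}. restrict d {..<p} i \<odot>\<^bsub>S\<^esub> \<alpha> [^]\<^bsub>S\<^esub> i)"
    unfolding s_def using cc \<alpha>c by (intro S.add.finprod_cong') auto
  have "\<exists>!c. c \<in> {..<p} \<rightarrow>\<^sub>E carrier R \<and> s = (\<Oplus>\<^bsub>S\<^esub>i\<in>{..<p}. c i \<odot>\<^bsub>S\<^esub> (\<alpha> [^]\<^bsub>S\<^esub> i))"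
    using assms(2) sc unfolding power_basis_def by (elim conjE) (rule bspec)
  moreover have "restrict c {..<p} \<in> {..<p} \<rightarrow>\<^sub>E carrier R" "restrict d {..<p} \<in> {..<p} \<rightarrow>\<^sub>E carrier R"
    using cc by auto
  ultimately have "restrict c {..<p} = restrict d {..<p}" using r r' by (blast dest: ex1_implies_ex)
  then show ?thesis using j by (metis lessThan_iff restrict_apply')
qed

lemma cyclic_integer_mod_group:
  assumes "p > 0"
  shows "cyclic_group (integer_mod_group p)"
proof -
  interpret group "integer_mod_group p" by (rule group_integer_mod_group)
  \<comment> \<open>The generator is written \<open>1 mod int p\<close> so that the trivial group, p
    = 1, is covered.\<close>
  have "x \<in> range (\<lambda>n. (n * (1 mod int p)) mod int p)" if "x \<in> {0..<int p}" for x :: int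
    using that by (intro range_eqI[of _ _ x]) (simp add: mod_mult_right_eq)
  then have "{0..<int p} = range (\<lambda>n. (n * (1 mod int p)) mod int p)" using assms by auto
  then have "carrier (integer_mod_group p) = range (\<lambda>n::int. (1 mod int p) [^]\<^bsub>integer_mod_group p\<^esub> n)"
    using assms by (simp add: int_pow_integer_mod_group carrier_integer_mod_group)
  moreover have "1 mod int p \<in> carrier (integer_mod_group p)"
    using assms by (simp add: carrier_integer_mod_group)
  ultimately show ?thesis unfolding cyclic_group by blast
qed

context kummerian
begin

text \<open>The group acts by \<alpha> -> \<chi>(g) \<alpha>, which respects \<alpha>^p = u because
  \<chi>(g)^p = 1. Explicit Galois coordinates then give separability.\<close>

lemma power_basis_galois:
  fixes S :: "('r, 's, 'x) module_scheme"
  assumes S: "algebra R S" and \<alpha>: "power_basis p R S \<alpha>"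
    and u: "u \<in> Units R" "\<alpha> [^]\<^bsub>S\<^esub> p = structure_map S u"
  shows "\<exists>\<phi>. galois_extension R S (integer_mod_group p) \<phi> \<and>
    primitive_element p R \<mu> S (integer_mod_group p) \<phi> \<alpha>"
proof -
  let ?G = "integer_mod_group p"
  interpret S: cring S using S by (rule algebra.axioms)
  interpret A: R_algebra R S using S by (simp add: R_algebra_def R.is_cring S.is_cring)
  interpret G: group ?G by (rule group_integer_mod_group)
  have oG: "order ?G = p" using p_gt by (simp add: order_def carrier_integer_mod_group)
  have cyc: "cyclic_group ?G" using p_gt(2) by (rule cyclic_integer_mod_group)
  obtain \<chi> where \<chi>: "\<chi> \<in> hom ?G M\<mu>" "\<exists>g\<in>carrier ?G. \<chi> g \<noteq> \<one>\<^bsub>R\<^esub>"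
    using mu_character_exists[OF G.is_group cyc oG] by blast
  have bij: "bij_betw \<chi> (carrier ?G) \<mu>" by (rule mu_character_bij[OF G.is_group oG \<chi>])
  have cm: "\<chi> g \<in> \<mu>" "\<chi> g \<in> carrier R" if "g \<in> carrier ?G" for g
    using bij that by (auto simp: bij_betw_def)
  have cmult: "\<chi> (g \<otimes>\<^bsub>?G\<^esub> h) = \<chi> g \<otimes>\<^bsub>R\<^esub> \<chi> h" if "g \<in> carrier ?G" "h \<in> carrier ?G" for g h
    using hom_mult[OF \<chi>(1) that] by (simp add: units_of_mult del: mult_integer_mod_group)
  have cone: "\<chi> \<one>\<^bsub>?G\<^esub> = \<one>\<^bsub>R\<^esub>"
    using hom_one[OF \<chi>(1) G.is_group M_group] by (simp add: units_of_one)
  have cinj: "\<chi> g = \<chi> h \<longleftrightarrow> g = h" if "g \<in> carrier ?G" "h \<in> carrier ?G" for g h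
    using bij that by (auto simp: bij_betw_def inj_on_def)
  have ac: "\<alpha> \<in> carrier S" using \<alpha> by (simp add: power_basis_def)
  have uc: "u \<in> carrier R" "inv\<^bsub>R\<^esub> u \<in> carrier R" using u(1) by auto
  \<comment> \<open>The inverse of \<alpha>, read off from \<alpha>^p = u.\<close>
  define \<beta> where "\<beta> = \<alpha> [^]\<^bsub>S\<^esub> (p - 1) \<otimes>\<^bsub>S\<^esub> structure_map S (inv\<^bsub>R\<^esub> u)"
  have bc: "\<beta> \<in> carrier S" unfolding \<beta>_def using ac uc by simp
  have "\<alpha> \<otimes>\<^bsub>S\<^esub> \<beta> = \<alpha> [^]\<^bsub>S\<^esub> Suc (p - 1) \<otimes>\<^bsub>S\<^esub> structure_map S (inv\<^bsub>R\<^esub> u)"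
    unfolding \<beta>_def using ac uc by (simp add: S.m_ac)
  also have "\<dots> = structure_map S (u \<otimes>\<^bsub>R\<^esub> inv\<^bsub>R\<^esub> u)"
    using p_gt u(2) uc ring_hom_mult[OF A.iota_hom] by simp
  finally have ab: "\<alpha> \<otimes>\<^bsub>S\<^esub> \<beta> = \<one>\<^bsub>S\<^esub>" using u(1) ring_hom_one[OF A.iota_hom] by simp
  have abp: "\<alpha> [^]\<^bsub>S\<^esub> (n::nat) \<otimes>\<^bsub>S\<^esub> \<beta> [^]\<^bsub>S\<^esub> n = \<one>\<^bsub>S\<^esub>" for n
    using ac bc ab by (simp flip: S.nat_pow_distrib)
  have sum0: "(\<Oplus>\<^bsub>S\<^esub>i\<in>{..<p}. (if 0 = i then r else \<zero>\<^bsub>R\<^esub>) \<odot>\<^bsub>S\<^esub> \<alpha> [^]\<^bsub>S\<^esub> i) = A.\<iota> r"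
    if r: "r \<in> carrier R" for r
  proof -
    have "(\<Oplus>\<^bsub>S\<^esub>i\<in>{..<p}. (if 0 = i then r else \<zero>\<^bsub>R\<^esub>) \<odot>\<^bsub>S\<^esub> \<alpha> [^]\<^bsub>S\<^esub> i) =
      (\<Oplus>\<^bsub>S\<^esub>i\<in>{..<p}. if 0 = i then r \<odot>\<^bsub>S\<^esub> \<alpha> [^]\<^bsub>S\<^esub> i else \<zero>\<^bsub>S\<^esub>)"
      using r ac by (intro S.add.finprod_cong') auto
    also have "\<dots> = r \<odot>\<^bsub>S\<^esub> \<alpha> [^]\<^bsub>S\<^esub> (0::nat)"
      using r ac p_gt by (intro S.add.finprod_singleton) auto
    finally show ?thesis by (simp add: structure_map_def)
  qed
  have iinj: "inj_on A.\<iota> (carrier R)"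
  proof (rule inj_onI)
    fix r r' assume r: "r \<in> carrier R" "r' \<in> carrier R" and eq: "A.\<iota> r = A.\<iota> r'"
    show "r = r'"
      using power_basis_coeff[OF S \<alpha>, of "\<lambda>i. if 0 = i then r else \<zero>\<^bsub>R\<^esub>" "\<lambda>i. if 0 = i then r' else \<zero>\<^bsub>R\<^esub>" 0]
        sum0[OF r(1)] sum0[OF r(2)] eq r p_gt by simp
  qed
  have "\<forall>g\<in>carrier ?G. \<exists>f\<in>algebra_hom R S S. f \<alpha> = \<chi> g \<odot>\<^bsub>S\<^esub> \<alpha>"
  proof
    fix g assume g: "g \<in> carrier ?G"
    have pw: "A.\<iota> r [^]\<^bsub>S\<^esub> (n::nat) = A.\<iota> (r [^]\<^bsub>R\<^esub> n)" if "r \<in> carrier R" for r n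
      using that ring_hom_mult[OF A.iota_hom] ring_hom_one[OF A.iota_hom] by (induction n) auto
    have "(\<chi> g \<odot>\<^bsub>S\<^esub> \<alpha>) [^]\<^bsub>S\<^esub> p = A.\<iota> (\<chi> g [^]\<^bsub>R\<^esub> p) \<otimes>\<^bsub>S\<^esub> \<alpha> [^]\<^bsub>S\<^esub> p"
      using cm(2)[OF g] ac by (simp add: A.smult_iota S.nat_pow_distrib pw)
    also have "\<dots> = A.\<iota> u"
      using mu_pow_p[OF cm(1)[OF g]] ring_hom_one[OF A.iota_hom] u(2) uc by simp
    finally show "\<exists>f\<in>algebra_hom R S S. f \<alpha> = \<chi> g \<odot>\<^bsub>S\<^esub> \<alpha>"
      using power_basis_hom[OF S S \<alpha> p_gt(2) uc(1) u(2), of "\<chi> g \<odot>\<^bsub>S\<^esub> \<alpha>"] cm(2)[OF g] ac by simp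
  qed
  then obtain F where F: "\<And>g. g \<in> carrier ?G \<Longrightarrow> F g \<in> algebra_hom R S S"
    "\<And>g. g \<in> carrier ?G \<Longrightarrow> F g \<alpha> = \<chi> g \<odot>\<^bsub>S\<^esub> \<alpha>" by metis
  note Fh = algebra_homD[OF F(1)]
  \<comment> \<open>A \<open>group_action\<close> takes values in the extensional bijections of the
    carrier, hence the restriction.\<close>
  define \<phi> where "\<phi> g = restrict (F g) (carrier S)" for g
  have \<phi>F: "\<phi> g s = F g s" if "s \<in> carrier S" for g s using that by (simp add: \<phi>_def)
  have Fc: "F (g \<otimes>\<^bsub>?G\<^esub> h) s = F g (F h s)" if g: "g \<in> carrier ?G" "h \<in> carrier ?G" and s: "s \<in> carrier S" for g h s
  proof (rule algebra_hom_eqI[OF S S \<alpha> F(1)[OF G.m_closed[OF g]] algebra_hom_comp[OF F(1)[OF g(2)] F(1)[OF g(1)]] _ s])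
    have "F g (F h \<alpha>) = \<chi> h \<odot>\<^bsub>S\<^esub> (\<chi> g \<odot>\<^bsub>S\<^esub> \<alpha>)"
      using Fh(5)[OF g(1) cm(2)[OF g(2)] ac] by (simp add: F(2) g)
    also have "\<dots> = (\<chi> g \<otimes>\<^bsub>R\<^esub> \<chi> h) \<odot>\<^bsub>S\<^esub> \<alpha>"
      using cm(2)[OF g(1)] cm(2)[OF g(2)] ac by (simp add: A.A.smult_assoc1[symmetric] R.m_comm)
    also have "\<dots> = F (g \<otimes>\<^bsub>?G\<^esub> h) \<alpha>" unfolding F(2)[OF G.m_closed[OF g]] cmult[OF g] ..
    finally show "F (g \<otimes>\<^bsub>?G\<^esub> h) \<alpha> = F g (F h \<alpha>)" ..
  qed
  have idh: "(\<lambda>x. x) \<in> algebra_hom R S S" by (rule algebra_homI) simp_all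
  have F1: "F \<one>\<^bsub>?G\<^esub> s = s" if s: "s \<in> carrier S" for s
  proof (rule algebra_hom_eqI[OF S S \<alpha> F(1)[OF G.one_closed] idh _ s])
    show "F \<one>\<^bsub>?G\<^esub> \<alpha> = \<alpha>" unfolding F(2)[OF G.one_closed] cone using ac by simp
  qed
  have Fbij: "bij_betw (F g) (carrier S) (carrier S)" if g: "g \<in> carrier ?G" for g
  proof (rule bij_betw_byWitness[where f' = "F (inv\<^bsub>?G\<^esub> g)"])
    have ig: "inv\<^bsub>?G\<^esub> g \<in> carrier ?G" using g by (rule G.inv_closed)
    show "\<forall>a\<in>carrier S. F (inv\<^bsub>?G\<^esub> g) (F g a) = a"
    proof
      fix a assume a: "a \<in> carrier S"
      show "F (inv\<^bsub>?G\<^esub> g) (F g a) = a" unfolding Fc[OF ig g a, symmetric] G.l_inv[OF g] by (rule F1[OF a])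
    qed
    show "\<forall>a\<in>carrier S. F g (F (inv\<^bsub>?G\<^esub> g) a) = a"
    proof
      fix a assume a: "a \<in> carrier S"
      show "F g (F (inv\<^bsub>?G\<^esub> g) a) = a" unfolding Fc[OF g ig a, symmetric] G.r_inv[OF g] by (rule F1[OF a])
    qed
    show "F g ` carrier S \<subseteq> carrier S" "F (inv\<^bsub>?G\<^esub> g) ` carrier S \<subseteq> carrier S"
      using Fh(1)[OF g] Fh(1)[OF ig] by auto
  qed
  have \<phi>bij: "\<phi> g \<in> Bij (carrier S)" if g: "g \<in> carrier ?G" for g
  proof -
    have "bij_betw (\<phi> g) (carrier S) (carrier S)"
      by (rule iffD2[OF bij_betw_cong Fbij[OF g]]) (rule \<phi>F)
    then show ?thesis by (simp add: Bij_def \<phi>_def)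
  qed
  have act: "group_action ?G (carrier S) \<phi>"
  proof (intro group_action.intro group_hom.intro group_hom_axioms.intro)
    show "\<phi> \<in> hom ?G (BijGroup (carrier S))"
    proof (rule homI)
      fix g h assume g: "g \<in> carrier ?G" and h: "h \<in> carrier ?G"
      have "\<phi> (g \<otimes>\<^bsub>?G\<^esub> h) = compose (carrier S) (\<phi> g) (\<phi> h)"
        using Fc[OF g h] Fh(1)[OF h] by (auto simp: \<phi>_def compose_def fun_eq_iff)
      then show "\<phi> (g \<otimes>\<^bsub>?G\<^esub> h) = \<phi> g \<otimes>\<^bsub>BijGroup (carrier S)\<^esub> \<phi> h"
        using \<phi>bij[OF g] \<phi>bij[OF h] by (simp add: BijGroup_def)
    qed (simp add: BijGroup_def \<phi>bij)
  qed (simp_all add: group_BijGroup)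
  have \<phi>iso: "\<phi> g \<in> ring_iso S S" if g: "g \<in> carrier ?G" for g
    using \<phi>bij[OF g] Fh[OF g] by (auto simp: ring_iso_def Bij_def \<phi>_def intro!: ring_hom_memI)
  have \<phi>lin: "\<phi> g (r \<odot>\<^bsub>S\<^esub> s) = r \<odot>\<^bsub>S\<^esub> \<phi> g s" if "g \<in> carrier ?G" "r \<in> carrier R" "s \<in> carrier S" for g r s
    using that Fh(5)[OF that] by (simp add: \<phi>F)
  have \<phi>\<alpha>: "\<phi> g (\<alpha> [^]\<^bsub>S\<^esub> i) = \<chi> g [^]\<^bsub>R\<^esub> i \<odot>\<^bsub>S\<^esub> \<alpha> [^]\<^bsub>S\<^esub> i" if g: "g \<in> carrier ?G" for g and i :: nat
  proof (induction i)
    case 0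
    show ?case using Fh(4)[OF g] by (simp add: \<phi>F)
  next
    case (Suc i)
    have "\<phi> g (\<alpha> [^]\<^bsub>S\<^esub> Suc i) = (\<chi> g [^]\<^bsub>R\<^esub> i \<odot>\<^bsub>S\<^esub> \<alpha> [^]\<^bsub>S\<^esub> i) \<otimes>\<^bsub>S\<^esub> (\<chi> g \<odot>\<^bsub>S\<^esub> \<alpha>)"
      using Suc.IH Fh(2)[OF g] F(2)[OF g] ac by (simp add: \<phi>F)
    also have "\<dots> = (A.\<iota> (\<chi> g [^]\<^bsub>R\<^esub> i) \<otimes>\<^bsub>S\<^esub> A.\<iota> (\<chi> g)) \<otimes>\<^bsub>S\<^esub> (\<alpha> [^]\<^bsub>S\<^esub> i \<otimes>\<^bsub>S\<^esub> \<alpha>)"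
      using cm(2)[OF g] ac by (simp add: A.smult_iota S.m_ac)
    also have "\<dots> = \<chi> g [^]\<^bsub>R\<^esub> Suc i \<odot>\<^bsub>S\<^esub> \<alpha> [^]\<^bsub>S\<^esub> Suc i"
      using cm(2)[OF g] ac by (simp add: A.smult_iota ring_hom_mult[OF A.iota_hom])
    finally show ?case .
  qed
  have fixed: "{s \<in> carrier S. \<forall>g\<in>carrier ?G. \<phi> g s = s} = A.\<iota> ` carrier R"
  proof
    show "A.\<iota> ` carrier R \<subseteq> {s \<in> carrier S. \<forall>g\<in>carrier ?G. \<phi> g s = s}"
      using \<phi>lin Fh(4) by (auto simp: structure_map_def \<phi>F Fh(5))
    show "{s \<in> carrier S. \<forall>g\<in>carrier ?G. \<phi> g s = s} \<subseteq> A.\<iota> ` carrier R"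
    proof
      fix s assume "s \<in> {s \<in> carrier S. \<forall>g\<in>carrier ?G. \<phi> g s = s}"
      then have s: "s \<in> carrier S" "\<And>g. g \<in> carrier ?G \<Longrightarrow> \<phi> g s = s" by auto
      obtain c where c: "c \<in> {..<p} \<rightarrow>\<^sub>E carrier R" "s = (\<Oplus>\<^bsub>S\<^esub>i\<in>{..<p}. c i \<odot>\<^bsub>S\<^esub> (\<alpha> [^]\<^bsub>S\<^esub> i))"
        using \<alpha> s(1) unfolding power_basis_def by blast
      have cc: "c i \<in> carrier R" if "i < p" for i using c(1) that by auto
      \<comment> \<open>One h with \<chi>(h) different from 1 suffices: comparing the coefficients
        of s and of h(s), the factor \<chi>(h)^i fixes c_i, which forces c_i = 0 for 0 < i <
        p.\<close>
      obtain h where h: "h \<in> carrier ?G" "\<chi> h \<noteq> \<one>\<^bsub>R\<^esub>" using \<chi>(2) by blast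
      have hm: "\<phi> h \<in> module_hom R S S"
        using Fh[OF h(1)] by (intro module_homI) (simp_all add: \<phi>F)
      have "s = (\<Oplus>\<^bsub>S\<^esub>i\<in>{..<p}. \<phi> h (c i \<odot>\<^bsub>S\<^esub> (\<alpha> [^]\<^bsub>S\<^esub> i)))"
        using s(2)[OF h(1)] module_hom_finsum[OF A.A.module A.A.module hm, of "\<lambda>i. c i \<odot>\<^bsub>S\<^esub> (\<alpha> [^]\<^bsub>S\<^esub> i)" "{..<p}"]
          cc ac c(2) by (simp add: Pi_def)
      also have "\<dots> = (\<Oplus>\<^bsub>S\<^esub>i\<in>{..<p}. (\<chi> h [^]\<^bsub>R\<^esub> i \<otimes>\<^bsub>R\<^esub> c i) \<odot>\<^bsub>S\<^esub> (\<alpha> [^]\<^bsub>S\<^esub> i))"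
        using cc ac cm(2)[OF h(1)]
        by (intro S.add.finprod_cong') (auto simp: \<phi>lin[OF h(1)] \<phi>\<alpha>[OF h(1)] R.m_comm A.A.smult_assoc1[symmetric])
      finally have "(\<Oplus>\<^bsub>S\<^esub>i\<in>{..<p}. (\<chi> h [^]\<^bsub>R\<^esub> i \<otimes>\<^bsub>R\<^esub> c i) \<odot>\<^bsub>S\<^esub> (\<alpha> [^]\<^bsub>S\<^esub> i)) =
        (\<Oplus>\<^bsub>S\<^esub>i\<in>{..<p}. c i \<odot>\<^bsub>S\<^esub> (\<alpha> [^]\<^bsub>S\<^esub> i))" using c(2) by simp
      then have cf: "\<chi> h [^]\<^bsub>R\<^esub> i \<otimes>\<^bsub>R\<^esub> c i = c i" if "i < p" for i
        using power_basis_coeff[OF S \<alpha> _ _ _ that, of "\<lambda>i. \<chi> h [^]\<^bsub>R\<^esub> i \<otimes>\<^bsub>R\<^esub> c i" c] cc cm(2)[OF h(1)] by simp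
      have "c i = \<zero>\<^bsub>R\<^esub>" if i: "0 < i" "i < p" for i
      proof -
        have "\<not> p dvd i" using i by (auto dest: dvd_imp_le)
        then have "\<chi> h [^]\<^bsub>R\<^esub> i \<noteq> \<one>\<^bsub>R\<^esub>" using mu_pow_neq_one[OF cm(1)[OF h(1)] h(2)] by blast
        then show ?thesis
          using mu_smult_cancel[OF R.regular_module_module mu_pow[OF cm(1)[OF h(1)]] mu_one, of i "c i"] cf cc i
          by (simp add: regular_module_def)
      qed
      then have "s = (\<Oplus>\<^bsub>S\<^esub>i\<in>{..<p}. (if 0 = i then c 0 else \<zero>\<^bsub>R\<^esub>) \<odot>\<^bsub>S\<^esub> \<alpha> [^]\<^bsub>S\<^esub> i)"
        unfolding c(2) using cc ac p_gt by (intro S.add.finprod_cong') auto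
      then show "s \<in> A.\<iota> ` carrier R" using sum0 cc p_gt by auto
    qed
  qed
  have action: "algebra_action R S ?G \<phi>"
    by (intro algebra_action.intro algebra_action_axioms.intro)
      (use A.R_algebra_axioms act \<phi>iso \<phi>lin fixed p_gt in \<open>simp_all add: carrier_integer_mod_group\<close>)
  interpret X: kummer_action R S ?G \<phi> p \<mu> \<chi> by (rule kummer_actionI[OF action oG \<chi>])
  \<comment> \<open>With x_i = \<alpha>^-i / p and y_i = \<alpha>^i the coordinate sum at g is 1/p
    times the sum of the powers of \<chi>(g).\<close>
  have coords: "X.galois_coordinates {..<p} (\<lambda>i. q \<odot>\<^bsub>S\<^esub> \<beta> [^]\<^bsub>S\<^esub> i) (\<lambda>i. \<alpha> [^]\<^bsub>S\<^esub> i)"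
    unfolding X.galois_coordinates_def
  proof (intro conjI ballI)
    fix g assume g: "g \<in> carrier ?G"
    have "(\<Oplus>\<^bsub>S\<^esub>i\<in>{..<p}. (q \<odot>\<^bsub>S\<^esub> \<beta> [^]\<^bsub>S\<^esub> i) \<otimes>\<^bsub>S\<^esub> \<phi> g (\<alpha> [^]\<^bsub>S\<^esub> i)) =
      (\<Oplus>\<^bsub>S\<^esub>i\<in>{..<p}. \<chi> g [^]\<^bsub>R\<^esub> i \<odot>\<^bsub>S\<^esub> A.\<iota> q)"
    proof (intro S.add.finprod_cong' refl)
      fix i :: nat
      have "(q \<odot>\<^bsub>S\<^esub> \<beta> [^]\<^bsub>S\<^esub> i) \<otimes>\<^bsub>S\<^esub> \<phi> g (\<alpha> [^]\<^bsub>S\<^esub> i) =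
        \<chi> g [^]\<^bsub>R\<^esub> i \<odot>\<^bsub>S\<^esub> (A.\<iota> q \<otimes>\<^bsub>S\<^esub> (\<alpha> [^]\<^bsub>S\<^esub> i \<otimes>\<^bsub>S\<^esub> \<beta> [^]\<^bsub>S\<^esub> i))"
        using cm(2)[OF g] ac bc by (simp add: \<phi>\<alpha>[OF g] A.smult_iota S.m_ac)
      then show "(q \<odot>\<^bsub>S\<^esub> \<beta> [^]\<^bsub>S\<^esub> i) \<otimes>\<^bsub>S\<^esub> \<phi> g (\<alpha> [^]\<^bsub>S\<^esub> i) = \<chi> g [^]\<^bsub>R\<^esub> i \<odot>\<^bsub>S\<^esub> A.\<iota> q"
        by (simp add: abp)
    qed (use cm(2)[OF g] in auto)
    also have "\<dots> = (\<Oplus>\<^bsub>R\<^esub>i\<in>{..<p}. \<chi> g [^]\<^bsub>R\<^esub> i) \<odot>\<^bsub>S\<^esub> A.\<iota> q"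
      using cm(2)[OF g] by (intro A.A.finsum_smult_rdistr[symmetric]) auto
    also have "\<dots> = (if g = \<one>\<^bsub>?G\<^esub> then \<one>\<^bsub>S\<^esub> else \<zero>\<^bsub>S\<^esub>)"
      using mu_power_sum[OF cm(1)[OF g]] X.chi_eq_one_iff[OF g] p_q(1) ring_hom_one[OF A.iota_hom]
      by (simp add: A.smult_iota ring_hom_mult[OF A.iota_hom, symmetric]) (simp add: structure_map_def)
    finally show "(\<Oplus>\<^bsub>S\<^esub>i\<in>{..<p}. (q \<odot>\<^bsub>S\<^esub> \<beta> [^]\<^bsub>S\<^esub> i) \<otimes>\<^bsub>S\<^esub> \<phi> g (\<alpha> [^]\<^bsub>S\<^esub> i)) =
      (if g = \<one>\<^bsub>?G\<^esub> then \<one>\<^bsub>S\<^esub> else \<zero>\<^bsub>S\<^esub>)" .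
  qed (use ac bc in auto)
  \<comment> \<open>The generator \<alpha> alone separates g from h against any e, idempotent or
    not. With e = 1 this also yields faithfulness.\<close>
  have distinct: "e = \<zero>\<^bsub>S\<^esub>"
    if "g \<in> carrier ?G" "h \<in> carrier ?G" "g \<noteq> h" "e \<in> carrier S" "\<phi> g \<alpha> \<otimes>\<^bsub>S\<^esub> e = \<phi> h \<alpha> \<otimes>\<^bsub>S\<^esub> e" for g h e
  proof -
    have "\<chi> g \<odot>\<^bsub>S\<^esub> (\<alpha> \<otimes>\<^bsub>S\<^esub> e) = \<chi> h \<odot>\<^bsub>S\<^esub> (\<alpha> \<otimes>\<^bsub>S\<^esub> e)"
      using that ac cm(2) by (simp add: \<phi>F F(2) A.A.smult_assoc2)
    then have "\<alpha> \<otimes>\<^bsub>S\<^esub> e = \<zero>\<^bsub>S\<^esub>"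
      using mu_smult_cancel[OF A.A.module cm(1) cm(1), of g h "\<alpha> \<otimes>\<^bsub>S\<^esub> e"] cinj that ac by simp
    moreover have "e = \<beta> \<otimes>\<^bsub>S\<^esub> (\<alpha> \<otimes>\<^bsub>S\<^esub> e)"
      using ab ac bc that(4) by (simp add: S.m_assoc[symmetric] S.m_comm[of \<beta>])
    ultimately show ?thesis using bc by simp
  qed
  \<comment> \<open>If \<open>S\<close> were zero then \<open>R\<close> would be zero, leaving no
    room for a nontrivial character.\<close>
  have nz: "\<one>\<^bsub>S\<^esub> \<noteq> \<zero>\<^bsub>S\<^esub>"
  proof
    assume "\<one>\<^bsub>S\<^esub> = \<zero>\<^bsub>S\<^esub>"
    then have "A.\<iota> \<one>\<^bsub>R\<^esub> = A.\<iota> \<zero>\<^bsub>R\<^esub>" using ring_hom_one[OF A.iota_hom] by (simp add: structure_map_def)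
    then have "\<one>\<^bsub>R\<^esub> = \<zero>\<^bsub>R\<^esub>" using iinj by (simp add: inj_on_def)
    moreover from this have "carrier R = {\<zero>\<^bsub>R\<^esub>}" by (simp add: R.carrier_one_zero)
    ultimately show False using \<chi>(2) cm(2) by auto
  qed
  have "galois_extension R S ?G \<phi>"
  proof (intro galois_extension.intro faithful_action.intro faithful_action_axioms.intro galois_extension_axioms.intro)
    show "inj_on \<phi> (carrier ?G)"
    proof (rule inj_onI, rule ccontr)
      fix g h assume "g \<in> carrier ?G" "h \<in> carrier ?G" "\<phi> g = \<phi> h" "g \<noteq> h"
      then show False using distinct[of g h "\<one>\<^bsub>S\<^esub>"] nz by simp
    qed
    show "\<exists>s\<in>carrier S. \<phi> g s \<otimes>\<^bsub>S\<^esub> e \<noteq> \<phi> h s \<otimes>\<^bsub>S\<^esub> e"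
      if "g \<in> carrier ?G" "h \<in> carrier ?G" "g \<noteq> h" "e \<in> carrier S" "e \<noteq> \<zero>\<^bsub>S\<^esub>" for g h e
      using distinct[OF that(1-4)] that(5) ac by blast
    show "separable_algebra R S" by (rule X.coords_separable[OF coords])
  qed (fact S act iinj X.finite_group \<phi>iso \<phi>lin fixed)+
  moreover have "primitive_element p R \<mu> S ?G \<phi> \<alpha>"
    unfolding primitive_element_iff using \<alpha> \<chi> F(2) ac by (auto simp: \<phi>F)
  ultimately show ?thesis by blast
qed

end

subsection \<open>The algebra with a prescribed Kummer unit\<close>

lemma periodic_mod:
  fixes F :: "int \<Rightarrow> 'b"
  assumes "\<And>n. F (n + m) = F n"
  shows "F n = F (n mod m)"
proof -
  have "F (x + m * k) = F x" for x k
  proof (induction k rule: int_induct[where k = 0])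
    case (step1 i)
    have e: "x + m * (i + 1) = x + m * i + m" by (simp add: algebra_simps)
    show ?case unfolding e assms by (rule step1(2))
  next
    case (step2 i)
    have e: "x + m * i = x + m * (i - 1) + m" by (simp add: algebra_simps)
    show ?case using step2(2) unfolding e assms .
  qed simp
  then have "F (n mod m + m * (n div m)) = F (n mod m)" .
  then show ?thesis by simp
qed

text \<open>A map that is injective modulo m permutes the residues, and a function of period m
  depends on residues only.\<close>

lemma (in abelian_monoid) finsum_periodic:
  fixes F :: "int \<Rightarrow> 'a"
  assumes F: "\<And>n. F n \<in> carrier G" "\<And>n. F (n + m) = F n" and m: "m > 0"
    and h: "\<And>i j. h i mod m = h j mod m \<Longrightarrow> i mod m = j mod m"
  shows "(\<Oplus>i\<in>{0..<m}. F (h i)) = (\<Oplus>i\<in>{0..<m}. F i)"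
proof -
  have inj: "inj_on (\<lambda>i. h i mod m) {0..<m}"
  proof (rule inj_onI)
    fix i j assume "i \<in> {0..<m}" "j \<in> {0..<m}" "h i mod m = h j mod m"
    then show "i = j" using h[of i j] by simp
  qed
  have "(\<lambda>i. h i mod m) ` {0..<m} \<subseteq> {0..<m}" using m by auto
  then have im: "(\<lambda>i. h i mod m) ` {0..<m} = {0..<m}"
    by (intro card_subset_eq) (simp_all add: card_image[OF inj])
  have "(\<Oplus>i\<in>(\<lambda>i. h i mod m) ` {0..<m}. F i) = (\<Oplus>i\<in>{0..<m}. F (h i mod m))"
    using F(1) by (intro add.finprod_reindex inj) auto
  moreover have "F (h i mod m) = F (h i)" for i using periodic_mod[of F m "h i", OF F(2)] by simp
  ultimately show ?thesis unfolding im by simp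
qed

lemma power_basis_transfer:
  assumes S: "algebra R S" and T: "algebra R T" and f: "f \<in> algebra_iso R S T" and \<alpha>: "power_basis p R S \<alpha>"
  shows "power_basis p R T (f \<alpha>)"
proof -
  interpret S: cring S using S by (rule algebra.axioms)
  interpret T: cring T using T by (rule algebra.axioms)
  interpret A: algebra R S by (rule S)
  interpret B: algebra R T by (rule T)
  note fh = algebra_isoD(1)[OF f] and bij = algebra_isoD(2)[OF f]
  have ac: "\<alpha> \<in> carrier S" using \<alpha> by (simp add: power_basis_def)
  have fs: "f (\<Oplus>\<^bsub>S\<^esub>i\<in>{..<p}. c i \<odot>\<^bsub>S\<^esub> (\<alpha> [^]\<^bsub>S\<^esub> i)) = (\<Oplus>\<^bsub>T\<^esub>i\<in>{..<p}. c i \<odot>\<^bsub>T\<^esub> (f \<alpha> [^]\<^bsub>T\<^esub> i))"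
    and cl: "(\<Oplus>\<^bsub>S\<^esub>i\<in>{..<p}. c i \<odot>\<^bsub>S\<^esub> (\<alpha> [^]\<^bsub>S\<^esub> i)) \<in> carrier S"
    if c: "c \<in> {..<p} \<rightarrow>\<^sub>E carrier R" for c
  proof -
    have cc: "c i \<in> carrier R" if "i < p" for i using c that by auto
    then show "(\<Oplus>\<^bsub>S\<^esub>i\<in>{..<p}. c i \<odot>\<^bsub>S\<^esub> (\<alpha> [^]\<^bsub>S\<^esub> i)) \<in> carrier S"
      using ac by (intro S.finsum_closed) auto
    have "f (\<Oplus>\<^bsub>S\<^esub>i\<in>{..<p}. c i \<odot>\<^bsub>S\<^esub> (\<alpha> [^]\<^bsub>S\<^esub> i)) = (\<Oplus>\<^bsub>T\<^esub>i\<in>{..<p}. f (c i \<odot>\<^bsub>S\<^esub> (\<alpha> [^]\<^bsub>S\<^esub> i)))"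
      using cc ac by (intro module_hom_finsum[OF A.module B.module algebra_hom_module_hom[OF fh]]) auto
    also have "\<dots> = (\<Oplus>\<^bsub>T\<^esub>i\<in>{..<p}. c i \<odot>\<^bsub>T\<^esub> (f \<alpha> [^]\<^bsub>T\<^esub> i))"
      using cc ac algebra_homD(1)[OF fh ac]
      by (intro T.add.finprod_cong') (auto simp: algebra_homD(5)[OF fh] algebra_hom_pow[OF S fh])
    finally show "f (\<Oplus>\<^bsub>S\<^esub>i\<in>{..<p}. c i \<odot>\<^bsub>S\<^esub> (\<alpha> [^]\<^bsub>S\<^esub> i)) = (\<Oplus>\<^bsub>T\<^esub>i\<in>{..<p}. c i \<odot>\<^bsub>T\<^esub> (f \<alpha> [^]\<^bsub>T\<^esub> i))" .
  qed
  show ?thesis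
    unfolding power_basis_def
  proof (intro conjI ballI)
    show "f \<alpha> \<in> carrier T" by (rule algebra_homD(1)[OF fh ac])
    fix t assume "t \<in> carrier T"
    then obtain s where s: "s \<in> carrier S" "t = f s" using bij by (auto simp: bij_betw_def)
    have iff: "c \<in> {..<p} \<rightarrow>\<^sub>E carrier R \<and> t = (\<Oplus>\<^bsub>T\<^esub>i\<in>{..<p}. c i \<odot>\<^bsub>T\<^esub> (f \<alpha> [^]\<^bsub>T\<^esub> i)) \<longleftrightarrow>
      c \<in> {..<p} \<rightarrow>\<^sub>E carrier R \<and> s = (\<Oplus>\<^bsub>S\<^esub>i\<in>{..<p}. c i \<odot>\<^bsub>S\<^esub> (\<alpha> [^]\<^bsub>S\<^esub> i))" for c
    proof (intro conj_cong refl)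
      assume c: "c \<in> {..<p} \<rightarrow>\<^sub>E carrier R"
      show "t = (\<Oplus>\<^bsub>T\<^esub>i\<in>{..<p}. c i \<odot>\<^bsub>T\<^esub> (f \<alpha> [^]\<^bsub>T\<^esub> i)) \<longleftrightarrow> s = (\<Oplus>\<^bsub>S\<^esub>i\<in>{..<p}. c i \<odot>\<^bsub>S\<^esub> (\<alpha> [^]\<^bsub>S\<^esub> i))"
        unfolding s(2) fs[OF c, symmetric] by (rule inj_on_eq_iff[OF bij_betw_imp_inj_on[OF bij] s(1) cl[OF c]])
    qed
    show "\<exists>!c. c \<in> {..<p} \<rightarrow>\<^sub>E carrier R \<and> t = (\<Oplus>\<^bsub>T\<^esub>i\<in>{..<p}. c i \<odot>\<^bsub>T\<^esub> (f \<alpha> [^]\<^bsub>T\<^esub> i))"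
      unfolding iff using \<alpha> s(1) unfolding power_basis_def by (elim conjE) (rule bspec)
  qed
qed

text \<open>An element \<open>\<Sum>\<^sub>i c\<^sub>i \<alpha>\<^sup>i\<close> of \<open>R[\<alpha>] / (\<alpha>\<^sup>p - u)\<close> is represented by its coefficients extended to all
  \<open>i \<in> \<int>\<close> by \<open>c\<^sub>i = u c\<^sub>i\<^sub>+\<^sub>p\<close>, which makes \<open>c\<^sub>i \<alpha>\<^sup>i\<close> periodic in \<open>i\<close>; the product is then a plain convolution
  over any set of residues.\<close>

locale kummer_algebra = R: cring R for R (structure) +
  fixes p :: nat and u
  assumes p: "p > 0" and u: "u \<in> Units R"
begin

abbreviation "I \<equiv> {0..<int p}"

definition quasi :: "(int \<Rightarrow> 'a) set"
  where "quasi = {c. \<forall>n. c n \<in> carrier R \<and> c n = u \<otimes> c (n + int p)}"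

text \<open>The coefficients of \<alpha>^m: for n = m - k p one has \<alpha>^m = u^k \<alpha>^n. The
  power is taken in the group of units because k may be negative.\<close>

definition \<delta> :: "int \<Rightarrow> int \<Rightarrow> 'a"
  where "\<delta> m n = (if int p dvd m - n then u [^]\<^bsub>units_of R\<^esub> ((m - n) div int p) else \<zero>)"

definition KA :: "('a, int \<Rightarrow> 'a) module"
  where "KA = \<lparr>carrier = quasi, monoid.mult = (\<lambda>c d k. \<Oplus>i\<in>I. c i \<otimes> d (k - i)), one = \<delta> 0,
    zero = (\<lambda>_. \<zero>), add = (\<lambda>c d n. c n \<oplus> d n), smult = (\<lambda>r c n. r \<otimes> c n)\<rparr>"

lemma uc [simp]: "u \<in> carrier R"
  using u by (rule R.Units_closed)

lemma quasiD:
  assumes "c \<in> quasi"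
  shows "c n \<in> carrier R" "u \<otimes> c (n + int p) = c n"
proof -
  have "\<forall>n. c n \<in> carrier R \<and> c n = u \<otimes> c (n + int p)" using assms unfolding quasi_def by (rule CollectD)
  then have *: "c n \<in> carrier R \<and> c n = u \<otimes> c (n + int p)" by (rule spec)
  show "c n \<in> carrier R" by (rule conjunct1[OF *])
  show "u \<otimes> c (n + int p) = c n" by (rule conjunct2[OF *, symmetric])
qed

lemma quasiI:
  assumes "\<And>n. c n \<in> carrier R" "\<And>n. u \<otimes> c (n + int p) = c n"
  shows "c \<in> quasi"
  unfolding quasi_def by (intro CollectI allI conjI assms(1) assms(2)[symmetric])

text \<open>Multiplication by the unit u is injective, so agreement at n and at n + p are
  equivalent; agreement on one period spreads to all integers.\<close>

lemma quasi_eqI: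
  assumes c: "c \<in> quasi" and d: "d \<in> quasi" and eq: "\<And>i. i \<in> I \<Longrightarrow> c i = d i"
  shows "c = d"
proof
  fix n
  have "(c (n + int p) = d (n + int p)) = (c n = d n)" for n
  proof
    assume "c n = d n"
    then have "u \<otimes> c (n + int p) = u \<otimes> d (n + int p)" unfolding quasiD(2)[OF c] quasiD(2)[OF d] .
    then show "c (n + int p) = d (n + int p)"
      using R.Units_l_cancel[OF u] quasiD(1)[OF c] quasiD(1)[OF d] by simp
  next
    assume "c (n + int p) = d (n + int p)"
    then show "c n = d n" unfolding quasiD(2)[OF c, of n, symmetric] quasiD(2)[OF d, of n, symmetric] by simp
  qed
  then have "(c n = d n) = (c (n mod int p) = d (n mod int p))"
    by (rule periodic_mod[of "\<lambda>n. c n = d n"])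
  then show "c n = d n" using eq[of "n mod int p"] p by simp
qed

text \<open>Raising i by p divides the first factor by u and multiplies the second by u.\<close>

lemma conv_periodic:
  assumes c: "c \<in> quasi" and d: "d \<in> quasi"
  shows "c (i + int p) \<otimes> d (k - (i + int p)) = c i \<otimes> d (k - i)"
proof -
  have "c i \<otimes> d (k - i) = u \<otimes> c (i + int p) \<otimes> d (k - i)" unfolding quasiD(2)[OF c, of i] ..
  also have "\<dots> = c (i + int p) \<otimes> (u \<otimes> d (k - i))"
    using quasiD(1)[OF c] quasiD(1)[OF d] by (simp add: R.m_ac)
  also have "u \<otimes> d (k - i) = d (k - (i + int p))"
  proof -
    have e: "k - (i + int p) + int p = k - i" by simp
    show ?thesis using quasiD(2)[OF d, of "k - (i + int p)"] unfolding e .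
  qed
  finally show ?thesis ..
qed

text \<open>By periodicity the summation may start anywhere, so the ring laws become substitutions
  of the index.\<close>

lemma conv_shift:
  assumes c: "c \<in> quasi" and d: "d \<in> quasi"
  shows "(\<Oplus>i\<in>I. c (i + a) \<otimes> d (k - (i + a))) = (\<Oplus>i\<in>I. c i \<otimes> d (k - i))"
  using p quasiD(1)[OF c] quasiD(1)[OF d] conv_periodic[OF c d]
  by (intro R.finsum_periodic[where F = "\<lambda>i. c i \<otimes> d (k - i)" and h = "\<lambda>i. i + a"])
    (auto simp: mod_eq_dvd_iff)

lemma conv_closed:
  assumes c: "c \<in> quasi" and d: "d \<in> quasi"
  shows "(\<lambda>k. \<Oplus>i\<in>I. c i \<otimes> d (k - i)) \<in> quasi"
proof (rule quasiI)
  show "(\<Oplus>i\<in>I. c i \<otimes> d (n - i)) \<in> carrier R" for n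
    using quasiD(1)[OF c] quasiD(1)[OF d] by (intro R.finsum_closed) auto
  fix n
  have "u \<otimes> (\<Oplus>i\<in>I. c i \<otimes> d (n + int p - i)) = (\<Oplus>i\<in>I. u \<otimes> (c i \<otimes> d (n + int p - i)))"
    using quasiD(1)[OF c] quasiD(1)[OF d] by (intro R.finsum_rdistr) auto
  also have "\<dots> = (\<Oplus>i\<in>I. c i \<otimes> d (n - i))"
  proof (intro R.add.finprod_cong' refl)
    fix i
    have e: "n + int p - i = n - i + int p" by simp
    show "u \<otimes> (c i \<otimes> d (n + int p - i)) = c i \<otimes> d (n - i)"
      unfolding e R.m_lcomm[OF uc quasiD(1)[OF c] quasiD(1)[OF d]] quasiD(2)[OF d] ..
  qed (use quasiD(1)[OF c] quasiD(1)[OF d] in auto)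
  finally show "u \<otimes> (\<Oplus>i\<in>I. c i \<otimes> d (n + int p - i)) = (\<Oplus>i\<in>I. c i \<otimes> d (n - i))" .
qed

text \<open>The substitution i -> k - i, which permutes the residues.\<close>

lemma conv_comm:
  assumes c: "c \<in> quasi" and d: "d \<in> quasi"
  shows "(\<Oplus>i\<in>I. c i \<otimes> d (k - i)) = (\<Oplus>i\<in>I. d i \<otimes> c (k - i))"
proof -
  have "(\<Oplus>i\<in>I. c (k - i) \<otimes> d (k - (k - i))) = (\<Oplus>i\<in>I. c i \<otimes> d (k - i))"
  proof (rule R.finsum_periodic[where F = "\<lambda>i. c i \<otimes> d (k - i)" and h = "\<lambda>i. k - i"])
    show "i mod int p = j mod int p" if "(k - i) mod int p = (k - j) mod int p" for i j
      using that by (simp add: mod_eq_dvd_iff dvd_diff_commute)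
  qed (use p quasiD(1)[OF c] quasiD(1)[OF d] conv_periodic[OF c d] in auto)
  moreover have "(\<Oplus>i\<in>I. c (k - i) \<otimes> d (k - (k - i))) = (\<Oplus>i\<in>I. d i \<otimes> c (k - i))"
    using quasiD(1)[OF c] quasiD(1)[OF d] by (intro R.add.finprod_cong') (auto simp: R.m_comm)
  ultimately show ?thesis by simp
qed

text \<open>After the sums are exchanged, the inner index i is shifted by j.\<close>

lemma conv_assoc:
  assumes c: "c \<in> quasi" and d: "d \<in> quasi" and e: "e \<in> quasi"
  shows "(\<Oplus>i\<in>I. (\<Oplus>j\<in>I. c j \<otimes> d (i - j)) \<otimes> e (k - i)) = (\<Oplus>j\<in>I. c j \<otimes> (\<Oplus>l\<in>I. d l \<otimes> e (k - j - l)))"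
proof -
  note q = quasiD(1)[OF c] quasiD(1)[OF d] quasiD(1)[OF e]
  have "(\<Oplus>i\<in>I. (\<Oplus>j\<in>I. c j \<otimes> d (i - j)) \<otimes> e (k - i)) =
    (\<Oplus>i\<in>I. \<Oplus>j\<in>I. c j \<otimes> (d (i - j) \<otimes> e (k - i)))"
  proof (intro R.add.finprod_cong' refl)
    fix i
    have "(\<Oplus>j\<in>I. c j \<otimes> d (i - j)) \<otimes> e (k - i) = (\<Oplus>j\<in>I. c j \<otimes> d (i - j) \<otimes> e (k - i))"
      using q by (intro R.finsum_ldistr) auto
    then show "(\<Oplus>j\<in>I. c j \<otimes> d (i - j)) \<otimes> e (k - i) = (\<Oplus>j\<in>I. c j \<otimes> (d (i - j) \<otimes> e (k - i)))"
      using q by (simp add: R.m_assoc)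
  qed (use q in \<open>auto intro!: R.finsum_closed\<close>)
  also have "\<dots> = (\<Oplus>j\<in>I. \<Oplus>i\<in>I. c j \<otimes> (d (i - j) \<otimes> e (k - i)))"
    using q by (intro R.finsum_swap) auto
  also have "\<dots> = (\<Oplus>j\<in>I. c j \<otimes> (\<Oplus>l\<in>I. d l \<otimes> e (k - j - l)))"
  proof (intro R.add.finprod_cong' refl)
    fix j
    have "(\<Oplus>i\<in>I. c j \<otimes> (d (i - j) \<otimes> e (k - i))) = c j \<otimes> (\<Oplus>i\<in>I. d (i - j) \<otimes> e (k - i))"
      using q by (intro R.finsum_rdistr[symmetric]) auto
    also have "(\<Oplus>i\<in>I. d (i - j) \<otimes> e (k - i)) = (\<Oplus>l\<in>I. d l \<otimes> e (k - j - l))"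
      using conv_shift[OF d e, of "- j" "k - j"] by (simp add: algebra_simps)
    finally show "(\<Oplus>i\<in>I. c j \<otimes> (d (i - j) \<otimes> e (k - i))) = c j \<otimes> (\<Oplus>l\<in>I. d l \<otimes> e (k - j - l))" .
  qed (use q in \<open>auto intro!: R.finsum_closed\<close>)
  finally show ?thesis .
qed

lemma upow_closed: "u [^]\<^bsub>units_of R\<^esub> (k::int) \<in> carrier R"
  using group.int_pow_closed[OF R.units_group, of u k] u by (simp add: units_of_carrier R.Units_closed)

lemma upow_Suc: "u [^]\<^bsub>units_of R\<^esub> (k + 1) = u \<otimes> u [^]\<^bsub>units_of R\<^esub> (k::int)"
  using group.int_pow_mult[OF R.units_group, of u 1 k] group.int_pow_1[OF R.units_group, of u] u
  by (simp add: units_of_carrier units_of_mult add.commute)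

lemma delta_quasi: "\<delta> m \<in> quasi"
proof (rule quasiI)
  show "\<delta> m n \<in> carrier R" for n using upow_closed by (simp add: \<delta>_def)
  show "u \<otimes> \<delta> m (n + int p) = \<delta> m n" for n
  proof -
    have e: "m - (n + int p) = (m - n) - int p" by simp
    have "int p dvd m - (n + int p) \<longleftrightarrow> int p dvd m - n" unfolding e by (rule dvd_diff_left_iff) simp
    moreover have "(m - n) div int p = (m - (n + int p)) div int p + 1"
      using p div_add_self2[of "int p" "m - (n + int p)"] by simp
    ultimately show ?thesis using upow_Suc by (auto simp: \<delta>_def)
  qed
qed

lemma delta_zero: "i \<in> I \<Longrightarrow> j \<in> I \<Longrightarrow> \<delta> i j = (if i = j then \<one> else \<zero>)"
proof -
  assume ij: "i \<in> I" "j \<in> I"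
  have "int p dvd i - j \<longleftrightarrow> i = j"
    unfolding mod_eq_dvd_iff[symmetric] using ij by simp
  then show ?thesis by (simp add: \<delta>_def units_of_one)
qed

lemma delta_shift: "\<delta> (m + a) (n + a) = \<delta> m n"
  by (simp add: \<delta>_def)

text \<open>Multiplication by \<alpha>^a shifts the coefficients. Once the summation is moved by a,
  the only nonzero value of \<open>\<delta> a\<close> in range is 1, at i = 0.\<close>

lemma delta_conv:
  assumes d: "d \<in> quasi"
  shows "(\<Oplus>i\<in>I. \<delta> a i \<otimes> d (k - i)) = d (k - a)"
proof -
  have "(\<Oplus>i\<in>I. \<delta> a i \<otimes> d (k - i)) = (\<Oplus>i\<in>I. \<delta> a (i + a) \<otimes> d (k - (i + a)))"
    by (rule conv_shift[OF delta_quasi d, symmetric])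
  also have "\<dots> = (\<Oplus>i\<in>I. if 0 = i then d (k - a - i) else \<zero>)"
    using quasiD(1)[OF d] delta_shift[of 0 a] p delta_zero[of 0]
    by (intro R.add.finprod_cong') (auto simp: algebra_simps)
  also have "\<dots> = d (k - a)"
    using R.add.finprod_singleton[of 0 I "\<lambda>i. d (k - a - i)"] quasiD(1)[OF d] p by simp
  finally show ?thesis .
qed

lemma KA_algebra: "algebra R KA"
proof (rule algebraI)
  show "cring KA"
  proof (rule cringI)
    show "abelian_group KA"
    proof (rule abelian_groupI)
      fix c assume c: "c \<in> carrier KA"
      then show "\<exists>d\<in>carrier KA. d \<oplus>\<^bsub>KA\<^esub> c = \<zero>\<^bsub>KA\<^esub>"
        by (intro bexI[of _ "\<lambda>n. \<ominus> c n"])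
          (auto simp: KA_def quasiD R.l_neg R.r_minus intro!: quasiI)
    qed (auto simp: KA_def quasiD R.a_ac R.r_distr intro!: quasiI)
    show "comm_monoid KA"
    proof (rule comm_monoidI)
      fix c d e assume q: "c \<in> carrier KA" "d \<in> carrier KA" "e \<in> carrier KA"
      then show "c \<otimes>\<^bsub>KA\<^esub> d \<otimes>\<^bsub>KA\<^esub> e = c \<otimes>\<^bsub>KA\<^esub> (d \<otimes>\<^bsub>KA\<^esub> e)"
        using conv_assoc by (simp add: KA_def fun_eq_iff)
    next
      fix c d assume "c \<in> carrier KA" "d \<in> carrier KA"
      then show "c \<otimes>\<^bsub>KA\<^esub> d = d \<otimes>\<^bsub>KA\<^esub> c" "c \<otimes>\<^bsub>KA\<^esub> d \<in> carrier KA"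
        using conv_comm conv_closed by (simp_all add: KA_def fun_eq_iff)
    qed (use delta_quasi delta_conv[of _ 0] in \<open>auto simp: KA_def fun_eq_iff\<close>)
    fix c d e assume q: "c \<in> carrier KA" "d \<in> carrier KA" "e \<in> carrier KA"
    have "(\<Oplus>i\<in>I. (c i \<oplus> d i) \<otimes> e (k - i)) = (\<Oplus>i\<in>I. c i \<otimes> e (k - i)) \<oplus> (\<Oplus>i\<in>I. d i \<otimes> e (k - i))" for k
    proof -
      have c: "c i \<in> carrier R" "d i \<in> carrier R" "e i \<in> carrier R" for i using q by (auto simp: KA_def quasiD)
      have "(\<Oplus>i\<in>I. (c i \<oplus> d i) \<otimes> e (k - i)) = (\<Oplus>i\<in>I. c i \<otimes> e (k - i) \<oplus> d i \<otimes> e (k - i))"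
        using c by (intro R.add.finprod_cong') (auto simp: R.l_distr)
      also have "\<dots> = (\<Oplus>i\<in>I. c i \<otimes> e (k - i)) \<oplus> (\<Oplus>i\<in>I. d i \<otimes> e (k - i))"
        using c by (intro R.finsum_addf) auto
      finally show ?thesis .
    qed
    then show "(c \<oplus>\<^bsub>KA\<^esub> d) \<otimes>\<^bsub>KA\<^esub> e = c \<otimes>\<^bsub>KA\<^esub> e \<oplus>\<^bsub>KA\<^esub> d \<otimes>\<^bsub>KA\<^esub> e" by (simp add: KA_def)
  qed
  fix r c d assume r: "r \<in> carrier R" and "c \<in> carrier KA" "d \<in> carrier KA"
  then have q: "c i \<in> carrier R" "d i \<in> carrier R" for i by (auto simp: KA_def quasiD)
  have "(\<Oplus>i\<in>I. r \<otimes> c i \<otimes> d (k - i)) = r \<otimes> (\<Oplus>i\<in>I. c i \<otimes> d (k - i))" for k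
    using r q by (subst R.finsum_rdistr) (auto simp: R.m_assoc)
  then show "(r \<odot>\<^bsub>KA\<^esub> c) \<otimes>\<^bsub>KA\<^esub> d = r \<odot>\<^bsub>KA\<^esub> (c \<otimes>\<^bsub>KA\<^esub> d)" by (simp add: KA_def)
next
  fix r c assume "r \<in> carrier R" "c \<in> carrier KA"
  then show "r \<odot>\<^bsub>KA\<^esub> c \<in> carrier KA"
    by (auto simp: KA_def R.m_lcomm[of u r] quasiD intro!: quasiI)
qed (auto simp: KA_def quasiD R.is_cring R.l_distr R.r_distr R.m_assoc)

lemma delta_mult: "\<delta> a \<otimes>\<^bsub>KA\<^esub> \<delta> b = \<delta> (a + b)"
proof -
  have "\<delta> b (k - a) = \<delta> (a + b) k" for k
    using delta_shift[of b a "k - a"] by (simp add: add.commute)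
  then show ?thesis by (simp add: KA_def delta_conv[OF delta_quasi])
qed

lemma delta_pow: "\<delta> 1 [^]\<^bsub>KA\<^esub> (n::nat) = \<delta> (int n)"
proof (induction n)
  case 0
  show ?case by (simp add: KA_def)
next
  case (Suc n)
  then show ?case using delta_mult[of "int n" 1] by (simp add: add.commute)
qed

lemma delta_pow_p: "\<delta> 1 [^]\<^bsub>KA\<^esub> p = structure_map KA u"
proof -
  have "\<delta> (int p) n = u \<otimes> \<delta> 0 n" for n
  proof -
    have "\<delta> 0 n = \<delta> (int p) (n + int p)" using delta_shift[of 0 "int p" n] by simp
    then show ?thesis using quasiD(2)[OF delta_quasi[of "int p"], of n] by simp
  qed
  then show ?thesis unfolding delta_pow by (simp add: KA_def structure_map_def fun_eq_iff)
qed

lemma KA_finsum: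
  assumes "finite A" "f \<in> A \<rightarrow> quasi"
  shows "(\<Oplus>\<^bsub>KA\<^esub>a\<in>A. f a) n = (\<Oplus>a\<in>A. f a n)"
proof -
  interpret K: algebra R KA by (rule KA_algebra)
  show ?thesis using assms
  proof (induction A)
    case empty
    have "(\<Oplus>\<^bsub>KA\<^esub>a\<in>{}. f a) = \<zero>\<^bsub>KA\<^esub>" by (rule K.M.finsum_empty)
    then show ?case by (simp add: KA_def)
  next
    case (insert b A)
    have c: "f \<in> A \<rightarrow> carrier KA" "f b \<in> carrier KA" using insert by (auto simp: KA_def)
    have "(\<Oplus>\<^bsub>KA\<^esub>a\<in>insert b A. f a) = f b \<oplus>\<^bsub>KA\<^esub> (\<Oplus>\<^bsub>KA\<^esub>a\<in>A. f a)"
      by (rule K.M.finsum_insert[OF insert(1,2) c])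
    then have "(\<Oplus>\<^bsub>KA\<^esub>a\<in>insert b A. f a) n = f b n \<oplus> (\<Oplus>\<^bsub>KA\<^esub>a\<in>A. f a) n" by (simp add: KA_def)
    then show ?case using insert by (simp add: quasiD Pi_def)
  qed
qed

lemma KA_comb:
  assumes c: "c \<in> {..<p} \<rightarrow> carrier R" and j: "j < p"
  shows "(\<Oplus>\<^bsub>KA\<^esub>i\<in>{..<p}. c i \<odot>\<^bsub>KA\<^esub> \<delta> 1 [^]\<^bsub>KA\<^esub> i) (int j) = c j"
proof -
  interpret K: algebra R KA by (rule KA_algebra)
  have cc: "c i \<in> carrier R" if "i < p" for i using c that by auto
  have q: "c i \<odot>\<^bsub>KA\<^esub> \<delta> (int i) \<in> quasi" if "i < p" for i
    using K.smult_closed[of "c i" "\<delta> (int i)"] c that delta_quasi by (auto simp: KA_def)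
  have "(\<Oplus>\<^bsub>KA\<^esub>i\<in>{..<p}. c i \<odot>\<^bsub>KA\<^esub> \<delta> 1 [^]\<^bsub>KA\<^esub> i) (int j) = (\<Oplus>i\<in>{..<p}. (c i \<odot>\<^bsub>KA\<^esub> \<delta> (int i)) (int j))"
    unfolding delta_pow using q by (intro KA_finsum) auto
  also have "\<dots> = (\<Oplus>i\<in>{..<p}. if j = i then c i else \<zero>)"
    using cc j by (intro R.add.finprod_cong') (auto simp: KA_def delta_zero)
  also have "\<dots> = c j" using c j by (intro R.add.finprod_singleton) auto
  finally show ?thesis .
qed

text \<open>The coefficients of s are its values at 0, ..., p - 1, and these determine s by
  \<open>quasi_eqI\<close>.\<close>

lemma KA_power_basis: "power_basis p R KA (\<delta> 1)"
  unfolding power_basis_def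
proof (intro conjI ballI)
  interpret K: algebra R KA by (rule KA_algebra)
  show "\<delta> 1 \<in> carrier KA" using delta_quasi by (simp add: KA_def)
  fix s assume "s \<in> carrier KA"
  then have s: "s \<in> quasi" by (simp add: KA_def)
  have dc: "\<delta> m \<in> carrier KA" for m using delta_quasi by (simp add: KA_def)
  let ?c = "\<lambda>i\<in>{..<p}. s (int i)"
  have cc: "?c \<in> {..<p} \<rightarrow>\<^sub>E carrier R" using quasiD(1)[OF s] by auto
  have cl: "(\<Oplus>\<^bsub>KA\<^esub>i\<in>{..<p}. c i \<odot>\<^bsub>KA\<^esub> \<delta> 1 [^]\<^bsub>KA\<^esub> i) \<in> quasi" if "c \<in> {..<p} \<rightarrow>\<^sub>E carrier R" for c
  proof -
    have "(\<Oplus>\<^bsub>KA\<^esub>i\<in>{..<p}. c i \<odot>\<^bsub>KA\<^esub> \<delta> 1 [^]\<^bsub>KA\<^esub> i) \<in> carrier KA"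
      unfolding delta_pow using that dc by (intro K.M.finsum_closed funcsetI K.smult_closed) auto
    then show ?thesis by (simp add: KA_def)
  qed
  show "\<exists>!c. c \<in> {..<p} \<rightarrow>\<^sub>E carrier R \<and> s = (\<Oplus>\<^bsub>KA\<^esub>i\<in>{..<p}. c i \<odot>\<^bsub>KA\<^esub> \<delta> 1 [^]\<^bsub>KA\<^esub> i)"
  proof (rule ex1I[of _ ?c], intro conjI cc)
    show "s = (\<Oplus>\<^bsub>KA\<^esub>i\<in>{..<p}. ?c i \<odot>\<^bsub>KA\<^esub> \<delta> 1 [^]\<^bsub>KA\<^esub> i)"
    proof (rule quasi_eqI[OF s cl[OF cc]])
      fix i assume i: "i \<in> I"
      have "(\<Oplus>\<^bsub>KA\<^esub>i\<in>{..<p}. ?c i \<odot>\<^bsub>KA\<^esub> \<delta> 1 [^]\<^bsub>KA\<^esub> i) (int (nat i)) = ?c (nat i)"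
        using cc i by (intro KA_comb) auto
      then show "s i = (\<Oplus>\<^bsub>KA\<^esub>i\<in>{..<p}. ?c i \<odot>\<^bsub>KA\<^esub> \<delta> 1 [^]\<^bsub>KA\<^esub> i) i"
        using i by (simp add: nat_less_iff)
    qed
    fix d assume d: "d \<in> {..<p} \<rightarrow>\<^sub>E carrier R \<and> s = (\<Oplus>\<^bsub>KA\<^esub>i\<in>{..<p}. d i \<odot>\<^bsub>KA\<^esub> \<delta> 1 [^]\<^bsub>KA\<^esub> i)"
    show "d = ?c"
    proof (rule PiE_ext[of _ "{..<p}" "\<lambda>_. carrier R"])
      fix j assume j: "j \<in> {..<p}"
      have "s (int j) = d j"
        by (subst conjunct2[OF d], rule KA_comb) (use d j in auto)
      then show "d j = ?c j" using j by simp
    qed (use d cc in auto)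
  qed
qed

end

text \<open>Listing the p basic coefficients embeds the carrier of \<open>KA\<close> into lists over
  \<open>R\<close>, hence into any type that receives those lists injectively.\<close>

lemma (in kummerian) kummer_extension_exists:
  fixes large_s :: "'r list \<Rightarrow> 's"
  assumes u: "u \<in> Units R" and large: "inj large_s"
  shows "\<exists>(S :: ('r, 's) module) \<phi> \<alpha>. galois_extension R S (integer_mod_group p) \<phi> \<and>
    primitive_element p R \<mu> S (integer_mod_group p) \<phi> \<alpha> \<and> \<alpha> [^]\<^bsub>S\<^esub> p = structure_map S u"
proof -
  interpret K: kummer_algebra R p u using p_gt u by unfold_locales
  define h where "h c = large_s (map (\<lambda>i. c (int i)) [0..<p])" for c
  have inj: "inj_on h (carrier K.KA)"
  proof (rule inj_onI)
    fix c d assume cd: "c \<in> carrier K.KA" "d \<in> carrier K.KA" and eq: "h c = h d"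
    have "map (\<lambda>i. c (int i)) [0..<p] = map (\<lambda>i. d (int i)) [0..<p]"
      using injD[OF large] eq unfolding h_def by blast
    then have e: "c (int i) = d (int i)" if "i < p" for i using that by simp
    show "c = d"
    proof (rule K.quasi_eqI)
      show "c i = d i" if "i \<in> {0..<int p}" for i using e[of "nat i"] that by (simp add: nat_less_iff)
    qed (use cd in \<open>simp_all add: K.KA_def\<close>)
  qed
  let ?S = "image_algebra h K.KA"
  note S = image_algebra_algebra[OF K.KA_algebra inj]
  have pb: "power_basis p R ?S (h (K.\<delta> 1))"
    by (rule power_basis_transfer[OF K.KA_algebra S K.KA_power_basis])
  have dc: "K.\<delta> 1 \<in> carrier K.KA" using K.delta_quasi by (simp add: K.KA_def)
  have "h (K.\<delta> 1) [^]\<^bsub>?S\<^esub> p = structure_map ?S u"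
    using algebra_hom_pow[OF K.KA_algebra algebra_isoD(1)[OF S(2)] dc, of p] K.delta_pow_p
      algebra_hom_structure_map[OF K.KA_algebra algebra_isoD(1)[OF S(2)], of u] u by simp
  then show ?thesis using power_basis_galois[OF S(1) pb u] by blast
qed

section \<open>The orbit correspondences\<close>

text \<open>Turns a relation between representatives into a bijection of classes. In
  \<open>eq\<close>, one implication makes the map well defined and the other makes it injective;
  \<open>saturated\<close> upgrades the description of the map from an implication to an
  equivalence.\<close>

lemma bij_betw_classes:
  assumes total: "\<And>a. a \<in> A \<Longrightarrow> \<exists>b\<in>B. P a b" "\<And>b. b \<in> B \<Longrightarrow> \<exists>a\<in>A. P a b"
    and eq: "\<And>a b a' b'. \<lbrakk>a \<in> A; a' \<in> A; b \<in> B; b' \<in> B; P a b; P a' b'\<rbrakk> \<Longrightarrow> f a = f a' \<longleftrightarrow> g b = g b'"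
    and saturated: "\<And>a b b'. \<lbrakk>a \<in> A; b \<in> B; b' \<in> B; P a b; g b = g b'\<rbrakk> \<Longrightarrow> P a b'"
  shows "\<exists>\<Phi>. bij_betw \<Phi> (f ` A) (g ` B) \<and> (\<forall>a\<in>A. \<forall>b\<in>B. \<Phi> (f a) = g b \<longleftrightarrow> P a b)"
proof -
  define \<Phi> where "\<Phi> x = (SOME y. \<exists>a\<in>A. \<exists>b\<in>B. f a = x \<and> P a b \<and> y = g b)" for x
  have P: "\<Phi> (f a) = g b" if a: "a \<in> A" and b: "b \<in> B" and ab: "P a b" for a b
  proof -
    have "\<exists>y. \<exists>a'\<in>A. \<exists>b'\<in>B. f a' = f a \<and> P a' b' \<and> y = g b'" using that by blast
    then have "\<exists>a'\<in>A. \<exists>b'\<in>B. f a' = f a \<and> P a' b' \<and> \<Phi> (f a) = g b'" unfolding \<Phi>_def by (rule someI_ex)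
    then obtain a' b' where "a' \<in> A" "b' \<in> B" "f a' = f a" "P a' b'" "\<Phi> (f a) = g b'" by blast
    then show ?thesis using eq[of a' a b' b] a b ab by metis
  qed
  have "inj_on \<Phi> (f ` A)"
  proof (rule inj_onI)
    fix x y assume "x \<in> f ` A" "y \<in> f ` A" and xy: "\<Phi> x = \<Phi> y"
    then obtain a a' where a: "a \<in> A" "x = f a" and a': "a' \<in> A" "y = f a'" by blast
    obtain b b' where b: "b \<in> B" "P a b" and b': "b' \<in> B" "P a' b'" using total(1) a(1) a'(1) by meson
    have "g b = g b'" using xy P[OF a(1) b] P[OF a'(1) b'] a(2) a'(2) by simp
    then show "x = y" using eq[OF a(1) a'(1) b(1) b'(1) b(2) b'(2)] a(2) a'(2) by simp
  qed
  moreover have "\<Phi> ` f ` A = g ` B"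
  proof (intro equalityI subsetI)
    fix y assume "y \<in> \<Phi> ` f ` A"
    then obtain a where a: "a \<in> A" "y = \<Phi> (f a)" by blast
    then obtain b where "b \<in> B" "P a b" using total(1) by blast
    then show "y \<in> g ` B" using P[OF a(1)] a(2) by blast
  next
    fix y assume "y \<in> g ` B"
    then obtain b where b: "b \<in> B" "y = g b" by blast
    then obtain a where a: "a \<in> A" "P a b" using total(2) by blast
    have "y = \<Phi> (f a)" using P[OF a(1) b(1) a(2)] b(2) by simp
    then show "y \<in> \<Phi> ` f ` A" using a(1) by blast
  qed
  ultimately have "bij_betw \<Phi> (f ` A) (g ` B)" by (rule bij_betw_imageI)
  moreover have "P a b" if a: "a \<in> A" and b: "b \<in> B" and eq: "\<Phi> (f a) = g b" for a b
  proof -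
    obtain b' where b': "b' \<in> B" "P a b'" using total(1)[OF a] by blast
    have "g b' = g b" using P[OF a b'] eq by simp
    then show ?thesis by (rule saturated[OF a b'(1) b b'(2)])
  qed
  ultimately show ?thesis using P by blast
qed

section \<open>Unit classes modulo p-th powers and their orbits\<close>

lemma mod_prime_inverse:
  assumes p: "Factorial_Ring.prime (p::nat)" and b: "b \<in> {1..<p}"
  shows "\<exists>c\<in>{1..<p}. (b * c) mod p = 1"
proof -
  have p1: "p > 1" using p by (rule prime_gt_1_nat)
  have "\<not> p dvd b" using b by (auto dest: dvd_imp_le)
  then have "coprime b p" using prime_imp_coprime[OF p, of b] by (simp add: coprime_commute)
  then obtain x where "[b * x = 1] (mod p)" using cong_solve_coprime_nat[of b p] by auto
  then have x: "(b * (x mod p)) mod p = 1" using p1 by (simp add: cong_def mod_mult_right_eq)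
  have "x mod p \<noteq> 0" using x by (intro notI) simp
  then show ?thesis using x p1 by (intro bexI[of _ "x mod p"]) simp_all
qed

lemma mult_mod_prime:
  assumes p: "Factorial_Ring.prime (p::nat)" and "b \<in> {1..<p}" "c \<in> {1..<p}"
  shows "(b * c) mod p \<in> {1..<p}"
proof -
  have "\<not> p dvd b * c" using prime_dvd_mult_iff[OF p] assms(2,3) by (auto dest: dvd_imp_le)
  then show ?thesis using prime_gt_0_nat[OF p] by (auto simp: dvd_eq_mod_eq_0 Suc_le_eq)
qed

lemma carrier_Zp_units:
  assumes "Factorial_Ring.prime p"
  shows "carrier (Zp_units p) = int ` {1..<p}"
proof -
  interpret residues_prime p "residue_ring (int p)" using assms by unfold_locales
  have "carrier (Zp_units p) = {1..int p - 1}"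
    unfolding units_of_carrier res_prime_units_eq using prime_ge_1_nat[OF assms] by (simp add: of_nat_diff)
  also have "\<dots> = int ` {1..<p}"
  proof (intro equalityI subsetI)
    fix x assume "x \<in> {1..int p - 1}"
    then show "x \<in> int ` {1..<p}" by (intro image_eqI[of _ _ "nat x"]) auto
  qed auto
  finally show ?thesis .
qed

context kummerian
begin

abbreviation "U \<equiv> units_of R"
abbreviation "H \<equiv> pth_powers p R"

lemma pth_powers_normal: "H \<lhd> U"
proof -
  interpret U: comm_group U by (rule R.units_comm_group)
  have H: "H = (\<lambda>u. u [^]\<^bsub>U\<^esub> p) ` carrier U"
    by (auto simp: pth_powers_def units_of_carrier R.units_of_pow)
  have "(\<lambda>u. u [^]\<^bsub>U\<^esub> p) \<in> hom U U" by (rule homI) (simp_all add: U.nat_pow_distrib)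
  then interpret P: group_hom U U "\<lambda>u. u [^]\<^bsub>U\<^esub> p" by unfold_locales
  show ?thesis unfolding H by (rule U.subgroup_imp_normal[OF P.img_is_subgroup])
qed

lemma power_coset_eq_iff:
  assumes x: "x \<in> Units R" and y: "y \<in> Units R"
  shows "H #>\<^bsub>U\<^esub> x = H #>\<^bsub>U\<^esub> y \<longleftrightarrow> (\<exists>w\<in>Units R. x = w [^]\<^bsub>R\<^esub> p \<otimes>\<^bsub>R\<^esub> y)"
proof -
  interpret N: normal H U by (rule pth_powers_normal)
  have c: "x \<in> carrier U" "y \<in> carrier U" using x y by (simp_all add: units_of_carrier)
  have "H #>\<^bsub>U\<^esub> x = H #>\<^bsub>U\<^esub> y \<longleftrightarrow> x \<in> H #>\<^bsub>U\<^esub> y"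
    using N.repr_independence[OF _ c(2) N.subgroup_axioms, of x] N.rcos_self[OF c(1) N.subgroup_axioms] by blast
  also have "\<dots> \<longleftrightarrow> (\<exists>w\<in>Units R. x = w [^]\<^bsub>R\<^esub> p \<otimes>\<^bsub>R\<^esub> y)"
    by (auto simp: r_coset_def pth_powers_def units_of_mult)
  finally show ?thesis .
qed

lemma Units_pow: "x \<in> Units R \<Longrightarrow> x [^]\<^bsub>R\<^esub> (n::nat) \<in> Units R"
  by (rule R.Units_pow_closed)

lemma power_coset_cong:
  assumes x: "x \<in> Units R" and y: "y \<in> Units R" and eq: "H #>\<^bsub>U\<^esub> x = H #>\<^bsub>U\<^esub> y"
  shows "H #>\<^bsub>U\<^esub> (x [^]\<^bsub>R\<^esub> (n::nat)) = H #>\<^bsub>U\<^esub> (y [^]\<^bsub>R\<^esub> n)"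
proof -
  obtain w where w: "w \<in> Units R" "x = w [^]\<^bsub>R\<^esub> p \<otimes>\<^bsub>R\<^esub> y" using eq power_coset_eq_iff[OF x y] by blast
  have c: "w \<in> carrier R" "y \<in> carrier R" using w y by (auto simp: R.Units_closed)
  have "x [^]\<^bsub>R\<^esub> n = (w [^]\<^bsub>R\<^esub> n) [^]\<^bsub>R\<^esub> p \<otimes>\<^bsub>R\<^esub> y [^]\<^bsub>R\<^esub> n"
    unfolding w(2) using c by (simp add: R.nat_pow_distrib R.nat_pow_pow mult.commute)
  then show ?thesis
    using power_coset_eq_iff[OF Units_pow[OF x] Units_pow[OF y]] Units_pow[OF w(1)] by blast
qed

text \<open>The part of the exponent divisible by p contributes a p-th power, so exponents count
  modulo p.\<close>

lemma power_coset_mod: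
  assumes x: "x \<in> Units R"
  shows "H #>\<^bsub>U\<^esub> (x [^]\<^bsub>R\<^esub> (n::nat)) = H #>\<^bsub>U\<^esub> (x [^]\<^bsub>R\<^esub> (n mod p))"
proof -
  have c: "x \<in> carrier R" using x by (rule R.Units_closed)
  have "(x [^]\<^bsub>R\<^esub> (n div p)) [^]\<^bsub>R\<^esub> p \<otimes>\<^bsub>R\<^esub> x [^]\<^bsub>R\<^esub> (n mod p) = x [^]\<^bsub>R\<^esub> (n div p * p + n mod p)"
    unfolding R.nat_pow_pow[OF c] R.nat_pow_mult[OF c] ..
  then have "x [^]\<^bsub>R\<^esub> n = (x [^]\<^bsub>R\<^esub> (n div p)) [^]\<^bsub>R\<^esub> p \<otimes>\<^bsub>R\<^esub> x [^]\<^bsub>R\<^esub> (n mod p)"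
    unfolding div_mult_mod_eq by (rule sym)
  then show ?thesis
    using power_coset_eq_iff[OF Units_pow[OF x] Units_pow[OF x]] Units_pow[OF x] by blast
qed

lemma unit_orbit_eq:
  assumes u: "u \<in> Units R"
  shows "unit_orbit p R u = (\<lambda>b. H #>\<^bsub>U\<^esub> (u [^]\<^bsub>R\<^esub> b)) ` {1..<p}"
proof -
  interpret N: normal H U by (rule pth_powers_normal)
  have c: "u \<in> carrier U" using u by (simp add: units_of_carrier)
  have "(H #>\<^bsub>U\<^esub> u) [^]\<^bsub>unit_classes p R\<^esub> int b = H #>\<^bsub>U\<^esub> (u [^]\<^bsub>R\<^esub> b)" for b
    using hom_int_pow[OF N.r_coset_hom_Mod c N.is_group N.factorgroup_is_group, of "int b"]
    by (simp add: unit_classes_def int_pow_int R.units_of_pow[OF u])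
  then show ?thesis
    unfolding orbit_def carrier_Zp_units[OF prime] by auto
qed

lemma unit_orbit_mem: "u \<in> Units R \<Longrightarrow> H #>\<^bsub>U\<^esub> u \<in> unit_orbit p R u"
  unfolding unit_orbit_eq using p_gt(1) R.Units_closed[of u] by (intro image_eqI[of _ _ "1::nat"]) auto

lemma unit_orbit_subset:
  assumes u: "u \<in> Units R" and v: "v \<in> Units R" and b: "b \<in> {1..<p}"
    and eq: "H #>\<^bsub>U\<^esub> u = H #>\<^bsub>U\<^esub> (v [^]\<^bsub>R\<^esub> b)"
  shows "unit_orbit p R u \<subseteq> unit_orbit p R v"
proof
  fix X assume "X \<in> unit_orbit p R u"
  then obtain n where n: "n \<in> {1..<p}" "X = H #>\<^bsub>U\<^esub> (u [^]\<^bsub>R\<^esub> n)" unfolding unit_orbit_eq[OF u] by blast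
  have "X = H #>\<^bsub>U\<^esub> (v [^]\<^bsub>R\<^esub> (b * n))"
    unfolding n(2) power_coset_cong[OF u Units_pow[OF v] eq] using R.nat_pow_pow[OF R.Units_closed[OF v]] by simp
  then have "X = H #>\<^bsub>U\<^esub> (v [^]\<^bsub>R\<^esub> (b * n mod p))" unfolding power_coset_mod[OF v, of "b * n"] .
  then show "X \<in> unit_orbit p R v"
    unfolding unit_orbit_eq[OF v] by (rule image_eqI) (rule mult_mod_prime[OF prime b n(1)])
qed

text \<open>Lying in the orbit of v is symmetric: with c inverse to b modulo p, the class of v is
  the c-th power of the class of u.\<close>

lemma unit_orbit_eq_iff:
  assumes u: "u \<in> Units R" and v: "v \<in> Units R"
  shows "unit_orbit p R u = unit_orbit p R v \<longleftrightarrow>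
    (\<exists>b\<in>{1..<p}. \<exists>w\<in>Units R. u = w [^]\<^bsub>R\<^esub> p \<otimes>\<^bsub>R\<^esub> v [^]\<^bsub>R\<^esub> (b::nat))"
proof -
  have "unit_orbit p R u = unit_orbit p R v \<longleftrightarrow> (\<exists>b\<in>{1..<p}. H #>\<^bsub>U\<^esub> u = H #>\<^bsub>U\<^esub> (v [^]\<^bsub>R\<^esub> (b::nat)))"
  proof
    assume "unit_orbit p R u = unit_orbit p R v"
    then have "H #>\<^bsub>U\<^esub> u \<in> unit_orbit p R v" using unit_orbit_mem[OF u] by simp
    then show "\<exists>b\<in>{1..<p}. H #>\<^bsub>U\<^esub> u = H #>\<^bsub>U\<^esub> (v [^]\<^bsub>R\<^esub> b)" unfolding unit_orbit_eq[OF v] by blast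
  next
    assume "\<exists>b\<in>{1..<p}. H #>\<^bsub>U\<^esub> u = H #>\<^bsub>U\<^esub> (v [^]\<^bsub>R\<^esub> b)"
    then obtain b where b: "b \<in> {1..<p}" "H #>\<^bsub>U\<^esub> u = H #>\<^bsub>U\<^esub> (v [^]\<^bsub>R\<^esub> b)" by blast
    obtain c where c: "c \<in> {1..<p}" "(b * c) mod p = 1" using mod_prime_inverse[OF prime b(1)] by blast
    have vc: "v \<in> carrier R" using v by (rule R.Units_closed)
    have "H #>\<^bsub>U\<^esub> (u [^]\<^bsub>R\<^esub> c) = H #>\<^bsub>U\<^esub> (v [^]\<^bsub>R\<^esub> (b * c))"
      unfolding power_coset_cong[OF u Units_pow[OF v] b(2)] R.nat_pow_pow[OF vc] ..
    also have "\<dots> = H #>\<^bsub>U\<^esub> v"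
      unfolding power_coset_mod[OF v, of "b * c"] c(2) using vc by simp
    finally have e: "H #>\<^bsub>U\<^esub> v = H #>\<^bsub>U\<^esub> (u [^]\<^bsub>R\<^esub> c)" ..
    show "unit_orbit p R u = unit_orbit p R v"
      by (rule equalityI[OF unit_orbit_subset[OF u v b] unit_orbit_subset[OF v u c(1) e]])
  qed
  also have "\<dots> \<longleftrightarrow> (\<exists>b\<in>{1..<p}. \<exists>w\<in>Units R. u = w [^]\<^bsub>R\<^esub> p \<otimes>\<^bsub>R\<^esub> v [^]\<^bsub>R\<^esub> (b::nat))"
    using power_coset_eq_iff[OF u Units_pow[OF v]] by simp
  finally show ?thesis .
qed

lemma unit_orbits_eq: "unit_orbits p R = unit_orbit p R ` Units R"
  unfolding orbits_def unit_classes_def carrier_FactGroup units_of_carrier by blast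

text \<open>Connects the quotient of units with the division-free relation that the conjugacy
  arguments produce.\<close>

lemma quotient_pth_power_iff:
  assumes u: "u \<in> Units R" and v: "v \<in> Units R"
  shows "(\<exists>b\<in>carrier (Zp_units p). u \<otimes>\<^bsub>U\<^esub> inv\<^bsub>U\<^esub> (v [^]\<^bsub>U\<^esub> b) \<in> H) \<longleftrightarrow>
    (\<exists>b\<in>{1..<p}. \<exists>w\<in>Units R. u = w [^]\<^bsub>R\<^esub> p \<otimes>\<^bsub>R\<^esub> v [^]\<^bsub>R\<^esub> (b::nat))"
proof -
  interpret U: group U by (rule R.units_group)
  have "u \<otimes>\<^bsub>U\<^esub> inv\<^bsub>U\<^esub> (v [^]\<^bsub>U\<^esub> int b) \<in> H \<longleftrightarrow> (\<exists>w\<in>Units R. u = w [^]\<^bsub>R\<^esub> p \<otimes>\<^bsub>R\<^esub> v [^]\<^bsub>R\<^esub> b)" for b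
  proof -
    have e: "v [^]\<^bsub>U\<^esub> int b = v [^]\<^bsub>R\<^esub> b" by (simp add: int_pow_int R.units_of_pow[OF v])
    have "w [^]\<^bsub>R\<^esub> p = u \<otimes>\<^bsub>U\<^esub> inv\<^bsub>U\<^esub> (v [^]\<^bsub>R\<^esub> b) \<longleftrightarrow> u = w [^]\<^bsub>R\<^esub> p \<otimes>\<^bsub>R\<^esub> v [^]\<^bsub>R\<^esub> b" if "w \<in> Units R" for w
      using U.inv_solve_right[of "w [^]\<^bsub>R\<^esub> p" u "v [^]\<^bsub>R\<^esub> b"] Units_pow[OF that] Units_pow[OF v] u
      by (simp add: units_of_carrier units_of_mult)
    then show ?thesis unfolding e pth_powers_def by (force simp: image_iff)
  qed
  then show ?thesis unfolding carrier_Zp_units[OF prime] by simp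
qed

end

section \<open>Isomorphism, conjugacy and twisting of extensions\<close>

text \<open>The conditions see the group through the automorphisms it induces, and h changes only
  their labels.\<close>

lemma galois_extension_transport:
  assumes X: "galois_extension R S G \<phi>" and H: "group H" and h: "h \<in> iso H G"
  shows "galois_extension R S H (\<lambda>g. \<phi> (h g))"
proof -
  interpret X: galois_extension R S G \<phi> by (rule X)
  interpret H: group H by (rule H)
  interpret hom: group_hom G "BijGroup (carrier S)" \<phi> by (rule X.group_hom)
  have hh: "h \<in> hom H G" and bij: "bij_betw h (carrier H) (carrier G)" using h by (auto simp: iso_def)
  have hc: "h g \<in> carrier G" if "g \<in> carrier H" for g using bij that by (rule bij_betwE[THEN bspec])
  have inj: "inj_on h (carrier H)" and im: "h ` carrier H = carrier G" using bij by (auto simp: bij_betw_def)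
  have \<phi>h: "(\<lambda>g. \<phi> (h g)) \<in> hom H (BijGroup (carrier S))"
    using hom_compose[OF hh hom.homh] by (simp add: comp_def)
  have act: "group_action H (carrier S) (\<lambda>g. \<phi> (h g))"
    by (intro group_action.intro group_hom.intro group_hom_axioms.intro H group_BijGroup \<phi>h)
  have faith: "inj_on (\<lambda>g. \<phi> (h g)) (carrier H)"
    using comp_inj_on[OF inj, of \<phi>] X.faithful unfolding im by (simp add: comp_def)
  have fixed: "(\<forall>g\<in>carrier H. \<phi> (h g) s = s) \<longleftrightarrow> (\<forall>g\<in>carrier G. \<phi> g s = s)" for s
    unfolding im[symmetric] by simp
  show ?thesis
  proof (intro galois_extension.intro galois_extension_axioms.intro faithful_action.intro faithful_action_axioms.intro)
    show "{s \<in> carrier S. \<forall>g\<in>carrier H. \<phi> (h g) s = s} = structure_map S ` carrier R"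
      unfolding fixed by (rule X.fixed_ring)
    show "finite (carrier H)" using X.finite_group bij_betw_finite[OF bij] by simp
    fix g k e
    assume gk: "g \<in> carrier H" "k \<in> carrier H" "g \<noteq> k" and e: "e \<in> carrier S" "e \<otimes>\<^bsub>S\<^esub> e = e" "e \<noteq> \<zero>\<^bsub>S\<^esub>"
    have "h g \<noteq> h k" using inj_on_eq_iff[OF inj gk(1,2)] gk(3) by simp
    then show "\<exists>s\<in>carrier S. \<phi> (h g) s \<otimes>\<^bsub>S\<^esub> e \<noteq> \<phi> (h k) s \<otimes>\<^bsub>S\<^esub> e"
      by (rule X.strongly_distinct[OF hc[OF gk(1)] hc[OF gk(2)] _ e])
  qed (fact X.algebra_axioms act faith X.extension X.separable X.ring_automorphism[OF hc] X.linear[OF hc])+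
qed

lemma algebra_iso_refl: "(\<lambda>s. s) \<in> algebra_iso R S S"
  by (simp add: algebra_iso_def ring_iso_def ring_hom_def bij_betw_def)

lemma algebra_iso_sym:
  assumes S: "algebra R S" and f: "f \<in> algebra_iso R S T"
  shows "inv_into (carrier S) f \<in> algebra_iso R T S"
proof -
  interpret S: cring S using S by (rule algebra.axioms)
  interpret A: algebra R S by (rule S)
  have r: "f \<in> ring_iso S T" using f by (simp add: algebra_iso_def)
  note bij = algebra_isoD(2)[OF f]
  have "inv_into (carrier S) f (r \<odot>\<^bsub>T\<^esub> t) = r \<odot>\<^bsub>S\<^esub> inv_into (carrier S) f t"
    if r: "r \<in> carrier R" and t: "t \<in> carrier T" for r t
  proof -
    obtain s where s: "s \<in> carrier S" "t = f s" using bij t by (auto simp: bij_betw_def)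
    have "r \<odot>\<^bsub>T\<^esub> t = f (r \<odot>\<^bsub>S\<^esub> s)" using f r s by (simp add: algebra_iso_def)
    then show ?thesis
      using inv_into_f_f[OF bij_betw_imp_inj_on[OF bij]] s r by simp
  qed
  then show ?thesis
    using ring_iso_set_sym[OF S.ring_axioms r] by (simp add: algebra_iso_def)
qed

lemma algebra_iso_trans:
  assumes f: "f \<in> algebra_iso R S T" and g: "g \<in> algebra_iso R T V"
  shows "(\<lambda>s. g (f s)) \<in> algebra_iso R S V"
proof -
  have "g \<circ> f \<in> ring_iso S V" using f g by (intro ring_iso_set_trans[of f S T g V]) (auto simp: algebra_iso_def)
  moreover have "f s \<in> carrier T" if "s \<in> carrier S" for s
    using algebra_isoD(2)[OF f] that by (rule bij_betwE[THEN bspec])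
  ultimately show ?thesis using f g by (simp add: algebra_iso_def comp_def)
qed

lemma conjugate_extensionsI:
  assumes "f \<in> algebra_iso R S T" "\<tau> \<in> iso G K"
    and "\<And>g s. g \<in> carrier G \<Longrightarrow> s \<in> carrier S \<Longrightarrow> f (\<phi> g s) = \<psi> (\<tau> g) (f s)"
  shows "conjugate_extensions R (S, G, \<phi>) (T, K, \<psi>)"
  unfolding conjugate_extensions_def prod.case
  by (intro bexI[of _ f] bexI[of _ \<tau>] ballI assms)

lemma harrison_relI:
  assumes "(S, \<phi>) \<in> C_extensions p R" "(T, \<psi>) \<in> C_extensions p R" "f \<in> algebra_iso R S T"
    and "\<And>g s. g \<in> carrier (Cyc p) \<Longrightarrow> s \<in> carrier S \<Longrightarrow> f (\<phi> g s) = \<psi> g (f s)"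
  shows "((S, \<phi>), (T, \<psi>)) \<in> harrison_rel p R"
  unfolding harrison_rel_def mem_Collect_eq prod.case
  by (intro conjI bexI[of _ f] ballI assms)

lemma harrison_relD:
  assumes "((S, \<phi>), (T, \<psi>)) \<in> harrison_rel p R"
  shows "(S, \<phi>) \<in> C_extensions p R" "(T, \<psi>) \<in> C_extensions p R"
    "\<exists>f\<in>algebra_iso R S T. \<forall>g\<in>carrier (Cyc p). \<forall>s\<in>carrier S. f (\<phi> g s) = \<psi> g (f s)"
  using assms unfolding harrison_rel_def mem_Collect_eq prod.case by blast+

lemma conjugate_refl: "conjugate_extensions R X X"
proof -
  obtain S G \<phi> where X: "X = (S, G, \<phi>)" by (cases X)
  have "(\<lambda>g. g) \<in> iso G G" by (simp add: iso_def hom_def bij_betw_def)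
  then show ?thesis unfolding X by (intro conjugate_extensionsI[OF algebra_iso_refl]) simp_all
qed

lemma conjugate_sym:
  assumes X: "galois_extension R S G \<phi>" and conj: "conjugate_extensions R (S, G, \<phi>) (T, K, \<psi>)"
  shows "conjugate_extensions R (T, K, \<psi>) (S, G, \<phi>)"
proof -
  interpret X: galois_extension R S G \<phi> by (rule X)
  obtain f \<tau> where f: "f \<in> algebra_iso R S T" and \<tau>: "\<tau> \<in> iso G K"
    and eq: "\<And>g s. g \<in> carrier G \<Longrightarrow> s \<in> carrier S \<Longrightarrow> f (\<phi> g s) = \<psi> (\<tau> g) (f s)"
    using conj unfolding conjugate_extensions_def by auto
  note bij = algebra_isoD(2)[OF f]
  have tb: "bij_betw \<tau> (carrier G) (carrier K)" using \<tau> by (simp add: iso_def)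
  let ?f = "inv_into (carrier S) f" and ?t = "inv_into (carrier G) \<tau>"
  have "?f (\<psi> k t) = \<phi> (?t k) (?f t)" if k: "k \<in> carrier K" and t: "t \<in> carrier T" for k t
  proof -
    obtain s where s: "s \<in> carrier S" "t = f s" using bij t by (auto simp: bij_betw_def)
    obtain g where g: "g \<in> carrier G" "k = \<tau> g" using tb k by (auto simp: bij_betw_def)
    have "\<phi> g s \<in> carrier S" by (rule X.element_image[OF g(1) s(1) refl])
    then show ?thesis
      unfolding s(2) g(2) eq[OF g(1) s(1), symmetric]
      by (simp add: inv_into_f_f[OF bij_betw_imp_inj_on[OF bij]] inv_into_f_f[OF bij_betw_imp_inj_on[OF tb]] s(1) g(1))
  qed
  then show ?thesis
    by (intro conjugate_extensionsI[OF algebra_iso_sym[OF X.algebra_axioms f] group.iso_set_sym[OF group_hom.axioms(1)[OF X.group_hom] \<tau>]])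
qed

lemma conjugate_trans:
  assumes 1: "conjugate_extensions R (S, G, \<phi>) (T, K, \<psi>)" and 2: "conjugate_extensions R (T, K, \<psi>) (V, L, \<xi>)"
  shows "conjugate_extensions R (S, G, \<phi>) (V, L, \<xi>)"
proof -
  obtain f \<tau> where f: "f \<in> algebra_iso R S T" and \<tau>: "\<tau> \<in> iso G K"
    and eq: "\<And>g s. g \<in> carrier G \<Longrightarrow> s \<in> carrier S \<Longrightarrow> f (\<phi> g s) = \<psi> (\<tau> g) (f s)"
    using 1 unfolding conjugate_extensions_def by auto
  obtain f' \<sigma> where f': "f' \<in> algebra_iso R T V" and \<sigma>: "\<sigma> \<in> iso K L"
    and eq': "\<And>g s. g \<in> carrier K \<Longrightarrow> s \<in> carrier T \<Longrightarrow> f' (\<psi> g s) = \<xi> (\<sigma> g) (f' s)"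
    using 2 unfolding conjugate_extensions_def by auto
  have fc: "f s \<in> carrier T" if "s \<in> carrier S" for s
    using algebra_isoD(2)[OF f] that by (rule bij_betwE[THEN bspec])
  have tc: "\<tau> g \<in> carrier K" if "g \<in> carrier G" for g
    using \<tau> that by (auto simp: iso_def dest: bij_betwE)
  have "f' (f (\<phi> g s)) = \<xi> ((\<sigma> \<circ> \<tau>) g) (f' (f s))" if "g \<in> carrier G" "s \<in> carrier S" for g s
    using eq[OF that] eq'[OF tc fc] that by simp
  then show ?thesis
    by (intro conjugate_extensionsI[OF algebra_iso_trans[OF f f'] iso_set_trans[OF \<tau> \<sigma>]])
qed

lemma harrison_rel_equiv: "equiv (C_extensions p R) (harrison_rel p R)"
proof (rule equivI)
  show "harrison_rel p R \<subseteq> C_extensions p R \<times> C_extensions p R" by (auto simp: harrison_rel_def)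
  show "refl_on (C_extensions p R) (harrison_rel p R)"
    by (rule refl_onI, clarify, rule harrison_relI[OF _ _ algebra_iso_refl]) simp_all
  show "sym (harrison_rel p R)"
  proof (rule symI, clarify)
    fix S\<^sub>1 \<phi>\<^sub>1 S\<^sub>2 \<phi>\<^sub>2
    assume r: "((S\<^sub>1, \<phi>\<^sub>1), (S\<^sub>2, \<phi>\<^sub>2)) \<in> harrison_rel p R"
    note E = harrison_relD(1,2)[OF r]
    obtain f where f: "f \<in> algebra_iso R S\<^sub>1 S\<^sub>2"
      and eq: "\<And>g s. g \<in> carrier (Cyc p) \<Longrightarrow> s \<in> carrier S\<^sub>1 \<Longrightarrow> f (\<phi>\<^sub>1 g s) = \<phi>\<^sub>2 g (f s)"
      using harrison_relD(3)[OF r] by blast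
    interpret X: galois_extension R S\<^sub>1 "Cyc p" \<phi>\<^sub>1 using E(1) by (simp add: C_extensions_def)
    note bij = algebra_isoD(2)[OF f]
    let ?f = "inv_into (carrier S\<^sub>1) f"
    have "?f (\<phi>\<^sub>2 g t) = \<phi>\<^sub>1 g (?f t)" if g: "g \<in> carrier (Cyc p)" and t: "t \<in> carrier S\<^sub>2" for g t
    proof -
      obtain s where s: "s \<in> carrier S\<^sub>1" "t = f s" using bij t by (auto simp: bij_betw_def)
      have "\<phi>\<^sub>1 g s \<in> carrier S\<^sub>1" by (rule X.element_image[OF g s(1) refl])
      then show ?thesis
        unfolding s(2) eq[OF g s(1), symmetric]
        by (simp add: inv_into_f_f[OF bij_betw_imp_inj_on[OF bij]] s(1))
    qed
    then show "((S\<^sub>2, \<phi>\<^sub>2), (S\<^sub>1, \<phi>\<^sub>1)) \<in> harrison_rel p R"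
      by (intro harrison_relI[OF E(2,1) algebra_iso_sym[OF X.algebra_axioms f]])
  qed
  show "trans (harrison_rel p R)"
  proof (rule transI, clarify)
    fix S\<^sub>1 \<phi>\<^sub>1 S\<^sub>2 \<phi>\<^sub>2 S\<^sub>3 \<phi>\<^sub>3
    assume r: "((S\<^sub>1, \<phi>\<^sub>1), (S\<^sub>2, \<phi>\<^sub>2)) \<in> harrison_rel p R" "((S\<^sub>2, \<phi>\<^sub>2), (S\<^sub>3, \<phi>\<^sub>3)) \<in> harrison_rel p R"
    obtain f where f: "f \<in> algebra_iso R S\<^sub>1 S\<^sub>2"
      and eq: "\<And>g s. g \<in> carrier (Cyc p) \<Longrightarrow> s \<in> carrier S\<^sub>1 \<Longrightarrow> f (\<phi>\<^sub>1 g s) = \<phi>\<^sub>2 g (f s)"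
      using harrison_relD(3)[OF r(1)] by blast
    obtain f' where f': "f' \<in> algebra_iso R S\<^sub>2 S\<^sub>3"
      and eq': "\<And>g s. g \<in> carrier (Cyc p) \<Longrightarrow> s \<in> carrier S\<^sub>2 \<Longrightarrow> f' (\<phi>\<^sub>2 g s) = \<phi>\<^sub>3 g (f' s)"
      using harrison_relD(3)[OF r(2)] by blast
    have fc: "f s \<in> carrier S\<^sub>2" if "s \<in> carrier S\<^sub>1" for s
      using algebra_isoD(2)[OF f] that by (rule bij_betwE[THEN bspec])
    have "f' (f (\<phi>\<^sub>1 g s)) = \<phi>\<^sub>3 g (f' (f s))" if "g \<in> carrier (Cyc p)" "s \<in> carrier S\<^sub>1" for g s
      using eq[OF that] eq'[OF that(1) fc[OF that(2)]] by simp
    then show "((S\<^sub>1, \<phi>\<^sub>1), (S\<^sub>3, \<phi>\<^sub>3)) \<in> harrison_rel p R"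
      by (intro harrison_relI[OF harrison_relD(1)[OF r(1)] harrison_relD(2)[OF r(2)] algebra_iso_trans[OF f f']])
  qed
qed

lemma C_extensions_twist:
  "(S, \<phi>) \<in> C_extensions p R \<Longrightarrow> \<tau> \<in> iso (Cyc p) (Cyc p) \<Longrightarrow> (S, \<lambda>g. \<phi> (\<tau> g)) \<in> C_extensions p R"
  unfolding C_extensions_def mem_Collect_eq prod.case
  by (rule galois_extension_transport[OF _ group_integer_mod_group])

lemma harrison_rel_twist:
  assumes r: "((S\<^sub>1, \<phi>\<^sub>1), (S\<^sub>2, \<phi>\<^sub>2)) \<in> harrison_rel p R" and \<tau>: "\<tau> \<in> iso (Cyc p) (Cyc p)"
  shows "((S\<^sub>1, \<lambda>g. \<phi>\<^sub>1 (\<tau> g)), (S\<^sub>2, \<lambda>g. \<phi>\<^sub>2 (\<tau> g))) \<in> harrison_rel p R"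
proof -
  have "\<tau> g \<in> carrier (Cyc p)" if "g \<in> carrier (Cyc p)" for g
    using \<tau> that by (auto simp: iso_def dest: bij_betwE)
  moreover obtain f where f: "f \<in> algebra_iso R S\<^sub>1 S\<^sub>2"
    and eq: "\<And>g s. g \<in> carrier (Cyc p) \<Longrightarrow> s \<in> carrier S\<^sub>1 \<Longrightarrow> f (\<phi>\<^sub>1 g s) = \<phi>\<^sub>2 g (f s)"
    using harrison_relD(3)[OF r] by blast
  ultimately show ?thesis
    by (intro harrison_relI[OF C_extensions_twist[OF _ \<tau>] C_extensions_twist[OF _ \<tau>] f]
        harrison_relD(1,2)[OF r] eq)
qed

text \<open>The twist of a class is a union over its members; related members have related twists,
  so the union is a single class.\<close>

lemma harrison_twist_class:
  assumes X: "(S, \<phi>) \<in> C_extensions p R" and \<tau>: "\<tau> \<in> iso (Cyc p) (Cyc p)"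
  shows "harrison_twist p R \<tau> (harrison_rel p R `` {(S, \<phi>)}) = harrison_rel p R `` {(S, \<lambda>g. \<phi> (\<tau> g))}"
proof -
  have "harrison_rel p R `` {(T, \<lambda>g. \<psi> (\<tau> g))} = harrison_rel p R `` {(S, \<lambda>g. \<phi> (\<tau> g))}"
    if "(T, \<psi>) \<in> harrison_rel p R `` {(S, \<phi>)}" for T \<psi>
  proof -
    have "((S, \<phi>), (T, \<psi>)) \<in> harrison_rel p R" using that by simp
    from equiv_class_eq[OF harrison_rel_equiv harrison_rel_twist[OF this \<tau>]] show ?thesis by (rule sym)
  qed
  moreover have "(S, \<phi>) \<in> harrison_rel p R `` {(S, \<phi>)}" by (rule equiv_class_self[OF harrison_rel_equiv X])
  ultimately show ?thesis unfolding harrison_twist_def by (intro equalityI subsetI) blast+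
qed

text \<open>\<open>AutoGroup\<close> contains only extensional automorphisms. Arbitrary isomorphisms
  give the same classes, because only their values on the carrier matter for the relation.\<close>

lemma harrison_orbit_eq:
  assumes X: "(S, \<phi>) \<in> C_extensions p R"
  shows "harrison_orbit p R (S, \<phi>) =
    (\<lambda>\<tau>. harrison_rel p R `` {(S, \<lambda>g. \<phi> (\<tau> g))}) ` iso (Cyc p) (Cyc p)" (is "?L = ?R")
proof (intro equalityI subsetI)
  fix Z assume "Z \<in> ?L"
  then obtain \<tau> where \<tau>: "\<tau> \<in> auto (Cyc p)" and Z: "Z = harrison_twist p R \<tau> (harrison_rel p R `` {(S, \<phi>)})"
    unfolding orbit_def AutoGroup_def by auto
  have "\<tau> \<in> iso (Cyc p) (Cyc p)" using \<tau> by (auto simp: auto_def Bij_def iso_def)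
  then show "Z \<in> ?R" unfolding Z by (intro image_eqI[of _ _ \<tau>] harrison_twist_class X)
next
  fix Z assume "Z \<in> ?R"
  then obtain \<tau> where \<tau>: "\<tau> \<in> iso (Cyc p) (Cyc p)" and Z: "Z = harrison_rel p R `` {(S, \<lambda>g. \<phi> (\<tau> g))}"
    by blast
  interpret C: group "Cyc p" by (rule group_integer_mod_group)
  let ?\<sigma> = "restrict \<tau> (carrier (Cyc p))"
  have bij: "bij_betw \<tau> (carrier (Cyc p)) (carrier (Cyc p))" and hom: "\<tau> \<in> hom (Cyc p) (Cyc p)"
    using \<tau> by (auto simp: iso_def)
  have "bij_betw ?\<sigma> (carrier (Cyc p)) (carrier (Cyc p))"
    using bij unfolding bij_betw_def by (simp add: inj_on_restrict_eq)
  moreover have "?\<sigma> \<in> hom (Cyc p) (Cyc p)"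
    by (rule C.hom_restrict[OF hom]) simp
  ultimately have \<sigma>: "?\<sigma> \<in> auto (Cyc p)" "?\<sigma> \<in> iso (Cyc p) (Cyc p)"
    by (auto simp: auto_def Bij_def iso_def)
  have "((S, \<lambda>g. \<phi> (\<tau> g)), (S, \<lambda>g. \<phi> (?\<sigma> g))) \<in> harrison_rel p R"
    by (rule harrison_relI[OF C_extensions_twist[OF X \<tau>] C_extensions_twist[OF X \<sigma>(2)] algebra_iso_refl]) simp
  then have "Z = harrison_twist p R ?\<sigma> (harrison_rel p R `` {(S, \<phi>)})"
    unfolding Z harrison_twist_class[OF X \<sigma>(2)] by (rule equiv_class_eq[OF harrison_rel_equiv])
  then show "Z \<in> ?L" using \<sigma>(1) unfolding orbit_def AutoGroup_def by auto
qed

text \<open>A conjugacy with group part \<tau> is the same as an equivariant isomorphism onto the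
  second extension twisted by \<tau>.\<close>

lemma harrison_orbit_eq_iff:
  assumes X: "(S\<^sub>1, \<phi>\<^sub>1) \<in> C_extensions p R" and Y: "(S\<^sub>2, \<phi>\<^sub>2) \<in> C_extensions p R"
  shows "harrison_orbit p R (S\<^sub>1, \<phi>\<^sub>1) = harrison_orbit p R (S\<^sub>2, \<phi>\<^sub>2) \<longleftrightarrow>
    conjugate_extensions R (S\<^sub>1, Cyc p, \<phi>\<^sub>1) (S\<^sub>2, Cyc p, \<phi>\<^sub>2)"
proof
  have id: "(\<lambda>g. g) \<in> iso (Cyc p) (Cyc p)" unfolding iso_def hom_def by (simp add: bij_betw_def)
  assume eq: "harrison_orbit p R (S\<^sub>1, \<phi>\<^sub>1) = harrison_orbit p R (S\<^sub>2, \<phi>\<^sub>2)"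
  have "harrison_rel p R `` {(S\<^sub>1, \<phi>\<^sub>1)} \<in> harrison_orbit p R (S\<^sub>1, \<phi>\<^sub>1)"
    unfolding harrison_orbit_eq[OF X] by (rule image_eqI[OF _ id]) simp
  then obtain \<tau> where \<tau>: "\<tau> \<in> iso (Cyc p) (Cyc p)"
    and cl: "harrison_rel p R `` {(S\<^sub>1, \<phi>\<^sub>1)} = harrison_rel p R `` {(S\<^sub>2, \<lambda>g. \<phi>\<^sub>2 (\<tau> g))}"
    unfolding eq harrison_orbit_eq[OF Y] by blast
  have r: "((S\<^sub>1, \<phi>\<^sub>1), (S\<^sub>2, \<lambda>g. \<phi>\<^sub>2 (\<tau> g))) \<in> harrison_rel p R"
    using eq_equiv_class[OF cl harrison_rel_equiv C_extensions_twist[OF Y \<tau>]] .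
  obtain f where "f \<in> algebra_iso R S\<^sub>1 S\<^sub>2"
    "\<And>g s. g \<in> carrier (Cyc p) \<Longrightarrow> s \<in> carrier S\<^sub>1 \<Longrightarrow> f (\<phi>\<^sub>1 g s) = \<phi>\<^sub>2 (\<tau> g) (f s)"
    using harrison_relD(3)[OF r] by blast
  then show "conjugate_extensions R (S\<^sub>1, Cyc p, \<phi>\<^sub>1) (S\<^sub>2, Cyc p, \<phi>\<^sub>2)"
    by (intro conjugate_extensionsI[OF _ \<tau>])
next
  \<comment> \<open>An inclusion of orbits is proved for arbitrary conjugate extensions; symmetry of
    conjugacy then gives the other one.\<close>
  have sub: "harrison_orbit p R (S\<^sub>1, \<phi>\<^sub>1) \<subseteq> harrison_orbit p R (S\<^sub>2, \<phi>\<^sub>2)"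
    if X: "(S\<^sub>1, \<phi>\<^sub>1) \<in> C_extensions p R" and Y: "(S\<^sub>2, \<phi>\<^sub>2) \<in> C_extensions p R"
      and conj: "conjugate_extensions R (S\<^sub>1, Cyc p, \<phi>\<^sub>1) (S\<^sub>2, Cyc p, \<phi>\<^sub>2)"
    for S\<^sub>1 S\<^sub>2 :: "('b, 'a) module" and \<phi>\<^sub>1 \<phi>\<^sub>2
  proof
    obtain f \<tau> where f: "f \<in> algebra_iso R S\<^sub>1 S\<^sub>2" and \<tau>: "\<tau> \<in> iso (Cyc p) (Cyc p)"
      and eq: "\<And>g s. g \<in> carrier (Cyc p) \<Longrightarrow> s \<in> carrier S\<^sub>1 \<Longrightarrow> f (\<phi>\<^sub>1 g s) = \<phi>\<^sub>2 (\<tau> g) (f s)"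
      using conj unfolding conjugate_extensions_def by auto
    fix Z assume "Z \<in> harrison_orbit p R (S\<^sub>1, \<phi>\<^sub>1)"
    then obtain \<sigma> where \<sigma>: "\<sigma> \<in> iso (Cyc p) (Cyc p)" and Z: "Z = harrison_rel p R `` {(S\<^sub>1, \<lambda>g. \<phi>\<^sub>1 (\<sigma> g))}"
      unfolding harrison_orbit_eq[OF X] by blast
    have \<tau>\<sigma>: "\<tau> \<circ> \<sigma> \<in> iso (Cyc p) (Cyc p)" by (rule iso_set_trans[OF \<sigma> \<tau>])
    have "\<sigma> g \<in> carrier (Cyc p)" if "g \<in> carrier (Cyc p)" for g
      using \<sigma> that by (auto simp: iso_def dest: bij_betwE)
    then have "((S\<^sub>1, \<lambda>g. \<phi>\<^sub>1 (\<sigma> g)), (S\<^sub>2, \<lambda>g. \<phi>\<^sub>2 ((\<tau> \<circ> \<sigma>) g))) \<in> harrison_rel p R"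
      by (intro harrison_relI[OF C_extensions_twist[OF X \<sigma>] C_extensions_twist[OF Y \<tau>\<sigma>] f]) (simp add: eq)
    then have "Z = harrison_rel p R `` {(S\<^sub>2, \<lambda>g. \<phi>\<^sub>2 ((\<tau> \<circ> \<sigma>) g))}"
      unfolding Z by (rule equiv_class_eq[OF harrison_rel_equiv])
    then show "Z \<in> harrison_orbit p R (S\<^sub>2, \<phi>\<^sub>2)"
      unfolding harrison_orbit_eq[OF Y] using \<tau>\<sigma> by (rule image_eqI)
  qed
  assume conj: "conjugate_extensions R (S\<^sub>1, Cyc p, \<phi>\<^sub>1) (S\<^sub>2, Cyc p, \<phi>\<^sub>2)"
  have "galois_extension R S\<^sub>1 (Cyc p) \<phi>\<^sub>1" using X by (simp add: C_extensions_def)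
  from sub[OF X Y conj] sub[OF Y X conjugate_sym[OF this conj]]
  show "harrison_orbit p R (S\<^sub>1, \<phi>\<^sub>1) = harrison_orbit p R (S\<^sub>2, \<phi>\<^sub>2)" by (rule equalityI)
qed

lemma harrison_orbits_eq: "harrison_orbits p R = harrison_orbit p R ` C_extensions p R"
  unfolding orbits_def quotient_def by blast

lemma conjugacy_equiv: "equiv (p_cyclic_extensions p R) (conjugacy p R)"
proof (rule equivI)
  show "conjugacy p R \<subseteq> p_cyclic_extensions p R \<times> p_cyclic_extensions p R" by (auto simp: conjugacy_def)
  show "refl_on (p_cyclic_extensions p R) (conjugacy p R)"
    by (rule refl_onI) (simp add: conjugacy_def conjugate_refl)
  show "sym (conjugacy p R)"
  proof (rule symI)
    fix X Y assume XY: "(X, Y) \<in> conjugacy p R"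
    obtain S G \<phi> T K \<psi> where X: "X = (S, G, \<phi>)" "Y = (T, K, \<psi>)" by (metis prod_cases3)
    have "galois_extension R S G \<phi>" "conjugate_extensions R (S, G, \<phi>) (T, K, \<psi>)"
      using XY unfolding X by (simp_all add: conjugacy_def p_cyclic_extensions_def p_cyclic_galois_def)
    from conjugate_sym[OF this] show "(Y, X) \<in> conjugacy p R"
      using XY unfolding X by (simp add: conjugacy_def)
  qed
  show "trans (conjugacy p R)"
  proof (rule transI)
    fix X Y Z assume r: "(X, Y) \<in> conjugacy p R" "(Y, Z) \<in> conjugacy p R"
    then have "conjugate_extensions R X Z"
      using conjugate_trans by (cases X, cases Y, cases Z) (auto simp only: conjugacy_def mem_Collect_eq prod.case)
    then show "(X, Z) \<in> conjugacy p R" using r by (simp add: conjugacy_def)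
  qed
qed

lemma conjugacy_class_eq_iff:
  "X \<in> p_cyclic_extensions p R \<Longrightarrow> Y \<in> p_cyclic_extensions p R \<Longrightarrow>
    conjugacy p R `` {X} = conjugacy p R `` {Y} \<longleftrightarrow> conjugate_extensions R X Y"
  using eq_equiv_class_iff[OF conjugacy_equiv, of X p R Y] by (simp add: conjugacy_def)

lemma conjugacy_classes_eq: "conjugacy_classes p R = (\<lambda>X. conjugacy p R `` {X}) ` p_cyclic_extensions p R"
  unfolding quotient_def by blast

section \<open>Replacing the group by an isomorphic one\<close>

lemma C_extensions_p_cyclic:
  "p > 0 \<Longrightarrow> (S, \<phi>) \<in> C_extensions p R \<Longrightarrow> p_cyclic_galois p R S (Cyc p) \<phi>"
  by (simp add: C_extensions_def p_cyclic_galois_def cyclic_integer_mod_group order_def carrier_integer_mod_group)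

lemma p_cyclic_transport:
  assumes X: "p_cyclic_galois p R S G \<phi>" and H: "group H" and h: "h \<in> iso H G"
  shows "p_cyclic_galois p R S H (\<lambda>g. \<phi> (h g))" "conjugate_extensions R (S, H, \<lambda>g. \<phi> (h g)) (S, G, \<phi>)"
proof -
  interpret X: galois_extension R S G \<phi> using X by (simp add: p_cyclic_galois_def)
  have "cyclic_group H \<longleftrightarrow> cyclic_group G"
    using h by (intro isomorphic_group_cyclicity H group_hom.axioms(1)[OF X.group_hom]) (auto simp: is_iso_def)
  moreover have "order H = order G" using h by (auto simp: iso_def order_def intro: bij_betw_same_card)
  ultimately show "p_cyclic_galois p R S H (\<lambda>g. \<phi> (h g))"
    using X galois_extension_transport[OF X.galois_extension_axioms H h] by (simp add: p_cyclic_galois_def)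
  show "conjugate_extensions R (S, H, \<lambda>g. \<phi> (h g)) (S, G, \<phi>)"
    by (rule conjugate_extensionsI[OF algebra_iso_refl h]) (rule refl)
qed

lemma p_cyclic_conjugate_C_extension:
  assumes p: "p > 0" and X: "p_cyclic_galois p R S G \<phi>"
  shows "\<exists>\<psi>. (S, \<psi>) \<in> C_extensions p R \<and> conjugate_extensions R (S, Cyc p, \<psi>) (S, G, \<phi>)"
proof -
  interpret X: galois_extension R S G \<phi> using X by (simp add: p_cyclic_galois_def)
  have "cyclic_group G" "order G = p" using X by (simp_all add: p_cyclic_galois_def)
  from cyclic_group_iso[OF group_hom.axioms(1)[OF X.group_hom] this p] obtain h where h: "h \<in> iso (Cyc p) G" by blast
  show ?thesis
    using p_cyclic_transport[OF X group_integer_mod_group h]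
    by (intro exI[of _ "\<lambda>g. \<phi> (h g)"]) (simp add: C_extensions_def p_cyclic_galois_def)
qed

text \<open>A copy of the cyclic group is placed in the type \<open>'g\<close> on the images of 0,
  ..., p - 1 under \<open>large_g\<close>, and the action is pulled back along the inverse of that
  labelling.\<close>

lemma C_extension_conjugate_p_cyclic:
  assumes p: "p > 0" and large: "inj (large_g :: nat \<Rightarrow> 'g)" and X: "(S, \<phi>) \<in> C_extensions p R"
  shows "\<exists>(G :: 'g monoid) \<psi>. p_cyclic_galois p R S G \<psi> \<and> conjugate_extensions R (S, Cyc p, \<phi>) (S, G, \<psi>)"
proof -
  interpret C: group "Cyc p" by (rule group_integer_mod_group)
  define h where "h = large_g \<circ> nat"
  have inj: "inj_on h (carrier (Cyc p))"
    unfolding h_def using p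
    by (intro comp_inj_on inj_on_subset[OF large subset_UNIV]) (auto simp: inj_on_def carrier_integer_mod_group)
  let ?G = "image_group h (Cyc p)"
  have G: "group ?G" by (rule C.inj_imp_image_group_is_group[OF inj])
  have "inv_into (carrier (Cyc p)) h \<in> iso ?G (Cyc p)"
    by (rule C.iso_set_sym[OF inj_imp_image_group_iso[OF inj]])
  note T = p_cyclic_transport[OF C_extensions_p_cyclic[OF p X] G this]
  have "galois_extension R S ?G (\<lambda>g. \<phi> (inv_into (carrier (Cyc p)) h g))" using T(1) by (simp add: p_cyclic_galois_def)
  from conjugate_sym[OF this T(2)] T(1) show ?thesis by blast
qed

section \<open>The two bijections\<close>

text \<open>Every extension is related to a unit by \<open>primitive_element_exists\<close>, and
  every unit to an extension by \<open>kummer_extension_exists\<close>. Equality of orbits amounts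
  on both sides to u = w^p v^b.\<close>

lemma (in kummerian) unit_harrison_correspondence:
  fixes large_s :: "'r list \<Rightarrow> 's"
  assumes Pic: "torsion_part (Pic R) p = {\<one>\<^bsub>Pic R\<^esub>}" and large: "inj large_s"
  shows "\<exists>\<Phi> :: 'r set set \<Rightarrow> (('r, 's) module \<times> (int \<Rightarrow> 's \<Rightarrow> 's)) set set.
    bij_betw \<Phi> (unit_orbits p R) (harrison_orbits p R) \<and>
    (\<forall>u\<in>Units R. \<forall>(S, \<phi>)\<in>C_extensions p R. \<Phi> (unit_orbit p R u) = harrison_orbit p R (S, \<phi>) \<longleftrightarrow>
      (\<exists>\<alpha>. primitive_element p R \<mu> S (Cyc p) \<phi> \<alpha> \<and> \<alpha> [^]\<^bsub>S\<^esub> p = structure_map S u))"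
proof -
  define P :: "'r \<Rightarrow> ('r, 's) module \<times> (int \<Rightarrow> 's \<Rightarrow> 's) \<Rightarrow> bool"
    where "P u X = (case X of (S, \<phi>) \<Rightarrow>
      \<exists>\<alpha>. primitive_element p R \<mu> S (Cyc p) \<phi> \<alpha> \<and> \<alpha> [^]\<^bsub>S\<^esub> p = structure_map S u)" for u X
  let ?E = "C_extensions p R :: (('r, 's) module \<times> (int \<Rightarrow> 's \<Rightarrow> 's)) set"
  note cyc = C_extensions_p_cyclic[OF p_gt(2)]
  have total: "\<exists>u\<in>Units R. P u X" if X: "X \<in> ?E" for X
  proof -
    obtain S \<phi> where XS: "X = (S, \<phi>)" by (cases X)
    note G = cyc[OF X[unfolded XS]]
    obtain \<alpha> where \<alpha>: "primitive_element p R \<mu> S (Cyc p) \<phi> \<alpha>" using primitive_element_exists[OF G Pic] by blast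
    obtain u where "u \<in> Units R" "structure_map S u = \<alpha> [^]\<^bsub>S\<^esub> p" by (rule primitive_elementE[OF G \<alpha>])
    then show ?thesis using \<alpha> unfolding P_def XS prod.case by (intro bexI[of _ u] exI[of _ \<alpha>] conjI) simp_all
  qed
  have "\<exists>\<Phi>. bij_betw \<Phi> (unit_orbit p R ` Units R) (harrison_orbit p R ` ?E) \<and>
    (\<forall>u\<in>Units R. \<forall>X\<in>?E. \<Phi> (unit_orbit p R u) = harrison_orbit p R X \<longleftrightarrow> P u X)"
  proof (rule bij_betw_classes)
    show "\<exists>X\<in>?E. P u X" if u: "u \<in> Units R" for u
    proof -
      obtain S :: "('r, 's) module" and \<phi> \<alpha> where "galois_extension R S (Cyc p) \<phi>"
        "primitive_element p R \<mu> S (Cyc p) \<phi> \<alpha>" "\<alpha> [^]\<^bsub>S\<^esub> p = structure_map S u"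
        using kummer_extension_exists[OF u large] by blast
      then show ?thesis by (intro bexI[of _ "(S, \<phi>)"]) (auto simp: P_def C_extensions_def)
    qed
    show "unit_orbit p R u = unit_orbit p R v \<longleftrightarrow> harrison_orbit p R X = harrison_orbit p R Y"
      if u: "u \<in> Units R" and v: "v \<in> Units R" and X: "X \<in> ?E" and Y: "Y \<in> ?E" and uX: "P u X" and vY: "P v Y"
      for u v X Y
    proof -
      obtain S \<phi> T \<psi> where XS: "X = (S, \<phi>)" "Y = (T, \<psi>)" by (cases X, cases Y)
      obtain \<alpha> \<beta> where \<alpha>: "primitive_element p R \<mu> S (Cyc p) \<phi> \<alpha>" "\<alpha> [^]\<^bsub>S\<^esub> p = structure_map S u"
        and \<beta>: "primitive_element p R \<mu> T (Cyc p) \<psi> \<beta>" "\<beta> [^]\<^bsub>T\<^esub> p = structure_map T v"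
        using uX vY unfolding P_def XS prod.case by blast
      show ?thesis
        unfolding unit_orbit_eq_iff[OF u v] XS harrison_orbit_eq_iff[OF X[unfolded XS] Y[unfolded XS]]
        by (rule conjugate_iff_unit[OF cyc[OF X[unfolded XS]] \<alpha>(1) cyc[OF Y[unfolded XS]] \<beta>(1)
              u \<alpha>(2)[symmetric] v \<beta>(2)[symmetric], symmetric])
    qed
    \<comment> \<open>If Y lies in the orbit of X and has the unit v, then u = w^p v^b; the element
      w \<beta>^b is again primitive in Y and realises u.\<close>
    show "P u Y" if u: "u \<in> Units R" and X: "X \<in> ?E" and Y: "Y \<in> ?E" and uX: "P u X"
      and eq: "harrison_orbit p R X = harrison_orbit p R Y" for u X Y
    proof -
      obtain S \<phi> T \<psi> where XS: "X = (S, \<phi>)" "Y = (T, \<psi>)" by (cases X, cases Y)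
      note G = cyc[OF X[unfolded XS]] and K = cyc[OF Y[unfolded XS]]
      obtain \<alpha> where \<alpha>: "primitive_element p R \<mu> S (Cyc p) \<phi> \<alpha>" "\<alpha> [^]\<^bsub>S\<^esub> p = structure_map S u"
        using uX unfolding P_def XS prod.case by blast
      obtain v where v: "v \<in> Units R" "P v Y" using total[OF Y] by blast
      obtain \<beta> where \<beta>: "primitive_element p R \<mu> T (Cyc p) \<psi> \<beta>" "\<beta> [^]\<^bsub>T\<^esub> p = structure_map T v"
        using v(2) unfolding P_def XS prod.case by blast
      have "conjugate_extensions R (S, Cyc p, \<phi>) (T, Cyc p, \<psi>)"
        using eq unfolding XS harrison_orbit_eq_iff[OF X[unfolded XS] Y[unfolded XS]] .
      from conjugate_imp_unit[OF G \<alpha>(1) K \<beta>(1) u \<alpha>(2)[symmetric] v(1) \<beta>(2)[symmetric] this]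
      obtain b w where b: "b \<in> {1..<p}" and w: "w \<in> Units R" "u = w [^]\<^bsub>R\<^esub> p \<otimes>\<^bsub>R\<^esub> v [^]\<^bsub>R\<^esub> (b::nat)" by blast
      have nd: "\<not> p dvd b" using b by (auto dest: dvd_imp_le)
      note pr = primitive_power[OF K \<beta>(1) w(1) nd v(1) \<beta>(2)[symmetric]]
      show ?thesis
        unfolding P_def XS prod.case using pr(1) pr(2)[folded w(2)] by blast
    qed
  qed (rule total)
  then show ?thesis
    unfolding unit_orbits_eq harrison_orbits_eq P_def by (simp add: case_prod_unfold)
qed

text \<open>The relation is conjugacy itself, total because the group can be replaced by an
  isomorphic one. Compatibility with classes is transitivity, once equality of orbits is read as
  conjugacy.\<close>

lemma harrison_conjugacy_correspondence:
  fixes R :: "('r, 'k) ring_scheme" and large_g :: "nat \<Rightarrow> 'g"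
  assumes p: "p > 0" and large: "inj large_g"
  shows "\<exists>\<Psi> :: (('r, 's) module \<times> (int \<Rightarrow> 's \<Rightarrow> 's)) set set
      \<Rightarrow> (('r, 's) module \<times> 'g monoid \<times> ('g \<Rightarrow> 's \<Rightarrow> 's)) set.
    bij_betw \<Psi> (harrison_orbits p R) (conjugacy_classes p R) \<and>
    (\<forall>(S, \<phi>)\<in>C_extensions p R. \<forall>X\<in>p_cyclic_extensions p R.
      \<Psi> (harrison_orbit p R (S, \<phi>)) = conjugacy p R `` {X} \<longleftrightarrow> conjugate_extensions R (S, Cyc p, \<phi>) X)"
proof -
  define P :: "('r, 's) module \<times> (int \<Rightarrow> 's \<Rightarrow> 's) \<Rightarrow> ('r, 's) module \<times> 'g monoid \<times> ('g \<Rightarrow> 's \<Rightarrow> 's) \<Rightarrow> bool"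
    where "P Y X = (case Y of (S, \<phi>) \<Rightarrow> conjugate_extensions R (S, Cyc p, \<phi>) X)" for X Y
  let ?E = "C_extensions p R :: (('r, 's) module \<times> (int \<Rightarrow> 's \<Rightarrow> 's)) set"
  let ?F = "p_cyclic_extensions p R :: (('r, 's) module \<times> 'g monoid \<times> ('g \<Rightarrow> 's \<Rightarrow> 's)) set"
  have "\<exists>\<Psi>. bij_betw \<Psi> (harrison_orbit p R ` ?E) ((\<lambda>X. conjugacy p R `` {X}) ` ?F) \<and>
    (\<forall>Y\<in>?E. \<forall>X\<in>?F. \<Psi> (harrison_orbit p R Y) = conjugacy p R `` {X} \<longleftrightarrow> P Y X)"
  proof (rule bij_betw_classes)
    show "\<exists>X\<in>?F. P Y X" if Y: "Y \<in> ?E" for Y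
    proof -
      obtain S \<phi> where YS: "Y = (S, \<phi>)" by (cases Y)
      obtain G :: "'g monoid" and \<psi> where "p_cyclic_galois p R S G \<psi>"
        "conjugate_extensions R (S, Cyc p, \<phi>) (S, G, \<psi>)"
        using C_extension_conjugate_p_cyclic[OF p large Y[unfolded YS]] by blast
      then show ?thesis
        by (intro bexI[of _ "(S, G, \<psi>)"]) (simp_all add: P_def YS p_cyclic_extensions_def)
    qed
    show "\<exists>Y\<in>?E. P Y X" if X: "X \<in> ?F" for X
    proof -
      obtain S G \<phi> where XS: "X = (S, G, \<phi>)" by (cases X)
      have "p_cyclic_galois p R S G \<phi>" using X by (simp add: XS p_cyclic_extensions_def)
      from p_cyclic_conjugate_C_extension[OF p this] show ?thesis unfolding P_def XS by force
    qed
    show "harrison_orbit p R Y = harrison_orbit p R Y' \<longleftrightarrow> conjugacy p R `` {X} = conjugacy p R `` {X'}"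
      if Y: "Y \<in> ?E" and Y': "Y' \<in> ?E" and X: "X \<in> ?F" and X': "X' \<in> ?F" and YX: "P Y X" and YX': "P Y' X'"
      for X X' Y Y'
    proof -
      obtain S \<phi> S' \<phi>' T G \<psi> T' G' \<psi>'
        where e: "Y = (S, \<phi>)" "Y' = (S', \<phi>')" "X = (T, G, \<psi>)" "X' = (T', G', \<psi>')"
        by (cases Y, cases Y', cases X, cases X')
      have g: "galois_extension R S (Cyc p) \<phi>" "galois_extension R S' (Cyc p) \<phi>'"
        "galois_extension R T G \<psi>" "galois_extension R T' G' \<psi>'"
        using Y Y' X X' by (simp_all add: e C_extensions_def p_cyclic_extensions_def p_cyclic_galois_def)
      have c: "conjugate_extensions R (S, Cyc p, \<phi>) (T, G, \<psi>)"
        "conjugate_extensions R (S', Cyc p, \<phi>') (T', G', \<psi>')"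
        using YX YX' by (simp_all add: P_def e)
      note s = conjugate_sym[OF g(1) c(1)] conjugate_sym[OF g(2) c(2)]
      show ?thesis
        unfolding conjugacy_class_eq_iff[OF X X'] unfolding e harrison_orbit_eq_iff[OF Y[unfolded e(1)] Y'[unfolded e(2)]]
      proof
        assume "conjugate_extensions R (S, Cyc p, \<phi>) (S', Cyc p, \<phi>')"
        from conjugate_trans[OF conjugate_trans[OF s(1) this] c(2)]
        show "conjugate_extensions R (T, G, \<psi>) (T', G', \<psi>')" .
      next
        assume "conjugate_extensions R (T, G, \<psi>) (T', G', \<psi>')"
        from conjugate_trans[OF conjugate_trans[OF c(1) this] s(2)]
        show "conjugate_extensions R (S, Cyc p, \<phi>) (S', Cyc p, \<phi>')" .
      qed
    qed
    show "P Y X'" if Y: "Y \<in> ?E" and X: "X \<in> ?F" and X': "X' \<in> ?F" and YX: "P Y X"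
      and eq: "conjugacy p R `` {X} = conjugacy p R `` {X'}" for X X' Y
    proof -
      obtain S \<phi> T G \<psi> T' G' \<psi>' where e: "Y = (S, \<phi>)" "X = (T, G, \<psi>)" "X' = (T', G', \<psi>')"
        by (cases Y, cases X, cases X')
      have "conjugate_extensions R (T, G, \<psi>) (T', G', \<psi>')"
        using eq unfolding conjugacy_class_eq_iff[OF X X'] unfolding e .
      then show ?thesis using conjugate_trans YX unfolding P_def e prod.case by blast
    qed
  qed
  then show ?thesis
    unfolding conjugacy_classes_eq harrison_orbits_eq P_def by (simp add: case_prod_unfold)
qed

theorem theorem3p42:
  fixes p :: nat and R :: "('r, 'k) ring_scheme" and \<mu> :: "'r set"
    and large_s :: "'r list \<Rightarrow> 's" and large_g :: "nat \<Rightarrow> 'g"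
  assumes "Factorial_Ring.prime p"
    and "p_kummerian p R \<mu>"
    and "torsion_part (Pic R) p = {\<one>\<^bsub>Pic R\<^esub>}"
    \<comment> \<open>size of the types \<open>'s\<close> and \<open>'g\<close> in which isomorphism classes are formed: Galois extensions
        are finitely generated modules, so every one has a copy carried by lists over \<open>R\<close>\<close>
    and "inj large_s" and "inj large_g"
  shows
    "(\<exists>(\<Phi> :: 'r set set \<Rightarrow> (('r, 's) module \<times> (int \<Rightarrow> 's \<Rightarrow> 's)) set set)
       (\<Psi> :: (('r, 's) module \<times> (int \<Rightarrow> 's \<Rightarrow> 's)) set set
              \<Rightarrow> (('r, 's) module \<times> 'g monoid \<times> ('g \<Rightarrow> 's \<Rightarrow> 's)) set).
        bij_betw \<Phi> (unit_orbits p R) (harrison_orbits p R) \<and>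
        bij_betw \<Psi> (harrison_orbits p R) (conjugacy_classes p R) \<and>
        (\<forall>u\<in>Units R. \<forall>(S, \<phi>)\<in>C_extensions p R.
           \<Phi> (unit_orbit p R u) = harrison_orbit p R (S, \<phi>) \<longleftrightarrow>
           (\<exists>\<alpha>. primitive_element p R \<mu> S (Cyc p) \<phi> \<alpha> \<and> \<alpha> [^]\<^bsub>S\<^esub> p = structure_map S u)) \<and>
        (\<forall>(S, \<phi>)\<in>C_extensions p R. \<forall>X\<in>p_cyclic_extensions p R.
           \<Psi> (harrison_orbit p R (S, \<phi>)) = conjugacy p R `` {X} \<longleftrightarrow>
           conjugate_extensions R (S, Cyc p, \<phi>) X)) \<and>
     (\<forall>(S\<^sub>1 :: ('r, 's1) module) (G\<^sub>1 :: 'g1 monoid) \<phi>\<^sub>1 \<alpha>\<^sub>1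
       (S\<^sub>2 :: ('r, 's2) module) (G\<^sub>2 :: 'g2 monoid) \<phi>\<^sub>2 \<alpha>\<^sub>2.
        p_cyclic_galois p R S\<^sub>1 G\<^sub>1 \<phi>\<^sub>1 \<and> primitive_element p R \<mu> S\<^sub>1 G\<^sub>1 \<phi>\<^sub>1 \<alpha>\<^sub>1 \<and>
        p_cyclic_galois p R S\<^sub>2 G\<^sub>2 \<phi>\<^sub>2 \<and> primitive_element p R \<mu> S\<^sub>2 G\<^sub>2 \<phi>\<^sub>2 \<alpha>\<^sub>2 \<longrightarrow>
        (conjugate_extensions R (S\<^sub>1, G\<^sub>1, \<phi>\<^sub>1) (S\<^sub>2, G\<^sub>2, \<phi>\<^sub>2) \<longleftrightarrow>
         (\<exists>b\<in>carrier (Zp_units p).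
            kummer_unit p R S\<^sub>1 \<alpha>\<^sub>1 \<otimes>\<^bsub>units_of R\<^esub>
              inv\<^bsub>units_of R\<^esub> (kummer_unit p R S\<^sub>2 \<alpha>\<^sub>2 [^]\<^bsub>units_of R\<^esub> b) \<in> pth_powers p R)))"
proof -
  interpret kummerian R p \<mu>
    using assms(1,2) by (auto simp: kummerian_def kummerian_axioms_def p_kummerian_def)
  obtain \<Phi> :: "'r set set \<Rightarrow> (('r, 's) module \<times> (int \<Rightarrow> 's \<Rightarrow> 's)) set set"
    where \<Phi>: "bij_betw \<Phi> (unit_orbits p R) (harrison_orbits p R) \<and>
    (\<forall>u\<in>Units R. \<forall>(S, \<phi>)\<in>C_extensions p R. \<Phi> (unit_orbit p R u) = harrison_orbit p R (S, \<phi>) \<longleftrightarrow>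
      (\<exists>\<alpha>. primitive_element p R \<mu> S (Cyc p) \<phi> \<alpha> \<and> \<alpha> [^]\<^bsub>S\<^esub> p = structure_map S u))"
    using unit_harrison_correspondence[OF assms(3,4)] by blast
  obtain \<Psi> :: "(('r, 's) module \<times> (int \<Rightarrow> 's \<Rightarrow> 's)) set set
      \<Rightarrow> (('r, 's) module \<times> 'g monoid \<times> ('g \<Rightarrow> 's \<Rightarrow> 's)) set"
    where \<Psi>: "bij_betw \<Psi> (harrison_orbits p R) (conjugacy_classes p R) \<and>
    (\<forall>(S, \<phi>)\<in>C_extensions p R. \<forall>X\<in>p_cyclic_extensions p R.
      \<Psi> (harrison_orbit p R (S, \<phi>)) = conjugacy p R `` {X} \<longleftrightarrow> conjugate_extensions R (S, Cyc p, \<phi>) X)"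
    using harrison_conjugacy_correspondence[OF p_gt(2) assms(5)] by blast
  show ?thesis
  proof (intro conjI allI impI)
    show "\<exists>(\<Phi> :: 'r set set \<Rightarrow> (('r, 's) module \<times> (int \<Rightarrow> 's \<Rightarrow> 's)) set set)
       (\<Psi> :: (('r, 's) module \<times> (int \<Rightarrow> 's \<Rightarrow> 's)) set set
              \<Rightarrow> (('r, 's) module \<times> 'g monoid \<times> ('g \<Rightarrow> 's \<Rightarrow> 's)) set).
        bij_betw \<Phi> (unit_orbits p R) (harrison_orbits p R) \<and>
        bij_betw \<Psi> (harrison_orbits p R) (conjugacy_classes p R) \<and>
        (\<forall>u\<in>Units R. \<forall>(S, \<phi>)\<in>C_extensions p R.
           \<Phi> (unit_orbit p R u) = harrison_orbit p R (S, \<phi>) \<longleftrightarrow>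
           (\<exists>\<alpha>. primitive_element p R \<mu> S (Cyc p) \<phi> \<alpha> \<and> \<alpha> [^]\<^bsub>S\<^esub> p = structure_map S u)) \<and>
        (\<forall>(S, \<phi>)\<in>C_extensions p R. \<forall>X\<in>p_cyclic_extensions p R.
           \<Psi> (harrison_orbit p R (S, \<phi>)) = conjugacy p R `` {X} \<longleftrightarrow>
           conjugate_extensions R (S, Cyc p, \<phi>) X)"
      by (intro exI[of _ \<Phi>] exI[of _ \<Psi>] conjI conjunct1[OF \<Phi>] conjunct2[OF \<Phi>] conjunct1[OF \<Psi>] conjunct2[OF \<Psi>])
  next
    fix S\<^sub>1 :: "('r, 's1) module" and G\<^sub>1 :: "'g1 monoid" and \<phi>\<^sub>1 \<alpha>\<^sub>1
    fix S\<^sub>2 :: "('r, 's2) module" and G\<^sub>2 :: "'g2 monoid" and \<phi>\<^sub>2 \<alpha>\<^sub>2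
    assume "p_cyclic_galois p R S\<^sub>1 G\<^sub>1 \<phi>\<^sub>1 \<and> primitive_element p R \<mu> S\<^sub>1 G\<^sub>1 \<phi>\<^sub>1 \<alpha>\<^sub>1 \<and>
      p_cyclic_galois p R S\<^sub>2 G\<^sub>2 \<phi>\<^sub>2 \<and> primitive_element p R \<mu> S\<^sub>2 G\<^sub>2 \<phi>\<^sub>2 \<alpha>\<^sub>2"
    then have G1: "p_cyclic_galois p R S\<^sub>1 G\<^sub>1 \<phi>\<^sub>1" and a1: "primitive_element p R \<mu> S\<^sub>1 G\<^sub>1 \<phi>\<^sub>1 \<alpha>\<^sub>1"
      and G2: "p_cyclic_galois p R S\<^sub>2 G\<^sub>2 \<phi>\<^sub>2" and a2: "primitive_element p R \<mu> S\<^sub>2 G\<^sub>2 \<phi>\<^sub>2 \<alpha>\<^sub>2" by simp_all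
    obtain u\<^sub>1 where u1: "u\<^sub>1 \<in> Units R" "structure_map S\<^sub>1 u\<^sub>1 = \<alpha>\<^sub>1 [^]\<^bsub>S\<^sub>1\<^esub> p" by (rule primitive_elementE[OF G1 a1])
    obtain u\<^sub>2 where u2: "u\<^sub>2 \<in> Units R" "structure_map S\<^sub>2 u\<^sub>2 = \<alpha>\<^sub>2 [^]\<^bsub>S\<^sub>2\<^esub> p" by (rule primitive_elementE[OF G2 a2])
    show "conjugate_extensions R (S\<^sub>1, G\<^sub>1, \<phi>\<^sub>1) (S\<^sub>2, G\<^sub>2, \<phi>\<^sub>2) \<longleftrightarrow>
         (\<exists>b\<in>carrier (Zp_units p).
            kummer_unit p R S\<^sub>1 \<alpha>\<^sub>1 \<otimes>\<^bsub>units_of R\<^esub>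
              inv\<^bsub>units_of R\<^esub> (kummer_unit p R S\<^sub>2 \<alpha>\<^sub>2 [^]\<^bsub>units_of R\<^esub> b) \<in> pth_powers p R)"
      unfolding kummer_unit_eq[OF G1 u1] kummer_unit_eq[OF G2 u2] quotient_pth_power_iff[OF u1(1) u2(1)]
      by (rule conjugate_iff_unit[OF G1 a1 G2 a2 u1 u2])
  qed
qed

end
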